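(* Let $\mathcal{A}_\alpha\subset A_0$ be an Aubry-Mather set with irrational rotation number $\alpha$. Suppose that $\mathcal{A}_\alpha$ is hyperbolic and has exactly one hole. Let $\phi:\mathbb{T}\times\mathbb{R}\times\mathbb{T}\times\mathbb{R}\to(0,\infty)$ be any function of class $C^1$ with mean value 1 in the sense that $\int_{\mathcal{S}_\alpha}\frac{1}{\phi}\,d\nu_\alpha=1$. Then the restriction of the reparametrized flow $X^t_{\hat H_\phi}$ to $\mathcal{S}_\alpha$ is $C^0$ conjugate to the restriction to $\mathcal{S}_\alpha$ of the initial flow $X^t_{\hat H}$, i.e. to the suspension flow over $(\mathcal{A}_\alpha,f_\alpha)$ with constant ceiling function equal to one.
   Context: Setting. $\mathbb{T}=\mathbb{R}/\mathbb{Z}$. On $\mathbb{T}\times\mathbb{R}\times\mathbb{T}\times\mathbb{R}$ with coordinates $(\theta,r,s,u)$ and symplectic form $\omega_0=d\theta\wedge dr+ds\wedge du$, let $\hat H(\theta,r,s,u)=u+\frac{r^2}{2}+\varepsilon H(\theta,r,s)$ with $H$ real of class $C^\infty$ and $\varepsilon\in\mathbb{R}$. Let $X^t_{\hat H}$ be its Hamiltonian flow, generated by the vector field $X_{\hat H}$ with $\omega_0(X_{\hat H},\cdot)=d\hat H(\cdot)$; note $ds/dt=1$. Fix an energy surface $\mathcal{E}=\{\hat H=\hat H_0\}$ and its Poincaré section $\{s=0\}$, parametrized by $(\theta,r)$ via $u=\hat H_0-\frac{r^2}{2}-\varepsilon H(\theta,r,0)$. Let $f$ be the Poincaré return map (the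 time-one map of the flow on this section), written in the coordinates $(\theta,r)$. Standing assumptions: $H$ is generic so that the flow satisfies the Kupka-Smale condition (periodic orbits are elementary/nondegenerate, and stable and unstable manifolds of hyperbolic periodic orbits intersect transversally), and $\varepsilon$ is small enough that, for some $R>0$, $f$ is a monotone twist map on $\{|r|\le R\}$ and has an invariant annulus $A_0\subset\mathbb{T}\times[-R/2,R/2]$ (bounded by two invariant circles) given by KAM theory. Aubry-Mather sets. A compact set $\mathcal{A}\subset A_0$ is $f$-ordered if it is $f$-invariant, projects injectively to $\mathbb{T}$ (first coordinate), and $f|_{\mathcal{A}}$ preserves the cyclic order given by the projection. Here an Aubry-Mather set $\mathcal{A}_\alpha$ of irrational rotation number $\alpha$ means a minimal $f$-ordered set of rotation number $\alpha$ that is a Cantor set; $f_\alpha=f|_{\mathcal{A}_\alpha}$. It lies on a Lipschitz graph over $\mathbb{T}$; gaps (wandering intervals) are the complementary intervals of $\mathcal{A}_\alpha$ in this graph (equivalently, of its projection in $\mathbb{T}$), and they are permuted by the dynamics. A hole is an orbit of gaps; $\mathcal{A}_\alpha$ has $k$ holes if there are exactly $k$ orbits of gaps. $\mathcal{A}_\alpha$ is hyperbolic if it is a (uniformly) hyperbolic set of $f$, i.e. it admits stable and unstable bundles. $f_\alpha$ has a unique invariant probability measure $\mu_\alpha$. Laminations. $\mathcal{S}_\alpha\subset\mathcal{E}$ is the union of the $X^t_{\hat H}$-orbits through the points of the section corresponding to $\mathcal{A}_\alpha$. On it $X^t_{\hat H}$ is the suspension of $f_\alpha$ with constant ceiling function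 1; its unique invariant probability measure $\nu_\alpha$ is the product of $\mu_\alpha$ with Lebesgue measure $ds$ on the fibers. Reparametrization. For a strictly positive function $\phi$, set $\hat H_\phi=\phi\,(\hat H-\hat H_0)$. The flow $X^t_{\hat H_\phi}$ on $\mathcal{E}$ is the flow of the vector field $\phi X_{\hat H}$ restricted to $\mathcal{E}$; it leaves $\mathcal{S}_\alpha$ invariant. Two flows on compact spaces are $C^0$ conjugate if a homeomorphism intertwines them for all $t$. *)

theory Defs
  imports "HOL-Analysis.Analysis"
begin

text \<open>
  The circle \<open>\<real>/\<int>\<close> is modelled by the unit circle of the complex plane through
  \<open>x \<mapsto> exp(2 \<pi> i x)\<close>; the point \<open>s = 0\<close> of \<open>\<real>/\<int>\<close> is the complex number 1.
  Topological objects (invariant sets, measures, conjugacies) live in products of circles and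
  lines, while derivatives are taken on the universal covers \<open>\<real>\<^sup>4\<close> and \<open>\<real>\<^sup>2\<close>.
\<close>

abbreviation circle :: "complex set" where
  "circle \<equiv> sphere 0 1"

definition circ :: "real \<Rightarrow> complex" where
  "circ x = cis (2 * pi * x)"

type_synonym phase = "complex \<times> real \<times> complex \<times> real"
type_synonym phase_cover = "real \<times> real \<times> real \<times> real"
type_synonym annulus = "complex \<times> real"
type_synonym plane = "real \<times> real"

definition phase_space :: "phase set" where
  "phase_space = circle \<times> UNIV \<times> circle \<times> UNIV"

definition proj2 :: "plane \<Rightarrow> annulus" where
  "proj2 = (\<lambda>(\<theta>, r). (circ \<theta>, r))"

definition proj3 :: "real \<times> real \<times> real \<Rightarrow> complex \<times> real \<times> complex" where
  "proj3 = (\<lambda>(\<theta>, r, s). (circ \<theta>, r, circ s))"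

definition proj4 :: "phase_cover \<Rightarrow> phase" where
  "proj4 = (\<lambda>(\<theta>, r, s, u). (circ \<theta>, r, circ s, u))"


subsection \<open>Differentiability classes\<close>

primrec Ck :: "nat \<Rightarrow> ('a::euclidean_space \<Rightarrow> 'b::real_normed_vector) \<Rightarrow> bool" where
  "Ck 0 f \<longleftrightarrow> continuous_on UNIV f"
| "Ck (Suc k) f \<longleftrightarrow>
     (\<forall>x. f differentiable (at x)) \<and> (\<forall>v. Ck k (\<lambda>x. frechet_derivative f (at x) v))"

definition Cinf :: "('a::euclidean_space \<Rightarrow> 'b::real_normed_vector) \<Rightarrow> bool" where
  "Cinf f \<longleftrightarrow> (\<forall>k. Ck k f)"


subsection \<open>Hamiltonian flows\<close>

definition omega0 :: "phase_cover \<Rightarrow> phase_cover \<Rightarrow> real" where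
  "omega0 = (\<lambda>(a, b, c, d) (a', b', c', d'). (a * b' - b * a') + (c * d' - d * c'))"

definition ham_vf :: "(phase_cover \<Rightarrow> real) \<Rightarrow> phase_cover \<Rightarrow> phase_cover" where
  "ham_vf G x = (THE X. \<forall>v. omega0 X v = frechet_derivative G (at x) v)"

text \<open>
  Hamiltonian vector fields need not be complete, so the flows below are only meaningful where
  an integral curve up to time \<open>t\<close> exists (\<open>t\<close> may be negative).
\<close>

definition integral_curve ::
    "(phase_cover \<Rightarrow> phase_cover) \<Rightarrow> real \<Rightarrow> (real \<Rightarrow> phase_cover) \<Rightarrow> bool" where
  "integral_curve V t c \<longleftrightarrow>
     (\<forall>\<tau> \<in> closed_segment 0 t.
        (c has_vector_derivative V (c \<tau>)) (at \<tau> within closed_segment 0 t))"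

definition lift_flow_dom :: "(phase \<Rightarrow> real) \<Rightarrow> real \<Rightarrow> phase_cover set" where
  "lift_flow_dom G t = {x. \<exists>c. integral_curve (ham_vf (G \<circ> proj4)) t c \<and> c 0 = x}"

definition lift_flow :: "(phase \<Rightarrow> real) \<Rightarrow> real \<Rightarrow> phase_cover \<Rightarrow> phase_cover" where
  "lift_flow G t x =
     (THE y. \<exists>c. integral_curve (ham_vf (G \<circ> proj4)) t c \<and> c 0 = x \<and> c t = y)"

definition ham_flow :: "(phase \<Rightarrow> real) \<Rightarrow> real \<Rightarrow> phase \<Rightarrow> phase" where
  "ham_flow G t z =
     (THE w. \<exists>c. integral_curve (ham_vf (G \<circ> proj4)) t c \<and> proj4 (c 0) = z \<and> proj4 (c t) = w)"

definition Hhat :: "(complex \<times> real \<times> complex \<Rightarrow> real) \<Rightarrow> real \<Rightarrow> phase \<Rightarrow> real" where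
  "Hhat H \<epsilon> = (\<lambda>(z, r, w, u). u + r\<^sup>2 / 2 + \<epsilon> * H (z, r, w))"

definition Hhat_reparam ::
    "(complex \<times> real \<times> complex \<Rightarrow> real) \<Rightarrow> real \<Rightarrow> real \<Rightarrow> (phase \<Rightarrow> real) \<Rightarrow> phase \<Rightarrow> real" where
  "Hhat_reparam H \<epsilon> h \<phi> = (\<lambda>x. \<phi> x * (Hhat H \<epsilon> x - h))"


subsection \<open>The Poincare return map\<close>

text \<open>
  The section \<open>{s = 0}\<close> of the energy surface \<open>{Hhat H \<epsilon> = h}\<close>, parametrized by
  \<open>(\<theta>, r)\<close>, downstairs and on the universal cover.
\<close>

definition sect :: "(complex \<times> real \<times> complex \<Rightarrow> real) \<Rightarrow> real \<Rightarrow> real \<Rightarrow> annulus \<Rightarrow> phase" where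
  "sect H \<epsilon> h = (\<lambda>(z, r). (z, r, 1, h - r\<^sup>2 / 2 - \<epsilon> * H (z, r, 1)))"

definition sect_lift ::
    "(complex \<times> real \<times> complex \<Rightarrow> real) \<Rightarrow> real \<Rightarrow> real \<Rightarrow> plane \<Rightarrow> phase_cover" where
  "sect_lift H \<epsilon> h = (\<lambda>(\<theta>, r). (\<theta>, r, 0, h - r\<^sup>2 / 2 - \<epsilon> * H (circ \<theta>, r, 1)))"

definition ret :: "(complex \<times> real \<times> complex \<Rightarrow> real) \<Rightarrow> real \<Rightarrow> real \<Rightarrow> annulus \<Rightarrow> annulus" where
  "ret H \<epsilon> h x = (case ham_flow (Hhat H \<epsilon>) 1 (sect H \<epsilon> h x) of (z, r, w, u) \<Rightarrow> (z, r))"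

text \<open>
  Since \<open>ds/dt = 1\<close>, the \<open>n\<close>-th iterate of the return map (\<open>n \<in> \<int>\<close>) is the time-\<open>n\<close> map
  on the section. \<open>ret_lift H \<epsilon> h n\<close> is its lift to the plane, with domain
  \<open>ret_dom H \<epsilon> h n\<close>.
\<close>

definition ret_lift ::
    "(complex \<times> real \<times> complex \<Rightarrow> real) \<Rightarrow> real \<Rightarrow> real \<Rightarrow> int \<Rightarrow> plane \<Rightarrow> plane" where
  "ret_lift H \<epsilon> h n x =
     (case lift_flow (Hhat H \<epsilon>) (of_int n) (sect_lift H \<epsilon> h x) of (\<theta>, r, s, u) \<Rightarrow> (\<theta>, r))"

definition ret_dom ::
    "(complex \<times> real \<times> complex \<Rightarrow> real) \<Rightarrow> real \<Rightarrow> real \<Rightarrow> int \<Rightarrow> plane set" where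
  "ret_dom H \<epsilon> h n = {x. sect_lift H \<epsilon> h x \<in> lift_flow_dom (Hhat H \<epsilon>) (of_int n)}"

text \<open>
  In what follows \<open>F n\<close> stands for the lift of the \<open>n\<close>-th iterate of a (possibly only partially
  defined) invertible map of the annulus, and \<open>D n\<close> for its domain.
\<close>


subsection \<open>The Kupka-Smale condition\<close>

text \<open>\<open>q\<close> is the minimal period and \<open>p\<close> the number of turns of the periodic point \<open>x\<close>.\<close>

definition periodic_pt ::
    "(int \<Rightarrow> plane \<Rightarrow> plane) \<Rightarrow> (int \<Rightarrow> plane set) \<Rightarrow> nat \<Rightarrow> int \<Rightarrow> plane \<Rightarrow> bool" where
  "periodic_pt F D q p x \<longleftrightarrow>
     0 < q \<and> x \<in> D (int q) \<and> F (int q) x = x + (of_int p, 0) \<and>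
     (\<forall>j. 0 < j \<and> j < q \<longrightarrow> proj2 (F (int j) x) \<noteq> proj2 x)"

text \<open>\<open>L (v + i w) = \<mu> (v + i w)\<close> for the complexification of \<open>L\<close>.\<close>

definition complex_eigenvalue :: "(plane \<Rightarrow> plane) \<Rightarrow> complex \<Rightarrow> bool" where
  "complex_eigenvalue L \<mu> \<longleftrightarrow>
     (\<exists>v w. (v \<noteq> 0 \<or> w \<noteq> 0) \<and>
        L v = Re \<mu> *\<^sub>R v - Im \<mu> *\<^sub>R w \<and> L w = Im \<mu> *\<^sub>R v + Re \<mu> *\<^sub>R w)"

definition nondegenerate_pt :: "(int \<Rightarrow> plane \<Rightarrow> plane) \<Rightarrow> nat \<Rightarrow> plane \<Rightarrow> bool" where
  "nondegenerate_pt F q x \<longleftrightarrow> \<not> complex_eigenvalue (frechet_derivative (F (int q)) (at x)) 1"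

definition hyperbolic_pt :: "(int \<Rightarrow> plane \<Rightarrow> plane) \<Rightarrow> nat \<Rightarrow> plane \<Rightarrow> bool" where
  "hyperbolic_pt F q x \<longleftrightarrow>
     (\<forall>\<mu>. complex_eigenvalue (frechet_derivative (F (int q)) (at x)) \<mu> \<longrightarrow> cmod \<mu> \<noteq> 1)"

text \<open>
  With \<open>\<sigma> = 1\<close> this is the stable manifold of the periodic point \<open>x\<close>, with \<open>\<sigma> = -1\<close> the
  unstable one, both lifted to the plane.
\<close>

definition inv_manifold ::
    "int \<Rightarrow> (int \<Rightarrow> plane \<Rightarrow> plane) \<Rightarrow> (int \<Rightarrow> plane set) \<Rightarrow> nat \<Rightarrow> int \<Rightarrow> plane \<Rightarrow> plane set" where
  "inv_manifold \<sigma> F D q p x =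
     {y. (\<forall>n::nat. y \<in> D (\<sigma> * int n * int q)) \<and>
         (\<lambda>n. F (\<sigma> * int n * int q) y - (of_int (\<sigma> * int n * p), 0)) \<longlonglongrightarrow> x}"

text \<open>
  The invariant manifolds are only injectively immersed and may accumulate on themselves. The
  tangent space at \<open>y\<close> consists of the velocities of \<open>C\<^sup>1\<close> curves through \<open>y\<close> along which
  the convergence to the periodic orbit is uniform; this forces the curve to stay in one sheet,
  i.e. to be a curve for the immersed manifold structure.
\<close>

definition inv_manifold_tangent ::
    "int \<Rightarrow> (int \<Rightarrow> plane \<Rightarrow> plane) \<Rightarrow> (int \<Rightarrow> plane set) \<Rightarrow> nat \<Rightarrow> int \<Rightarrow> plane \<Rightarrow> plane \<Rightarrow> plane set"
  where
  "inv_manifold_tangent \<sigma> F D q p x y =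
     {v. \<exists>c. c C1_differentiable_on {-1..1} \<and> c ` {-1..1} \<subseteq> inv_manifold \<sigma> F D q p x \<and>
             c 0 = y \<and> (c has_vector_derivative v) (at 0) \<and>
             uniform_limit {-1..1}
               (\<lambda>n \<tau>. F (\<sigma> * int n * int q) (c \<tau>) - (of_int (\<sigma> * int n * p), 0))
               (\<lambda>\<tau>. x) sequentially}"

definition kupka_smale :: "(int \<Rightarrow> plane \<Rightarrow> plane) \<Rightarrow> (int \<Rightarrow> plane set) \<Rightarrow> bool" where
  "kupka_smale F D \<longleftrightarrow>
     (\<forall>q p x. periodic_pt F D q p x \<longrightarrow> nondegenerate_pt F q x) \<and>
     (\<forall>q p x q' p' x' y.
        periodic_pt F D q p x \<and> hyperbolic_pt F q x \<and>
        periodic_pt F D q' p' x' \<and> hyperbolic_pt F q' x' \<and>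
        y \<in> inv_manifold 1 F D q p x \<inter> inv_manifold (-1) F D q' p' x' \<longrightarrow>
        span (inv_manifold_tangent 1 F D q p x y \<union> inv_manifold_tangent (-1) F D q' p' x' y) = UNIV)"


subsection \<open>Twist maps and invariant annuli\<close>

definition det2 :: "plane \<Rightarrow> plane \<Rightarrow> real" where
  "det2 v w = fst v * snd w - snd v * fst w"

definition monotone_twist :: "real \<Rightarrow> (int \<Rightarrow> plane \<Rightarrow> plane) \<Rightarrow> (int \<Rightarrow> plane set) \<Rightarrow> bool" where
  "monotone_twist R F D \<longleftrightarrow>
     (let S = {x. \<bar>snd x\<bar> \<le> R}; DF = (\<lambda>x. frechet_derivative (F 1) (at x)) in
        S \<subseteq> D 1 \<and> (\<forall>x\<in>S. F 1 differentiable (at x)) \<and>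
        (\<forall>v. continuous_on S (\<lambda>x. DF x v)) \<and> inj_on (F 1) S \<and>
        (\<forall>x\<in>S. F 1 (x + (1, 0)) = F 1 x + (1, 0)) \<and>
        (\<forall>x\<in>S. \<forall>v w. det2 (DF x v) (DF x w) = det2 v w) \<and>
        (\<forall>x\<in>S. 0 < fst (DF x (0, 1))))"

definition circle_graph :: "(complex \<Rightarrow> real) \<Rightarrow> annulus set" where
  "circle_graph g = (\<lambda>z. (z, g z)) ` circle"

definition invariant_annulus :: "(annulus \<Rightarrow> annulus) \<Rightarrow> annulus set \<Rightarrow> bool" where
  "invariant_annulus f A \<longleftrightarrow>
     (\<exists>g1 g2. continuous_on circle g1 \<and> continuous_on circle g2 \<and> (\<forall>z\<in>circle. g1 z < g2 z) \<and>
        f ` circle_graph g1 = circle_graph g1 \<and> f ` circle_graph g2 = circle_graph g2 \<and>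
        A = {(z, r). z \<in> circle \<and> g1 z \<le> r \<and> r \<le> g2 z}) \<and>
     f ` A = A"


subsection \<open>Aubry-Mather sets\<close>

definition cyclic :: "complex \<Rightarrow> complex \<Rightarrow> complex \<Rightarrow> bool" where
  "cyclic x y z \<longleftrightarrow>
     (\<exists>a b c. x = circ a \<and> y = circ b \<and> z = circ c \<and> a < b \<and> b < c \<and> c < a + 1)"

definition f_ordered :: "(annulus \<Rightarrow> annulus) \<Rightarrow> annulus set \<Rightarrow> bool" where
  "f_ordered f \<A> \<longleftrightarrow>
     compact \<A> \<and> f ` \<A> = \<A> \<and> inj_on fst \<A> \<and>
     (\<forall>x\<in>\<A>. \<forall>y\<in>\<A>. \<forall>z\<in>\<A>.
        cyclic (fst x) (fst y) (fst z) \<longrightarrow> cyclic (fst (f x)) (fst (f y)) (fst (f z)))"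

definition minimal_f_ordered :: "(annulus \<Rightarrow> annulus) \<Rightarrow> annulus set \<Rightarrow> bool" where
  "minimal_f_ordered f \<A> \<longleftrightarrow>
     f_ordered f \<A> \<and> \<A> \<noteq> {} \<and> (\<forall>B. B \<subseteq> \<A> \<and> B \<noteq> {} \<and> f_ordered f B \<longrightarrow> B = \<A>)"

definition cantor_set :: "'a::metric_space set \<Rightarrow> bool" where
  "cantor_set C \<longleftrightarrow>
     compact C \<and> C \<noteq> {} \<and> (\<forall>x\<in>C. x islimpt C) \<and> (\<forall>x\<in>C. connected_component_set C x = {x})"

definition rotation_number :: "(int \<Rightarrow> plane \<Rightarrow> plane) \<Rightarrow> annulus set \<Rightarrow> real \<Rightarrow> bool" where
  "rotation_number F \<A> \<alpha> \<longleftrightarrow>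
     (\<forall>x. proj2 x \<in> \<A> \<longrightarrow> (\<lambda>n. (fst (F (int n) x) - fst x) / real n) \<longlonglongrightarrow> \<alpha>)"

definition aubry_mather ::
    "(annulus \<Rightarrow> annulus) \<Rightarrow> (int \<Rightarrow> plane \<Rightarrow> plane) \<Rightarrow> real \<Rightarrow> annulus set \<Rightarrow> bool" where
  "aubry_mather f F \<alpha> \<A> \<longleftrightarrow>
     minimal_f_ordered f \<A> \<and> rotation_number F \<A> \<alpha> \<and> cantor_set \<A>"

text \<open>\<open>DF\<^sup>n\<close> at a point of the annulus is the derivative of the lift at any preimage.\<close>

definition hyperbolic_set :: "(int \<Rightarrow> plane \<Rightarrow> plane) \<Rightarrow> annulus set \<Rightarrow> bool" where
  "hyperbolic_set F \<A> \<longleftrightarrow>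
     (\<exists>Es Eu C \<rho>. 0 < C \<and> 0 < \<rho> \<and> \<rho> < 1 \<and>
        (\<forall>x. proj2 x \<in> \<A> \<longrightarrow>
           subspace (Es (proj2 x)) \<and> subspace (Eu (proj2 x)) \<and>
           Es (proj2 x) \<inter> Eu (proj2 x) = {0} \<and>
           {v + w | v w. v \<in> Es (proj2 x) \<and> w \<in> Eu (proj2 x)} = UNIV \<and>
           frechet_derivative (F 1) (at x) ` Es (proj2 x) = Es (proj2 (F 1 x)) \<and>
           frechet_derivative (F 1) (at x) ` Eu (proj2 x) = Eu (proj2 (F 1 x)) \<and>
           (\<forall>n::nat. \<forall>v \<in> Es (proj2 x).
              norm (frechet_derivative (F (int n)) (at x) v) \<le> C * \<rho> ^ n * norm v) \<and>
           (\<forall>n::nat. \<forall>v \<in> Eu (proj2 x).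
              norm (frechet_derivative (F (- int n)) (at x) v) \<le> C * \<rho> ^ n * norm v)))"

definition gaps :: "annulus set \<Rightarrow> complex set set" where
  "gaps \<A> = components (circle - fst ` \<A>)"

definition gap_ends :: "annulus set \<Rightarrow> complex set \<Rightarrow> annulus set" where
  "gap_ends \<A> I = {x \<in> \<A>. fst x \<in> closure I}"

text \<open>
  A gap of a Cantor set is determined by its two end points, so the action of the dynamics on
  gaps is read off from the end points.
\<close>

definition gap_orbit_rel :: "(annulus \<Rightarrow> annulus) \<Rightarrow> annulus set \<Rightarrow> (complex set \<times> complex set) set"
  where
  "gap_orbit_rel f \<A> =
     {(I, J). I \<in> gaps \<A> \<and> J \<in> gaps \<A> \<and>
        (\<exists>n::nat. (f ^^ n) ` gap_ends \<A> I = gap_ends \<A> J \<or>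
                  (f ^^ n) ` gap_ends \<A> J = gap_ends \<A> I)}"

definition has_holes :: "nat \<Rightarrow> (annulus \<Rightarrow> annulus) \<Rightarrow> annulus set \<Rightarrow> bool" where
  "has_holes k f \<A> \<longleftrightarrow>
     finite (gaps \<A> // gap_orbit_rel f \<A>) \<and> card (gaps \<A> // gap_orbit_rel f \<A>) = k"


subsection \<open>Laminations, invariant measures, suspensions and conjugacy\<close>

definition lamination ::
    "(complex \<times> real \<times> complex \<Rightarrow> real) \<Rightarrow> real \<Rightarrow> real \<Rightarrow> annulus set \<Rightarrow> phase set" where
  "lamination H \<epsilon> h \<A> = {ham_flow (Hhat H \<epsilon>) t (sect H \<epsilon> h x) | t x. x \<in> \<A>}"

definition invariant_prob ::
    "'a::topological_space set \<Rightarrow> (real \<Rightarrow> 'a \<Rightarrow> 'a) \<Rightarrow> 'a measure \<Rightarrow> bool" where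
  "invariant_prob S \<Phi> \<nu> \<longleftrightarrow>
     space \<nu> = S \<and> sets \<nu> = sets (restrict_space borel S) \<and> emeasure \<nu> S = 1 \<and>
     (\<forall>t. \<Phi> t \<in> measurable \<nu> \<nu> \<and> distr \<nu> \<nu> (\<Phi> t) = \<nu>)"

text \<open>
  Suspension of \<open>(\<A>, f)\<close> with ceiling 1: the quotient of \<open>\<A> \<times> \<real>\<close> by
  \<open>(x, a + 1) \<sim> (f x, a)\<close>, with the flow \<open>[x, a] \<mapsto> [x, a + t]\<close>.
\<close>

definition suspension_rel ::
    "'a set \<Rightarrow> ('a \<Rightarrow> 'a) \<Rightarrow> (('a \<times> real) \<times> ('a \<times> real)) set" where
  "suspension_rel A f =
     {((x, a), (y, b)). x \<in> A \<and> y \<in> A \<and>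
        (\<exists>n::nat. (y = (f ^^ n) x \<and> a = b + real n) \<or> (x = (f ^^ n) y \<and> b = a + real n))}"

definition suspension_space ::
    "'a::topological_space set \<Rightarrow> ('a \<Rightarrow> 'a) \<Rightarrow> ('a \<times> real) set topology" where
  "suspension_space A f = topology (\<lambda>U.
     U \<subseteq> (A \<times> UNIV) // suspension_rel A f \<and>
     openin (top_of_set (A \<times> UNIV)) {p \<in> A \<times> UNIV. suspension_rel A f `` {p} \<in> U})"

definition suspension_flow :: "real \<Rightarrow> ('a \<times> real) set \<Rightarrow> ('a \<times> real) set" where
  "suspension_flow t c = (\<lambda>(x, a). (x, a + t)) ` c"

definition C0_conjugate ::
    "'a topology \<Rightarrow> (real \<Rightarrow> 'a \<Rightarrow> 'a) \<Rightarrow> 'b topology \<Rightarrow> (real \<Rightarrow> 'b \<Rightarrow> 'b) \<Rightarrow> bool" where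
  "C0_conjugate X \<Phi> Y \<Psi> \<longleftrightarrow>
     (\<exists>g. homeomorphic_map X Y g \<and> (\<forall>t. \<forall>x \<in> topspace X. g (\<Phi> t x) = \<Psi> t (g x)))"

end

theory Submission
  imports Defs
begin

text \<open>
Write \<open>q = 1 / \<phi>\<close>. An orbit of the reparametrized flow is an orbit of \<open>\<Phi>\<close> travelled so that reaching
  \<open>\<Phi> s z\<close> takes the time \<open>J z s = \<integral>\<^sub>0\<^sup>s q (\<Phi> u z) du\<close>. If a continuous \<open>w\<close> on the lamination solves
  the cohomological equation \<open>w (\<Phi> s z) - w z = J z s - s\<close>, then \<open>z \<mapsto> \<Phi> (w z) z\<close> conjugates the two
  flows (\<open>time_change_conjugate\<close>). The flow on the lamination is minimal, so by a theorem of
  Gottschalk and Hedlund such a \<open>w\<close> exists as soon as \<open>J z s - s\<close> is bounded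
  (\<open>gottschalk_hedlund\<close>). As \<open>q\<close> has mean 1, it is enough that \<open>J z s - J z' s\<close> is bounded over all
  \<open>z, z'\<close> and \<open>s \<ge> 0\<close>: a function of mean \<open>s\<close> whose oscillation is bounded stays within that bound
  of \<open>s\<close>.

  On the section, \<open>J z n\<close> is the Birkhoff sum \<open>S\<^sub>n P\<close> of the return time \<open>P\<close>, so the heart of the
  proof is a bound for \<open>S\<^sub>n P y - S\<^sub>n P x\<close> on the Aubry-Mather set. Lift the set to a closed
  1-periodic set \<open>K\<close> of reals on which the dynamics becomes an increasing bijection \<open>g\<close>. Three facts
  are used.

  \<^item> The set lies on a Lipschitz graph: the twist condition bounds the slopes from one side for
    \<open>f\<close> and from the other side for its inverse (\<open>graph_locally_lipschitz\<close>). Hence \<open>P\<close> is a Lipschitz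
    function of the angle.

  \<^item> Hyperbolicity makes every short arc with end points in \<open>K\<close> much longer under \<open>g\<^sup>M\<close> or under
    \<open>g\<^sup>-\<^sup>M\<close> (\<open>expansion_on_K\<close>). The arcs that remain after removing finitely many gaps are disjoint,
    and so are their images; the images have total length at most 2, so the remaining arcs
    themselves have total length at most \<open>2 / \<kappa>\<close> for any prescribed expansion factor \<open>\<kappa>\<close>
    (\<open>gaps_full_length\<close>). The increment of a Lipschitz function is therefore the sum of its
    increments over gaps.

  \<^item> There is one orbit of gaps \<open>(a n, b n)\<close>, \<open>n \<in> \<int>\<close>. Put \<open>\<tau> n = P (b n) - P (a n)\<close>. Once around the
    circle the increments of the periodic function \<open>P\<close> cancel, so the \<open>\<tau> n\<close> sum to 0 over \<open>\<int>\<close>; with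
    several holes this would hold only for the sum over all the orbits. The gap lengths tend to 0
    and expand in one of the two time directions, so they decay exponentially in \<open>\<bar>n\<bar>\<close>, and \<open>\<tau>\<close>
    with them.

  The increment of \<open>S\<^sub>n P\<close> over the gap number \<open>k\<close> is the block sum \<open>\<tau> k + \<dots> + \<tau> (k + n - 1)\<close>. By
  the vanishing of the total sum it equals minus the two tails, so it is of order
  \<open>\<theta>\<^bsup>\<bar>k\<bar>\<^esup> + \<theta>\<^bsup>\<bar>k + n\<bar>\<^esup>\<close> with \<open>\<theta> < 1\<close>, and the sum over \<open>k\<close> is bounded independently of \<open>n\<close>, \<open>x\<close> and
  \<open>y\<close> (\<open>birkhoff_sums_bounded\<close>).

  The remaining work connects this with the Hamiltonian flows. A Gronwall estimate gives uniqueness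
  and Lipschitz dependence of integral curves. Orbits through the Aubry-Mather set are global because
  a solution over one return time can be continued by the solution of the image point. The
  Hamiltonian vector field of the reparametrized flow is merely continuous off the energy surface;
  the surface is nevertheless invariant, because the energy satisfies a linear equation along every
  integral curve, and on the surface the field is locally Lipschitz.
\<close>

section \<open>Coordinates on the circle\<close>

lemma circ_add_int [simp]: "circ (x + of_int k) = circ x"
proof -
  have "cis (2 * pi * of_int k) = 1" by (simp add: cis_multiple_2pi)
  then show ?thesis by (simp add: circ_def distrib_left flip: cis_mult)
qed

lemma circ_eq_iff: "circ x = circ y \<longleftrightarrow> (\<exists>k::int. y = x + of_int k)"
proof
  assume "circ x = circ y"
  then have "cis (2 * pi * y - 2 * pi * x) = 1" by (simp add: circ_def cis_divide[symmetric])
  then have "cos (2 * pi * y - 2 * pi * x) = 1" by (metis cis.simps(1) one_complex.simps(1))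
  then obtain k :: int where "2 * pi * y - 2 * pi * x = of_int k * (2 * pi)"
    using cos_one_2pi_int by auto
  then have "(2 * pi) * y = (2 * pi) * (x + of_int k)" by (simp add: algebra_simps)
  then show "\<exists>k::int. y = x + of_int k" by auto
qed auto

lemma circ_0 [simp]: "circ 0 = 1" by (simp add: circ_def)

lemma circ_in_circle: "circ x \<in> circle" by (simp add: circ_def)

lemma circ_surj: assumes "z \<in> circle" obtains x where "z = circ x"
proof -
  have "z \<noteq> 0" "norm z = 1" using assms by auto
  then have "z = cis (Arg z)" using rcis_cmod_Arg[of z] by (simp add: rcis_def)
  then have "z = circ (Arg z / (2 * pi))" by (simp add: circ_def)
  then show thesis by (rule that)
qed

lemma continuous_circ: "continuous_on UNIV circ"
  unfolding circ_def by (intro continuous_intros)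

text \<open>
  The covering map \<open>circ\<close> is open: nearby points of the circle have nearby lifts. Continuity
  statements on the quotients are reduced to the covers in this way.
\<close>

lemma circ_local_lift:
  assumes "0 < e"
  obtains d where "0 < d" "\<And>z. z \<in> circle \<Longrightarrow> dist z (circ x) < d \<Longrightarrow> \<exists>y. circ y = z \<and> dist y x < e"
proof -
  have "continuous (at (1::complex)) Arg" by (rule continuous_at_Arg) auto
  then obtain d where d: "0 < d" "\<And>w. dist w 1 < d \<Longrightarrow> dist (Arg w) (Arg 1) < 2 * pi * e"
    unfolding continuous_at_eps_delta using assms by (metis mult_pos_pos pi_gt_zero zero_less_numeral)
  show thesis
  proof (rule that[OF d(1)])
    fix z assume z: "z \<in> circle" "dist z (circ x) < d"
    define w where "w = z / circ x"
    have "w - 1 = (z - circ x) / circ x" by (simp add: w_def circ_def diff_divide_distrib)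
    then have "dist w 1 < d" using z by (simp add: dist_norm norm_divide circ_def)
    then have "\<bar>Arg w\<bar> < 2 * pi * e" using d(2) by (fastforce simp: dist_real_def)
    moreover have "circ (x + Arg w / (2 * pi)) = z"
    proof -
      have "w \<noteq> 0" "norm w = 1" using z by (auto simp: w_def norm_divide circ_def)
      then have "w = cis (Arg w)" using rcis_cmod_Arg[of w] by (simp add: rcis_def)
      moreover have "circ (x + Arg w / (2 * pi)) = circ x * cis (Arg w)"
        by (simp add: circ_def distrib_left cis_mult)
      ultimately show ?thesis by (simp add: w_def circ_def)
    qed
    ultimately show "\<exists>y. circ y = z \<and> dist y x < e"
      by (intro exI[of _ "x + Arg w / (2 * pi)"]) (auto simp: dist_real_def field_simps)
  qed
qed

lemma proj4_eq_iff: "proj4 p = proj4 p' \<longleftrightarrow> (\<exists>k l::int. p' = p + (of_int k, 0, of_int l, 0))"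
  by (cases p; cases p') (auto simp: proj4_def circ_eq_iff)

lemma proj4_deck [simp]: "proj4 (p + (of_int k, 0, of_int l, 0)) = proj4 p"
  using proj4_eq_iff by metis

lemma proj2_eq_iff: "proj2 x = proj2 y \<longleftrightarrow> (\<exists>k::int. y = x + (of_int k, 0))"
  by (cases x; cases y) (auto simp: proj2_def circ_eq_iff)

lemma proj2_deck [simp]: "proj2 (x + (of_int k, 0)) = proj2 x"
  using proj2_eq_iff by metis

lemma continuous_proj4: "continuous_on UNIV proj4"
  unfolding proj4_def case_prod_unfold
  by (intro continuous_intros continuous_on_compose2[OF continuous_circ]) auto

lemma proj4_in_phase_space: "proj4 p \<in> phase_space"
  by (cases p) (auto simp: proj4_def phase_space_def circ_in_circle[simplified])

section \<open>Locally Lipschitz vector fields and their integral curves\<close>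

text \<open>
  By the Lipschitz condition the squared distance of the two curves, multiplied by \<open>exp (- 2 L s)\<close>,
  has a nonpositive derivative.
\<close>

lemma gronwall:
  fixes c1 c2 :: "real \<Rightarrow> 'a::real_inner"
  assumes c1: "\<And>t. t \<in> {0..T} \<Longrightarrow> (c1 has_vector_derivative V (c1 t)) (at t within {0..T})"
    and c2: "\<And>t. t \<in> {0..T} \<Longrightarrow> (c2 has_vector_derivative V (c2 t)) (at t within {0..T})"
    and lip: "L-lipschitz_on B V"
    and B: "\<And>t. t \<in> {0..T} \<Longrightarrow> c1 t \<in> B \<and> c2 t \<in> B"
    and t: "t \<in> {0..T}"
  shows "norm (c1 t - c2 t) \<le> exp (L * t) * norm (c1 0 - c2 0)"
proof -
  define d where "d s = c1 s - c2 s" for s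
  define N where "N s = (d s \<bullet> d s) * exp (- (2 * L) * s)" for s
  define N' where "N' s = 2 * (d s \<bullet> (V (c1 s) - V (c2 s)) - L * (d s \<bullet> d s)) * exp (- (2 * L) * s)" for s
  have der_d: "(d has_vector_derivative (V (c1 s) - V (c2 s))) (at s within {0..T})" if "s \<in> {0..T}" for s
    unfolding d_def using c1[OF that] c2[OF that] by (rule has_vector_derivative_diff)
  have N_der: "(N has_derivative (\<lambda>x. N' s * x)) (at s within {0..T})" if "s \<in> {0..T}" for s
  proof -
    have 1: "(d has_derivative (\<lambda>x. x *\<^sub>R (V (c1 s) - V (c2 s)))) (at s within {0..T})"
      using der_d[OF that] by (simp add: has_vector_derivative_def)
    show ?thesis
      unfolding N_def
      by (rule has_derivative_eq_rhs, (rule derivative_intros 1)+)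
         (auto simp: N'_def fun_eq_iff inner_commute algebra_simps)
  qed
  have N'_le: "N' s \<le> 0" if s: "s \<in> {0..T}" for s
  proof -
    have "d s \<bullet> (V (c1 s) - V (c2 s)) \<le> norm (d s) * norm (V (c1 s) - V (c2 s))"
      by (rule norm_cauchy_schwarz)
    also have "\<dots> \<le> norm (d s) * (L * norm (d s))"
      using lipschitz_onD[OF lip, of "c1 s" "c2 s"] B[OF s]
      by (intro mult_left_mono) (auto simp: dist_norm d_def)
    also have "\<dots> = L * (d s \<bullet> d s)"
      by (simp add: dot_square_norm power2_eq_square)
    finally show ?thesis
      unfolding N'_def by (intro mult_nonpos_nonneg[OF mult_nonneg_nonpos]) auto
  qed
  have "N t \<le> N 0"
  proof (cases "t = 0")
    case False
    then have "0 < t" using t by auto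
    moreover have "(N has_derivative (\<lambda>x. N' s * x)) (at s within {0..t})" if "s \<in> {0..t}" for s
      by (rule has_derivative_subset[OF N_der]) (use that t in auto)
    ultimately obtain s where "s \<in> {0<..<t}" "N t - N 0 = N' s * (t - 0)"
      using mvt_simple[of 0 t N "\<lambda>s x. N' s * x"] by auto
    moreover have "N' s * (t - 0) \<le> 0" 
      using N'_le[of s] \<open>s \<in> {0<..<t}\<close> t by (intro mult_nonpos_nonneg) auto
    ultimately show ?thesis by linarith
  qed simp
  then have "norm (d t) ^ 2 * exp (- (2 * L) * t) \<le> norm (d 0) ^ 2"
    by (simp add: N_def dot_square_norm)
  then have "norm (d t) ^ 2 * exp (- (2 * L) * t) * exp (2 * L * t) \<le> norm (d 0) ^ 2 * exp (2 * L * t)"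
    by (intro mult_right_mono) auto
  moreover have "exp (- (2 * L) * t) * exp (2 * L * t) = 1" by (simp flip: exp_add)
  moreover have "exp (2 * L * t) = exp (L * t) ^ 2" by (simp add: exp_double[symmetric] mult.assoc)
  ultimately have "norm (d t) ^ 2 \<le> norm (d 0) ^ 2 * exp (L * t) ^ 2"
    by (metis mult.assoc mult.right_neutral)
  then have "norm (d t) ^ 2 \<le> (exp (L * t) * norm (d 0)) ^ 2"
    by (simp add: power_mult_distrib mult.commute)
  then show ?thesis
    unfolding d_def by (rule power2_le_imp_le) simp
qed

definition locally_lipschitz_field :: "('a::real_normed_vector \<Rightarrow> 'b::real_normed_vector) \<Rightarrow> bool" where
  "locally_lipschitz_field V \<longleftrightarrow> (\<forall>r. \<exists>L. L-lipschitz_on (cball 0 r) V)"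

text \<open>
  The notion \<open>integral_curve\<close> for vector fields on an arbitrary space.
\<close>

definition solves where
  "solves V t c \<longleftrightarrow> (\<forall>\<tau> \<in> closed_segment 0 t.
        (c has_vector_derivative V (c \<tau>)) (at \<tau> within closed_segment 0 t))"

lemma solves_continuous: "solves V t c \<Longrightarrow> continuous_on (closed_segment 0 t) c"
  unfolding solves_def by (intro continuous_on_vector_derivative) auto

text \<open>
  Time reversal, which reduces negative times to positive ones.
\<close>

lemma solves_reflect:
  fixes c :: "real \<Rightarrow> 'a::real_normed_vector"
  assumes "solves V t c" shows "solves (\<lambda>x. - V x) (- t) (\<lambda>s. c (- s))"
  unfolding solves_def
proof
  fix s assume s: "s \<in> closed_segment 0 (- t)"
  have img: "uminus ` closed_segment 0 (- t) = closed_segment 0 t"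
    by (auto simp: closed_segment_eq_real_ivl image_iff intro!: bexI[of _ "- _"] split: if_splits)
  have "- s \<in> closed_segment 0 t" using s img by auto
  then have "(c has_vector_derivative V (c (- s))) (at (- s) within uminus ` closed_segment 0 (- t))"
    using assms unfolding solves_def img by auto
  moreover have "(uminus has_vector_derivative (- 1 :: real)) (at s within closed_segment 0 (- t))"
    by (auto intro!: derivative_eq_intros)
  ultimately have "((c \<circ> uminus) has_vector_derivative ((-1::real) *\<^sub>R V (c (- s)))) (at s within closed_segment 0 (- t))"
    by (intro vector_diff_chain_within) auto
  then show "((\<lambda>s. c (- s)) has_vector_derivative - V (c (- s))) (at s within closed_segment 0 (- t))"
    by (simp add: o_def)
qed

text \<open>
  A curve that starts close to \<open>c0\<close> cannot leave the tube of radius 1 around it before time \<open>t\<close>: up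
  to the first exit time the Gronwall estimate holds with the Lipschitz constant of a ball that
  contains the tube, and it keeps the distance below 1.
\<close>

lemma lipschitz_dependence_forward:
  fixes V :: "'a::euclidean_space \<Rightarrow> 'a"
  assumes V: "locally_lipschitz_field V" and c0: "solves V t c0" and t: "0 \<le> t"
  shows "\<exists>\<delta>>0. \<exists>C\<ge>0. \<forall>c1 c2. solves V t c1 \<longrightarrow> solves V t c2 \<longrightarrow> norm (c1 0 - c0 0) < \<delta> \<longrightarrow>
           norm (c2 0 - c0 0) < \<delta> \<longrightarrow>
           (\<forall>s\<in>closed_segment 0 t. norm (c1 s - c2 s) \<le> C * norm (c1 0 - c2 0))"
proof -
  have seg: "closed_segment 0 t = {0..t}" using t by (simp add: closed_segment_eq_real_ivl)
  have "compact (c0 ` {0..t})"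
    using solves_continuous[OF c0] by (intro compact_continuous_image) (auto simp: seg)
  then obtain b where b: "\<And>s. s \<in> {0..t} \<Longrightarrow> norm (c0 s) \<le> b"
    using compact_imp_bounded bounded_iff by (metis imageI)
  obtain L where L: "L-lipschitz_on (cball 0 (b + 1)) V"
    using V unfolding locally_lipschitz_field_def by blast
  have L0: "0 \<le> L" using L lipschitz_on_nonneg by blast
  \<comment> \<open>with this radius the Gronwall factor at time \<open>t\<close> keeps the distance below 1\<close>
  define \<delta> where "\<delta> = exp (- (L * t))"
  have close: "norm (c s - c0 s) < 1" 
    if c: "solves V t c" and cd: "norm (c 0 - c0 0) < \<delta>" and s: "s \<in> {0..t}" for c s
  proof (rule ccontr)
    assume far: "\<not> norm (c s - c0 s) < 1"
    define E where "E = {0..t} \<inter> (\<lambda>s. norm (c s - c0 s)) -` {1..}"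
    have cont: "continuous_on {0..t} (\<lambda>s. norm (c s - c0 s))"
      using solves_continuous[OF c] solves_continuous[OF c0] by (auto simp: seg intro!: continuous_intros)
    have "closed E" unfolding E_def
      by (rule continuous_closed_preimage[OF cont]) auto
    moreover have "E \<noteq> {}" using far s by (auto simp: E_def)
    moreover have bdd: "bdd_below E" by (auto simp: E_def intro!: bdd_belowI[of _ 0])
    ultimately have inf: "Inf E \<in> E" using closed_contains_Inf by blast
    define m where "m = Inf E"
    have m: "0 \<le> m" "m \<le> t" "1 \<le> norm (c m - c0 m)" using inf by (auto simp: E_def m_def)
    have less: "norm (c s - c0 s) < 1" if "0 \<le> s" "s < m" for s
    proof (rule ccontr)
      assume "\<not> norm (c s - c0 s) < 1"
      then have "s \<in> E" using that m by (auto simp: E_def)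
      then show False using cInf_lower[OF _ bdd, of s] that by (simp add: m_def)
    qed
    have exp_le: "exp (L * m) * norm (c 0 - c0 0) < 1"
    proof -
      have "exp (L * m) * norm (c 0 - c0 0) \<le> exp (L * t) * norm (c 0 - c0 0)"
        using m L0 by (intro mult_right_mono) (auto intro: mult_left_mono)
      also have "\<dots> < exp (L * t) * \<delta>" using cd by simp
      also have "\<dots> = 1" by (simp add: \<delta>_def exp_minus)
      finally show ?thesis .
    qed
    have m0: "0 < m"
    proof (rule ccontr)
      assume "\<not> 0 < m"
      then have "m = 0" using m by simp
      then show False using exp_le m by simp
    qed
    have le1: "norm (c s - c0 s) \<le> 1" if "s \<in> {0..m}" for s
    proof -
      have cm: "continuous_on {0..m} (\<lambda>s. norm (c s - c0 s))"
        by (rule continuous_on_subset[OF cont]) (use m in auto)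
      have "closure {0<..<m} = {0..m}" using m0 by simp
      then show ?thesis
        using continuous_le_on_closure[of "{0<..<m}" "\<lambda>s. norm (c s - c0 s)" s 1] cm that
        by simp (metis less less_imp_le)
    qed
    have "norm (c m - c0 m) \<le> exp (L * m) * norm (c 0 - c0 0)"
    proof (rule gronwall[where T = m and V = V and B = "cball 0 (b + 1)"])
      fix s assume s: "s \<in> {0..m}"
      then have s': "s \<in> closed_segment 0 t" using m by (auto simp: seg)
      show "(c has_vector_derivative V (c s)) (at s within {0..m})"
        by (rule has_vector_derivative_within_subset[of _ _ _ "closed_segment 0 t"])
           (use c s' m in \<open>auto simp: solves_def seg\<close>)
      show "(c0 has_vector_derivative V (c0 s)) (at s within {0..m})"
        by (rule has_vector_derivative_within_subset[of _ _ _ "closed_segment 0 t"])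
           (use c0 s' m in \<open>auto simp: solves_def seg\<close>)
      have "norm (c s) \<le> norm (c s - c0 s) + norm (c0 s)" using norm_triangle_sub[of "c s" "c0 s"] by simp
      then show "c s \<in> cball 0 (b + 1) \<and> c0 s \<in> cball 0 (b + 1)"
        using b[of s] le1[OF s] s m by auto
    qed (use L m in auto)
    then show False using exp_le m by linarith
  qed
  have main: "norm (c1 s - c2 s) \<le> exp (L * t) * norm (c1 0 - c2 0)"
    if c: "solves V t c1" "solves V t c2" and cd: "norm (c1 0 - c0 0) < \<delta>" "norm (c2 0 - c0 0) < \<delta>"
      and s: "s \<in> {0..t}" for c1 c2 s
  proof -
    have inB: "c s \<in> cball 0 (b + 1)" if "solves V t c" "norm (c 0 - c0 0) < \<delta>" "s \<in> {0..t}" for c s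
    proof -
      have "norm (c s) \<le> norm (c s - c0 s) + norm (c0 s)" using norm_triangle_sub[of "c s" "c0 s"] by simp
      then show ?thesis using close[OF that] b[OF that(3)] by auto
    qed
    have "norm (c1 s - c2 s) \<le> exp (L * s) * norm (c1 0 - c2 0)"
      by (rule gronwall[where T = t and V = V and B = "cball 0 (b + 1)"])
         (use c cd s L inB in \<open>auto simp: solves_def seg\<close>)
    also have "\<dots> \<le> exp (L * t) * norm (c1 0 - c2 0)"
      using s L0 by (intro mult_right_mono) (auto intro: mult_left_mono)
    finally show ?thesis .
  qed
  show ?thesis
    by (rule exI[of _ \<delta>], rule conjI, simp add: \<delta>_def, rule exI[of _ "exp (L * t)"])
       (use main in \<open>auto simp: seg\<close>)
qed

lemma lipschitz_dependence:
  fixes V :: "'a::euclidean_space \<Rightarrow> 'a"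
  assumes V: "locally_lipschitz_field V" and c0: "solves V t c0"
  obtains \<delta> C where "0 < \<delta>" "0 \<le> C"
    "\<And>c1 c2 s. solves V t c1 \<Longrightarrow> solves V t c2 \<Longrightarrow> norm (c1 0 - c0 0) < \<delta> \<Longrightarrow>
           norm (c2 0 - c0 0) < \<delta> \<Longrightarrow> s \<in> closed_segment 0 t \<Longrightarrow>
           norm (c1 s - c2 s) \<le> C * norm (c1 0 - c2 0)"
proof (cases "0 \<le> t")
  case True
  show ?thesis using lipschitz_dependence_forward[OF V c0 True] that by metis
next
  case False
  have "locally_lipschitz_field (\<lambda>x. - V x)"
    using V unfolding locally_lipschitz_field_def by (simp add: lipschitz_on_minus)
  from lipschitz_dependence_forward[OF this solves_reflect[OF c0]] False
  have "\<exists>\<delta>>0. \<exists>C\<ge>0. \<forall>c1 c2. solves (\<lambda>x. - V x) (- t) c1 \<longrightarrow> solves (\<lambda>x. - V x) (- t) c2 \<longrightarrow>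
      norm (c1 0 - c0 0) < \<delta> \<longrightarrow> norm (c2 0 - c0 0) < \<delta> \<longrightarrow>
           (\<forall>s\<in>closed_segment 0 (- t). norm (c1 s - c2 s) \<le> C * norm (c1 0 - c2 0))"
    by simp
  then obtain \<delta> C where *: "0 < \<delta>" "0 \<le> C"
    "\<And>c1 c2 s. solves (\<lambda>x. - V x) (- t) c1 \<Longrightarrow> solves (\<lambda>x. - V x) (- t) c2 \<Longrightarrow> norm (c1 0 - c0 0) < \<delta> \<Longrightarrow>
           norm (c2 0 - c0 0) < \<delta> \<Longrightarrow> s \<in> closed_segment 0 (- t) \<Longrightarrow>
           norm (c1 s - c2 s) \<le> C * norm (c1 0 - c2 0)"
    by metis
  show ?thesis
  proof (rule that[OF *(1,2)])
    fix c1 c2 s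
    assume c: "solves V t c1" "solves V t c2" "norm (c1 0 - c0 0) < \<delta>" "norm (c2 0 - c0 0) < \<delta>"
      and s: "s \<in> closed_segment 0 t"
    have "- s \<in> closed_segment 0 (- t)"
      using s by (auto simp: closed_segment_eq_real_ivl split: if_splits)
    from *(3)[OF solves_reflect[OF c(1)] solves_reflect[OF c(2)] _ _ this] c(3,4)
    show "norm (c1 s - c2 s) \<le> C * norm (c1 0 - c2 0)" by simp
  qed
qed

lemma solves_unique:
  fixes V :: "'a::euclidean_space \<Rightarrow> 'a"
  assumes "locally_lipschitz_field V" "solves V t c1" "solves V t c2" "c1 0 = c2 0" "s \<in> closed_segment 0 t"
  shows "c1 s = c2 s"
proof -
  obtain \<delta> C where "0 < \<delta>" "0 \<le> C"
    and *: "\<And>c c' s. solves V t c \<Longrightarrow> solves V t c' \<Longrightarrow> norm (c 0 - c1 0) < \<delta> \<Longrightarrow>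
           norm (c' 0 - c1 0) < \<delta> \<Longrightarrow> s \<in> closed_segment 0 t \<Longrightarrow>
           norm (c s - c' s) \<le> C * norm (c 0 - c' 0)"
    using lipschitz_dependence[OF assms(1,2)] by metis
  from *[OF assms(2,3) _ _ assms(5)] \<open>0 < \<delta>\<close> assms(4) show ?thesis by simp
qed

lemma locally_lipschitz_const: "locally_lipschitz_field (\<lambda>_. c)"
  unfolding locally_lipschitz_field_def by (metis lipschitz_on_constant)

lemma locally_lipschitz_bounded_linear:
  assumes "bounded_linear f" shows "locally_lipschitz_field f"
proof -
  obtain K where "\<And>x. norm (f x) \<le> norm x * K" "K > 0" using bounded_linear.pos_bounded[OF assms] by metis
  then have "K-lipschitz_on UNIV f"
    by (intro lipschitz_onI) (auto simp: dist_norm mult.commute simp flip: linear_diff[OF bounded_linear.linear[OF assms]])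
  then show ?thesis unfolding locally_lipschitz_field_def by (meson lipschitz_on_subset subset_UNIV)
qed

lemma locally_lipschitz_combine:
  fixes f :: "'a::real_normed_vector \<Rightarrow> 'b::real_normed_vector" and g :: "'a \<Rightarrow> 'c::real_normed_vector"
    and k :: "'a \<Rightarrow> 'd::real_normed_vector"
  assumes f: "locally_lipschitz_field f" and g: "locally_lipschitz_field g"
    and dist: "\<And>x y. dist (k x) (k y) \<le> dist (f x) (f y) + dist (g x) (g y)"
  shows "locally_lipschitz_field k"
  unfolding locally_lipschitz_field_def
proof
  fix r
  obtain L M where L: "L-lipschitz_on (cball 0 r) f" and M: "M-lipschitz_on (cball 0 r) g"
    using f g unfolding locally_lipschitz_field_def by blast
  have "(L + M)-lipschitz_on (cball 0 r) k"
  proof (rule lipschitz_onI)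
    fix x y :: 'a assume xy: "x \<in> cball 0 r" "y \<in> cball 0 r"
    show "dist (k x) (k y) \<le> (L + M) * dist x y"
      using dist[of x y] lipschitz_onD[OF L xy] lipschitz_onD[OF M xy] by (simp add: distrib_right)
  qed (use lipschitz_on_nonneg[OF L] lipschitz_on_nonneg[OF M] in simp)
  then show "\<exists>L. L-lipschitz_on (cball 0 r) k" by blast
qed

lemma locally_lipschitz_add:
  "locally_lipschitz_field f \<Longrightarrow> locally_lipschitz_field g \<Longrightarrow> locally_lipschitz_field (\<lambda>x. f x + g x)"
  by (erule locally_lipschitz_combine, assumption) (rule dist_triangle_add)

lemma locally_lipschitz_Pair:
  "locally_lipschitz_field f \<Longrightarrow> locally_lipschitz_field g \<Longrightarrow> locally_lipschitz_field (\<lambda>x. (f x, g x))"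
  by (erule locally_lipschitz_combine, assumption)
     (simp add: dist_Pair_Pair sqrt_sum_squares_le_sum)

lemma locally_lipschitz_bound:
  fixes f :: "'a::real_normed_vector \<Rightarrow> 'b::real_normed_vector"
  assumes "locally_lipschitz_field f"
  obtains B where "0 \<le> B" "\<And>x. x \<in> cball 0 r \<Longrightarrow> norm (f x) \<le> B"
proof -
  obtain L where L: "L-lipschitz_on (cball 0 (max r 0)) f" using assms unfolding locally_lipschitz_field_def by blast
  have L0: "0 \<le> L" using L by (rule lipschitz_on_nonneg)
  show thesis
  proof (rule that[of "norm (f 0) + L * max r 0"])
    fix x :: 'a assume x: "x \<in> cball 0 r"
    then have "dist (f x) (f 0) \<le> L * dist x 0" by (intro lipschitz_onD[OF L]) auto
    also have "\<dots> \<le> L * max r 0" using x L0 by (intro mult_left_mono) auto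
    finally have "norm (f x - f 0) \<le> L * max r 0" by (simp add: dist_norm)
    then show "norm (f x) \<le> norm (f 0) + L * max r 0"
      using norm_triangle_sub[of "f x" "f 0"] by simp
  qed (use L0 in auto)
qed

lemma locally_lipschitz_compose:
  fixes f :: "'b::real_normed_vector \<Rightarrow> 'c::real_normed_vector"
    and g :: "'a::real_normed_vector \<Rightarrow> 'b"
  assumes f: "locally_lipschitz_field f" and g: "locally_lipschitz_field g"
  shows "locally_lipschitz_field (\<lambda>x. f (g x))"
  unfolding locally_lipschitz_field_def
proof
  fix r
  obtain L where L: "L-lipschitz_on (cball 0 r) g" using g unfolding locally_lipschitz_field_def by blast
  obtain B where B: "\<And>x. x \<in> cball 0 r \<Longrightarrow> norm (g x) \<le> B" by (metis locally_lipschitz_bound[OF g])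
  obtain M where M: "M-lipschitz_on (cball 0 B) f" using f unfolding locally_lipschitz_field_def by blast
  have "M-lipschitz_on (g ` cball 0 r) f"
    by (rule lipschitz_on_subset[OF M]) (use B in auto)
  from lipschitz_on_compose2[OF L this] show "\<exists>L. L-lipschitz_on (cball 0 r) (\<lambda>x. f (g x))" by (auto simp: o_def)
qed

lemma locally_lipschitz_scaleR:
  fixes a :: "'a::real_normed_vector \<Rightarrow> real" and f :: "'a \<Rightarrow> 'b::real_normed_vector"
  assumes a: "locally_lipschitz_field a" and f: "locally_lipschitz_field f"
  shows "locally_lipschitz_field (\<lambda>x. a x *\<^sub>R f x)"
  unfolding locally_lipschitz_field_def
proof
  fix r
  obtain L where L: "L-lipschitz_on (cball 0 r) f" using f unfolding locally_lipschitz_field_def by blast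
  obtain M where M: "M-lipschitz_on (cball 0 r) a" using a unfolding locally_lipschitz_field_def by blast
  obtain B where B: "0 \<le> B" "\<And>x. x \<in> cball 0 r \<Longrightarrow> norm (f x) \<le> B" by (metis locally_lipschitz_bound[OF f])
  obtain C where C: "0 \<le> C" "\<And>x. x \<in> cball 0 r \<Longrightarrow> norm (a x) \<le> C" by (metis locally_lipschitz_bound[OF a])
  have L0: "0 \<le> L" "0 \<le> M" using L M lipschitz_on_nonneg by blast+
  have "(C * L + M * B)-lipschitz_on (cball 0 r) (\<lambda>x. a x *\<^sub>R f x)"
  proof (rule lipschitz_onI)
    fix x y :: 'a assume xy: "x \<in> cball 0 r" "y \<in> cball 0 r"
    have "a x *\<^sub>R f x - a y *\<^sub>R f y = a x *\<^sub>R (f x - f y) + (a x - a y) *\<^sub>R f y" by (simp add: algebra_simps)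
    then have "norm (a x *\<^sub>R f x - a y *\<^sub>R f y) \<le> norm (a x) * norm (f x - f y) + norm (a x - a y) * norm (f y)"
      by (metis norm_scaleR norm_triangle_ineq real_norm_def)
    also have "\<dots> \<le> C * (L * dist x y) + (M * dist x y) * B"
      using xy B C L0 lipschitz_onD[OF L, of x y] lipschitz_onD[OF M, of x y]
      by (intro add_mono mult_mono) (auto simp: dist_norm)
    finally show "dist (a x *\<^sub>R f x) (a y *\<^sub>R f y) \<le> (C * L + M * B) * dist x y"
      by (simp add: dist_norm algebra_simps)
  qed (use B C L0 in simp)
  then show "\<exists>L. L-lipschitz_on (cball 0 r) (\<lambda>x. a x *\<^sub>R f x)" by blast
qed

lemma locally_lipschitz_continuous:
  fixes f :: "'a::real_normed_vector \<Rightarrow> 'b::real_normed_vector"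
  shows "locally_lipschitz_field f \<Longrightarrow> continuous_on UNIV f"
proof -
  assume f: "locally_lipschitz_field f"
  have "isCont f x" for x
  proof -
    obtain L where "L-lipschitz_on (cball 0 (norm x + 1)) f" using f unfolding locally_lipschitz_field_def by blast
    then have "continuous_on (ball x 1) f"
    proof (rule continuous_on_subset[OF lipschitz_on_continuous_on])
      show "ball x 1 \<subseteq> cball 0 (norm x + 1)"
      proof
        fix y assume "y \<in> ball x 1"
        then show "y \<in> cball 0 (norm x + 1)"
          using norm_triangle_sub[of y x] by (simp add: dist_norm norm_minus_commute)
      qed
    qed
    then show ?thesis by (simp add: continuous_on_eq_continuous_at)
  qed
  then show ?thesis by (simp add: continuous_at_imp_continuous_on)
qed

lemma Ck_1_iff: "Ck 1 f \<longleftrightarrow> (\<forall>x. f differentiable (at x)) \<and> (\<forall>v. continuous_on UNIV (\<lambda>x. frechet_derivative f (at x) v))"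
  by simp

lemma Ck_1_locally_lipschitz:
  fixes f :: "'a::euclidean_space \<Rightarrow> 'b::real_normed_vector"
  assumes "Ck 1 f" shows "locally_lipschitz_field f"
  unfolding locally_lipschitz_field_def
proof
  fix r :: real
  let ?D = "\<lambda>x. frechet_derivative f (at x)"
  have der: "(f has_derivative ?D x) (at x)" for x
    using assms Ck_1_iff frechet_derivative_works by metis
  have "\<exists>B\<ge>0. \<forall>x\<in>cball 0 r. norm (?D x b) \<le> B" for b
  proof -
    have "continuous_on (cball 0 r) (\<lambda>x. ?D x b)"
      by (rule continuous_on_subset[of UNIV]) (use assms in \<open>auto simp: Ck_1_iff simp del: One_nat_def\<close>)
    then have "bounded ((\<lambda>x. ?D x b) ` cball 0 r)"
      by (intro compact_imp_bounded compact_continuous_image) auto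
    then obtain B where "\<forall>x\<in>cball 0 r. norm (?D x b) \<le> B" by (auto simp: bounded_iff)
    then show ?thesis by (intro exI[of _ "max B 0"]) auto
  qed
  then obtain B where B: "\<And>b. 0 \<le> B b" "\<And>b x. x \<in> cball 0 r \<Longrightarrow> norm (?D x b) \<le> B b" by metis
  define C where "C = (\<Sum>b\<in>Basis. B b)"
  have "C-lipschitz_on (cball 0 r) f"
  proof (rule lipschitz_onI)
    fix x y :: 'a assume xy: "x \<in> cball 0 r" "y \<in> cball 0 r"
    have "norm (f x - f y) \<le> C * norm (x - y)"
    proof (rule differentiable_bound[OF convex_cball _ _ xy])
      fix z :: 'a assume z: "z \<in> cball 0 r"
      show "(f has_derivative ?D z) (at z within cball 0 r)" using der by (rule has_derivative_at_withinI)
      have lin: "linear (?D z)" using der[of z] by (rule has_derivative_linear)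
      show "onorm (?D z) \<le> C"
      proof (rule onorm_le)
        fix v
        have "?D z v = (\<Sum>b\<in>Basis. (v \<bullet> b) *\<^sub>R ?D z b)"
          by (subst euclidean_representation[of v, symmetric]) (simp add: linear_sum[OF lin] linear_scale[OF lin])
        also have "norm \<dots> \<le> (\<Sum>b\<in>Basis. B b * norm v)"
        proof (rule sum_norm_le)
          fix b :: 'a assume "b \<in> Basis"
          then have "\<bar>v \<bullet> b\<bar> * norm (?D z b) \<le> norm v * B b"
            using B(2)[OF z, of b] Basis_le_norm[of b v] by (intro mult_mono) auto
          then show "norm ((v \<bullet> b) *\<^sub>R ?D z b) \<le> B b * norm v" by (simp add: mult.commute)
        qed
        finally show "norm (?D z v) \<le> C * norm v" by (simp add: C_def sum_distrib_right)
      qed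
    qed
    then show "dist (f x) (f y) \<le> C * dist x y" by (simp add: dist_norm)
  qed (simp add: C_def B sum_nonneg)
  then show "\<exists>L. L-lipschitz_on (cball 0 r) f" by blast
qed

lemma locally_lipschitz_inverse:
  fixes f :: "'a::euclidean_space \<Rightarrow> real"
  assumes f: "locally_lipschitz_field f" and pos: "\<And>x. 0 < f x"
  shows "locally_lipschitz_field (\<lambda>x. 1 / f x)"
  unfolding locally_lipschitz_field_def
proof
  fix r :: real
  show "\<exists>L. L-lipschitz_on (cball 0 r) (\<lambda>x. 1 / f x)"
  proof (cases "cball (0::'a) r = {}")
    case True then show ?thesis by (metis lipschitz_on_empty order_refl)
  next
    case False
    obtain L where L: "L-lipschitz_on (cball 0 r) f" using f unfolding locally_lipschitz_field_def by blast
    have L0: "0 \<le> L" using L by (rule lipschitz_on_nonneg)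
    obtain x0 where x0: "\<And>x. x \<in> cball 0 r \<Longrightarrow> f x0 \<le> f x"
      using continuous_attains_inf[OF compact_cball False continuous_on_subset[OF locally_lipschitz_continuous[OF f]]]
      by blast
    define m where "m = f x0"
    have m: "0 < m" using pos by (simp add: m_def)
    have "(L / (m * m))-lipschitz_on (cball 0 r) (\<lambda>x. 1 / f x)"
    proof (rule lipschitz_onI)
      fix x y :: 'a assume xy: "x \<in> cball 0 r" "y \<in> cball 0 r"
      have eq: "1 / f x - 1 / f y = (f y - f x) / (f x * f y)"
        using pos[of x] pos[of y] by (simp add: field_simps)
      have "dist (1 / f x) (1 / f y) = \<bar>f y - f x\<bar> / (f x * f y)"
        unfolding dist_real_def eq using pos[of x] pos[of y] by (simp add: abs_mult)
      also have "\<dots> \<le> (L * dist x y) / (m * m)"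
        using lipschitz_onD[OF L xy] x0[OF xy(1)] x0[OF xy(2)] m L0
        by (intro frac_le mult_mono) (auto simp: m_def dist_real_def abs_minus_commute)
      finally show "dist (1 / f x) (1 / f y) \<le> L / (m * m) * dist x y" by simp
    qed (use L0 m in simp)
    then show ?thesis by blast
  qed
qed

lemma has_vector_derivative_Un:
  assumes "(c has_vector_derivative D) (at t within S)" "(c has_vector_derivative D) (at t within T)"
  shows "(c has_vector_derivative D) (at t within (S \<union> T))"
  using assms unfolding has_vector_derivative_def has_derivative_within by (auto intro: Lim_Un)

lemma has_vector_derivative_off_closed:
  assumes "closed S" "t \<notin> S" shows "(c has_vector_derivative D) (at t within S)"
proof -
  have "\<not> t islimpt S" using assms closed_limpt by blast
  then have "at t within S = bot" by (simp add: trivial_limit_within)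
  then show ?thesis by (simp add: has_vector_derivative_def has_derivative_def bounded_linear_scaleR_left)
qed

text \<open>
  A solution is assembled from pieces on the intervals between consecutive integers. At an integer the
  one-sided derivatives agree, since both are the value of the vector field at the common point.
\<close>

lemma glue_pieces:
  fixes P :: "int \<Rightarrow> real \<Rightarrow> 'a::real_normed_vector"
  assumes der: "\<And>i t. t \<in> {of_int i..of_int i + 1} \<Longrightarrow>
      (P i has_vector_derivative V (P i t)) (at t within {of_int i..of_int i + 1})"
    and match: "\<And>i. P i (of_int i + 1) = P (i + 1) (of_int i + 1)"
  shows "((\<lambda>t. P \<lfloor>t\<rfloor> t) has_vector_derivative V (P \<lfloor>t\<rfloor> t)) (at t)"
proof -
  let ?c = "\<lambda>t. P \<lfloor>t\<rfloor> t"
  have eq: "?c t = P i t" if "t \<in> {of_int i..of_int i + 1}" for i t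
  proof (cases "t = of_int i + 1")
    case True
    then have "\<lfloor>t\<rfloor> = i + 1" by simp
    then show ?thesis using match[of i] True by simp
  next
    case False
    then have "\<lfloor>t\<rfloor> = i" using that by (intro floor_unique) auto
    then show ?thesis by simp
  qed
  have within: "(?c has_vector_derivative V (?c t)) (at t within {of_int i..of_int i + 1})" for i t
  proof (cases "t \<in> {of_int i..of_int i + 1}")
    case True
    have "(P i has_vector_derivative V (?c t)) (at t within {of_int i..of_int i + 1})"
      using der[OF True] eq[OF True] by simp
    then show ?thesis by (rule has_vector_derivative_transform[OF True, rotated]) (use eq in auto)
  qed (intro has_vector_derivative_off_closed closed_atLeastAtMost)
  define i where "i = \<lfloor>t\<rfloor>"
  have ti: "of_int (i - 1) < t" "t < of_int i + 1" unfolding i_def by linarith+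
  have "(?c has_vector_derivative V (?c t)) (at t within ({of_int (i - 1)..of_int (i - 1) + 1} \<union> {of_int i..of_int i + 1}))"
    by (intro has_vector_derivative_Un within)
  moreover have "{of_int (i - 1)..of_int (i - 1) + 1} \<union> {of_int i..of_int i + 1} = {of_int (i - 1)..of_int i + (1::real)}"
    by auto
  moreover have "at t within {of_int (i - 1)..of_int i + (1::real)} = at t"
    using ti by (intro at_within_interior) simp
  ultimately show ?thesis by simp
qed

lemma solves_append:
  fixes V :: "'a::real_normed_vector \<Rightarrow> 'a"
  assumes c: "solves V a c" and c': "solves V b c'" and ab: "0 \<le> a" "0 \<le> b"
    and per: "\<And>x. V (x + p) = V x" and match: "c a = c' 0 + p"
  shows "solves V (a + b) (\<lambda>t. if t \<le> a then c t else c' (t - a) + p)"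
proof -
  let ?c = "\<lambda>t. if t \<le> a then c t else c' (t - a) + p"
  have seg: "closed_segment 0 a = {0..a}" "closed_segment 0 b = {0..b}" "closed_segment 0 (a + b) = {0..a} \<union> {a..a + b}"
    using ab by (auto simp: closed_segment_eq_real_ivl)
  have 1: "(?c has_vector_derivative V (?c t)) (at t within {0..a})" for t
  proof (cases "t \<in> {0..a}")
    case True
    then have "(c has_vector_derivative V (?c t)) (at t within {0..a})" using c by (auto simp: solves_def seg)
    then show ?thesis by (rule has_vector_derivative_transform[OF True, rotated]) auto
  qed (intro has_vector_derivative_off_closed closed_atLeastAtMost)
  have 2: "(?c has_vector_derivative V (?c t)) (at t within {a..a + b})" for t
  proof (cases "t \<in> {a..a + b}")
    case True
    have eq: "?c s = c' (s - a) + p" if "s \<in> {a..a + b}" for s using that match by auto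
    have "((\<lambda>s. s - a) has_vector_derivative 1) (at t within {a..a + b})" by (auto intro!: derivative_eq_intros)
    moreover have "(\<lambda>s. s - a) ` {a..a + b} = {0..b}" by (auto simp: image_iff intro!: bexI[of _ "_ + a"])
    moreover have "(c' has_vector_derivative V (c' (t - a))) (at (t - a) within {0..b})"
      using c' True by (auto simp: solves_def seg)
    ultimately have "((c' \<circ> (\<lambda>s. s - a)) has_vector_derivative 1 *\<^sub>R V (c' (t - a))) (at t within {a..a + b})"
      by (intro vector_diff_chain_within) auto
    then have "((\<lambda>s. c' (s - a) + p) has_vector_derivative V (?c t)) (at t within {a..a + b})"
      unfolding eq[OF True] per by (auto simp: o_def intro!: derivative_eq_intros)
    then show ?thesis by (rule has_vector_derivative_transform[OF True, rotated]) (use eq in auto)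
  qed (intro has_vector_derivative_off_closed closed_atLeastAtMost)
  show ?thesis unfolding solves_def seg(3) using has_vector_derivative_Un[OF 1 2] by blast
qed

section \<open>Gaps of an ordered set on the line\<close>

text \<open>
  \<open>K\<close> is the lift to the line of a compact nowhere dense set of the circle and \<open>g\<close> a lift of a cyclic
  order preserving bijection of that set, with inverse \<open>h\<close>.
\<close>

locale circle_lift =
  fixes K :: "real set" and g h :: "real \<Rightarrow> real"
  assumes closed_K: "closed K"
    and K_shift: "\<And>x. x + 1 \<in> K \<longleftrightarrow> x \<in> K"
    and g_in: "\<And>x. x \<in> K \<Longrightarrow> g x \<in> K" and h_in: "\<And>x. x \<in> K \<Longrightarrow> h x \<in> K"
    and gh: "\<And>x. x \<in> K \<Longrightarrow> g (h x) = x" and hg: "\<And>x. x \<in> K \<Longrightarrow> h (g x) = x"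
    and g_less: "\<And>x y. x \<in> K \<Longrightarrow> y \<in> K \<Longrightarrow> x < y \<Longrightarrow> g x < g y"
    and g_shift: "\<And>x. x \<in> K \<Longrightarrow> g (x + 1) = g x + 1"
    and nowhere_dense: "\<And>x y. x < y \<Longrightarrow> \<exists>z. x < z \<and> z < y \<and> z \<notin> K"
    and K_nonempty: "K \<noteq> {}"
begin

lemma K_shift_int: "x + of_int m \<in> K \<longleftrightarrow> x \<in> K"
proof (induction m rule: int_induct[where k = 0])
  case (step1 i) then show ?case using K_shift[of "x + of_int i"] by (simp add: add.assoc)
next
  case (step2 i) then show ?case using K_shift[of "x + of_int (i - 1)"] by (simp add: algebra_simps)
qed simp

lemma g_shift_int: "x \<in> K \<Longrightarrow> g (x + of_int m) = g x + of_int m"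
proof (induction m rule: int_induct[where k = 0])
  case (step1 i) then show ?case using g_shift[of "x + of_int i"] by (simp add: K_shift_int algebra_simps)
next
  case (step2 i) 
  have "x + of_int (i - 1) \<in> K" using step2 by (simp only: K_shift_int)
  from g_shift[OF this] step2 show ?case by (simp add: algebra_simps)
qed simp

lemma g_less_iff: "x \<in> K \<Longrightarrow> y \<in> K \<Longrightarrow> g x < g y \<longleftrightarrow> x < y"
  using g_less[of x y] g_less[of y x] by (metis less_asym linorder_neqE)

lemma h_less_iff: "x \<in> K \<Longrightarrow> y \<in> K \<Longrightarrow> h x < h y \<longleftrightarrow> x < y"
  using g_less_iff[of "h x" "h y"] by (simp add: h_in gh)

lemma h_shift_int: "x \<in> K \<Longrightarrow> h (x + of_int m) = h x + of_int m"
  using g_shift_int[OF h_in, of x m] hg[of "h x + of_int m"] by (simp add: gh h_in K_shift_int)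

text \<open>
  The situation is symmetric under time reversal, so each statement about \<open>g\<close> holds for \<open>h\<close> too.
\<close>

lemma inverse_lift: "circle_lift K h g"
proof
  show "h (x + 1) = h x + 1" if "x \<in> K" for x using h_shift_int[OF that, of 1] by simp
qed (auto simp: closed_K K_shift g_in h_in gh hg h_less_iff nowhere_dense K_nonempty)

lemma gn_in: "x \<in> K \<Longrightarrow> (g ^^ n) x \<in> K"
  by (induction n) (auto simp: g_in)

lemma gn_shift_int: "x \<in> K \<Longrightarrow> (g ^^ n) (x + of_int m) = (g ^^ n) x + of_int m"
  by (induction n) (auto simp: gn_in g_shift_int)

lemma gn_shift: "x \<in> K \<Longrightarrow> (g ^^ n) (x + 1) = (g ^^ n) x + 1"
  using gn_shift_int[of x n 1] by simp

lemma gn_less_iff: "x \<in> K \<Longrightarrow> y \<in> K \<Longrightarrow> (g ^^ n) x < (g ^^ n) y \<longleftrightarrow> x < y"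
  by (induction n) (auto simp: gn_in g_less_iff)

lemma gn_le_iff: "x \<in> K \<Longrightarrow> y \<in> K \<Longrightarrow> (g ^^ n) x \<le> (g ^^ n) y \<longleftrightarrow> x \<le> y"
  using gn_less_iff[of y x n] by auto

lemma hn_gn: "x \<in> K \<Longrightarrow> (h ^^ n) ((g ^^ n) x) = x"
proof (induction n)
  case (Suc n)
  then show ?case by (simp add: funpow_swap1[of h] hg gn_in)
qed simp

lemmas hn_in = circle_lift.gn_in[OF inverse_lift]
lemmas hn_shift = circle_lift.gn_shift[OF inverse_lift]
lemmas hn_shift_int = circle_lift.gn_shift_int[OF inverse_lift]
lemmas hn_less_iff = circle_lift.gn_less_iff[OF inverse_lift]
lemmas hn_le_iff = circle_lift.gn_le_iff[OF inverse_lift]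
lemmas gn_hn = circle_lift.hn_gn[OF inverse_lift]

lemma shift_into_unit:
  assumes "y \<in> K" 
  obtains m :: int where "x \<le> y + of_int m" "y + of_int m < x + 1" "y + of_int m \<in> K"
  by (rule that[of "- \<lfloor>y - x\<rfloor>"]) (use assms in \<open>auto simp only: K_shift_int\<close>, linarith+)

definition gap :: "real \<Rightarrow> real \<Rightarrow> bool" where
  "gap a b \<longleftrightarrow> a \<in> K \<and> b \<in> K \<and> a < b \<and> (\<forall>z. a < z \<longrightarrow> z < b \<longrightarrow> z \<notin> K)"

lemma gap_shift_int: "gap (a + of_int m) (b + of_int m) \<longleftrightarrow> gap a b"
proof -
  have *: "gap (a + of_int m) (b + of_int m)" if "gap a b" for a b m
    unfolding gap_def
  proof (intro conjI allI impI notI)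
    fix z assume "a + of_int m < z" "z < b + of_int m" "z \<in> K"
    then have "z + of_int (- m) \<in> K" by (simp only: K_shift_int)
    then show False using that \<open>a + of_int m < z\<close> \<open>z < b + of_int m\<close>
      unfolding gap_def by (auto dest!: spec[of _ "z - of_int m"])
  qed (use that in \<open>auto simp: gap_def K_shift_int\<close>)
  from *[of a b m] *[of "a + of_int m" "b + of_int m" "- m"] show ?thesis by auto
qed

lemma gap_g: assumes "gap a b" shows "gap (g a) (g b)"
  unfolding gap_def
proof (intro conjI allI impI notI)
  fix z assume z: "g a < z" "z < g b" "z \<in> K"
  then have "a < h z" "h z < b" "h z \<in> K"
    using assms g_less_iff[of a "h z"] g_less_iff[of "h z" b] by (auto simp: gap_def gh h_in)
  then show False using assms by (auto simp: gap_def)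
qed (use assms in \<open>auto simp: gap_def g_in g_less_iff\<close>)

lemma gap_gn: "gap a b \<Longrightarrow> gap ((g ^^ n) a) ((g ^^ n) b)"
  by (induction n) (auto simp: gap_g)

lemmas gap_hn = circle_lift.gap_gn[OF inverse_lift]

lemma gaps_disjoint: "gap a b \<Longrightarrow> gap c d \<Longrightarrow> b \<le> c \<or> d \<le> a \<or> (a = c \<and> b = d)"
  unfolding gap_def by (smt (verit))

lemma gap_same_left: "gap a b \<Longrightarrow> gap a d \<Longrightarrow> b = d"
  unfolding gap_def by (smt (verit))

lemma K_above: obtains y where "y \<in> K" "z \<le> y"
proof -
  obtain k where "k \<in> K" using K_nonempty by auto
  from shift_into_unit[OF this] that show thesis by metis
qed

lemma K_below: obtains y where "y \<in> K" "y \<le> z"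
proof -
  obtain k where "k \<in> K" using K_nonempty by auto
  from shift_into_unit[OF this, of "z - 1"] that show thesis by (metis less_eq_real_def diff_add_cancel)
qed

lemma gap_around:
  assumes "z \<notin> K"
  obtains a b where "gap a b" "a < z" "z < b"
proof -
  obtain y1 where y1: "y1 \<in> K" "z \<le> y1" by (rule K_above)
  obtain y2 where y2: "y2 \<in> K" "y2 \<le> z" by (rule K_below)
  define a where "a = Sup (K \<inter> {..z})"
  define b where "b = Inf (K \<inter> {z..})"
  have a: "a \<in> K \<inter> {..z}" unfolding a_def
    by (rule closed_contains_Sup) (use y2 closed_K in auto)
  have b: "b \<in> K \<inter> {z..}" unfolding b_def
    by (rule closed_contains_Inf) (use y1 closed_K in auto)
  have "a < z" "z < b" using a b assms by (auto simp: less_le)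
  moreover have "gap a b" unfolding gap_def
  proof (intro conjI allI impI notI)
    fix w assume w: "a < w" "w < b" "w \<in> K"
    show False
    proof (cases "w \<le> z")
      case True
      then have "w \<le> a" unfolding a_def using w by (intro cSup_upper) auto
      then show False using w by simp
    next
      case False
      then have "b \<le> w" unfolding b_def using w by (intro cInf_lower) auto
      then show False using w by simp
    qed
  qed (use a b \<open>a < z\<close> \<open>z < b\<close> in auto)
  ultimately show thesis using that by blast
qed

text \<open>
  Finitely many gaps cut \<open>[x, y]\<close> into arcs. If on these arcs the increments of \<open>P\<close> are dominated by
  those of \<open>B\<close>, then so is the increment of \<open>P\<close> outside the gaps. The induction removes one gap and
  treats both sides separately, which spares an enumeration of the gaps in increasing order. The lemma
  is used with \<open>P\<close> Lipschitz and \<open>B\<close> linear, and with \<open>P\<close> linear and \<open>B\<close> measuring the lengths of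
  images of arcs.
\<close>

lemma gap_partition_bound:
  fixes P B :: "real \<Rightarrow> real"
  assumes "finite G" and "\<And>a b. (a, b) \<in> G \<Longrightarrow> gap a b \<and> x \<le> a \<and> b \<le> y"
    and "x \<in> K" "y \<in> K" "x \<le> y"
    and "\<And>u v. u \<in> K \<Longrightarrow> v \<in> K \<Longrightarrow> x \<le> u \<Longrightarrow> u \<le> v \<Longrightarrow> v \<le> y \<Longrightarrow>
           (\<And>a b. (a, b) \<in> G \<Longrightarrow> \<not> (u \<le> a \<and> b \<le> v)) \<Longrightarrow> \<bar>P v - P u\<bar> \<le> B v - B u"
  shows "\<bar>P y - P x - (\<Sum>(a, b)\<in>G. P b - P a)\<bar> \<le> B y - B x - (\<Sum>(a, b)\<in>G. B b - B a)"
  using assms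
proof (induction "card G" arbitrary: G x y rule: less_induct)
  case less
  show ?case
  proof (cases "G = {}")
    case True
    then show ?thesis using less.prems(6)[of x y] less.prems(3-5) by simp
  next
    case False
    then obtain a b where ab: "(a, b) \<in> G" by auto
    define G1 where "G1 = {p \<in> G. snd p \<le> a}"
    define G2 where "G2 = {p \<in> G. b \<le> fst p}"
    note gapG = less.prems(2)
    have gab: "gap a b" "x \<le> a" "b \<le> y" "a < b" "a \<in> K" "b \<in> K" using gapG[OF ab] by (auto simp: gap_def)
    have ord: "fst p < snd p" if "p \<in> G" for p using gapG[of "fst p" "snd p"] that by (auto simp: gap_def)
    have G_eq: "G = insert (a, b) (G1 \<union> G2)"
    proof -
      have "p \<in> insert (a, b) (G1 \<union> G2)" if "p \<in> G" for p
        using gaps_disjoint[OF gab(1), of "fst p" "snd p"] gapG[of "fst p" "snd p"] that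
        unfolding G1_def G2_def by (cases p) auto
      then show ?thesis using ab unfolding G1_def G2_def by blast
    qed
    have nin: "(a, b) \<notin> G1 \<union> G2" "G1 \<inter> G2 = {}"
    proof -
      show "(a, b) \<notin> G1 \<union> G2" using gab by (simp add: G1_def G2_def)
      have False if "p \<in> G1" "p \<in> G2" for p
        using ord[of p] that gab(4) by (simp add: G1_def G2_def)
      then show "G1 \<inter> G2 = {}" by blast
    qed
    have fin: "finite G1" "finite G2" using less.prems(1) by (auto simp: G1_def G2_def)
    have sum_eq: "(\<Sum>p\<in>G. f p) = f (a, b) + (\<Sum>p\<in>G1. f p) + (\<Sum>p\<in>G2. f p)" for f :: "_ \<Rightarrow> real"
    proof -
      have "sum f G = sum f (insert (a, b) (G1 \<union> G2))" using G_eq by simp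
      also have "\<dots> = f (a, b) + sum f (G1 \<union> G2)" using nin(1) fin by (intro sum.insert) auto
      also have "sum f (G1 \<union> G2) = sum f G1 + sum f G2" using nin(2) fin by (intro sum.union_disjoint) auto
      finally show ?thesis by simp
    qed
    have card: "card G1 < card G" "card G2 < card G"
    proof -
      have "G1 \<subset> G" "G2 \<subset> G" using G_eq nin(1) by blast+
      then show "card G1 < card G" "card G2 < card G"
        using less.prems(1) by (simp_all add: psubset_card_mono)
    qed
    have 1: "\<bar>P a - P x - (\<Sum>(a, b)\<in>G1. P b - P a)\<bar> \<le> B a - B x - (\<Sum>(a, b)\<in>G1. B b - B a)"
    proof (rule less.hyps[OF card(1) fin(1)])
      fix u v assume uv: "u \<in> K" "v \<in> K" "x \<le> u" "u \<le> v" "v \<le> a"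
        "\<And>c d. (c, d) \<in> G1 \<Longrightarrow> \<not> (u \<le> c \<and> d \<le> v)"
      show "\<bar>P v - P u\<bar> \<le> B v - B u"
      proof (rule less.prems(6))
        show "\<not> (u \<le> c \<and> d \<le> v)" if "(c, d) \<in> G" for c d
          using uv(6)[of c d] uv(3-5) that unfolding G1_def by auto
      qed (use uv gab in simp_all)
    next
      show "gap c d \<and> x \<le> c \<and> d \<le> a" if "(c, d) \<in> G1" for c d
        using gapG[of c d] that by (simp add: G1_def)
    qed (use gab less.prems(3) in simp_all)
    have 2: "\<bar>P y - P b - (\<Sum>(a, b)\<in>G2. P b - P a)\<bar> \<le> B y - B b - (\<Sum>(a, b)\<in>G2. B b - B a)"
    proof (rule less.hyps[OF card(2) fin(2)])
      fix u v assume uv: "u \<in> K" "v \<in> K" "b \<le> u" "u \<le> v" "v \<le> y"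
        "\<And>c d. (c, d) \<in> G2 \<Longrightarrow> \<not> (u \<le> c \<and> d \<le> v)"
      show "\<bar>P v - P u\<bar> \<le> B v - B u"
      proof (rule less.prems(6))
        show "\<not> (u \<le> c \<and> d \<le> v)" if "(c, d) \<in> G" for c d
          using uv(6)[of c d] uv(3-5) that unfolding G2_def by auto
      qed (use uv gab in simp_all)
    next
      show "gap c d \<and> b \<le> c \<and> d \<le> y" if "(c, d) \<in> G2" for c d
        using gapG[of c d] that by (simp add: G2_def)
    qed (use gab less.prems(4) in simp_all)
    show ?thesis unfolding sum_eq using 1 2 by (simp add: abs_le_iff)
  qed
qed

lemma gap_lengths_le:
  assumes "finite G" and "\<And>a b. (a, b) \<in> G \<Longrightarrow> gap a b \<and> x \<le> a \<and> b \<le> y"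
    and "x \<in> K" "y \<in> K" "x \<le> y"
  shows "(\<Sum>(a, b)\<in>G. b - a) \<le> y - x"
  using gap_partition_bound[OF assms, of "\<lambda>_. 0" "\<lambda>x. x"] by auto

text \<open>
  Each cell of a grid of mesh \<open>\<delta> / 2\<close> contains a point off \<open>K\<close>; the gaps around these points suffice,
  because an arc of length \<open>\<delta>\<close> contains a full cell.
\<close>

lemma finite_gaps_meeting_long_arcs:
  assumes "0 < \<delta>" "x \<le> y"
  obtains G where "finite G" "\<And>a b. (a, b) \<in> G \<Longrightarrow> gap a b"
    "\<And>u v. u \<in> K \<Longrightarrow> v \<in> K \<Longrightarrow> x \<le> u \<Longrightarrow> v \<le> y \<Longrightarrow> \<delta> \<le> v - u \<Longrightarrow> \<exists>(a, b)\<in>G. u \<le> a \<and> b \<le> v"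
proof -
  define e where "e = \<delta> / 2"
  have e: "0 < e" using assms by (simp add: e_def)
  define p where "p i = x + real i * e" for i
  have "\<exists>q. \<forall>i. p i < q i \<and> q i < p (Suc i) \<and> q i \<notin> K"
    by (rule choice) (use e nowhere_dense in \<open>auto simp: p_def algebra_simps\<close>)
  then obtain q where q: "\<And>i. p i < q i" "\<And>i. q i < p (Suc i)" "\<And>i. q i \<notin> K" by blast
  have "\<exists>A B. gap A B \<and> A < q i \<and> q i < B" for i using gap_around[OF q(3)] by metis
  then obtain A B where AB: "\<And>i. gap (A i) (B i)" "\<And>i. A i < q i" "\<And>i. q i < B i" by metis
  define N where "N = nat \<lceil>(y - x) / e\<rceil>"
  show thesis
  proof (rule that[of "(\<lambda>i. (A i, B i)) ` {..N}"])
    fix u v assume uv: "u \<in> K" "v \<in> K" "x \<le> u" "v \<le> y" "\<delta> \<le> v - u"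
    define i where "i = nat \<lceil>(u - x) / e\<rceil>"
    have i: "real i = of_int \<lceil>(u - x) / e\<rceil>" using uv e by (simp add: i_def)
    have "(u - x) / e \<le> real i" "real i < (u - x) / e + 1" unfolding i by linarith+
    then have "u - x \<le> real i * e" "real i * e < u - x + e" using e by (auto simp: field_simps)
    then have pi: "u \<le> p i" "p (Suc i) \<le> v"
      using uv e by (auto simp: p_def e_def field_simps)
    have "u - x \<le> y - x" using uv assms by simp
    then have "i \<le> N" unfolding i_def N_def using e by (intro nat_mono ceiling_mono divide_right_mono) auto
    moreover have "u \<le> A i"
    proof (rule ccontr)
      assume "\<not> u \<le> A i"
      then have "A i < u" "u < B i" using pi(1) q(1)[of i] AB(3)[of i] by auto
      then show False using AB(1)[of i] uv(1) by (auto simp: gap_def)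
    qed
    moreover have "B i \<le> v"
    proof (rule ccontr)
      assume "\<not> B i \<le> v"
      then have "v < B i" "A i < v" using pi(2) q(2)[of i] AB(2)[of i] by auto
      then show False using AB(1)[of i] uv(2) by (auto simp: gap_def)
    qed
    ultimately show "\<exists>(a, b)\<in>(\<lambda>i. (A i, B i)) ` {..N}. u \<le> a \<and> b \<le> v" by auto
  qed (use AB in auto)
qed

end

locale expansive_circle_lift = circle_lift +
  assumes expansion: "\<And>\<kappa>. \<exists>M\<ge>1. \<exists>\<delta>>0. \<forall>x\<in>K. \<forall>y\<in>K. x < y \<longrightarrow> y - x < \<delta> \<longrightarrow>
            \<kappa> * (y - x) \<le> max ((g ^^ M) y - (g ^^ M) x) ((h ^^ M) y - (h ^^ M) x)"
begin

text \<open>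
  Suppose \<open>G\<close> contains enough gaps for the arcs left in \<open>[x, y]\<close> to be short. Each such arc has an image
  under \<open>g\<^sup>M\<close> or \<open>h\<^sup>M\<close> that is longer by the factor \<open>\<kappa>\<close>. These images are disjoint arcs within one
  turn for each of the two maps, so \<open>\<kappa>\<close> times the total length of the remaining arcs is at most 2.
  In other words, \<open>K\<close> has measure zero.
\<close>

lemma gaps_full_length:
  assumes "0 < \<eta>" "x \<in> K" "y \<in> K" "x \<le> y" "y \<le> x + 1"
  obtains G0 where "finite G0" "\<And>a b. (a, b) \<in> G0 \<Longrightarrow> gap a b \<and> x \<le> a \<and> b \<le> y"
    "\<And>G. finite G \<Longrightarrow> G0 \<subseteq> G \<Longrightarrow> (\<And>a b. (a, b) \<in> G \<Longrightarrow> gap a b \<and> x \<le> a \<and> b \<le> y) \<Longrightarrow>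
       y - x - (\<Sum>(a, b)\<in>G. b - a) \<le> \<eta>"
proof -
  define \<kappa> where "\<kappa> = 2 / \<eta>"
  have \<kappa>: "0 < \<kappa>" using assms by (simp add: \<kappa>_def)
  obtain M \<delta> where M: "0 < \<delta>" "\<And>x y. x \<in> K \<Longrightarrow> y \<in> K \<Longrightarrow> x < y \<Longrightarrow> y - x < \<delta> \<Longrightarrow>
            \<kappa> * (y - x) \<le> max ((g ^^ M) y - (g ^^ M) x) ((h ^^ M) y - (h ^^ M) x)"
    using expansion[of \<kappa>] by blast
  obtain G1 where G1: "finite G1" "\<And>a b. (a, b) \<in> G1 \<Longrightarrow> gap a b"
    "\<And>u v. u \<in> K \<Longrightarrow> v \<in> K \<Longrightarrow> x \<le> u \<Longrightarrow> v \<le> y \<Longrightarrow> \<delta> \<le> v - u \<Longrightarrow> \<exists>(a, b)\<in>G1. u \<le> a \<and> b \<le> v"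
    using finite_gaps_meeting_long_arcs[OF M(1) assms(4)] by metis
  define G0 where "G0 = {p \<in> G1. x \<le> fst p \<and> snd p \<le> y}"
  show thesis
  proof (rule that[of G0])
    fix G assume G: "finite G" "G0 \<subseteq> G" and gapG: "\<And>a b. (a, b) \<in> G \<Longrightarrow> gap a b \<and> x \<le> a \<and> b \<le> y"
    define B where "B z = (g ^^ M) z + (h ^^ M) z" for z
    have mono: "B u \<le> B v" if "u \<in> K" "v \<in> K" "u \<le> v" for u v
      unfolding B_def using gn_le_iff[of u v M] hn_le_iff[of u v M] that by (intro add_mono) auto
    have "\<bar>\<kappa> * y - \<kappa> * x - (\<Sum>(a, b)\<in>G. \<kappa> * b - \<kappa> * a)\<bar> \<le> B y - B x - (\<Sum>(a, b)\<in>G. B b - B a)"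
    proof (rule gap_partition_bound[OF G(1) gapG assms(2-4)])
      fix u v assume uv: "u \<in> K" "v \<in> K" "x \<le> u" "u \<le> v" "v \<le> y"
        and no: "\<And>a b. (a, b) \<in> G \<Longrightarrow> \<not> (u \<le> a \<and> b \<le> v)"
      have "v - u < \<delta>"
      proof (rule ccontr)
        assume "\<not> v - u < \<delta>"
        then obtain a b where ab: "(a, b) \<in> G1" "u \<le> a" "b \<le> v" using G1(3)[of u v] uv by auto
        then have "(a, b) \<in> G" using G(2) uv by (auto simp: G0_def)
        then show False using no ab by blast
      qed
      then have "\<kappa> * (v - u) \<le> max ((g ^^ M) v - (g ^^ M) u) ((h ^^ M) v - (h ^^ M) u)"
        using M(2)[of u v] uv by (cases "u = v") auto
      also have "\<dots> \<le> B v - B u"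
        using gn_le_iff[of u v M] hn_le_iff[of u v M] uv unfolding B_def by auto
      finally show "\<bar>\<kappa> * v - \<kappa> * u\<bar> \<le> B v - B u"
        using uv \<kappa> by (simp add: right_diff_distrib)
    qed
    moreover have "0 \<le> (\<Sum>(a, b)\<in>G. B b - B a)"
    proof (intro sum_nonneg, clarify)
      fix a b assume "(a, b) \<in> G"
      then show "0 \<le> B b - B a" using gapG[of a b] mono[of a b] by (auto simp: gap_def)
    qed
    moreover have "B y \<le> B (x + 1)" using assms by (intro mono) (auto simp: K_shift)
    moreover have "B (x + 1) = B x + 2" using assms by (simp add: B_def gn_shift hn_shift)
    moreover have "\<kappa> * y - \<kappa> * x - (\<Sum>(a, b)\<in>G. \<kappa> * b - \<kappa> * a) = \<kappa> * (y - x - (\<Sum>(a, b)\<in>G. b - a))"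
      by (simp add: right_diff_distrib sum_distrib_left case_prod_unfold)
    ultimately have "\<kappa> * (y - x - (\<Sum>(a, b)\<in>G. b - a)) \<le> 2" by linarith
    then show "y - x - (\<Sum>(a, b)\<in>G. b - a) \<le> \<eta>"
      using assms(1) by (simp add: \<kappa>_def field_simps)
  qed (use G1 in \<open>auto simp: G0_def\<close>)
qed

lemma increment_eq_sum_over_gaps:
  fixes P :: "real \<Rightarrow> real"
  assumes "0 < \<eta>" "x \<in> K" "y \<in> K" "x \<le> y" "y \<le> x + 1"
    and lip: "\<And>u v. u \<in> K \<Longrightarrow> v \<in> K \<Longrightarrow> u \<le> v \<Longrightarrow> \<bar>P v - P u\<bar> \<le> L * (v - u)"
  obtains G0 where "finite G0" "\<And>a b. (a, b) \<in> G0 \<Longrightarrow> gap a b \<and> x \<le> a \<and> b \<le> y"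
    "\<And>G. finite G \<Longrightarrow> G0 \<subseteq> G \<Longrightarrow> (\<And>a b. (a, b) \<in> G \<Longrightarrow> gap a b \<and> x \<le> a \<and> b \<le> y) \<Longrightarrow>
       \<bar>P y - P x - (\<Sum>(a, b)\<in>G. P b - P a)\<bar> \<le> \<eta>"
proof -
  have L: "0 \<le> L"
  proof -
    have "\<bar>P (x + 1) - P x\<bar> \<le> L * 1" using lip[of x "x + 1"] assms by (simp add: K_shift)
    then show ?thesis by simp
  qed
  have pos: "0 < \<eta> / (L + 1)" using L assms by simp
  obtain G0 where G0: "finite G0" "\<And>a b. (a, b) \<in> G0 \<Longrightarrow> gap a b \<and> x \<le> a \<and> b \<le> y"
    "\<And>G. finite G \<Longrightarrow> G0 \<subseteq> G \<Longrightarrow> (\<And>a b. (a, b) \<in> G \<Longrightarrow> gap a b \<and> x \<le> a \<and> b \<le> y) \<Longrightarrow>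
       y - x - (\<Sum>(a, b)\<in>G. b - a) \<le> \<eta> / (L + 1)"
    by (rule gaps_full_length[OF pos assms(2-5)]) blast
  show thesis
  proof (rule that[OF G0(1,2)])
    fix G assume G: "finite G" "G0 \<subseteq> G" "\<And>a b. (a, b) \<in> G \<Longrightarrow> gap a b \<and> x \<le> a \<and> b \<le> y"
    have "\<bar>P y - P x - (\<Sum>(a, b)\<in>G. P b - P a)\<bar> \<le> L * y - L * x - (\<Sum>(a, b)\<in>G. L * b - L * a)"
      by (rule gap_partition_bound[OF G(1,3) assms(2-4)]) (use lip in \<open>auto simp: right_diff_distrib\<close>)
    also have "\<dots> = L * (y - x - (\<Sum>(a, b)\<in>G. b - a))"
      by (simp add: right_diff_distrib sum_distrib_left case_prod_unfold)
    also have "\<dots> \<le> L * (\<eta> / (L + 1))" using G0(3)[OF G] L by (intro mult_left_mono) auto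
    also have "\<dots> \<le> \<eta>" using L assms(1) by (simp add: field_simps)
    finally show "\<bar>P y - P x - (\<Sum>(a, b)\<in>G. P b - P a)\<bar> \<le> \<eta>" .
  qed auto
qed

end

text \<open>
  If some step of length \<open>M\<close> did not halve the sequence, then the sequence would double at every
  following step and leave the region below \<open>\<delta>\<close>.
\<close>

lemma expansive_sequence_decays:
  fixes e :: "nat \<Rightarrow> real"
  assumes pos: "\<And>n. 0 < e n" and M: "1 \<le> M" and small: "\<And>n. n0 \<le> n \<Longrightarrow> e n < \<delta>"
    and exp: "\<And>n. n0 + M \<le> n \<Longrightarrow> 2 * e n \<le> max (e (n + M)) (e (n - M))"
  obtains C \<kappa> where "0 < C" "0 < \<kappa>" "\<kappa> < 1" "\<And>n. e n \<le> C * \<kappa> ^ n"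
proof -
  have half: "2 * e (n + M) \<le> e n" if n: "n0 \<le> n" for n
  proof (rule ccontr)
    assume no: "\<not> 2 * e (n + M) \<le> e n"
    have grow: "2 * e (n + Suc k * M) \<le> e (n + Suc (Suc k) * M)" for k
    proof (induction k)
      case 0
      show ?case using exp[of "n + M"] no n by (auto simp: max_def algebra_simps split: if_splits)
    next
      case (Suc k)
      have "n0 + M \<le> n + Suc (Suc k) * M" using n by (simp add: algebra_simps)
      from exp[OF this] have
        "2 * e (n + Suc (Suc k) * M) \<le> max (e (n + Suc (Suc (Suc k)) * M)) (e (n + Suc k * M))"
        by (simp add: algebra_simps)
      moreover have "e (n + Suc k * M) < 2 * e (n + Suc (Suc k) * M)"
        using Suc pos[of "n + Suc k * M"] by linarith
      ultimately show ?case by (auto simp: max_def split: if_splits)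
    qed
    have pow: "2 ^ k * e (n + M) \<le> e (n + Suc k * M)" for k
    proof (induction k)
      case (Suc k)
      have "2 ^ Suc k * e (n + M) \<le> 2 * e (n + Suc k * M)" using Suc by simp
      also have "\<dots> \<le> e (n + Suc (Suc k) * M)" by (rule grow)
      finally show ?case .
    qed simp
    obtain k where "\<delta> / e (n + M) < 2 ^ k" using real_arch_pow[of 2] by auto
    then have "\<delta> < 2 ^ k * e (n + M)" using pos[of "n + M"] by (simp add: field_simps)
    moreover have "2 ^ k * e (n + M) \<le> e (n + Suc k * M)" by (rule pow)
    moreover have "e (n + Suc k * M) < \<delta>" using n by (intro small) simp
    ultimately show False by linarith
  qed
  \<comment> \<open>halving every \<open>M\<close> steps is a geometric decay with this ratio\<close>
  define \<kappa> where "\<kappa> = root M (1 / 2)"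
  have \<kappa>: "0 < \<kappa>" "\<kappa> < 1" "\<kappa> ^ M = 1 / 2" using M by (auto simp: \<kappa>_def)
  define C where "C = Max ((\<lambda>n. e n / \<kappa> ^ n) ` {..n0 + M})"
  have C: "e n / \<kappa> ^ n \<le> C" if "n \<le> n0 + M" for n
    unfolding C_def by (rule Max_ge) (use that in auto)
  have "0 < e 0 / \<kappa> ^ 0" using pos[of 0] by simp
  also have "\<dots> \<le> C" by (rule C) simp
  finally have "0 < C" .
  moreover have "e n \<le> C * \<kappa> ^ n" for n
  proof (induction n rule: less_induct)
    case (less n)
    show ?case
    proof (cases "n \<le> n0 + M")
      case True
      then show ?thesis using C[OF True] \<kappa> by (simp add: field_simps)
    next
      case False
      then have "2 * e n \<le> e (n - M)" using half[of "n - M"] by simp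
      also have "\<dots> \<le> C * \<kappa> ^ (n - M)" using less[of "n - M"] False M by simp
      finally have "e n \<le> C * \<kappa> ^ (n - M) * (1 / 2)" by simp
      then have "e n \<le> C * (\<kappa> ^ (n - M) * \<kappa> ^ M)" by (simp only: \<kappa>(3) mult.assoc)
      moreover have "\<kappa> ^ (n - M) * \<kappa> ^ M = \<kappa> ^ n" using False by (simp flip: power_add)
      ultimately show ?thesis by simp
    qed
  qed
  ultimately show thesis using that \<kappa> by blast
qed

lemma geometric_sum_int_le:
  fixes \<kappa> :: real
  assumes \<kappa>: "0 < \<kappa>" "\<kappa> < 1" and I: "finite I" "\<And>i. i \<in> I \<Longrightarrow> p \<le> f i" and f: "inj_on f I"
    and p: "0 \<le> (p::int)"
  shows "(\<Sum>i\<in>I. \<kappa> ^ nat (f i)) \<le> \<kappa> ^ nat p / (1 - \<kappa>)"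
proof -
  let ?j = "\<lambda>i. nat (f i - p)"
  have inj: "inj_on ?j I"
    using f I(2) unfolding inj_on_def by (smt (verit) nat_diff_distrib int_nat_eq)
  have "(\<Sum>i\<in>I. \<kappa> ^ nat (f i)) = (\<Sum>i\<in>I. \<kappa> ^ nat p * \<kappa> ^ ?j i)"
  proof (rule sum.cong[OF refl])
    fix i assume "i \<in> I"
    then have "nat (f i) = nat p + ?j i" using I(2)[of i] p by simp
    then show "\<kappa> ^ nat (f i) = \<kappa> ^ nat p * \<kappa> ^ ?j i" by (simp add: power_add)
  qed
  also have "\<dots> = \<kappa> ^ nat p * sum ((^) \<kappa>) (?j ` I)"
    using inj by (simp add: sum.reindex sum_distrib_left)
  also have "sum ((^) \<kappa>) (?j ` I) \<le> (\<Sum>k. \<kappa> ^ k)"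
    using \<kappa> I by (intro sum_le_suminf summable_geometric) auto
  also have "(\<Sum>k. \<kappa> ^ k) = 1 / (1 - \<kappa>)" using \<kappa> by (intro suminf_geometric) auto
  finally show ?thesis using \<kappa> by simp
qed

lemma two_sided_geometric_sum_le:
  fixes \<kappa> :: real
  assumes \<kappa>: "0 < \<kappa>" "\<kappa> < 1" and I: "finite I"
  shows "(\<Sum>i\<in>I. \<kappa> ^ nat \<bar>i + c\<bar>) \<le> 2 / (1 - \<kappa>)"
proof -
  let ?P = "{i \<in> I. 0 \<le> i + c}" and ?N = "{i \<in> I. i + c < 0}"
  have "(\<Sum>i\<in>I. \<kappa> ^ nat \<bar>i + c\<bar>) = (\<Sum>i\<in>?P \<union> ?N. \<kappa> ^ nat \<bar>i + c\<bar>)"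
    by (rule sum.cong) auto
  also have "\<dots> = (\<Sum>i\<in>?P. \<kappa> ^ nat \<bar>i + c\<bar>) + (\<Sum>i\<in>?N. \<kappa> ^ nat \<bar>i + c\<bar>)"
    using I by (intro sum.union_disjoint) auto
  also have "(\<Sum>i\<in>?P. \<kappa> ^ nat \<bar>i + c\<bar>) \<le> \<kappa> ^ nat 0 / (1 - \<kappa>)"
    using \<kappa> I by (intro geometric_sum_int_le) (auto simp: inj_on_def)
  also have "(\<Sum>i\<in>?N. \<kappa> ^ nat \<bar>i + c\<bar>) \<le> \<kappa> ^ nat 0 / (1 - \<kappa>)"
    using \<kappa> I by (intro geometric_sum_int_le) (auto simp: inj_on_def)
  finally show ?thesis using \<kappa> by (simp add: add_divide_distrib[symmetric])
qed

lemma (in expansive_circle_lift) increment_near_gap_sum: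
  fixes P :: "real \<Rightarrow> real"
  assumes "0 < \<eta>" "x \<in> K" "y \<in> K" "x \<le> y" "y \<le> x + 1"
    and lip: "\<And>u v. u \<in> K \<Longrightarrow> v \<in> K \<Longrightarrow> u \<le> v \<Longrightarrow> \<bar>P v - P u\<bar> \<le> L * (v - u)"
  shows "\<exists>G. finite G \<and> (\<forall>(a, b)\<in>G. gap a b \<and> x \<le> a \<and> b \<le> y) \<and>
    \<bar>P y - P x - (\<Sum>(a, b)\<in>G. P b - P a)\<bar> \<le> \<eta>"
proof (rule increment_eq_sum_over_gaps[of \<eta> x y P L])
  show "\<bar>P v - P u\<bar> \<le> L * (v - u)" if "u \<in> K" "v \<in> K" "u \<le> v" for u v
    using that by (rule lip)
next
  fix G assume G: "finite G" "\<And>a b. (a, b) \<in> G \<Longrightarrow> gap a b \<and> x \<le> a \<and> b \<le> y"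
    and G': "\<And>G'. finite G' \<Longrightarrow> G \<subseteq> G' \<Longrightarrow> (\<And>a b. (a, b) \<in> G' \<Longrightarrow> gap a b \<and> x \<le> a \<and> b \<le> y) \<Longrightarrow>
      \<bar>P y - P x - (\<Sum>(a, b)\<in>G'. P b - P a)\<bar> \<le> \<eta>"
  have "\<bar>P y - P x - (\<Sum>(a, b)\<in>G. P b - P a)\<bar> \<le> \<eta>" by (rule G'[OF G(1) order_refl G(2)])
  moreover have "\<forall>(a, b)\<in>G. gap a b \<and> x \<le> a \<and> b \<le> y" by (intro ballI, clarify) (rule G(2))
  ultimately show ?thesis using G(1) by blast
qed (use assms(1-5) in simp_all)

text \<open>
  The gaps form a single orbit under \<open>g\<close> and integer translations. It is enough to require this of
  their left end points.
\<close>

locale one_gap_orbit = expansive_circle_lift +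
  fixes a0 b0 :: real
  assumes gap0: "gap a0 b0"
    and gap_orbit: "\<And>c d. gap c d \<Longrightarrow> \<exists>(n::nat) (m::int). c = (g ^^ n) a0 + of_int m \<or> c = (h ^^ n) a0 + of_int m"
    and aperiodic: "\<And>(n::nat) (m::int). (g ^^ n) a0 = a0 + of_int m \<Longrightarrow> n = 0"
    and g_lipschitz: "\<exists>L. \<forall>u\<in>K. \<forall>v\<in>K. u \<le> v \<longrightarrow> g v - g u \<le> L * (v - u)"
begin

definition itr :: "int \<Rightarrow> real \<Rightarrow> real" where
  "itr n x = (if 0 \<le> n then (g ^^ nat n) x else (h ^^ nat (- n)) x)"

lemma itr_in: "x \<in> K \<Longrightarrow> itr n x \<in> K"
  by (simp add: itr_def gn_in hn_in)

lemma itr_Suc: "x \<in> K \<Longrightarrow> itr (n + 1) x = g (itr n x)"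
proof -
  assume x: "x \<in> K"
  consider "0 \<le> n" | "n = -1" | "n < -1" by linarith
  then show ?thesis
  proof cases
    case 1 then have "nat (n + 1) = Suc (nat n)" by simp
    then show ?thesis using 1 by (simp add: itr_def)
  next
    case 2 then show ?thesis using x by (simp add: itr_def gh)
  next
    case 3 then have "nat (- n) = Suc (nat (- (n + 1)))" by simp
    then show ?thesis using 3 x by (simp add: itr_def gh hn_in)
  qed
qed

lemma gn_itr: "x \<in> K \<Longrightarrow> (g ^^ k) (itr n x) = itr (n + int k) x"
proof (induction k)
  case (Suc k)
  then show ?case using itr_Suc[of x "n + int k"] by (simp add: algebra_simps)
qed simp

lemma hn_itr: "x \<in> K \<Longrightarrow> (h ^^ k) (itr n x) = itr (n - int k) x"
  using gn_itr[of x k "n - int k"] hn_gn[OF itr_in, of x k "n - int k"] by simp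

lemma itr_0 [simp]: "itr 0 x = x" by (simp add: itr_def)

lemma gap_itr: "gap a b \<Longrightarrow> gap (itr n a) (itr n b)"
  by (simp add: itr_def gap_gn gap_hn)

abbreviation a :: "int \<Rightarrow> real" where "a n \<equiv> itr n a0"
abbreviation b :: "int \<Rightarrow> real" where "b n \<equiv> itr n b0"

lemma a0_in: "a0 \<in> K" and b0_in: "b0 \<in> K" using gap0 by (auto simp: gap_def)

lemma gap_ab: "gap (a n) (b n)" using gap0 by (rule gap_itr)

lemma a_inj_le:
  assumes "a n + of_int m = a n' + of_int m'" "n \<le> n'" shows "n = n'"
proof -
  define j where "j = nat (n' - n)"
  have n': "n' = n + int j" using assms by (simp add: j_def)
  have "a n' = a n + of_int (m - m')" using assms(1) by simp
  then have *: "(g ^^ j) (a n) = a n + of_int (m - m')"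
    unfolding n' by (simp add: gn_itr a0_in)
  have "(g ^^ j) a0 = a0 + of_int (m - m')"
  proof (cases "0 \<le> n")
    case True
    have "a (int j) = (h ^^ nat n) (a (n + int j))" using True by (simp add: hn_itr a0_in)
    also have "a (n + int j) = a n + of_int (m - m')" using * by (simp add: gn_itr a0_in)
    also have "(h ^^ nat n) (a n + of_int (m - m')) = (h ^^ nat n) (a n) + of_int (m - m')"
      by (rule hn_shift_int) (simp add: itr_in a0_in)
    also have "(h ^^ nat n) (a n) = a0" using True by (simp add: hn_itr a0_in)
    finally show ?thesis by (simp add: itr_def)
  next
    case False
    have "a (int j) = (g ^^ nat (- n)) (a (n + int j))" using False by (simp add: gn_itr a0_in)
    also have "a (n + int j) = a n + of_int (m - m')" using * by (simp add: gn_itr a0_in)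
    also have "(g ^^ nat (- n)) (a n + of_int (m - m')) = (g ^^ nat (- n)) (a n) + of_int (m - m')"
      by (rule gn_shift_int) (simp add: itr_in a0_in)
    also have "(g ^^ nat (- n)) (a n) = a0" using False by (simp add: gn_itr a0_in)
    finally show ?thesis by (simp add: itr_def)
  qed
  then have "j = 0" by (rule aperiodic)
  then show ?thesis using n' by simp
qed

lemma a_inj: "a n + of_int m = a n' + of_int m' \<Longrightarrow> n = n'"
  using a_inj_le[of n m n' m'] a_inj_le[of n' m' n m] by (metis linear)

lemma gap_eq: assumes "gap c d" obtains n m where "c = a n + of_int m" "d = b n + of_int m"
proof -
  obtain n :: nat and m :: int where "c = (g ^^ n) a0 + of_int m \<or> c = (h ^^ n) a0 + of_int m"
    using gap_orbit[OF assms] by blast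
  then have "\<exists>n. c = a n + of_int m"
  proof
    assume "c = (g ^^ n) a0 + of_int m"
    then show ?thesis by (intro exI[of _ "int n"]) (simp add: itr_def)
  next
    assume "c = (h ^^ n) a0 + of_int m"
    then show ?thesis by (intro exI[of _ "- int n"]) (auto simp: itr_def)
  qed
  then obtain n' where n': "c = a n' + of_int m" by blast
  have "gap c (b n' + of_int m)" unfolding n' using gap_ab by (simp add: gap_shift_int)
  then show thesis using that n' gap_same_left[OF assms] by blast
qed

definition turn :: "real \<Rightarrow> int \<Rightarrow> int" where "turn x n = \<lceil>x - a n\<rceil>"

text \<open>
  The translate of the gap number \<open>n\<close> that lies in the fundamental domain \<open>[x, x + 1]\<close>.
\<close>

definition gap_in :: "real \<Rightarrow> int \<Rightarrow> real \<times> real" where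
  "gap_in x n = (a n + of_int (turn x n), b n + of_int (turn x n))"

lemma gap_in_bounds:
  assumes "x \<in> K" "gap_in x n = (c, d)" shows "gap c d \<and> x \<le> c \<and> d \<le> x + 1"
proof -
  have 1: "x \<le> a n + of_int (turn x n)" "a n + of_int (turn x n) < x + 1"
    unfolding turn_def by linarith+
  have 2: "gap c d" using gap_ab assms by (auto simp: gap_in_def gap_shift_int)
  have "\<not> (c < x + 1 \<and> x + 1 < d)" using 2 assms K_shift[of x] by (auto simp: gap_def)
  then show ?thesis using 1 2 assms by (auto simp: gap_in_def)
qed

lemma inj_gap_in: "inj_on (gap_in x) N"
  unfolding inj_on_def gap_in_def by (auto dest: a_inj)

lemma gaps_eq_image:
  assumes "finite G" "\<And>c d. (c, d) \<in> G \<Longrightarrow> gap c d \<and> x \<le> c \<and> d \<le> x + 1"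
  obtains N where "finite N" "G = gap_in x ` N"
proof -
  have "\<exists>n. p = gap_in x n" if "p \<in> G" for p
  proof -
    obtain c d where p: "p = (c, d)" by force
    have cd: "gap c d" "x \<le> c" "d \<le> x + 1" using assms(2) that p by auto
    then obtain n m where nm: "c = a n + of_int m" "d = b n + of_int m" using gap_eq by metis
    have "c < x + 1" using cd by (auto simp: gap_def)
    then have "turn x n = m" unfolding turn_def using cd nm by (intro ceiling_unique) auto
    then show ?thesis using nm p by (auto simp: gap_in_def)
  qed
  then obtain \<iota> where \<iota>: "\<And>p. p \<in> G \<Longrightarrow> p = gap_in x (\<iota> p)" by metis
  show thesis
  proof (rule that[of "\<iota> ` G"])
    show "G = gap_in x ` \<iota> ` G" using \<iota> by (simp add: image_image)
  qed (use assms in auto)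
qed

definition d :: "int \<Rightarrow> real" where "d n = b n - a n"

lemma d_pos: "0 < d n" using gap_ab[of n] by (auto simp: d_def gap_def)

lemma sum_gap_in:
  assumes "\<And>u m. u \<in> K \<Longrightarrow> P (u + of_int m) - P u = (Q m :: real)"
  shows "(\<Sum>(c, d)\<in>gap_in x ` N. P d - P c) = (\<Sum>n\<in>N. P (b n) - P (a n))"
proof -
  have "P (b n + of_int m) - P (a n + of_int m) = P (b n) - P (a n)" for n m
    using assms[of "a n" m] assms[of "b n" m] itr_in[OF a0_in, of n] itr_in[OF b0_in, of n] by simp
  then show ?thesis
    by (simp add: sum.reindex[OF inj_gap_in]) (simp add: gap_in_def)
qed

lemma sum_d_le: assumes "finite N" shows "sum d N \<le> 1"
proof -
  have "sum d N = (\<Sum>(c, d)\<in>gap_in a0 ` N. d - c)"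
    unfolding d_def by (rule sum_gap_in[of "\<lambda>x. x" of_int, symmetric]) simp
  also have "\<dots> \<le> a0 + 1 - a0"
  proof (rule gap_lengths_le)
    show "gap c d \<and> a0 \<le> c \<and> d \<le> a0 + 1" if "(c, d) \<in> gap_in a0 ` N" for c d
      using that gap_in_bounds[OF a0_in] by (metis imageE)
  qed (use assms in \<open>auto simp: a0_in K_shift\<close>)
  finally show ?thesis by simp
qed

lemma finite_large_gaps: assumes "0 < \<delta>" shows "finite {n. \<delta> \<le> d n}"
proof (rule ccontr)
  assume inf: "infinite {n. \<delta> \<le> d n}"
  obtain k :: nat where k: "1 / \<delta> < real k" using reals_Archimedean2 by blast
  obtain N where N: "N \<subseteq> {n. \<delta> \<le> d n}" "finite N" "card N = k"
    using infinite_arbitrarily_large[OF inf, of k] by blast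
  have "real k * \<delta> \<le> sum d N" using sum_bounded_below[of N \<delta> d] N by auto
  also have "\<dots> \<le> 1" using N by (intro sum_d_le)
  finally show False using k assms by (simp add: field_simps)
qed

lemma d_decay:
  obtains C \<kappa> where "0 < C" "0 < \<kappa>" "\<kappa> < 1" "\<And>n. d n \<le> C * \<kappa> ^ nat \<bar>n\<bar>"
proof -
  obtain M \<delta> where M: "1 \<le> M" "0 < \<delta>" "\<And>x y. x \<in> K \<Longrightarrow> y \<in> K \<Longrightarrow> x < y \<Longrightarrow> y - x < \<delta> \<Longrightarrow>
            2 * (y - x) \<le> max ((g ^^ M) y - (g ^^ M) x) ((h ^^ M) y - (h ^^ M) x)"
    using expansion[of 2] by blast
  have exp: "2 * d n \<le> max (d (n + int M)) (d (n - int M))" if "d n < \<delta>" for n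
    using M(3)[of "a n" "b n"] that d_pos[of n]
    by (simp add: itr_in a0_in b0_in d_def gn_itr hn_itr)
  have fin: "finite ((\<lambda>n. nat \<bar>n\<bar>) ` {n. \<delta> \<le> d n})" using finite_large_gaps[OF M(2)] by simp
  obtain n0 where n0: "\<And>n. \<delta> \<le> d n \<Longrightarrow> nat \<bar>n\<bar> < n0"
    using finite_nat_set_iff_bounded[THEN iffD1, OF fin] by auto
  have small: "d n < \<delta>" if "int n0 \<le> \<bar>n\<bar>" for n using n0[of n] that by force
  obtain C1 \<kappa>1 where 1: "0 < C1" "0 < \<kappa>1" "\<kappa>1 < 1" "\<And>n. d (int n) \<le> C1 * \<kappa>1 ^ n"
  proof (rule expansive_sequence_decays[of "\<lambda>n. d (int n)" M n0 \<delta>])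
    fix n assume "n0 + M \<le> n"
    then show "2 * d (int n) \<le> max (d (int (n + M))) (d (int (n - M)))"
      using exp[OF small, of "int n"] by (simp add: of_nat_diff)
  qed (use M d_pos small in auto)
  obtain C2 \<kappa>2 where 2: "0 < C2" "0 < \<kappa>2" "\<kappa>2 < 1" "\<And>n. d (- int n) \<le> C2 * \<kappa>2 ^ n"
  proof (rule expansive_sequence_decays[of "\<lambda>n. d (- int n)" M n0 \<delta>])
    fix n assume "n0 + M \<le> n"
    then show "2 * d (- int n) \<le> max (d (- int (n + M))) (d (- int (n - M)))"
      using exp[OF small, of "- int n"] by (simp add: of_nat_diff max.commute)
  qed (use M d_pos small in auto)
  show thesis
  proof (rule that[of "C1 + C2" "max \<kappa>1 \<kappa>2"])
    fix n :: int
    show "d n \<le> (C1 + C2) * max \<kappa>1 \<kappa>2 ^ nat \<bar>n\<bar>"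
    proof (cases "0 \<le> n")
      case True
      have "d n \<le> C1 * \<kappa>1 ^ nat n" using 1(4)[of "nat n"] True by simp
      also have "\<dots> \<le> (C1 + C2) * max \<kappa>1 \<kappa>2 ^ nat n"
        using 1 2 by (intro mult_mono power_mono) auto
      finally show ?thesis using True by simp
    next
      case False
      have "d n \<le> C2 * \<kappa>2 ^ nat (- n)" using 2(4)[of "nat (- n)"] False by simp
      also have "\<dots> \<le> (C1 + C2) * max \<kappa>1 \<kappa>2 ^ nat (- n)"
        using 1 2 by (intro mult_mono power_mono) auto
      finally show ?thesis using False by simp
    qed
  qed (use 1 2 in auto)
qed

text \<open>
  The increment of a periodic Lipschitz function over one full turn vanishes, and it is the sum of the
  increments over all gaps.
\<close>

lemma gap_increments_sum_zero:
  fixes P :: "real \<Rightarrow> real"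
  assumes perm: "\<And>u m. u \<in> K \<Longrightarrow> P (u + of_int m) = P u"
    and lip: "\<And>u v. u \<in> K \<Longrightarrow> v \<in> K \<Longrightarrow> u \<le> v \<Longrightarrow> \<bar>P v - P u\<bar> \<le> L * (v - u)"
    and "0 < \<eta>"
  shows "\<exists>N0. finite N0 \<and> (\<forall>N. finite N \<longrightarrow> N0 \<subseteq> N \<longrightarrow> \<bar>\<Sum>n\<in>N. P (b n) - P (a n)\<bar> \<le> \<eta>)"
proof -
  obtain G0 where G0: "finite G0" "\<And>c d. (c, d) \<in> G0 \<Longrightarrow> gap c d \<and> a0 \<le> c \<and> d \<le> a0 + 1"
    "\<And>G. finite G \<Longrightarrow> G0 \<subseteq> G \<Longrightarrow> (\<And>c d. (c, d) \<in> G \<Longrightarrow> gap c d \<and> a0 \<le> c \<and> d \<le> a0 + 1) \<Longrightarrow>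
       \<bar>P (a0 + 1) - P a0 - (\<Sum>(c, d)\<in>G. P d - P c)\<bar> \<le> \<eta>"
    by (rule increment_eq_sum_over_gaps[of \<eta> a0 "a0 + 1" P L])
       (use assms a0_in in \<open>auto simp: K_shift\<close>)
  have per: "P (a0 + 1) = P a0" using perm[OF a0_in, of 1] by simp
  obtain N0 where N0: "finite N0" "G0 = gap_in a0 ` N0"
    by (rule gaps_eq_image[OF G0(1,2)]) auto
  show ?thesis
  proof (intro exI[of _ N0] conjI allI impI N0(1))
    fix N assume N: "finite N" "N0 \<subseteq> N"
    have "\<bar>P (a0 + 1) - P a0 - (\<Sum>(c, d)\<in>gap_in a0 ` N. P d - P c)\<bar> \<le> \<eta>"
    proof (rule G0(3))
      show "gap c d \<and> a0 \<le> c \<and> d \<le> a0 + 1" if "(c, d) \<in> gap_in a0 ` N" for c d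
        using that gap_in_bounds[OF a0_in] by (metis imageE)
    qed (use N N0 in auto)
    moreover have "(\<Sum>(c, d)\<in>gap_in a0 ` N. P d - P c) = (\<Sum>n\<in>N. P (b n) - P (a n))"
      by (rule sum_gap_in[of P "\<lambda>_. 0"]) (simp add: perm)
    ultimately show "\<bar>\<Sum>n\<in>N. P (b n) - P (a n)\<bar> \<le> \<eta>"
      using per by simp
  qed
qed

text \<open>
  The increment of the Birkhoff sum over the gap number \<open>k\<close> is a block of \<open>n\<close> consecutive terms of the
  exponentially small sequence \<open>\<tau>\<close>. A block that lies on one side of 0 is a small tail; a block
  that straddles 0 is minus the sum of two small tails, because \<open>\<tau>\<close> sums to 0. In both cases
  its size is governed by the distances of its two ends from 0, which gives a bound summable in \<open>k\<close>
  and uniform in \<open>n\<close>.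
\<close>

theorem birkhoff_sums_bounded:
  fixes P :: "real \<Rightarrow> real"
  assumes per: "\<And>u m. u \<in> K \<Longrightarrow> P (u + of_int m) = P u"
    and lip: "\<And>u v. u \<in> K \<Longrightarrow> v \<in> K \<Longrightarrow> u \<le> v \<Longrightarrow> \<bar>P v - P u\<bar> \<le> L * (v - u)"
  obtains C where "\<And>n x y. x \<in> K \<Longrightarrow> y \<in> K \<Longrightarrow>
     \<bar>(\<Sum>i<n. P ((g ^^ i) y)) - (\<Sum>i<n. P ((g ^^ i) x))\<bar> \<le> C"
proof -
  have per1: "P (u + 1) = P u" if "u \<in> K" for u using per[OF that, of 1] by simp
  have L: "0 \<le> L"
    using lip[of a0 "a0 + 1"] per1[OF a0_in] a0_in by (simp add: K_shift)
  define \<tau> where "\<tau> n = P (b n) - P (a n)" for n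
  obtain C \<kappa> where C: "0 < C" "0 < \<kappa>" "\<kappa> < 1" "\<And>n. d n \<le> C * \<kappa> ^ nat \<bar>n\<bar>" using d_decay by blast
  define B where "B = L * C / (1 - \<kappa>)"
  have B0: "0 \<le> B" using L C by (simp add: B_def)
  have \<tau>_le: "\<bar>\<tau> n\<bar> \<le> L * C * \<kappa> ^ nat \<bar>n\<bar>" for n
  proof -
    have "\<bar>\<tau> n\<bar> \<le> L * d n"
      unfolding \<tau>_def d_def by (rule lip) (use gap_ab[of n] in \<open>auto simp: gap_def\<close>)
    also have "\<dots> \<le> L * (C * \<kappa> ^ nat \<bar>n\<bar>)" using C L by (intro mult_left_mono) auto
    finally show ?thesis by simp
  qed
  have right_inj: "inj_on (\<lambda>i. \<bar>i\<bar>) I" if "I \<subseteq> {p..}" "0 \<le> p" for I and p :: int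
  proof (rule inj_onI)
    fix x y assume "x \<in> I" "y \<in> I" "\<bar>x\<bar> = \<bar>y\<bar>"
    moreover from this have "0 \<le> x" "0 \<le> y" using that by auto
    ultimately show "x = y" by simp
  qed
  have right: "\<bar>sum \<tau> I\<bar> \<le> B * \<kappa> ^ nat \<bar>p\<bar>" if "finite I" "I \<subseteq> {p..}" "0 \<le> p" for I p
  proof -
    have "\<bar>sum \<tau> I\<bar> \<le> (\<Sum>i\<in>I. L * C * \<kappa> ^ nat \<bar>i\<bar>)" using \<tau>_le by (intro order_trans[OF sum_abs] sum_mono)
    also have "\<dots> = L * C * (\<Sum>i\<in>I. \<kappa> ^ nat \<bar>i\<bar>)" by (simp add: sum_distrib_left)
    also have "\<dots> \<le> L * C * (\<kappa> ^ nat p / (1 - \<kappa>))"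
      using that L C by (intro mult_left_mono geometric_sum_int_le right_inj[of _ p]) (auto simp: subset_iff)
    finally show ?thesis using that by (simp add: B_def)
  qed
  have left_inj: "inj_on (\<lambda>i. \<bar>i\<bar>) I" if "I \<subseteq> {..<p}" "p \<le> 0" for I and p :: int
  proof (rule inj_onI)
    fix x y assume "x \<in> I" "y \<in> I" "\<bar>x\<bar> = \<bar>y\<bar>"
    moreover from this have "x \<le> 0" "y \<le> 0" using that by auto
    ultimately show "x = y" by simp
  qed
  have left: "\<bar>sum \<tau> I\<bar> \<le> B * \<kappa> ^ nat \<bar>p\<bar>" if "finite I" "I \<subseteq> {..<p}" "p \<le> 0" for I p
  proof -
    have "\<bar>sum \<tau> I\<bar> \<le> (\<Sum>i\<in>I. L * C * \<kappa> ^ nat \<bar>i\<bar>)" using \<tau>_le by (intro order_trans[OF sum_abs] sum_mono)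
    also have "\<dots> = L * C * (\<Sum>i\<in>I. \<kappa> ^ nat \<bar>i\<bar>)" by (simp add: sum_distrib_left)
    also have "\<dots> \<le> L * C * (\<kappa> ^ nat (- p) / (1 - \<kappa>))"
      using that L C by (intro mult_left_mono geometric_sum_int_le left_inj[of _ p]) (auto simp: subset_iff)
    finally show ?thesis using that by (simp add: B_def)
  qed
  have block: "\<bar>\<Sum>i<n. \<tau> (k + int i)\<bar> \<le> B * (\<kappa> ^ nat \<bar>k + 0\<bar> + \<kappa> ^ nat \<bar>k + int n\<bar>)" for k n
  proof -
    have "(\<Sum>i<n. \<tau> (k + int i)) = sum \<tau> {k..<k + int n}"
      by (rule sum.reindex_bij_witness[of _ "\<lambda>j. nat (j - k)" "\<lambda>i. k + int i"]) auto
    moreover have "\<bar>sum \<tau> {k..<k + int n}\<bar> \<le> B * \<kappa> ^ nat \<bar>k\<bar> + B * \<kappa> ^ nat \<bar>k + int n\<bar>"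
    proof -
      have nn: "0 \<le> B * \<kappa> ^ i" for i using B0 C by simp
      have sub: "{k..<k + int n} \<subseteq> {k..}" "{k..<k + int n} \<subseteq> {..<k + int n}" by auto
      consider "0 \<le> k" | "k + int n \<le> 0" | "k < 0" "0 < k + int n" by linarith
      then show ?thesis
      proof cases
        case 1 then show ?thesis using right[OF _ sub(1)] nn[of "nat \<bar>k + int n\<bar>"] by simp
      next
        case 2 then show ?thesis using left[OF _ sub(2)] nn[of "nat \<bar>k\<bar>"] by simp
      next
        case 3
        show ?thesis
        proof (rule field_le_epsilon)
          fix \<eta> :: real assume "0 < \<eta>"
          have "\<exists>N0. finite N0 \<and> (\<forall>N. finite N \<longrightarrow> N0 \<subseteq> N \<longrightarrow> \<bar>sum \<tau> N\<bar> \<le> \<eta>)"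
            unfolding \<tau>_def
            by (rule gap_increments_sum_zero[where P = P and L = L, OF per lip \<open>0 < \<eta>\<close>])
          then obtain N0 where N0: "finite N0" "\<And>N. finite N \<Longrightarrow> N0 \<subseteq> N \<Longrightarrow> \<bar>sum \<tau> N\<bar> \<le> \<eta>"
            by metis
          \<comment> \<open>complete the block to a large set of indices by terms far out on both sides\<close>
          let ?I = "{k..<k + int n}"
          let ?R = "{i \<in> N0. k + int n \<le> i}" and ?L = "{i \<in> N0. i < k}"
          have "sum \<tau> (?I \<union> (?R \<union> ?L)) = sum \<tau> ?I + sum \<tau> (?R \<union> ?L)"
            using N0(1) by (intro sum.union_disjoint) auto
          also have "sum \<tau> (?R \<union> ?L) = sum \<tau> ?R + sum \<tau> ?L"
            using N0(1) by (intro sum.union_disjoint) auto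
          finally have "sum \<tau> (?I \<union> (?R \<union> ?L)) = sum \<tau> ?I + (sum \<tau> ?R + sum \<tau> ?L)" .
          moreover have "\<bar>sum \<tau> (?I \<union> (?R \<union> ?L))\<bar> \<le> \<eta>" using N0(1) by (intro N0(2)) auto
          moreover have "\<bar>sum \<tau> ?R\<bar> \<le> B * \<kappa> ^ nat \<bar>k + int n\<bar>" using N0(1) 3 by (intro right) auto
          moreover have "\<bar>sum \<tau> ?L\<bar> \<le> B * \<kappa> ^ nat \<bar>k\<bar>" using N0(1) 3 by (intro left) auto
          ultimately show "\<bar>sum \<tau> ?I\<bar> \<le> B * \<kappa> ^ nat \<bar>k\<bar> + B * \<kappa> ^ nat \<bar>k + int n\<bar> + \<eta>" by linarith
        qed
      qed
    qed
    ultimately show ?thesis by (simp add: distrib_left)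
  qed
  define S where "S n x = (\<Sum>i<n. P ((g ^^ i) x))" for n x
  have S_per: "S n (x + of_int m) = S n x" if "x \<in> K" for n x m
    unfolding S_def using that by (simp add: gn_shift_int per gn_in)
  define D where "D = B * (2 / (1 - \<kappa>) + 2 / (1 - \<kappa>))"
  obtain Lg0 where Lg0: "\<And>u v. u \<in> K \<Longrightarrow> v \<in> K \<Longrightarrow> u \<le> v \<Longrightarrow> g v - g u \<le> Lg0 * (v - u)"
    using g_lipschitz by blast
  define Lg where "Lg = \<bar>Lg0\<bar>"
  have Lg: "g v - g u \<le> Lg * (v - u)" if "u \<in> K" "v \<in> K" "u \<le> v" for u v
  proof -
    have "Lg0 * (v - u) \<le> Lg * (v - u)" using that by (intro mult_right_mono) (auto simp: Lg_def)
    then show ?thesis using Lg0[OF that] by linarith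
  qed
  have gn_lip: "(g ^^ i) v - (g ^^ i) u \<le> Lg ^ i * (v - u)" if "u \<in> K" "v \<in> K" "u \<le> v" for i u v
  proof (induction i)
    case (Suc i)
    have "(g ^^ Suc i) v - (g ^^ Suc i) u \<le> Lg * ((g ^^ i) v - (g ^^ i) u)"
      using Lg[of "(g ^^ i) u" "(g ^^ i) v"] that by (simp add: gn_in gn_le_iff)
    also have "\<dots> \<le> Lg * (Lg ^ i * (v - u))" using Suc by (intro mult_left_mono) (auto simp: Lg_def)
    finally show ?case by simp
  qed simp
  have S_lip: "\<bar>S n v - S n u\<bar> \<le> (\<Sum>i<n. L * Lg ^ i) * (v - u)" if "u \<in> K" "v \<in> K" "u \<le> v" for n u v
  proof -
    have "\<bar>S n v - S n u\<bar> \<le> (\<Sum>i<n. \<bar>P ((g ^^ i) v) - P ((g ^^ i) u)\<bar>)"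
      unfolding S_def sum_subtractf[symmetric] by (rule sum_abs)
    also have "\<dots> \<le> (\<Sum>i<n. L * (Lg ^ i * (v - u)))"
    proof (rule sum_mono)
      fix i
      have "\<bar>P ((g ^^ i) v) - P ((g ^^ i) u)\<bar> \<le> L * ((g ^^ i) v - (g ^^ i) u)"
        using that by (intro lip) (auto simp: gn_in gn_le_iff)
      also have "\<dots> \<le> L * (Lg ^ i * (v - u))" using gn_lip[OF that] L by (intro mult_left_mono)
      finally show "\<bar>P ((g ^^ i) v) - P ((g ^^ i) u)\<bar> \<le> L * (Lg ^ i * (v - u))" .
    qed
    also have "\<dots> = (\<Sum>i<n. L * Lg ^ i) * (v - u)" by (simp add: sum_distrib_right mult.assoc)
    finally show ?thesis .
  qed
  have main: "\<bar>S n y - S n x\<bar> \<le> D" if xy: "x \<in> K" "y \<in> K" "x \<le> y" "y \<le> x + 1" for n x y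
  proof (rule field_le_epsilon)
    fix \<eta> :: real assume "0 < \<eta>"
    have "\<exists>G. finite G \<and> (\<forall>(a, b)\<in>G. gap a b \<and> x \<le> a \<and> b \<le> y) \<and>
        \<bar>S n y - S n x - (\<Sum>(a, b)\<in>G. S n b - S n a)\<bar> \<le> \<eta>"
      by (rule increment_near_gap_sum[OF \<open>0 < \<eta>\<close> xy S_lip])
    then obtain G where G: "finite G" "\<And>a b. (a, b) \<in> G \<Longrightarrow> gap a b \<and> x \<le> a \<and> b \<le> y"
      and err: "\<bar>S n y - S n x - (\<Sum>(a, b)\<in>G. S n b - S n a)\<bar> \<le> \<eta>"
      by blast
    obtain N where N: "finite N" "G = gap_in x ` N"
    proof (rule gaps_eq_image[OF G(1), of x])
      show "gap c d \<and> x \<le> c \<and> d \<le> x + 1" if "(c, d) \<in> G" for c d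
        using G(2)[OF that] xy by auto
    qed
    have "(\<Sum>(a, b)\<in>G. S n b - S n a) = (\<Sum>k\<in>N. S n (b k) - S n (a k))"
      unfolding N(2) by (rule sum_gap_in[of "S n" "\<lambda>_. 0"]) (simp add: S_per)
    also have "\<dots> = (\<Sum>k\<in>N. \<Sum>i<n. \<tau> (k + int i))"
      by (simp add: S_def \<tau>_def gn_itr a0_in b0_in sum_subtractf)
    finally have "\<bar>\<Sum>(a, b)\<in>G. S n b - S n a\<bar> \<le> (\<Sum>k\<in>N. \<bar>\<Sum>i<n. \<tau> (k + int i)\<bar>)"
      by simp
    also have "\<dots> \<le> (\<Sum>k\<in>N. B * (\<kappa> ^ nat \<bar>k + 0\<bar> + \<kappa> ^ nat \<bar>k + int n\<bar>))"
      by (rule sum_mono) (rule block)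
    also have "\<dots> = B * ((\<Sum>k\<in>N. \<kappa> ^ nat \<bar>k + 0\<bar>) + (\<Sum>k\<in>N. \<kappa> ^ nat \<bar>k + int n\<bar>))"
      by (simp add: sum_distrib_left sum.distrib distrib_left)
    also have "\<dots> \<le> D"
      unfolding D_def using C B0 N(1) by (intro mult_left_mono add_mono two_sided_geometric_sum_le) auto
    finally show "\<bar>S n y - S n x\<bar> \<le> D + \<eta>" using err by linarith
  qed
  show thesis
  proof (rule that[of D])
    fix n x y assume xy: "x \<in> K" "y \<in> K"
    obtain m :: int where m: "x \<le> y + of_int m" "y + of_int m < x + 1" "y + of_int m \<in> K"
      by (rule shift_into_unit[OF xy(2)])
    have "\<bar>S n (y + of_int m) - S n x\<bar> \<le> D" using xy m by (intro main) auto
    then show "\<bar>(\<Sum>i<n. P ((g ^^ i) y)) - (\<Sum>i<n. P ((g ^^ i) x))\<bar> \<le> D"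
      using S_per[OF xy(2)] by (simp add: S_def)
  qed
qed

end

section \<open>Hyperbolic invariant sets of twist maps\<close>

context circle_lift
begin

lemma next_point:
  assumes "0 < e"
  obtains v where "v \<in> K" "u < v" "\<And>w. w \<in> K \<Longrightarrow> w < v \<Longrightarrow> w < u + e"
proof (cases "\<exists>v\<in>K. u < v \<and> v < u + e")
  case True then show ?thesis using that by (meson less_trans)
next
  case False
  define v where "v = Inf (K \<inter> {u + e..})"
  obtain y where "y \<in> K" "u + e \<le> y" by (rule K_above)
  then have v: "v \<in> K \<inter> {u + e..}" unfolding v_def
    by (intro closed_contains_Inf) (auto intro: closed_K closed_Int)
  show ?thesis
  proof (rule that[of v])
    fix w assume w: "w \<in> K" "w < v"
    show "w < u + e"
    proof (rule ccontr)
      assume "\<not> w < u + e"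
      then have "v \<le> w" unfolding v_def using w by (intro cInf_lower) auto
      then show False using w by simp
    qed
  qed (use v assms in auto)
qed

lemma prev_point:
  assumes "0 < e"
  obtains v where "v \<in> K" "v < u" "\<And>w. w \<in> K \<Longrightarrow> v < w \<Longrightarrow> u - e < w"
proof (cases "\<exists>v\<in>K. u - e < v \<and> v < u")
  case True then show ?thesis using that by (meson less_trans)
next
  case False
  define v where "v = Sup (K \<inter> {..u - e})"
  obtain y where "y \<in> K" "y \<le> u - e" by (rule K_below)
  then have v: "v \<in> K \<inter> {..u - e}" unfolding v_def
    by (intro closed_contains_Sup) (auto intro: closed_K closed_Int)
  show ?thesis
  proof (rule that[of v])
    fix w assume w: "w \<in> K" "v < w"
    show "u - e < w"
    proof (rule ccontr)
      assume "\<not> u - e < w"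
      then have "w \<le> v" unfolding v_def using w by (intro cSup_upper) auto
      then show False using w by simp
    qed
  qed (use v assms in auto)
qed

text \<open>
  An increasing bijection of a closed set is continuous: a point of \<open>K\<close> beyond \<open>g x\<close>, chosen so that
  no points of \<open>K\<close> before it are \<open>e\<close> or more above \<open>g x\<close>, pulls back to a point beyond \<open>x\<close>.
\<close>

lemma g_continuous: "continuous_on K g"
  unfolding continuous_on_iff
proof (intro ballI allI impI)
  fix x e :: real assume x: "x \<in> K" and e: "0 < e"
  obtain v where v: "v \<in> K" "g x < v" "\<And>w. w \<in> K \<Longrightarrow> w < v \<Longrightarrow> w < g x + e" using next_point[OF e] by metis
  obtain u where u: "u \<in> K" "u < g x" "\<And>w. w \<in> K \<Longrightarrow> u < w \<Longrightarrow> g x - e < w" using prev_point[OF e] by metis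
  have less: "h u < x" "x < h v"
    using h_less_iff[OF u(1) g_in[OF x]] h_less_iff[OF g_in[OF x] v(1)] u v by (auto simp: hg x)
  show "\<exists>d>0. \<forall>x'\<in>K. dist x' x < d \<longrightarrow> dist (g x') (g x) < e"
  proof (intro exI[of _ "min (x - h u) (h v - x)"] conjI ballI impI)
    fix y assume y: "y \<in> K" "dist y x < min (x - h u) (h v - x)"
    then have "h u < y" "y < h v" by (auto simp: dist_real_def abs_less_iff)
    then have "u < g y" "g y < v"
      using g_less[OF h_in[OF u(1)] y(1)] g_less[OF y(1) h_in[OF v(1)]] by (auto simp: gh u v)
    then have "g x - e < g y" "g y < g x + e" using u(3) v(3) g_in y(1) by blast+
    then show "dist (g y) (g x) < e" by (simp add: dist_real_def abs_less_iff)
  qed (use less in auto)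
qed

lemma uniformly_continuous_on_K:
  fixes \<psi> :: "real \<Rightarrow> 'b::metric_space"
  assumes cont: "continuous_on K \<psi>"
    and per: "\<And>x y m. x \<in> K \<Longrightarrow> y \<in> K \<Longrightarrow> dist (\<psi> (x + of_int m)) (\<psi> (y + of_int m)) = dist (\<psi> x) (\<psi> y)"
    and e: "0 < e"
  obtains d where "0 < d" "\<And>x y. x \<in> K \<Longrightarrow> y \<in> K \<Longrightarrow> \<bar>y - x\<bar> < d \<Longrightarrow> dist (\<psi> y) (\<psi> x) < e"
proof -
  have "continuous_on (K \<inter> {-1..2}) \<psi>" using cont by (rule continuous_on_subset) simp
  then have "uniformly_continuous_on (K \<inter> {-1..2}) \<psi>"
    by (rule compact_uniformly_continuous) (simp add: closed_Int_compact closed_K)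
  then obtain d where d: "0 < d" "\<And>x y. x \<in> K \<inter> {-1..2} \<Longrightarrow> y \<in> K \<inter> {-1..2} \<Longrightarrow> dist y x < d \<Longrightarrow>
      dist (\<psi> y) (\<psi> x) < e"
    unfolding uniformly_continuous_on_def using e by metis
  show thesis
  proof (rule that[of "min d 1"])
    fix x y assume xy: "x \<in> K" "y \<in> K" "\<bar>y - x\<bar> < min d 1"
    obtain m :: int where m: "0 \<le> x + of_int m" "x + of_int m < 0 + 1" by (rule shift_into_unit[OF xy(1)])
    have "dist (\<psi> (y + of_int m)) (\<psi> (x + of_int m)) < e"
      by (rule d(2)) (use xy m in \<open>auto simp: K_shift_int dist_real_def\<close>)
    then show "dist (\<psi> y) (\<psi> x) < e" using per[OF xy(2,1)] by simp
  qed (use d in auto)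
qed

lemma gn_uniformly_continuous:
  assumes "0 < e"
  shows "\<exists>d>0. \<forall>x\<in>K. \<forall>y\<in>K. \<bar>y - x\<bar> < d \<longrightarrow> \<bar>(g ^^ n) y - (g ^^ n) x\<bar> < e"
proof -
  have cont: "continuous_on K (g ^^ n)"
  proof (induction n)
    case 0
    show ?case by (simp add: id_def)
  next
    case (Suc n)
    have "(g ^^ n) ` K \<subseteq> K" using gn_in by blast
    from continuous_on_compose[OF Suc continuous_on_subset[OF g_continuous this]] show ?case by simp
  qed
  obtain d where "0 < d" "\<And>x y. x \<in> K \<Longrightarrow> y \<in> K \<Longrightarrow> \<bar>y - x\<bar> < d \<Longrightarrow> dist ((g ^^ n) y) ((g ^^ n) x) < e"
    by (rule uniformly_continuous_on_K[OF cont _ assms]) (simp add: gn_shift_int dist_norm, blast)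
  then show ?thesis unfolding dist_real_def by blast
qed

end

lemma norm_plane_le: "norm v \<le> \<bar>fst v\<bar> + \<bar>snd v\<bar>" for v :: plane
  by (simp add: norm_Pair_le norm_prod_def sqrt_sum_squares_le_sum_abs)

lemma fst_le_norm: "\<bar>fst v\<bar> \<le> norm v" and snd_le_norm: "\<bar>snd v\<bar> \<le> norm v" for v :: plane
  using norm_fst_le[of "fst v" "snd v"] norm_snd_le[of "snd v" "fst v"] by auto

lemma det2_le: "\<bar>det2 v w\<bar> \<le> 2 * norm v * norm w"
proof -
  have "\<bar>det2 v w\<bar> \<le> \<bar>fst v\<bar> * \<bar>snd w\<bar> + \<bar>snd v\<bar> * \<bar>fst w\<bar>"
    unfolding det2_def using abs_triangle_ineq4[of "fst v * snd w" "snd v * fst w"] by (simp add: abs_mult)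
  also have "\<dots> \<le> norm v * norm w + norm v * norm w"
    by (intro add_mono mult_mono fst_le_norm snd_le_norm) auto
  finally show ?thesis by simp
qed

text \<open>
  The points \<open>(x, \<rho> x)\<close> with \<open>x \<in> K\<close> form the lifted invariant set, and \<open>A x\<close> is the derivative there
  of the lifted twist map. Since this map commutes with the deck transformations, it may be compared
  with \<open>g\<close> up to an integer; only differences enter.
\<close>

locale twist_graph = circle_lift +
  fixes \<rho> :: "real \<Rightarrow> real" and A :: "real \<Rightarrow> plane \<Rightarrow> plane"
  assumes A_linear: "\<And>x. x \<in> K \<Longrightarrow> linear (A x)"
    and linearization: "\<And>e. 0 < e \<Longrightarrow> \<exists>d>0. \<forall>x\<in>K. \<forall>y\<in>K. \<bar>y - x\<bar> < d \<longrightarrow>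
       norm ((g y, \<rho> (g y)) - (g x, \<rho> (g x)) - A x ((y, \<rho> y) - (x, \<rho> x))) \<le> e * norm ((y, \<rho> y) - (x, \<rho> x))"
    and A_bounded: "\<exists>c. \<forall>x\<in>K. \<forall>v. norm (A x v) \<le> c * norm v"
    and A_det: "\<And>x v w. x \<in> K \<Longrightarrow> det2 (A x v) (A x w) = det2 v w"
    and A_twist: "\<exists>b>0. \<forall>x\<in>K. b \<le> fst (A x (0, 1))"
begin

definition pt :: "real \<Rightarrow> plane" where "pt x = (x, \<rho> x)"

lemma fst_pt_diff: "\<bar>y - x\<bar> \<le> norm (pt y - pt x)"
  using fst_le_norm[of "pt y - pt x"] by (simp add: pt_def)

lemma bound_ge_1: obtains c where "1 \<le> c" "\<And>x v. x \<in> K \<Longrightarrow> norm (A x v) \<le> c * norm v"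
proof -
  obtain c where c: "\<And>x v. x \<in> K \<Longrightarrow> norm (A x v) \<le> c * norm v" using A_bounded by blast
  show thesis
  proof (rule that[of "max c 1"])
    fix x v assume "x \<in> K"
    then have "norm (A x v) \<le> c * norm v" by (rule c)
    also have "\<dots> \<le> max c 1 * norm v" by (intro mult_right_mono) auto
    finally show "norm (A x v) \<le> max c 1 * norm v" .
  qed auto
qed

text \<open>
  A nearly vertical segment that points down is tilted to the left by a twist map, and one that points
  up is tilted to the left by its inverse. Both would violate the monotonicity of \<open>g\<close> and \<open>h\<close>, so
  the slopes of short chords are bounded from below and from above.
\<close>

lemma graph_locally_lipschitz:
  obtains L d where "0 \<le> L" "0 < d" 
    "\<And>x y. x \<in> K \<Longrightarrow> y \<in> K \<Longrightarrow> \<bar>y - x\<bar> < d \<Longrightarrow> \<bar>\<rho> y - \<rho> x\<bar> \<le> L * \<bar>y - x\<bar>"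
proof -
  obtain c where c: "1 \<le> c" "\<And>x v. x \<in> K \<Longrightarrow> norm (A x v) \<le> c * norm v" using bound_ge_1 by blast
  obtain b where b: "0 < b" "\<And>x. x \<in> K \<Longrightarrow> b \<le> fst (A x (0, 1))" using A_twist by blast
  \<comment> \<open>the first bound serves the lower estimate; in the upper one the second bounds a chord by its image
    and the third then keeps the linearization error below a fraction of the twist\<close>
  define e where "e = min (b / 2) (min (1 / (8 * c)) (b / (64 * c * c)))"
  have e: "0 < e" "e \<le> b / 2" "e \<le> 1 / (8 * c)" "e \<le> b / (64 * c * c)" using b c by (auto simp: e_def)
  obtain d where d: "0 < d" "\<And>x y. x \<in> K \<Longrightarrow> y \<in> K \<Longrightarrow> \<bar>y - x\<bar> < d \<Longrightarrow>
      norm (pt (g y) - pt (g x) - A x (pt y - pt x)) \<le> e * norm (pt y - pt x)"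
    using linearization[OF e(1)] unfolding pt_def by blast
  define L where "L = 2 * (c + b) / b"
  have L: "0 \<le> L" using b c by (simp add: L_def)
  have lower: "- (\<rho> y - \<rho> x) \<le> L * (y - x)" if x: "x \<in> K" and y: "y \<in> K" and xy: "x < y" "y - x < d" for x y
  proof (cases "0 \<le> \<rho> y - \<rho> x")
    case True
    then have "- (\<rho> y - \<rho> x) \<le> 0" by simp
    also have "0 \<le> L * (y - x)" using L xy by simp
    finally show ?thesis .
  next
    case False
    define p r where "p = y - x" and "r = - (\<rho> y - \<rho> x)"
    have pr: "0 < p" "0 < r" using xy False by (auto simp: p_def r_def)
    have Delta: "pt y - pt x = p *\<^sub>R (1, 0) - r *\<^sub>R (0, 1)" by (simp add: pt_def p_def r_def)
    have "A x (pt y - pt x) = p *\<^sub>R A x (1, 0) - r *\<^sub>R A x (0, 1)"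
      unfolding Delta using A_linear[OF x] by (simp only: linear_diff linear_scale)
    then have "fst (A x (pt y - pt x)) = p * fst (A x (1, 0)) - r * fst (A x (0, 1))" by simp
    also have "\<dots> \<le> p * c - r * b"
    proof -
      have "fst (A x (1, 0)) \<le> c"
        using fst_le_norm[of "A x (1, 0)"] c(2)[OF x, of "(1, 0)"] by simp
      then show ?thesis using pr b(2)[OF x] by (intro diff_mono mult_left_mono) auto
    qed
    finally have 1: "fst (A x (pt y - pt x)) \<le> p * c - r * b" .
    have "norm (pt y - pt x) \<le> p + r" using norm_plane_le[of "pt y - pt x"] pr by (simp add: pt_def p_def r_def)
    then have "e * norm (pt y - pt x) \<le> b / 2 * (p + r)" using e b pr by (intro mult_mono) auto
    then have "g y - g x - fst (A x (pt y - pt x)) \<le> b / 2 * (p + r)"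
      using d(2)[OF x y] xy fst_le_norm[of "pt (g y) - pt (g x) - A x (pt y - pt x)"] by (simp add: pt_def)
    moreover have "g x < g y" using g_less[OF x y xy(1)] .
    ultimately have "0 \<le> b / 2 * (p + r) + (p * c - r * b)" using 1 by linarith
    moreover have "b / 2 * (p + r) = b * p / 2 + r * b / 2" "2 * (c + b) * p = 2 * (p * c) + 2 * (b * p)"
      by (simp_all add: field_simps)
    ultimately have "r * b \<le> 2 * (c + b) * p" using mult_pos_pos[OF b(1) pr(1)] by linarith
    then show ?thesis using b by (simp add: L_def p_def r_def field_simps)
  qed
  have upper: "\<rho> (g y) - \<rho> (g x) \<le> L * (g y - g x)"
    if x: "x \<in> K" and y: "y \<in> K" and xy: "x < y" "y - x < d" for x y
  proof (cases "\<rho> (g y) - \<rho> (g x) \<le> 0")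
    case True
    also have "0 \<le> L * (g y - g x)" using L g_less[OF x y xy(1)] by simp
    finally show ?thesis .
  next
    case False
    define p' r' where "p' = g y - g x" and "r' = \<rho> (g y) - \<rho> (g x)"
    define \<Delta> where "\<Delta> = pt y - pt x"
    define err where "err = pt (g y) - pt (g x) - A x \<Delta>"
    have pr: "0 < p'" "0 < r'" using g_less[OF x y xy(1)] False by (auto simp: p'_def r'_def)
    have err_le: "norm err \<le> e * norm \<Delta>" using d(2)[OF x y] xy by (simp add: err_def \<Delta>_def)
    have A\<Delta>: "A x \<Delta> = (p', r') - err" by (simp add: err_def pt_def p'_def r'_def)
    have Ae: "norm (A x (1, 0)) \<le> c" "norm (A x (0, 1)) \<le> c"
      using c(2)[OF x, of "(1, 0)"] c(2)[OF x, of "(0, 1)"] by auto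
    \<comment> \<open>area preservation recovers a vector from its image, without an inverse matrix\<close>
    have fst\<Delta>: "fst \<Delta> = det2 (A x \<Delta>) (A x (0, 1))" by (simp add: A_det[OF x]) (simp add: det2_def)
    have snd\<Delta>: "snd \<Delta> = - det2 (A x \<Delta>) (A x (1, 0))" by (simp add: A_det[OF x]) (simp add: det2_def)
    have "norm \<Delta> \<le> 2 * norm (A x \<Delta>) * c + 2 * norm (A x \<Delta>) * c"
    proof (rule order_trans[OF norm_plane_le add_mono])
      show "\<bar>fst \<Delta>\<bar> \<le> 2 * norm (A x \<Delta>) * c" unfolding fst\<Delta>
        by (rule order_trans[OF det2_le]) (use Ae in \<open>auto intro: mult_left_mono\<close>)
      show "\<bar>snd \<Delta>\<bar> \<le> 2 * norm (A x \<Delta>) * c" unfolding snd\<Delta> abs_minus_cancel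
        by (rule order_trans[OF det2_le]) (use Ae in \<open>auto intro: mult_left_mono\<close>)
    qed
    then have 1: "norm \<Delta> \<le> 4 * c * norm (A x \<Delta>)" by simp
    have "norm (A x \<Delta>) \<le> (p' + r') + norm err"
      unfolding A\<Delta> using norm_triangle_ineq4[of "(p', r')" err] norm_plane_le[of "(p', r')"] pr by simp
    also have "norm err \<le> 1 / (8 * c) * norm \<Delta>"
      by (rule order_trans[OF err_le mult_right_mono[OF e(3)]]) simp
    finally have "4 * c * norm (A x \<Delta>) \<le> 4 * c * ((p' + r') + 1 / (8 * c) * norm \<Delta>)"
      using c by (intro mult_left_mono) auto
    also have "\<dots> = 4 * c * (p' + r') + norm \<Delta> / 2" using c by (simp add: field_simps)
    finally have "norm \<Delta> \<le> 8 * c * (p' + r')" using 1 by linarith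
    then have "e * norm \<Delta> \<le> b / (64 * c * c) * (8 * c * (p' + r'))"
      using e b by (intro mult_mono) auto
    with err_le have "norm err \<le> b / (64 * c * c) * (8 * c * (p' + r'))" by linarith
    moreover have "b / (64 * c * c) * (8 * c * (p' + r')) = b / (8 * c) * (p' + r')"
      using c(1) by (simp add: field_simps)
    ultimately have err': "norm err \<le> b / (8 * c) * (p' + r')" by simp
    define \<beta> \<gamma> where "\<beta> = fst (A x (0, 1))" and "\<gamma> = snd (A x (0, 1))"
    have \<beta>: "b \<le> \<beta>" "\<bar>\<beta>\<bar> \<le> c" "\<bar>\<gamma>\<bar> \<le> c"
      using b(2)[OF x] Ae(2) fst_le_norm[of "A x (0, 1)"] snd_le_norm[of "A x (0, 1)"]
      by (auto simp: \<beta>_def \<gamma>_def)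
    have "fst \<Delta> = (p' - fst err) * \<gamma> - (r' - snd err) * \<beta>"
      unfolding fst\<Delta> A\<Delta> by (simp add: det2_def \<beta>_def \<gamma>_def)
    moreover have "0 < fst \<Delta>" using xy by (simp add: \<Delta>_def pt_def)
    ultimately have "r' * \<beta> < p' * \<gamma> + (- fst err * \<gamma>) + snd err * \<beta>" by (simp add: algebra_simps)
    moreover have "p' * \<gamma> \<le> p' * c" using \<beta> pr by (intro mult_left_mono) auto
    moreover have "- fst err * \<gamma> \<le> norm err * c"
    proof -
      have "- fst err * \<gamma> \<le> \<bar>fst err\<bar> * \<bar>\<gamma>\<bar>" by (metis abs_ge_self abs_minus_cancel abs_mult)
      also have "\<dots> \<le> norm err * c" using \<beta> fst_le_norm[of err] by (intro mult_mono) auto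
      finally show ?thesis .
    qed
    moreover have "snd err * \<beta> \<le> norm err * c"
    proof -
      have "snd err * \<beta> \<le> \<bar>snd err\<bar> * \<bar>\<beta>\<bar>" by (metis abs_ge_self abs_mult)
      also have "\<dots> \<le> norm err * c" using \<beta> snd_le_norm[of err] by (intro mult_mono) auto
      finally show ?thesis .
    qed
    moreover have "norm err * c \<le> b / 8 * (p' + r')"
    proof -
      have "norm err * c \<le> b / (8 * c) * (p' + r') * c" using err' c(1) by (intro mult_right_mono) auto
      also have "\<dots> = b / 8 * (p' + r')" using c(1) by (simp add: field_simps)
      finally show ?thesis .
    qed
    moreover have "r' * b \<le> r' * \<beta>" using \<beta> pr by (intro mult_left_mono) auto
    ultimately have "r' * b \<le> p' * c + b / 4 * (p' + r')" by linarith
    moreover have "b / 4 * (p' + r') = b * p' / 4 + r' * b / 4" "2 * (c + b) * p' = 2 * (p' * c) + 2 * (b * p')"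
      by (simp_all add: field_simps)
    moreover have "0 < p' * c" using pr c by simp
    ultimately have "r' * b \<le> 2 * (c + b) * p'"
      using mult_pos_pos[OF b(1) pr(1)] mult_pos_pos[OF pr(2) b(1)] by linarith
    then show ?thesis using b by (simp add: L_def p'_def r'_def field_simps)
  qed
  obtain d2 where d2: "0 < d2" "\<And>x y. x \<in> K \<Longrightarrow> y \<in> K \<Longrightarrow> \<bar>y - x\<bar> < d2 \<Longrightarrow> \<bar>h y - h x\<bar> < d"
    using circle_lift.gn_uniformly_continuous[OF inverse_lift d(1), of 1] by auto
  have main: "\<bar>\<rho> y - \<rho> x\<bar> \<le> L * (y - x)" if x: "x \<in> K" and y: "y \<in> K" and xy: "x < y" "y - x < min d d2" for x y
  proof -
    have "h x < h y" using h_less_iff x y xy by simp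
    then have "\<rho> y - \<rho> x \<le> L * (y - x)"
      using upper[of "h x" "h y"] d2(2)[OF x y] xy x y by (simp add: h_in gh)
    then show ?thesis using lower[OF x y] xy by (simp add: abs_le_iff)
  qed
  show thesis
  proof (rule that[of L "min d d2"])
    fix x y assume "x \<in> K" "y \<in> K" "\<bar>y - x\<bar> < min d d2"
    then show "\<bar>\<rho> y - \<rho> x\<bar> \<le> L * \<bar>y - x\<bar>"
      using main[of x y] main[of y x] by (cases x y rule: linorder_cases) (auto simp: abs_minus_commute)
  qed (use L d d2 in auto)
qed

lemma pt_locally_lipschitz:
  obtains L d where "1 \<le> L" "0 < d" 
    "\<And>x y. x \<in> K \<Longrightarrow> y \<in> K \<Longrightarrow> \<bar>y - x\<bar> < d \<Longrightarrow> norm (pt y - pt x) \<le> L * \<bar>y - x\<bar>"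
proof -
  obtain L d where L: "0 \<le> L" "0 < d" 
    "\<And>x y. x \<in> K \<Longrightarrow> y \<in> K \<Longrightarrow> \<bar>y - x\<bar> < d \<Longrightarrow> \<bar>\<rho> y - \<rho> x\<bar> \<le> L * \<bar>y - x\<bar>"
    using graph_locally_lipschitz by blast
  show thesis
  proof (rule that[of "L + 1" d])
    fix x y assume "x \<in> K" "y \<in> K" "\<bar>y - x\<bar> < d"
    then show "norm (pt y - pt x) \<le> (L + 1) * \<bar>y - x\<bar>"
      using L(3)[of x y] norm_plane_le[of "pt y - pt x"] by (simp add: pt_def distrib_right)
  qed (use L in auto)
qed

primrec An :: "nat \<Rightarrow> real \<Rightarrow> plane \<Rightarrow> plane" where
  "An 0 x v = v"
| "An (Suc n) x v = A ((g ^^ n) x) (An n x v)"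

lemma An_add: "An (m + n) x v = An m ((g ^^ n) x) (An n x v)"
  by (induction m) (simp_all add: funpow_add)

lemma An_linear: "x \<in> K \<Longrightarrow> linear (An n x)"
proof (induction n)
  case 0
  have "An 0 x = (\<lambda>v. v)" by auto
  then show ?case by (simp add: linear_id[unfolded id_def])
next
  case (Suc n)
  have "An (Suc n) x = A ((g ^^ n) x) \<circ> An n x" by auto
  then show ?case using linear_compose[OF Suc.IH[OF Suc.prems] A_linear[OF gn_in[OF Suc.prems]]] by metis
qed

text \<open>
  Uniformity over \<open>K\<close> replaces the differentiability of the iterates: the errors of the individual
  steps are controlled along the whole orbit.
\<close>

lemma An_linearization:
  assumes "0 < e"
  shows "\<exists>d>0. \<forall>x\<in>K. \<forall>y\<in>K. \<bar>y - x\<bar> < d \<longrightarrow>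
       norm (pt ((g ^^ n) y) - pt ((g ^^ n) x) - An n x (pt y - pt x)) \<le> e * norm (pt y - pt x)"
  using assms
proof (induction n arbitrary: e)
  case 0
  then show ?case by (intro exI[of _ 1]) auto
next
  case (Suc n)
  obtain c where c: "1 \<le> c" "\<And>x v. x \<in> K \<Longrightarrow> norm (A x v) \<le> c * norm v" using bound_ge_1 by blast
  have An_le: "norm (An n x v) \<le> c ^ n * norm v" if "x \<in> K" for n x v
  proof (induction n)
    case (Suc n)
    have "norm (An (Suc n) x v) \<le> c * norm (An n x v)" using c(2)[OF gn_in[OF that]] by simp
    also have "\<dots> \<le> c * (c ^ n * norm v)" using Suc c by (intro mult_left_mono) auto
    finally show ?case by simp
  qed simp
  define N where "N = c ^ n + 1"
  define e1 where "e1 = e / (2 * N)"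
  define e2 where "e2 = min 1 (e / (2 * c))"
  have cn: "0 < c ^ n" using c by simp
  have "0 < N" using cn by (simp add: N_def)
  then have e12: "0 < e1" "e1 * N = e / 2" using Suc.prems by (simp_all add: e1_def)
  have e2: "0 < e2" "e2 \<le> 1" "c * e2 \<le> e / 2"
    using Suc.prems c(1) unfolding e2_def by (auto simp: min_def field_simps)
  obtain d1 where d1: "0 < d1" "\<And>x y. x \<in> K \<Longrightarrow> y \<in> K \<Longrightarrow> \<bar>y - x\<bar> < d1 \<Longrightarrow>
      norm (pt (g y) - pt (g x) - A x (pt y - pt x)) \<le> e1 * norm (pt y - pt x)"
    using linearization[OF e12(1)] unfolding pt_def by blast
  obtain d2 where d2: "0 < d2" "\<And>x y. x \<in> K \<Longrightarrow> y \<in> K \<Longrightarrow> \<bar>y - x\<bar> < d2 \<Longrightarrow>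
      norm (pt ((g ^^ n) y) - pt ((g ^^ n) x) - An n x (pt y - pt x)) \<le> e2 * norm (pt y - pt x)"
    using Suc.IH[OF e2(1)] by blast
  obtain d3 where d3: "0 < d3" "\<And>x y. x \<in> K \<Longrightarrow> y \<in> K \<Longrightarrow> \<bar>y - x\<bar> < d3 \<Longrightarrow> \<bar>(g ^^ n) y - (g ^^ n) x\<bar> < d1"
    using gn_uniformly_continuous[OF d1(1)] by blast
  show ?case
  proof (intro exI[of _ "min d2 d3"] conjI ballI impI)
    fix x y assume xy: "x \<in> K" "y \<in> K" "\<bar>y - x\<bar> < min d2 d3"
    let ?x = "(g ^^ n) x" and ?y = "(g ^^ n) y"
    define \<Delta> where "\<Delta> = pt y - pt x"
    define Dn where "Dn = pt ?y - pt ?x"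
    have 1: "norm (pt (g ?y) - pt (g ?x) - A ?x Dn) \<le> e1 * norm Dn"
      unfolding Dn_def by (rule d1(2)) (use xy d3(2) gn_in in auto)
    have 2: "norm (Dn - An n x \<Delta>) \<le> e2 * norm \<Delta>" unfolding Dn_def \<Delta>_def by (rule d2(2)) (use xy in auto)
    have "norm Dn \<le> norm (An n x \<Delta>) + norm (Dn - An n x \<Delta>)" by (rule norm_triangle_sub)
    also have "\<dots> \<le> c ^ n * norm \<Delta> + 1 * norm \<Delta>"
      using An_le[OF xy(1)] order_trans[OF 2 mult_right_mono[OF e2(2)]] by (intro add_mono) auto
    finally have 3: "norm Dn \<le> N * norm \<Delta>" by (simp add: distrib_right N_def)
    have "A ?x Dn - A ?x (An n x \<Delta>) = A ?x (Dn - An n x \<Delta>)"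
      using linear_diff[OF A_linear[OF gn_in[OF xy(1)]]] by simp
    then have "norm (A ?x Dn - A ?x (An n x \<Delta>)) \<le> c * norm (Dn - An n x \<Delta>)" using c(2)[OF gn_in[OF xy(1)]] by simp
    also have "\<dots> \<le> c * (e2 * norm \<Delta>)" using 2 c by (intro mult_left_mono) auto
    also have "\<dots> \<le> e / 2 * norm \<Delta>" using mult_right_mono[OF e2(3), of "norm \<Delta>"] by (simp add: mult.assoc)
    finally have 4: "norm (A ?x Dn - A ?x (An n x \<Delta>)) \<le> e / 2 * norm \<Delta>" .
    have "e1 * norm Dn \<le> e1 * (N * norm \<Delta>)" using 3 e12 by (intro mult_left_mono) auto
    also have "\<dots> = e / 2 * norm \<Delta>" by (simp only: mult.assoc[symmetric] e12(2))
    finally have "norm ((pt (g ?y) - pt (g ?x) - A ?x Dn) + (A ?x Dn - A ?x (An n x \<Delta>))) \<le> e * norm \<Delta>"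
      using norm_triangle_ineq[of "pt (g ?y) - pt (g ?x) - A ?x Dn" "A ?x Dn - A ?x (An n x \<Delta>)"] 1 4 by simp
    then show "norm (pt ((g ^^ Suc n) y) - pt ((g ^^ Suc n) x) - An (Suc n) x (pt y - pt x)) \<le> e * norm (pt y - pt x)"
      by (simp add: \<Delta>_def)
  qed (use d2 d3 in auto)
qed

lemma g_lipschitz_on_K: "\<exists>L. \<forall>u\<in>K. \<forall>v\<in>K. u \<le> v \<longrightarrow> g v - g u \<le> L * (v - u)"
proof -
  obtain c where c: "1 \<le> c" "\<And>x v. x \<in> K \<Longrightarrow> norm (A x v) \<le> c * norm v" using bound_ge_1 by blast
  obtain L d where L: "1 \<le> L" "0 < d" 
    "\<And>x y. x \<in> K \<Longrightarrow> y \<in> K \<Longrightarrow> \<bar>y - x\<bar> < d \<Longrightarrow> norm (pt y - pt x) \<le> L * \<bar>y - x\<bar>"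
    using pt_locally_lipschitz by blast
  obtain d1 where d1: "0 < d1" "\<And>x y. x \<in> K \<Longrightarrow> y \<in> K \<Longrightarrow> \<bar>y - x\<bar> < d1 \<Longrightarrow>
      norm (pt (g y) - pt (g x) - A x (pt y - pt x)) \<le> 1 * norm (pt y - pt x)"
    using linearization[of 1] unfolding pt_def by fastforce
  define \<delta> where "\<delta> = min d d1"
  define L' where "L' = max ((c + 1) * L) (1 + 1 / \<delta>)"
  have \<delta>: "0 < \<delta>" using L d1 by (simp add: \<delta>_def)
  have "g v - g u \<le> L' * (v - u)" if uv: "u \<in> K" "v \<in> K" "u \<le> v" for u v
  proof (cases "v - u < \<delta>")
    case True
    have "g v - g u \<le> norm (pt (g v) - pt (g u))" using fst_pt_diff[of "g v" "g u"] by simp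
    also have "\<dots> \<le> norm (A u (pt v - pt u)) + norm (pt (g v) - pt (g u) - A u (pt v - pt u))"
      by (rule norm_triangle_sub)
    also have "\<dots> \<le> c * norm (pt v - pt u) + 1 * norm (pt v - pt u)"
      using c(2) d1(2) uv True by (intro add_mono) (auto simp: \<delta>_def)
    also have "\<dots> = (c + 1) * norm (pt v - pt u)" by (simp add: distrib_right)
    also have "\<dots> \<le> (c + 1) * (L * (v - u))"
      using L(3)[of u v] uv True c by (intro mult_left_mono) (auto simp: \<delta>_def)
    also have "\<dots> \<le> L' * (v - u)" using uv by (simp add: L'_def mult.assoc[symmetric] mult_right_mono)
    finally show ?thesis .
  next
    case False
    define m where "m = \<lceil>v - u\<rceil>"
    have m: "v \<le> u + of_int m" "of_int m \<le> v - u + 1" unfolding m_def by linarith+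
    have "g v \<le> g (u + of_int m)"
      using gn_le_iff[of v "u + of_int m" 1] uv m by (simp add: K_shift_int)
    then have "g v - g u \<le> v - u + 1" using m uv by (simp add: g_shift_int)
    also have "\<dots> \<le> (1 + 1 / \<delta>) * (v - u)" using False \<delta> by (simp add: field_simps)
    also have "\<dots> \<le> L' * (v - u)" using uv by (simp add: L'_def mult_right_mono)
    finally show ?thesis .
  qed
  then show ?thesis by blast
qed

end

text \<open>
  The growth on the unstable bundle is expressed through the forward cocycle, so that the derivatives
  of negative iterates can be avoided.
\<close>

locale hyperbolic_twist_graph = twist_graph +
  fixes Es Eu :: "real \<Rightarrow> plane set" and C0 \<Lambda> :: real
  assumes C0: "0 < C0" and \<Lambda>: "0 < \<Lambda>" "\<Lambda> < 1"
    and splitting: "\<And>x v. x \<in> K \<Longrightarrow> \<exists>vs\<in>Es x. \<exists>vu\<in>Eu x. v = vs + vu"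
    and Es_inv: "\<And>x v. x \<in> K \<Longrightarrow> v \<in> Es x \<Longrightarrow> A x v \<in> Es (g x)"
    and Eu_inv: "\<And>x v. x \<in> K \<Longrightarrow> v \<in> Eu x \<Longrightarrow> A x v \<in> Eu (g x)"
    and Es_contract: "\<And>x v n. x \<in> K \<Longrightarrow> v \<in> Es x \<Longrightarrow> norm (An n x v) \<le> C0 * \<Lambda> ^ n * norm v"
    and Eu_expand: "\<And>x v n. x \<in> K \<Longrightarrow> v \<in> Eu x \<Longrightarrow> norm v \<le> C0 * \<Lambda> ^ n * norm (An n x v)"
begin

lemma An_Es: "x \<in> K \<Longrightarrow> v \<in> Es x \<Longrightarrow> An n x v \<in> Es ((g ^^ n) x)"
  by (induction n) (auto simp: Es_inv gn_in)

lemma An_Eu: "x \<in> K \<Longrightarrow> v \<in> Eu x \<Longrightarrow> An n x v \<in> Eu ((g ^^ n) x)"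
  by (induction n) (auto simp: Eu_inv gn_in)

text \<open>
  Consider three consecutive images of a vector, \<open>M\<close> steps apart. If the unstable part dominates in the
  middle one, the last one is long; if the stable part dominates, the first one is.
\<close>

lemma vector_expansion:
  assumes x: "x \<in> K" and \<epsilon>: "C0 * \<Lambda> ^ M \<le> \<epsilon>" "0 < \<epsilon>"
  shows "(1 / \<epsilon> - \<epsilon>) / 2 * norm (An M x w) \<le> max (norm (An M ((g ^^ M) x) (An M x w))) (norm w)"
proof -
  obtain ws wu where w: "ws \<in> Es x" "wu \<in> Eu x" "w = ws + wu" using splitting[OF x] by blast
  define x' where "x' = (g ^^ M) x"
  have x': "x' \<in> K" using gn_in[OF x] by (simp add: x'_def)
  define vs vu where "vs = An M x ws" and "vu = An M x wu"
  define us uu where "us = An M x' vs" and "uu = An M x' vu"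
  have v: "An M x w = vs + vu" using linear_add[OF An_linear[OF x]] by (simp add: w vs_def vu_def)
  have u: "An M x' (An M x w) = us + uu" using linear_add[OF An_linear[OF x']] by (simp add: v us_def uu_def)
  have mem: "vs \<in> Es x'" "vu \<in> Eu x'" using An_Es An_Eu x w by (auto simp: vs_def vu_def x'_def)
  have weaken: "a \<le> \<epsilon> * norm b" if "a \<le> C0 * \<Lambda> ^ M * norm b" for a and b :: plane
    using that \<epsilon> by (smt (verit) mult_right_mono norm_ge_zero)
  have 1: "norm vs \<le> \<epsilon> * norm ws" "norm wu \<le> \<epsilon> * norm vu" "norm us \<le> \<epsilon> * norm vs" "norm vu \<le> \<epsilon> * norm uu"
    using Es_contract[OF x w(1), of M] Eu_expand[OF x w(2), of M] Es_contract[OF x' mem(1), of M] Eu_expand[OF x' mem(2), of M]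
    by (auto intro!: weaken simp: vs_def vu_def us_def uu_def)
  have key: "(1 / \<epsilon> - \<epsilon>) / 2 * norm (p + q) \<le> norm (P + Q)"
    if "norm q \<le> norm p" "norm p \<le> \<epsilon> * norm P" "norm Q \<le> \<epsilon> * norm q" and \<epsilon>1: "\<epsilon> \<le> 1" for p q P Q :: plane
  proof -
    have pos: "0 \<le> 1 / \<epsilon> - \<epsilon>" using \<epsilon> \<epsilon>1 by (simp add: field_simps mult_le_one)
    have "norm (p + q) \<le> 2 * norm p" using norm_triangle_ineq[of p q] that(1) by linarith
    then have "(1 / \<epsilon> - \<epsilon>) / 2 * norm (p + q) \<le> (1 / \<epsilon> - \<epsilon>) / 2 * (2 * norm p)"
      using pos by (intro mult_left_mono) auto
    also have "\<dots> = norm p / \<epsilon> - \<epsilon> * norm p" by (simp add: field_simps)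
    also have "\<dots> \<le> norm P - norm Q"
    proof -
      have "norm p / \<epsilon> \<le> norm P" using that(2) \<epsilon> by (simp add: field_simps)
      moreover have "\<epsilon> * norm q \<le> \<epsilon> * norm p" using that(1) \<epsilon> by (intro mult_left_mono) auto
      ultimately show ?thesis using that(3) by linarith
    qed
    also have "\<dots> \<le> norm (P + Q)" using norm_diff_ineq[of P Q] by simp
    finally show ?thesis .
  qed
  show ?thesis
  proof (cases "\<epsilon> \<le> 1")
    case False
    then have "1 / \<epsilon> - \<epsilon> \<le> 0" using \<epsilon> by (simp add: field_simps) (smt (verit) mult_le_cancel_left1)
    then have "(1 / \<epsilon> - \<epsilon>) / 2 * norm (An M x w) \<le> 0" by (intro mult_nonpos_nonneg) auto
    also have "0 \<le> max (norm (An M ((g ^^ M) x) (An M x w))) (norm w)" by (simp add: le_max_iff_disj)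
    finally show ?thesis .
  next
    case True
    show ?thesis
    proof (cases "norm vs \<le> norm vu")
      case le: True
      have "(1 / \<epsilon> - \<epsilon>) / 2 * norm (vu + vs) \<le> norm (uu + us)" by (rule key) (use 1 le True in auto)
      then show ?thesis using u v by (simp add: x'_def add.commute le_max_iff_disj)
    next
      case False
      have "(1 / \<epsilon> - \<epsilon>) / 2 * norm (vs + vu) \<le> norm (ws + wu)" by (rule key) (use 1 False True in auto)
      then show ?thesis using v w by (simp add: le_max_iff_disj)
    qed
  qed
qed

text \<open>
  Chords of the graph behave like tangent vectors up to the linearization error, and by the Lipschitz
  property their lengths are comparable with the lengths of their projections. The linearization is
  needed only forwards in time, starting from the preimages of \<open>x\<close> and \<open>y\<close> under \<open>g\<^sup>M\<close>.
\<close>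

theorem expansion_on_K:
  "\<exists>M\<ge>1. \<exists>\<delta>>0. \<forall>x\<in>K. \<forall>y\<in>K. x < y \<longrightarrow> y - x < \<delta> \<longrightarrow>
      \<kappa> * (y - x) \<le> max ((g ^^ M) y - (g ^^ M) x) ((h ^^ M) y - (h ^^ M) x)"
proof -
  obtain L dL where L: "1 \<le> L" "0 < dL" 
    "\<And>x y. x \<in> K \<Longrightarrow> y \<in> K \<Longrightarrow> \<bar>y - x\<bar> < dL \<Longrightarrow> norm (pt y - pt x) \<le> L * \<bar>y - x\<bar>"
    using pt_locally_lipschitz by blast
  define \<kappa>1 where "\<kappa>1 = max \<kappa> 1"
  define \<kappa>2 where "\<kappa>2 = 2 * \<kappa>1 * L"
  have \<kappa>: "1 \<le> \<kappa>1" "\<kappa> \<le> \<kappa>1" by (auto simp: \<kappa>1_def)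
  have "1 * 1 \<le> \<kappa>1 * L" using \<kappa> L by (intro mult_mono) auto
  then have \<kappa>2: "2 \<le> \<kappa>2" by (simp add: \<kappa>2_def)
  \<comment> \<open>small enough for the factor in \<open>vector_expansion\<close> to exceed \<open>\<kappa>2\<close>\<close>
  define \<epsilon> where "\<epsilon> = 1 / (2 * \<kappa>2 + 1)"
  have \<epsilon>: "0 < \<epsilon>" "\<kappa>2 \<le> (1 / \<epsilon> - \<epsilon>) / 2" using \<kappa>2 by (auto simp: \<epsilon>_def field_simps)
  obtain M0 where M0: "\<Lambda> ^ M0 < \<epsilon> / C0" using real_arch_pow_inv[of "\<epsilon> / C0" \<Lambda>] \<epsilon> C0 \<Lambda> by auto
  define M where "M = Suc M0"
  have "\<Lambda> ^ M \<le> \<Lambda> ^ M0" using \<Lambda> by (simp add: M_def mult_left_le_one_le)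
  then have "C0 * \<Lambda> ^ M \<le> \<epsilon>" using M0 C0 by (smt (verit) mult.commute pos_less_divide_eq mult_left_mono)
  note vec = vector_expansion[OF _ this \<epsilon>(1)]
  \<comment> \<open>the error \<open>\<eta> * norm D0\<close> is at most an eighth of \<open>norm D1\<close> unless \<open>D0\<close> is already long enough\<close>
  define \<eta> where "\<eta> = 1 / (4 * \<kappa>2)"
  have \<eta>: "0 < \<eta>" "\<eta> * (\<kappa>2 / 2) = 1 / 8" using \<kappa>2 by (auto simp: \<eta>_def)
  obtain d1 where d1: "0 < d1" "\<And>x y. x \<in> K \<Longrightarrow> y \<in> K \<Longrightarrow> \<bar>y - x\<bar> < d1 \<Longrightarrow>
      norm (pt ((g ^^ M) y) - pt ((g ^^ M) x) - An M x (pt y - pt x)) \<le> \<eta> * norm (pt y - pt x)"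
    using An_linearization[OF \<eta>(1)] by blast
  obtain d2 where d2: "0 < d2" "\<And>x y. x \<in> K \<Longrightarrow> y \<in> K \<Longrightarrow> \<bar>y - x\<bar> < d2 \<Longrightarrow>
      norm (pt ((g ^^ (M + M)) y) - pt ((g ^^ (M + M)) x) - An (M + M) x (pt y - pt x)) \<le> \<eta> * norm (pt y - pt x)"
    using An_linearization[OF \<eta>(1)] by blast
  have "0 < min (min d1 d2) dL" using d1 d2 L by simp
  then obtain d3 where d3: "0 < d3" "\<And>x y. x \<in> K \<Longrightarrow> y \<in> K \<Longrightarrow> \<bar>y - x\<bar> < d3 \<Longrightarrow>
      \<bar>(h ^^ M) y - (h ^^ M) x\<bar> < min (min d1 d2) dL"
    using circle_lift.gn_uniformly_continuous[OF inverse_lift] by blast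
  obtain d4 where d4: "0 < d4" "\<And>x y. x \<in> K \<Longrightarrow> y \<in> K \<Longrightarrow> \<bar>y - x\<bar> < d4 \<Longrightarrow>
      \<bar>(g ^^ M) y - (g ^^ M) x\<bar> < dL"
    using gn_uniformly_continuous[OF L(2)] by blast
  have main: "\<kappa> * (y - x) \<le> max ((g ^^ M) y - (g ^^ M) x) ((h ^^ M) y - (h ^^ M) x)"
    if x: "x \<in> K" and y: "y \<in> K" and xy: "x < y" "y - x < min d3 d4" for x y
  proof -
    define x0 y0 where "x0 = (h ^^ M) x" and "y0 = (h ^^ M) y"
    have in0: "x0 \<in> K" "y0 \<in> K" using x y hn_in by (auto simp: x0_def y0_def)
    have g0: "(g ^^ M) x0 = x" "(g ^^ M) y0 = y" using x y gn_hn by (auto simp: x0_def y0_def)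
    have close: "\<bar>y0 - x0\<bar> < d1" "\<bar>y0 - x0\<bar> < d2" "\<bar>y0 - x0\<bar> < dL" "\<bar>(g ^^ M) y - (g ^^ M) x\<bar> < dL"
      using d3(2)[OF x y] d4(2)[OF x y] xy by (auto simp: x0_def y0_def)
    have pos: "0 < y0 - x0" "0 < (g ^^ M) y - (g ^^ M) x"
      using hn_less_iff[OF x y] gn_less_iff[OF x y] xy by (auto simp: x0_def y0_def)
    define D0 D1 D2 where "D0 = pt y0 - pt x0" and "D1 = pt y - pt x" and "D2 = pt ((g ^^ M) y) - pt ((g ^^ M) x)"
    define v1 v2 where "v1 = An M x0 D0" and "v2 = An M x v1"
    have e1: "norm (D1 - v1) \<le> \<eta> * norm D0"
      using d1(2)[OF in0 close(1)] by (simp add: D0_def D1_def v1_def g0)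
    have e2: "norm (D2 - v2) \<le> \<eta> * norm D0"
      using d2(2)[OF in0 close(2)] by (simp add: D0_def D2_def v1_def v2_def g0 An_add funpow_add)
    have "(1 / \<epsilon> - \<epsilon>) / 2 * norm v1 \<le> max (norm v2) (norm D0)"
      using vec[OF in0(1), of D0] by (simp add: v1_def v2_def g0)
    moreover have "\<kappa>2 * norm v1 \<le> (1 / \<epsilon> - \<epsilon>) / 2 * norm v1" using \<epsilon> by (intro mult_right_mono) auto
    ultimately have v: "\<kappa>2 * norm v1 \<le> max (norm v2) (norm D0)" by linarith
    have D: "\<kappa>2 / 2 * norm D1 \<le> max (norm D2) (norm D0)"
    proof (cases "\<kappa>2 / 2 * norm D1 \<le> norm D0")
      case False
      then have "\<eta> * norm D0 \<le> \<eta> * (\<kappa>2 / 2 * norm D1)" using \<eta> by (intro mult_left_mono) auto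
      also have "\<dots> = norm D1 / 8" using \<eta>(2) by (simp add: mult.assoc[symmetric])
      finally have small: "\<eta> * norm D0 \<le> norm D1 / 8" .
      have "norm D1 \<le> norm v1 + norm (D1 - v1)" by (rule norm_triangle_sub)
      then have v1: "7 / 8 * norm D1 \<le> norm v1" using e1 small by linarith
      then have k: "\<kappa>2 * (7 / 8 * norm D1) \<le> \<kappa>2 * norm v1" using \<kappa>2 by (intro mult_left_mono) auto
      have D1: "0 \<le> \<kappa>2 * norm D1" using \<kappa>2 by simp
      have "norm D0 < \<kappa>2 * norm v1 \<or> norm D1 = 0" using False k D1 by linarith
      then have "\<kappa>2 * norm v1 \<le> norm v2 \<or> norm D1 = 0" using v by (auto simp: le_max_iff_disj)
      moreover have "norm v2 \<le> norm D2 + norm (D2 - v2)" using norm_triangle_sub[of v2 D2] by (simp add: norm_minus_commute)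
      moreover have "2 * norm D1 \<le> \<kappa>2 * norm D1" using \<kappa>2 by (intro mult_right_mono) auto
      moreover have "\<kappa>2 / 2 * norm D1 \<le> norm D2" if "\<kappa>2 * norm v1 \<le> norm v2" "norm v2 \<le> norm D2 + norm (D2 - v2)"
        "2 * norm D1 \<le> \<kappa>2 * norm D1"
      proof -
        have "7 / 8 * (\<kappa>2 * norm D1) \<le> \<kappa>2 * norm v1" "\<kappa>2 / 2 * norm D1 = (\<kappa>2 * norm D1) / 2"
          using k by simp_all
        then show ?thesis using that e2 small D1 by linarith
      qed
      ultimately have "\<kappa>2 / 2 * norm D1 \<le> norm D2 \<or> norm D1 = 0" by blast
      then show ?thesis by (auto simp: le_max_iff_disj)
    qed (simp add: le_max_iff_disj)
    have "norm D0 \<le> L * (y0 - x0)" "norm D2 \<le> L * ((g ^^ M) y - (g ^^ M) x)"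
      using L(3)[OF in0 close(3)] L(3)[OF gn_in[OF x] gn_in[OF y] close(4)] pos by (auto simp: D0_def D2_def)
    then have "\<kappa>2 / 2 * norm D1 \<le> L * max ((g ^^ M) y - (g ^^ M) x) (y0 - x0)"
      using D L(1) by (auto simp: max_mult_distrib_left le_max_iff_disj)
    also have "\<kappa>2 / 2 * norm D1 = L * (\<kappa>1 * norm D1)" by (simp add: \<kappa>2_def)
    finally have "\<kappa>1 * norm D1 \<le> max ((g ^^ M) y - (g ^^ M) x) (y0 - x0)"
      by (rule mult_left_le_imp_le) (use L(1) in simp)
    moreover have "\<kappa> * (y - x) \<le> \<kappa>1 * norm D1"
      using fst_pt_diff[of y x] xy \<kappa> by (intro mult_mono) (auto simp: D1_def)
    ultimately show ?thesis by (simp add: x0_def y0_def)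
  qed
  show ?thesis
    by (rule exI[of _ M], rule conjI, simp add: M_def, rule exI[of _ "min d3 d4"])
       (use main d3 d4 in auto)
qed

end

section \<open>Time changes of minimal flows and suspensions\<close>

locale compact_flow =
  fixes S :: "'a::metric_space set" and \<Phi> :: "real \<Rightarrow> 'a \<Rightarrow> 'a"
  assumes compact_S: "compact S"
    and flow_in: "\<And>t z. z \<in> S \<Longrightarrow> \<Phi> t z \<in> S"
    and flow_0: "\<And>z. z \<in> S \<Longrightarrow> \<Phi> 0 z = z"
    and flow_add: "\<And>s t z. z \<in> S \<Longrightarrow> \<Phi> (s + t) z = \<Phi> s (\<Phi> t z)"
    and flow_continuous: "continuous_on (UNIV \<times> S) (\<lambda>(t, z). \<Phi> t z)"
begin

lemma flow_continuous_time: "z \<in> S \<Longrightarrow> continuous_on UNIV (\<lambda>t. \<Phi> t z)"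
  using continuous_on_compose2[OF flow_continuous, of UNIV "\<lambda>t. (t, z)"]
  by (simp add: continuous_on_Pair image_subset_iff)

lemma flow_minus: "z \<in> S \<Longrightarrow> \<Phi> (- t) (\<Phi> t z) = z"
  using flow_add[of z "- t" t] by (simp add: flow_0)

end

locale time_change = compact_flow S \<Phi> for S :: "'a::metric_space set" and \<Phi> +
  fixes q :: "'a \<Rightarrow> real"
  assumes q_continuous: "continuous_on S q" and q_pos: "\<And>z. z \<in> S \<Longrightarrow> 0 < q z"
begin

text \<open>
  \<open>J z t = \<integral>\<^sub>0\<^sup>t q (\<Phi> s z) ds\<close>, as an antiderivative so that both signs of \<open>t\<close> are covered.
\<close>

definition J :: "'a \<Rightarrow> real \<Rightarrow> real" where
  "J z = (SOME j. j 0 = 0 \<and> (\<forall>t. (j has_real_derivative q (\<Phi> t z)) (at t)))"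

lemma q_flow_continuous: "continuous_on (UNIV \<times> S) (\<lambda>(t, z). q (\<Phi> t z))"
  using continuous_on_compose2[OF q_continuous flow_continuous] flow_in
  by (simp add: case_prod_unfold image_subset_iff)

lemma J_props:
  assumes "z \<in> S"
  shows J_0: "J z 0 = 0" and J_deriv: "(J z has_real_derivative q (\<Phi> t z)) (at t)"
proof -
  have "isCont (\<lambda>t. q (\<Phi> t z)) t" for t
  proof -
    have "continuous_on UNIV (\<lambda>t. q (\<Phi> t z))"
      by (rule continuous_on_compose2[OF q_continuous flow_continuous_time[OF assms]]) (use flow_in assms in auto)
    then show ?thesis by (simp add: continuous_on_eq_continuous_at)
  qed
  then obtain F where F: "\<And>t. (F has_vector_derivative q (\<Phi> t z)) (at t)"
    using einterval_antiderivative[of "-\<infinity>" \<infinity> "\<lambda>t. q (\<Phi> t z)"] by auto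
  have "((\<lambda>t. F t - F 0) has_real_derivative q (\<Phi> t z)) (at t)" for t
    using F[of t] by (auto intro!: derivative_eq_intros simp: has_real_derivative_iff_has_vector_derivative)
  then have "\<exists>j. j 0 = 0 \<and> (\<forall>t. (j has_real_derivative q (\<Phi> t z)) (at t))"
    by (intro exI[of _ "\<lambda>t. F t - F 0"]) auto
  from someI_ex[OF this] show "J z 0 = 0" "(J z has_real_derivative q (\<Phi> t z)) (at t)"
    unfolding J_def by auto
qed

lemma J_unique:
  assumes "z \<in> S" "j 0 = 0" "\<And>t. (j has_real_derivative q (\<Phi> t z)) (at t)"
  shows "j t = J z t"
proof -
  have "\<forall>t. ((\<lambda>t. j t - J z t) has_real_derivative 0) (at t)"
    using assms J_deriv by (auto intro!: derivative_eq_intros)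
  from DERIV_isconst_all[OF this, of t 0] show ?thesis using assms J_0 by simp
qed

lemma J_add: assumes "z \<in> S" shows "J z (t + s) = J z s + J (\<Phi> s z) t"
proof -
  have "((\<lambda>t. J z (t + s) - J z s) has_real_derivative q (\<Phi> t (\<Phi> s z))) (at t)" for t
    using DERIV_shift[of "J z" "q (\<Phi> (t + s) z)" t s] J_deriv[OF assms, of "t + s"] flow_add[OF assms, of t s]
    by (auto intro!: derivative_eq_intros)
  then have "J z (t + s) - J z s = J (\<Phi> s z) t"
    by (rule J_unique[OF flow_in[OF assms] _ , rotated]) simp
  then show ?thesis by simp
qed

lemma q_bounds:
  obtains m M where "0 < m" "\<And>z. z \<in> S \<Longrightarrow> m \<le> q z \<and> q z \<le> M"
proof (cases "S = {}")
  case True then show ?thesis using that[of 1 1] by auto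
next
  case False
  obtain x where x: "x \<in> S" "\<And>y. y \<in> S \<Longrightarrow> q x \<le> q y"
    using continuous_attains_inf[OF compact_S False q_continuous] by blast
  obtain y where y: "y \<in> S" "\<And>z. z \<in> S \<Longrightarrow> q z \<le> q y"
    using continuous_attains_sup[OF compact_S False q_continuous] by blast
  show ?thesis using that[of "q x" "q y"] x y q_pos by auto
qed

lemma J_strict_mono: "z \<in> S \<Longrightarrow> s < t \<Longrightarrow> J z s < J z t"
  using DERIV_pos_imp_increasing[of s t "J z"] J_deriv q_pos flow_in by blast

lemma J_surj: assumes z: "z \<in> S" obtains s where "J z s = y"
proof -
  obtain m M where m: "0 < m" "\<And>z. z \<in> S \<Longrightarrow> m \<le> q z \<and> q z \<le> M" by (metis q_bounds)
  have grow: "m * (t - s) \<le> J z t - J z s" if "s \<le> t" for s t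
  proof -
    have "J z s - m * s \<le> J z t - m * t"
    proof (rule DERIV_nonneg_imp_nondecreasing[OF that])
      fix x
      show "\<exists>y. ((\<lambda>x. J z x - m * x) has_real_derivative y) (at x) \<and> 0 \<le> y"
        using J_deriv[OF z, of x] m(2)[OF flow_in[OF z, of x]]
        by (intro exI[of _ "q (\<Phi> x z) - m"]) (auto intro!: derivative_eq_intros)
    qed
    then show ?thesis by (simp add: algebra_simps)
  qed
  have ab: "J z (- \<bar>y\<bar> / m) \<le> y" "y \<le> J z (\<bar>y\<bar> / m)" "- \<bar>y\<bar> / m \<le> \<bar>y\<bar> / m"
    using grow[of 0 "\<bar>y\<bar> / m"] grow[of "- \<bar>y\<bar> / m" 0] m(1) J_0[OF z] by auto
  have "\<forall>x. - \<bar>y\<bar> / m \<le> x \<and> x \<le> \<bar>y\<bar> / m \<longrightarrow> isCont (J z) x"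
    using J_deriv[OF z] DERIV_isCont by blast
  with IVT[of "J z" "- \<bar>y\<bar> / m" y "\<bar>y\<bar> / m"] ab that show thesis by blast
qed

lemma J_continuous: "continuous_on S (\<lambda>z. J z t)"
  unfolding continuous_on_iff
proof (intro ballI allI impI)
  fix z e :: "real" and x assume x: "x \<in> S" and e: "0 < (e::real)"
  define N where "N = \<bar>t\<bar>"
  have "uniformly_continuous_on ({-N..N} \<times> S) (\<lambda>(t, z). q (\<Phi> t z))"
    by (rule compact_uniformly_continuous[OF continuous_on_subset[OF q_flow_continuous]])
       (auto intro: compact_Times compact_S)
  then obtain d where d: "0 < d" "\<And>s z z'. s \<in> {-N..N} \<Longrightarrow> z \<in> S \<Longrightarrow> z' \<in> S \<Longrightarrow> dist z' z < d \<Longrightarrow>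
      dist (q (\<Phi> s z')) (q (\<Phi> s z)) < e / (N + 1)"
    using e unfolding uniformly_continuous_on_def
    by (elim allE[of _ "e / (N + 1)"]) (auto simp: N_def dist_Pair_Pair)
  show "\<exists>d>0. \<forall>x'\<in>S. dist x' x < d \<longrightarrow> dist (J x' t) (J x t) < e"
  proof (intro exI[of _ d] conjI d(1) ballI impI)
    fix x' assume x': "x' \<in> S" "dist x' x < d"
    have "norm ((J x' t - J x t) - (J x' 0 - J x 0)) \<le> e / (N + 1) * norm (t - 0)"
    proof (rule field_differentiable_bound[of "{-N..N}" "\<lambda>s. J x' s - J x s" "\<lambda>s. q (\<Phi> s x') - q (\<Phi> s x)"])
      fix s assume s: "s \<in> {-N..N}"
      show "((\<lambda>s. J x' s - J x s) has_field_derivative q (\<Phi> s x') - q (\<Phi> s x)) (at s within {-N..N})"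
        using J_deriv[OF x'(1)] J_deriv[OF x] by (intro DERIV_subset[OF DERIV_diff]) auto
      show "norm (q (\<Phi> s x') - q (\<Phi> s x)) \<le> e / (N + 1)"
        using d(2)[OF s x x'] by (simp add: dist_real_def)
    qed (auto simp: N_def)
    then have "\<bar>J x' t - J x t\<bar> \<le> e / (N + 1) * N" using J_0[OF x] J_0[OF x'(1)] by (simp add: N_def)
    also have "\<dots> < e" using e by (simp add: N_def field_simps)
    finally show "dist (J x' t) (J x t) < e" by (simp add: dist_real_def)
  qed
qed

text \<open>
  Let \<open>E z t = J z t - t\<close>. Its supremum \<open>u\<close> and its infimum \<open>l\<close> over all times both solve the
  cohomological equation up to sign, so \<open>u - l\<close> is invariant. Its sublevel sets are closed, and by
  minimality it is constant. Now \<open>u\<close> is lower and \<open>l\<close> is upper semicontinuous, hence \<open>u\<close> is both.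
\<close>

theorem gottschalk_hedlund:
  assumes minimal: "\<And>C. C \<subseteq> S \<Longrightarrow> closed C \<Longrightarrow> C \<noteq> {} \<Longrightarrow> (\<And>t z. z \<in> C \<Longrightarrow> \<Phi> t z \<in> C) \<Longrightarrow> C = S"
    and bounded: "\<And>z t. z \<in> S \<Longrightarrow> \<bar>J z t - t\<bar> \<le> B"
  obtains w where "continuous_on S w" "\<And>z s. z \<in> S \<Longrightarrow> w (\<Phi> s z) = w z + (J z s - s)"
proof -
  define E where "E z t = J z t - t" for z t
  define u where "u z = (SUP t. E z t)" for z
  define l where "l z = (INF t. E z t)" for z
  have E_le: "\<bar>E z t\<bar> \<le> B" if "z \<in> S" for z t using bounded[OF that] by (simp add: E_def)
  have bdd: "bdd_above (range (E z))" "bdd_below (range (E z))" if "z \<in> S" for z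
    using E_le[OF that] by (auto simp: abs_le_iff minus_le_iff intro!: bdd_aboveI[of _ B] bdd_belowI[of _ "- B"])
  have E_add: "E z (t + s) = E z s + E (\<Phi> s z) t" if "z \<in> S" for z s t
    using J_add[OF that, of t s] by (simp add: E_def)
  have Eu: "E z t \<le> u z" and El: "l z \<le> E z t" if "z \<in> S" for z t
    unfolding u_def l_def using bdd[OF that] by (auto intro: cSUP_upper cINF_lower)
  have u_le: "u z \<le> c" if "\<And>t. E z t \<le> c" for z c unfolding u_def using that by (intro cSUP_least) auto
  have l_ge: "c \<le> l z" if "\<And>t. c \<le> E z t" for z c unfolding l_def using that by (intro cINF_greatest) auto
  have u_flow: "u (\<Phi> s z) = u z - E z s" if z: "z \<in> S" for z s
  proof (rule antisym)
    show "u (\<Phi> s z) \<le> u z - E z s"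
      by (rule u_le) (use E_add[OF z, of _ s] Eu[OF z] in \<open>smt (verit)\<close>)
    have "u z \<le> u (\<Phi> s z) + E z s"
    proof (rule u_le)
      fix t
      show "E z t \<le> u (\<Phi> s z) + E z s"
        using E_add[OF z, of "t - s" s] Eu[OF flow_in[OF z], of s "t - s"] by simp
    qed
    then show "u z - E z s \<le> u (\<Phi> s z)" by simp
  qed
  define dd where "dd z = u z - l z" for z
  have dd_le: "dd z \<le> dd z0" if z0: "z0 \<in> S" and z: "z \<in> S" for z z0
  proof -
    \<comment> \<open>the sublevel set of \<open>u - l\<close>, written as an intersection of closed sets\<close>
    define C where "C = {z \<in> S. \<forall>t t'. E z t - E z t' \<le> dd z0}"
    have C_eq: "C = (\<Inter>t. \<Inter>t'. S \<inter> (\<lambda>z. E z t - E z t') -` {..dd z0})"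
      by (auto simp: C_def)
    have "closed C" unfolding C_eq
      unfolding E_def by (intro closed_INT ballI continuous_closed_preimage continuous_intros J_continuous
          compact_imp_closed[OF compact_S] closed_atMost)
    moreover have "z0 \<in> C"
    proof -
      have "E z0 t - E z0 t' \<le> dd z0" for t t'
        using Eu[OF z0, of t] El[OF z0, of t'] by (simp add: dd_def)
      then show ?thesis using z0 by (simp add: C_def)
    qed
    moreover have "\<Phi> s z \<in> C" if "z \<in> C" for s z
    proof -
      have zS: "z \<in> S" and *: "\<And>t t'. E z t - E z t' \<le> dd z0" using that by (auto simp: C_def)
      have "E (\<Phi> s z) t - E (\<Phi> s z) t' \<le> dd z0" for t t'
        using *[of "t + s" "t' + s"] by (simp add: E_add[OF zS])
      then show ?thesis using flow_in[OF zS] by (simp add: C_def)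
    qed
    ultimately have "C = S" by (intro minimal) (auto simp: C_def)
    then have "E z t - E z t' \<le> dd z0" for t t' using z by (auto simp: C_def)
    then have "E z t \<le> l z + dd z0" for t
      using l_ge[of "E z t - dd z0" z] by (smt (verit))
    from u_le[OF this] show ?thesis by (simp add: dd_def)
  qed
  have "continuous_on S u"
    unfolding continuous_on_iff
  proof (intro ballI allI impI)
    fix z and e :: real assume z: "z \<in> S" and e: "0 < e"
    obtain t where t: "u z - e / 2 < E z t"
      using less_cSUP_iff[OF _ bdd(1)[OF z], of "u z - e / 2"] e by (auto simp: u_def)
    obtain t' where t': "E z t' < l z + e / 2"
      using cINF_less_iff[OF _ bdd(2)[OF z], of "l z + e / 2"] e by (auto simp: l_def)
    have cont: "continuous_on S (\<lambda>z. E z t)" for t unfolding E_def by (intro continuous_intros J_continuous)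
    obtain d1 where d1: "0 < d1" "\<And>x. x \<in> S \<Longrightarrow> dist x z < d1 \<Longrightarrow> dist (E x t) (E z t) < e / 2"
      using cont[of t] z e unfolding continuous_on_iff by (meson half_gt_zero)
    obtain d2 where d2: "0 < d2" "\<And>x. x \<in> S \<Longrightarrow> dist x z < d2 \<Longrightarrow> dist (E x t') (E z t') < e / 2"
      using cont[of t'] z e unfolding continuous_on_iff by (meson half_gt_zero)
    show "\<exists>d>0. \<forall>x'\<in>S. dist x' z < d \<longrightarrow> dist (u x') (u z) < e"
    proof (intro exI[of _ "min d1 d2"] conjI ballI impI)
      fix x assume x: "x \<in> S" "dist x z < min d1 d2"
      have "u z - e < u x" using d1(2)[of x] x t Eu[OF x(1), of t] unfolding dist_real_def by linarith
      moreover have "l x < l z + e" using d2(2)[of x] x t' El[OF x(1), of t'] unfolding dist_real_def by linarith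
      moreover have "dd x = dd z" using dd_le[OF x(1) z] dd_le[OF z x(1)] by simp
      ultimately show "dist (u x) (u z) < e" by (simp add: dist_real_def dd_def)
    qed (use d1 d2 in auto)
  qed
  then show thesis
    by (intro that[of "\<lambda>z. - u z"]) (auto intro: continuous_intros simp: u_flow E_def)
qed

text \<open>
  On each orbit the map \<open>z \<mapsto> \<Phi> (w z) z\<close> changes the time parameter \<open>s\<close> into \<open>w z + J z s\<close>, an
  increasing bijection of the reals. As distinct times give distinct points, the map is a continuous
  bijection of a compact space.
\<close>

theorem time_change_conjugate:
  assumes w: "continuous_on S w" "\<And>z s. z \<in> S \<Longrightarrow> w (\<Phi> s z) = w z + (J z s - s)"
    and free: "\<And>z t. z \<in> S \<Longrightarrow> \<Phi> t z = z \<Longrightarrow> t = 0"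
    and \<Phi>': "\<And>z s. z \<in> S \<Longrightarrow> \<Phi>' (J z s) z = \<Phi> s z"
  shows "C0_conjugate (top_of_set S) \<Phi>' (top_of_set S) \<Phi>"
proof -
  define G where "G z = \<Phi> (w z) z" for z
  have G_in: "G z \<in> S" if "z \<in> S" for z using flow_in[OF that] by (simp add: G_def)
  have G_flow: "G (\<Phi> s z) = \<Phi> (J z s) (G z)" if z: "z \<in> S" for s z
  proof -
    have "G (\<Phi> s z) = \<Phi> (w z + (J z s - s) + s) z"
      unfolding G_def w(2)[OF z] by (rule flow_add[OF z, symmetric])
    also have "w z + (J z s - s) + s = J z s + w z" by simp
    finally show ?thesis unfolding G_def by (simp add: flow_add[OF z])
  qed
  have cont: "continuous_on S G"
    unfolding G_def
    using continuous_on_compose2[OF flow_continuous, of S "\<lambda>z. (w z, z)"] w(1)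
    by (simp add: continuous_on_Pair image_subset_iff)
  have inj: "inj_on G S"
  proof (rule inj_onI)
    fix z z' assume z: "z \<in> S" "z' \<in> S" and eq: "G z = G z'"
    define s where "s = - w z' + w z"
    have "z' = \<Phi> (- w z') (G z)" unfolding eq using flow_minus[OF z(2)] by (simp add: G_def)
    then have z': "z' = \<Phi> s z" unfolding s_def flow_add[OF z(1)] by (simp add: G_def)
    have "\<Phi> (J z s) (G z) = G z" using G_flow[OF z(1), of s] z' eq by simp
    then have "J z s = 0" using free G_in z by blast
    then have "s = 0" using J_strict_mono[OF z(1), of s 0] J_strict_mono[OF z(1), of 0 s] J_0[OF z(1)]
      by (metis less_irrefl linorder_neqE)
    then show "z = z'" using z' flow_0 z by simp
  qed
  have surj: "G ` S = S"
  proof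
    show "S \<subseteq> G ` S"
    proof
      fix y assume y: "y \<in> S"
      obtain s where s: "J y s = - w y" by (rule J_surj[OF y])
      have "G (\<Phi> s y) = y" using G_flow[OF y, of s] s flow_minus[OF y] by (simp add: G_def)
      then show "y \<in> G ` S" using flow_in[OF y] by (metis imageI)
    qed
  qed (use G_in in auto)
  have "homeomorphic_map (top_of_set S) (top_of_set S) G"
  proof (rule bijective_closed_imp_homeomorphic_map)
    show "continuous_map (top_of_set S) (top_of_set S) G" using cont G_in by auto
    then show "closed_map (top_of_set S) (top_of_set S) G"
      by (intro continuous_imp_closed_map)
         (auto simp: compact_space_subtopology compact_S Hausdorff_space_subtopology)
  qed (use inj surj in auto)
  moreover have "G (\<Phi>' t z) = \<Phi> t (G z)" if z: "z \<in> S" for t z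
  proof -
    obtain s where s: "J z s = t" by (rule J_surj[OF z])
    show ?thesis using \<Phi>'[OF z, of s] G_flow[OF z, of s] s by simp
  qed
  ultimately show ?thesis unfolding C0_conjugate_def by auto
qed

end

context compact_flow
begin

text \<open>
  The map \<open>(x, a) \<mapsto> \<Phi> a (\<iota> x)\<close> has the classes of \<open>suspension_rel\<close> as fibers. It is a quotient map
  because its restriction to the compact set \<open>A \<times> [0, 1]\<close> is already onto \<open>S\<close>.
\<close>

theorem suspension_conjugate:
  fixes A :: "'b::metric_space set" and \<iota> :: "'b \<Rightarrow> 'a"
  assumes A: "compact A" and f_surj: "f ` A = A"
    and \<iota>_cont: "continuous_on A \<iota>" and \<iota>_inj: "inj_on \<iota> A"
    and \<iota>_f: "\<And>x. x \<in> A \<Longrightarrow> \<Phi> 1 (\<iota> x) = \<iota> (f x)"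
    and \<iota>_return: "\<And>x y t. x \<in> A \<Longrightarrow> y \<in> A \<Longrightarrow> \<Phi> t (\<iota> x) = \<iota> y \<Longrightarrow> t \<in> \<int>"
    and \<iota>_in: "\<And>x. x \<in> A \<Longrightarrow> \<iota> x \<in> S"
    and S_sub: "\<And>z. z \<in> S \<Longrightarrow> \<exists>t x. x \<in> A \<and> z = \<Phi> t (\<iota> x)"
  shows "C0_conjugate (top_of_set S) \<Phi> (suspension_space A f) suspension_flow"
proof -
  define k where "k p = \<Phi> (snd p) (\<iota> (fst p))" for p
  define R where "R = suspension_rel A f"
  define Q where "Q = (A \<times> (UNIV :: real set)) // R"
  define e where "e z = {p \<in> A \<times> UNIV. k p = z}" for z
  have k_in: "k p \<in> S" if "p \<in> A \<times> UNIV" for p using that flow_in \<iota>_in by (auto simp: k_def)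
  have f: "f x \<in> A" if "x \<in> A" for x using f_surj that by blast
  have fn: "(f ^^ n) x \<in> A" if "x \<in> A" for n x using that by (induction n) (auto simp: f)
  have fn_surj: "\<exists>y\<in>A. x = (f ^^ n) y" if "x \<in> A" for n x
    using that
  proof (induction n arbitrary: x)
    case (Suc n)
    obtain y where "y \<in> A" "x = f y" using f_surj Suc.prems by blast
    moreover obtain y' where "y' \<in> A" "y = (f ^^ n) y'" using Suc.IH calculation by blast
    ultimately show ?case by auto
  qed auto
  have \<iota>_fn: "\<Phi> (real n) (\<iota> x) = \<iota> ((f ^^ n) x)" if x: "x \<in> A" for n x
  proof (induction n)
    case 0 then show ?case using flow_0 \<iota>_in x by simp
  next
    case (Suc n)
    have "\<Phi> (real (Suc n)) (\<iota> x) = \<Phi> 1 (\<Phi> (real n) (\<iota> x))"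
      using flow_add[OF \<iota>_in[OF x], of 1 "real n"] by (simp add: add.commute)
    then show ?case using Suc \<iota>_f[OF fn[OF x]] by simp
  qed
  have later: "\<Phi> (b + real n) (\<iota> x) = \<Phi> b (\<iota> ((f ^^ n) x))" if "x \<in> A" for b n x
    using flow_add[OF \<iota>_in[OF that], of b "real n"] \<iota>_fn[OF that] by simp
  have split: "y = (f ^^ nat m) x" if x: "x \<in> A" and y: "y \<in> A" and eq: "\<Phi> a (\<iota> x) = \<Phi> b (\<iota> y)"
    and m: "a - b = of_int m" "0 \<le> m" for x y a b m
  proof -
    have "\<Phi> b (\<iota> y) = \<Phi> b (\<iota> ((f ^^ nat m) x))" using later[OF x, of b "nat m"] eq m by (simp add: algebra_simps)
    then have "\<Phi> (-b) (\<Phi> b (\<iota> y)) = \<Phi> (-b) (\<Phi> b (\<iota> ((f ^^ nat m) x)))" by simp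
    then have "\<iota> y = \<iota> ((f ^^ nat m) x)" using flow_minus \<iota>_in x y fn by simp
    then show ?thesis using \<iota>_inj x y fn by (auto dest: inj_onD)
  qed
  have R_iff: "(p, p') \<in> R \<longleftrightarrow> p \<in> A \<times> UNIV \<and> p' \<in> A \<times> UNIV \<and> k p = k p'" for p p'
  proof -
    obtain x a y b where p: "p = (x, a)" "p' = (y, b)" by (metis surj_pair)
    have "(p, p') \<in> R" if xy: "x \<in> A" "y \<in> A" and eq: "\<Phi> a (\<iota> x) = \<Phi> b (\<iota> y)"
    proof -
      have "\<Phi> (a - b) (\<iota> x) = \<Phi> (- b) (\<Phi> a (\<iota> x))" using flow_add[OF \<iota>_in[OF xy(1)], of "- b" a] by simp
      also have "\<dots> = \<iota> y" unfolding eq using flow_minus \<iota>_in xy by simp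
      finally have "a - b \<in> \<int>" by (rule \<iota>_return[OF xy])
      then obtain m where m: "a - b = of_int m" by (rule Ints_cases)
      show ?thesis
      proof (cases "0 \<le> m")
        case True
        then have "y = (f ^^ nat m) x \<and> a = b + real (nat m)" using split[OF xy eq m] m by simp
        then show ?thesis unfolding R_def suspension_rel_def p using xy by blast
      next
        case False
        have "b - a = of_int (- m)" using m by simp
        then have "x = (f ^^ nat (- m)) y \<and> b = a + real (nat (- m))"
          using split[OF xy(2,1) eq[symmetric], of "- m"] False by simp
        then show ?thesis unfolding R_def suspension_rel_def p using xy by blast
      qed
    qed
    moreover have "x \<in> A \<and> y \<in> A \<and> \<Phi> a (\<iota> x) = \<Phi> b (\<iota> y)" if pR: "(p, p') \<in> R"
    proof -
      have xy: "x \<in> A" "y \<in> A" using pR by (auto simp: R_def suspension_rel_def p)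
      obtain n where "(y = (f ^^ n) x \<and> a = b + real n) \<or> (x = (f ^^ n) y \<and> b = a + real n)"
        using pR unfolding R_def suspension_rel_def p by blast
      then show ?thesis using later xy by metis
    qed
    ultimately show ?thesis by (auto simp: p k_def)
  qed
  have class_eq: "R `` {p} = e (k p)" if "p \<in> A \<times> UNIV" for p
    using that by (auto simp: e_def R_iff)
  have k_surj: "k ` (A \<times> UNIV) = S"
    using k_in S_sub by (force simp: k_def image_iff)
  have e_image: "e ` S = Q"
    unfolding Q_def quotient_def k_surj[symmetric] using class_eq by auto
  have inj_e: "inj_on e S"
  proof (rule inj_onI)
    fix z z' assume "z \<in> S" "z' \<in> S" "e z = e z'"
    moreover from this obtain p where "p \<in> A \<times> UNIV" "k p = z" using k_surj by auto
    ultimately show "z = z'" by (auto simp: e_def)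
  qed
  have k_cont: "continuous_on (A \<times> UNIV) k"
  proof -
    have "continuous_on (A \<times> UNIV) (\<lambda>p. (snd p, \<iota> (fst p)))"
      by (intro continuous_intros continuous_on_compose2[OF \<iota>_cont]) auto
    from continuous_on_compose2[OF flow_continuous this] show ?thesis
      using \<iota>_in by (simp add: k_def image_subset_iff)
  qed
  have cell: "\<exists>p\<in>A \<times> {0..1}. k p = z" if "z \<in> S" for z
  proof -
    obtain x a where x: "x \<in> A" "z = \<Phi> a (\<iota> x)" using S_sub \<open>z \<in> S\<close> by blast
    have fl: "\<Phi> a (\<iota> x) = \<Phi> (frac a) (\<Phi> (of_int \<lfloor>a\<rfloor>) (\<iota> x))"
      using flow_add[OF \<iota>_in[OF x(1)], of "frac a" "of_int \<lfloor>a\<rfloor>"] by (simp add: frac_def)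
    have "\<exists>y\<in>A. \<Phi> (of_int m) (\<iota> x) = \<iota> y" for m
    proof (cases "0 \<le> m")
      case True
      then show ?thesis using \<iota>_fn[OF x(1), of "nat m"] fn[OF x(1)] by auto
    next
      case False
      obtain y where y: "y \<in> A" "x = (f ^^ nat (- m)) y" using fn_surj[OF x(1)] by metis
      have "\<Phi> (of_int m) (\<iota> x) = \<Phi> (- real (nat (- m))) (\<Phi> (real (nat (- m))) (\<iota> y))"
        using False \<iota>_fn[OF y(1), of "nat (- m)"] y(2) by simp
      also have "\<dots> = \<iota> y" by (rule flow_minus[OF \<iota>_in[OF y(1)]])
      finally show ?thesis using y(1) by blast
    qed
    then obtain y where "y \<in> A" "\<Phi> (of_int \<lfloor>a\<rfloor>) (\<iota> x) = \<iota> y" by blast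
    then have "(y, frac a) \<in> A \<times> {0..1}" "k (y, frac a) = z"
      using fl x frac_lt_1[of a] by (auto simp: k_def intro: less_imp_le)
    then show ?thesis by blast
  qed
  have k_quot: "openin (top_of_set S) V \<longleftrightarrow> openin (top_of_set (A \<times> UNIV)) {p \<in> A \<times> UNIV. k p \<in> V}"
    if V: "V \<subseteq> S" for V
  proof
    assume "openin (top_of_set S) V"
    from continuous_openin_preimage[OF k_cont _ this] k_in
    have "openin (top_of_set (A \<times> UNIV)) (A \<times> UNIV \<inter> k -` V)" by auto
    moreover have "A \<times> UNIV \<inter> k -` V = {p \<in> A \<times> UNIV. k p \<in> V}" by auto
    ultimately show "openin (top_of_set (A \<times> UNIV)) {p \<in> A \<times> UNIV. k p \<in> V}" by simp
  next
    assume o: "openin (top_of_set (A \<times> UNIV)) {p \<in> A \<times> UNIV. k p \<in> V}"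
    let ?B = "A \<times> {0..1::real}"
    obtain T where T: "open T" "{p \<in> A \<times> UNIV. k p \<in> V} = A \<times> UNIV \<inter> T" using o by (auto simp: openin_open)
    have "{p \<in> ?B. k p \<in> V} = ?B \<inter> T" using T(2) by blast
    then have o': "openin (top_of_set ?B) {p \<in> ?B. k p \<in> V}" using T(1) by (auto simp: openin_open)
    have "quotient_map (top_of_set ?B) (top_of_set S) k"
    proof (rule continuous_imp_quotient_map)
      show "continuous_map (top_of_set ?B) (top_of_set S) k"
        using continuous_on_subset[OF k_cont, of ?B] k_in by auto
      show "compact_space (top_of_set ?B)" using A by (simp add: compact_space_subtopology compact_Times)
      show "k ` topspace (top_of_set ?B) = topspace (top_of_set S)"
        using cell k_in by (auto simp: image_iff)
    qed (simp add: Hausdorff_space_subtopology)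
    then show "openin (top_of_set S) V" using o' V unfolding quotient_map_def by auto
  qed
  let ?L = "\<lambda>U. U \<subseteq> Q \<and> openin (top_of_set (A \<times> UNIV)) {p \<in> A \<times> UNIV. R `` {p} \<in> U}"
  have L_iff: "?L U \<longleftrightarrow> U \<subseteq> Q \<and> openin (top_of_set S) {z \<in> S. e z \<in> U}" for U
  proof -
    have "{p \<in> A \<times> UNIV. R `` {p} \<in> U} = {p \<in> A \<times> UNIV. k p \<in> {z \<in> S. e z \<in> U}}"
      using class_eq k_in by auto
    then show ?thesis using k_quot[of "{z \<in> S. e z \<in> U}"] by simp
  qed
  have "istopology ?L"
    unfolding L_iff istopology_def
  proof (intro conjI allI impI)
    fix U V assume "U \<subseteq> Q \<and> openin (top_of_set S) {z \<in> S. e z \<in> U}" "V \<subseteq> Q \<and> openin (top_of_set S) {z \<in> S. e z \<in> V}"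
    moreover have "{z \<in> S. e z \<in> U \<inter> V} = {z \<in> S. e z \<in> U} \<inter> {z \<in> S. e z \<in> V}" by auto
    ultimately show "U \<inter> V \<subseteq> Q" "openin (top_of_set S) {z \<in> S. e z \<in> U \<inter> V}" by auto
  next
    fix \<U> assume *: "\<forall>U\<in>\<U>. U \<subseteq> Q \<and> openin (top_of_set S) {z \<in> S. e z \<in> U}"
    have "{z \<in> S. e z \<in> \<Union> \<U>} = (\<Union>U\<in>\<U>. {z \<in> S. e z \<in> U})" by auto
    then show "openin (top_of_set S) {z \<in> S. e z \<in> \<Union> \<U>}" using * by auto
    show "\<Union> \<U> \<subseteq> Q" using * by auto
  qed
  then have open_iff: "openin (suspension_space A f) U \<longleftrightarrow> U \<subseteq> Q \<and> openin (top_of_set S) {z \<in> S. e z \<in> U}" for U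
    unfolding suspension_space_def R_def[symmetric] Q_def[symmetric] L_iff[symmetric]
    by (simp add: topology_inverse')
  have top: "topspace (suspension_space A f) = Q"
  proof
    show "topspace (suspension_space A f) \<subseteq> Q" using open_iff[of "topspace (suspension_space A f)"] by simp
    have "{z \<in> S. e z \<in> Q} = S" using e_image by auto
    then have "openin (suspension_space A f) Q" by (simp add: open_iff)
    then show "Q \<subseteq> topspace (suspension_space A f)" by (rule openin_subset)
  qed
  have "homeomorphic_map (top_of_set S) (suspension_space A f) e"
    unfolding homeomorphic_map_def quotient_map_def using inj_e e_image by (auto simp: top open_iff)
  moreover have "e (\<Phi> t z) = suspension_flow t (e z)" if z: "z \<in> S" for t z
  proof -
    have kt: "k (x, a + t) = \<Phi> t (k (x, a))" if "x \<in> A" for x a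
      using flow_add[OF \<iota>_in[OF that], of t a] by (simp add: k_def add.commute)
    have "(x, a) \<in> (\<lambda>(x, a). (x, a + t)) ` e z" if "x \<in> A" "k (x, a) = \<Phi> t z" for x a
    proof -
      have "k (x, a - t) = \<Phi> (- t) (k (x, a))"
        using flow_add[OF \<iota>_in[OF that(1)], of "- t" a] by (simp add: k_def)
      also have "\<dots> = z" unfolding that(2) by (rule flow_minus[OF z])
      finally have "k (x, a - t) = z" .
      then show ?thesis using that(1) by (intro image_eqI[of _ _ "(x, a - t)"]) (auto simp: e_def)
    qed
    then show ?thesis unfolding suspension_flow_def by (auto simp: e_def kt)
  qed
  ultimately show ?thesis unfolding C0_conjugate_def by auto
qed

end

lemma C0_conjugate_trans:
  assumes "C0_conjugate X \<Phi> Y \<Psi>" "C0_conjugate Y \<Psi> Z \<Theta>"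
  shows "C0_conjugate X \<Phi> Z \<Theta>"
proof -
  obtain g1 g2 where g: "homeomorphic_map X Y g1" "\<And>t x. x \<in> topspace X \<Longrightarrow> g1 (\<Phi> t x) = \<Psi> t (g1 x)"
    "homeomorphic_map Y Z g2" "\<And>t x. x \<in> topspace Y \<Longrightarrow> g2 (\<Psi> t x) = \<Theta> t (g2 x)"
    using assms unfolding C0_conjugate_def by metis
  have "g1 x \<in> topspace Y" if "x \<in> topspace X" for x
    using homeomorphic_imp_surjective_map[OF g(1)] that by auto
  then show ?thesis unfolding C0_conjugate_def
    by (intro exI[of _ "g2 \<circ> g1"]) (auto simp: g intro: homeomorphic_map_compose[OF g(1,3)])
qed

section \<open>Cyclically ordered Cantor sets and their holes\<close>

lemma circ_diff_int [simp]: "circ (x - of_int k) = circ x"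
  using circ_add_int[of x "- k"] by simp

lemma circ_eq_close: "circ a = circ b \<Longrightarrow> \<bar>b - a\<bar> < 1 \<Longrightarrow> a = b"
proof -
  assume "circ a = circ b" "\<bar>b - a\<bar> < 1"
  then obtain k :: int where k: "b = a + of_int k" using circ_eq_iff by blast
  then have "\<bar>of_int k :: real\<bar> < 1" using \<open>\<bar>b - a\<bar> < 1\<close> by simp
  then have "k = 0" by linarith
  then show "a = b" using k by simp
qed

lemma circ_lift_in_unit:
  assumes "z \<in> circle" obtains y where "circ y = z" "x \<le> y" "y < x + 1"
proof -
  obtain y where y: "z = circ y" using circ_surj[OF assms] by blast
  show thesis
    by (rule that[of "y + of_int (- \<lfloor>y - x\<rfloor>)"]) (use y in \<open>simp only: circ_add_int\<close>, linarith+)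
qed

lemma cyclicI: "a < b \<Longrightarrow> b < c \<Longrightarrow> c < a + 1 \<Longrightarrow> cyclic (circ a) (circ b) (circ c)"
  unfolding cyclic_def by blast

lemma cyclic_lifts:
  assumes "cyclic (circ a) y z" obtains b c where "y = circ b" "z = circ c" "a < b" "b < c" "c < a + 1"
proof -
  obtain a' b c where abc: "circ a = circ a'" "y = circ b" "z = circ c" "a' < b" "b < c" "c < a' + 1"
    using assms unfolding cyclic_def by blast
  obtain k :: int where k: "a' = a + of_int k" using abc(1) circ_eq_iff by blast
  show thesis
    by (rule that[of "b + of_int (- k)" "c + of_int (- k)"]) (use abc k in simp_all)
qed

lemma cyclic_distinct: assumes "cyclic x y z" shows "x \<noteq> y" "y \<noteq> z" "x \<noteq> z"
proof -
  obtain a b c where abc: "x = circ a" "y = circ b" "z = circ c" "a < b" "b < c" "c < a + 1"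
    using assms unfolding cyclic_def by blast
  show "x \<noteq> y" "y \<noteq> z" "x \<noteq> z"
    using circ_eq_close[of a b] circ_eq_close[of b c] circ_eq_close[of a c] abc by auto
qed

lemma cyclic_total:
  assumes "x \<in> circle" "y \<in> circle" "z \<in> circle" "x \<noteq> y" "y \<noteq> z" "x \<noteq> z"
  shows "cyclic x y z \<or> cyclic y x z"
proof -
  obtain a where a: "x = circ a" using circ_surj assms(1) by blast
  obtain b where b: "circ b = y" "a \<le> b" "b < a + 1" using circ_lift_in_unit[OF assms(2)] by blast
  obtain c where c: "circ c = z" "a \<le> c" "c < a + 1" using circ_lift_in_unit[OF assms(3)] by blast
  have ne: "a < b" "a < c" "b \<noteq> c" using assms a b c by (auto simp: less_le)
  show ?thesis
  proof (cases "b < c")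
    case True then show ?thesis using cyclicI[of a b c] ne a b c by auto
  next
    case False
    then have "cyclic (circ b) (circ (a + of_int 1)) (circ (c + of_int 1))" using ne b c by (intro cyclicI) auto
    then have "cyclic (circ b) (circ a) (circ c)" by (simp only: circ_add_int)
    then have "cyclic y x z" by (simp only: a b(1) c(1))
    then show ?thesis by simp
  qed
qed

text \<open>
  A lift is chosen on one fundamental domain with values in one fundamental domain and is extended
  periodically; preservation of the cyclic order of triples that contain the base point makes it
  increasing. This lift may differ by integers that depend on the point from the restriction of a lift
  of the annulus map.
\<close>

lemma lift_cyclic_map:
  assumes Z: "Z \<subseteq> circle" "Z \<noteq> {}" and q: "q ` Z = Z" "inj_on q Z"
    and cyc: "\<And>x y z. x \<in> Z \<Longrightarrow> y \<in> Z \<Longrightarrow> z \<in> Z \<Longrightarrow> cyclic x y z \<Longrightarrow> cyclic (q x) (q y) (q z)"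
  obtains g where "\<And>x. circ x \<in> Z \<Longrightarrow> circ (g x) = q (circ x)"
    "\<And>x y. circ x \<in> Z \<Longrightarrow> circ y \<in> Z \<Longrightarrow> x < y \<Longrightarrow> g x < g y"
    "\<And>x. circ x \<in> Z \<Longrightarrow> g (x + 1) = g x + 1"
proof -
  obtain z0 where z0: "z0 \<in> Z" using Z by auto
  then obtain x0 where x0: "z0 = circ x0" using Z circ_surj by blast
  have qZ: "q z \<in> Z" "q z \<in> circle" if "z \<in> Z" for z
  proof -
    show "q z \<in> Z" using that q(1) by blast
    then show "q z \<in> circle" using Z(1) by blast
  qed
  \<comment> \<open>base points of the two fundamental domains\<close>
  obtain y0 where y0: "q z0 = circ y0" using qZ(2)[OF z0] circ_surj by blast
  have "\<exists>y. circ y = q (circ x) \<and> y0 \<le> y \<and> y < y0 + 1" if "circ x \<in> Z" for x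
    using circ_lift_in_unit[OF qZ(2)[OF that], of y0] by blast
  then obtain g0 where g0: "\<And>x. circ x \<in> Z \<Longrightarrow> circ (g0 x) = q (circ x)"
    "\<And>x. circ x \<in> Z \<Longrightarrow> y0 \<le> g0 x" "\<And>x. circ x \<in> Z \<Longrightarrow> g0 x < y0 + 1" by metis
  have g0_x0: "g0 x0 = y0"
    using circ_eq_close[of "g0 x0" y0] g0[of x0] z0 x0 y0 by auto
  have mono0: "g0 x < g0 y" if x: "circ x \<in> Z" and y: "circ y \<in> Z" and o: "x0 \<le> x" "x < y" "y < x0 + 1" for x y
  proof (cases "x = x0")
    case True
    have "circ y \<noteq> circ x0" using circ_eq_close[of x0 y] o True by auto
    then have "q (circ y) \<noteq> q z0" using q(2) y z0 x0 by (metis inj_onD)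
    then have "g0 y \<noteq> y0" using g0(1)[OF y] y0 by auto
    then show ?thesis using g0(2)[OF y] True g0_x0 by simp
  next
    case False
    then have "cyclic (circ x0) (circ x) (circ y)" using o by (intro cyclicI) auto
    then have "cyclic (circ y0) (q (circ x)) (q (circ y))" using cyc[of "circ x0" "circ x" "circ y"] x y z0 x0 y0 by metis
    then obtain b c where bc: "q (circ x) = circ b" "q (circ y) = circ c" "y0 < b" "b < c" "c < y0 + 1"
      using cyclic_lifts by metis
    have "g0 x = b" using circ_eq_close[of "g0 x" b] g0[OF x] bc by auto
    moreover have "g0 y = c" using circ_eq_close[of "g0 y" c] g0[OF y] bc by auto
    ultimately show ?thesis using bc by simp
  qed
  define m where "m x = \<lfloor>x - x0\<rfloor>" for x :: real
  define g where "g x = g0 (x + of_int (- m x)) + of_int (m x)" for x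
  have red: "x0 \<le> x + of_int (- m x)" "x + of_int (- m x) < x0 + 1" for x unfolding m_def by linarith+
  have circ_red: "circ (x + of_int (- m x)) = circ x" for x by (rule circ_add_int)
  show thesis
  proof (rule that[of g])
    show "circ (g x) = q (circ x)" if "circ x \<in> Z" for x
      unfolding g_def using g0(1)[of "x + of_int (- m x)"] that by (simp only: circ_add_int)
    show "g (x + 1) = g x + 1" if "circ x \<in> Z" for x
    proof -
      have "m (x + 1) = m x + 1" unfolding m_def by linarith
      then show ?thesis by (simp add: g_def)
    qed
    show "g x < g y" if x: "circ x \<in> Z" and y: "circ y \<in> Z" and xy: "x < y" for x y
    proof -
      let ?x = "x + of_int (- m x)" and ?y = "y + of_int (- m y)"
      have Zx: "circ ?x \<in> Z" "circ ?y \<in> Z" using x y by (simp_all only: circ_add_int)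
      have "m x \<le> m y" unfolding m_def using xy by (intro floor_mono) simp
      then consider "m x = m y" | "m x + 1 \<le> m y" by linarith
      then show ?thesis
      proof cases
        case 1
        then have "g0 ?x < g0 ?y" using red[of x] red[of y] xy by (intro mono0 Zx) auto
        then show ?thesis using 1 by (simp add: g_def)
      next
        case 2
        have "g x < y0 + 1 + of_int (m x)" using g0(3)[OF Zx(1)] by (simp add: g_def)
        also have "\<dots> \<le> y0 + of_int (m y)" using 2 by linarith
        also have "\<dots> \<le> g y" using g0(2)[OF Zx(2)] by (simp add: g_def)
        finally show ?thesis .
      qed
    qed
  qed
qed

lemma circ_open_image: assumes "open U" shows "openin (top_of_set circle) (circ ` U)"
  unfolding openin_euclidean_subtopology_iff
proof (intro conjI ballI)
  show "circ ` U \<subseteq> circle" using circ_in_circle by blast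
  fix z assume "z \<in> circ ` U"
  then obtain x where x: "x \<in> U" "z = circ x" by blast
  obtain e where e: "0 < e" "\<And>y. dist y x < e \<Longrightarrow> y \<in> U" using assms x(1) unfolding open_dist by blast
  obtain d where d: "0 < d" "\<And>z. z \<in> circle \<Longrightarrow> dist z (circ x) < d \<Longrightarrow> \<exists>y. circ y = z \<and> dist y x < e"
    using circ_local_lift[OF e(1), of x] by blast
  show "\<exists>e>0. \<forall>z'\<in>circle. dist z' z < e \<longrightarrow> z' \<in> circ ` U"
    by (intro exI[of _ d]) (use d e(2) x(2) in blast)
qed

text \<open>
  A minimal cyclically ordered Cantor set on a graph over the circle. Its dynamics is transported to
  the line through \<open>K\<close>, the lift of its projection, and \<open>g\<close>, an increasing lift of the induced map.
\<close>

locale ordered_cantor_set =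
  fixes A :: "annulus set" and f :: "annulus \<Rightarrow> annulus"
  assumes A_circle: "A \<subseteq> circle \<times> UNIV" and ordered: "f_ordered f A" and cantor: "cantor_set A"
    and minimal: "\<And>B. B \<subseteq> A \<Longrightarrow> compact B \<Longrightarrow> B \<noteq> {} \<Longrightarrow> f ` B = B \<Longrightarrow> B = A"
begin

lemma compact_A: "compact A" and f_A: "f ` A = A" and fst_inj: "inj_on fst A"
  and f_cyclic: "\<And>x y z. x \<in> A \<Longrightarrow> y \<in> A \<Longrightarrow> z \<in> A \<Longrightarrow> cyclic (fst x) (fst y) (fst z) \<Longrightarrow>
      cyclic (fst (f x)) (fst (f y)) (fst (f z))"
  using ordered unfolding f_ordered_def by blast+

lemma A_nonempty: "A \<noteq> {}" and infinite_A: "infinite A"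
proof -
  show "A \<noteq> {}" using cantor by (simp add: cantor_set_def)
  then obtain x where "x \<in> A" "x islimpt A" using cantor unfolding cantor_set_def by blast
  then show "infinite A" using islimpt_finite by blast
qed

definition Z where "Z = fst ` A"
definition height where "height z = snd (the_inv_into A fst z)"
definition K where "K = {x. circ x \<in> Z}"
definition pt where "pt x = (x, height (circ x))"

lemma height: "z \<in> Z \<Longrightarrow> (z, height z) \<in> A"
  using the_inv_into_into[OF fst_inj, of z A] f_the_inv_into_f[OF fst_inj, of z]
  unfolding Z_def height_def by (metis order_refl prod.collapse)

lemma height_unique: "a \<in> A \<Longrightarrow> a = (fst a, height (fst a))"
  unfolding height_def by (simp add: the_inv_into_f_f[OF fst_inj])

lemma Z_circle: "Z \<subseteq> circle" using A_circle by (auto simp: Z_def)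

lemma infinite_Z: "infinite Z"
  unfolding Z_def using infinite_A finite_imageD[OF _ fst_inj] by blast

lemma proj2_pt: "proj2 (pt x) = (circ x, height (circ x))"
  by (simp add: pt_def proj2_def)

lemma pt_in: "x \<in> K \<Longrightarrow> proj2 (pt x) \<in> A"
  using height by (simp add: pt_def proj2_def K_def)

lemma in_A_iff_pt: "proj2 x \<in> A \<longleftrightarrow> (\<exists>t\<in>K. x = pt t)"
proof
  assume x: "proj2 x \<in> A"
  obtain \<theta> r where xx: "x = (\<theta>, r)" by (cases x)
  have "circ \<theta> \<in> Z" using x by (force simp: xx proj2_def Z_def)
  moreover have "r = height (circ \<theta>)" using height_unique[OF x] by (simp add: xx proj2_def)
  ultimately show "\<exists>t\<in>K. x = pt t" by (auto simp: xx pt_def K_def)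
qed (use pt_in in auto)

lemma f_inj: "inj_on f A"
proof (rule inj_onI, rule ccontr)
  fix x y assume xy: "x \<in> A" "y \<in> A" "f x = f y" "x \<noteq> y"
  have "\<not> Z \<subseteq> {fst x, fst y}" using infinite_Z finite_subset by blast
  then obtain z where z: "z \<in> A" "fst z \<noteq> fst x" "fst z \<noteq> fst y" unfolding Z_def by blast
  have ne: "fst x \<noteq> fst y" using xy fst_inj by (meson inj_onD)
  have "fst x \<in> circle" "fst y \<in> circle" "fst z \<in> circle" using xy z A_circle by (auto simp: mem_Times_iff)
  then have "cyclic (fst x) (fst y) (fst z) \<or> cyclic (fst y) (fst x) (fst z)" using cyclic_total ne z by metis
  then have "fst (f x) \<noteq> fst (f y)" using f_cyclic cyclic_distinct(1) xy z by metis
  then show False using xy by simp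
qed

definition q where "q z = fst (f (z, height z))"

lemma q_fst: "a \<in> A \<Longrightarrow> q (fst a) = fst (f a)"
  using height_unique by (simp add: q_def)

lemma q_props: "q ` Z = Z" "inj_on q Z"
  "x \<in> Z \<Longrightarrow> y \<in> Z \<Longrightarrow> z \<in> Z \<Longrightarrow> cyclic x y z \<Longrightarrow> cyclic (q x) (q y) (q z)"
proof -
  have "q ` Z = fst ` f ` A" unfolding Z_def by (simp add: image_image q_fst)
  then show "q ` Z = Z" using f_A by (simp add: Z_def)
  show "inj_on q Z"
  proof (rule inj_onI)
    fix z w assume zw: "z \<in> Z" "w \<in> Z" "q z = q w"
    have "f (z, height z) \<in> A" "f (w, height w) \<in> A" using height zw f_A by blast+
    then have "f (z, height z) = f (w, height w)" using zw(3) fst_inj unfolding q_def by (meson inj_onD)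
    then show "z = w" using f_inj height zw by (meson inj_onD prod.inject)
  qed
  show "cyclic (q x) (q y) (q z)" if "x \<in> Z" "y \<in> Z" "z \<in> Z" "cyclic x y z"
    using f_cyclic[OF height height height] that unfolding q_def by simp
qed

definition g where "g = (SOME g. (\<forall>x. circ x \<in> Z \<longrightarrow> circ (g x) = q (circ x)) \<and>
  (\<forall>x y. circ x \<in> Z \<longrightarrow> circ y \<in> Z \<longrightarrow> x < y \<longrightarrow> g x < g y) \<and> (\<forall>x. circ x \<in> Z \<longrightarrow> g (x + 1) = g x + 1))"

lemma g_props: "\<And>x. x \<in> K \<Longrightarrow> circ (g x) = q (circ x)" "\<And>x y. x \<in> K \<Longrightarrow> y \<in> K \<Longrightarrow> x < y \<Longrightarrow> g x < g y"
  "\<And>x. x \<in> K \<Longrightarrow> g (x + 1) = g x + 1"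
proof -
  have "\<exists>g. (\<forall>x. circ x \<in> Z \<longrightarrow> circ (g x) = q (circ x)) \<and>
    (\<forall>x y. circ x \<in> Z \<longrightarrow> circ y \<in> Z \<longrightarrow> x < y \<longrightarrow> g x < g y) \<and> (\<forall>x. circ x \<in> Z \<longrightarrow> g (x + 1) = g x + 1)"
  proof (rule lift_cyclic_map[of Z q])
    show "Z \<noteq> {}" using A_nonempty by (simp add: Z_def)
  qed (use Z_circle q_props in metis)+
  from someI_ex[OF this] show "\<And>x. x \<in> K \<Longrightarrow> circ (g x) = q (circ x)" "\<And>x y. x \<in> K \<Longrightarrow> y \<in> K \<Longrightarrow> x < y \<Longrightarrow> g x < g y"
    "\<And>x. x \<in> K \<Longrightarrow> g (x + 1) = g x + 1" unfolding g_def[symmetric] K_def by blast+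
qed

lemma g_in_K: "x \<in> K \<Longrightarrow> g x \<in> K"
  using g_props(1) q_props(1) unfolding K_def by auto

lemma f_pt: assumes "x \<in> K" shows "f (proj2 (pt x)) = proj2 (pt (g x))"
proof -
  have "f (proj2 (pt x)) \<in> A" using pt_in[OF assms] f_A by blast
  moreover have "fst (f (proj2 (pt x))) = circ (g x)"
    using g_props(1)[OF assms] by (simp add: pt_def proj2_def q_def)
  ultimately show ?thesis using height_unique proj2_pt by metis
qed

lemma K_shift_int: "x + of_int k \<in> K \<longleftrightarrow> x \<in> K"
  by (simp add: K_def)

lemma pt_shift_int: "pt (x + of_int k) = pt x + (of_int k, 0)"
  by (simp add: pt_def)

lemma g_shift_int: assumes "x \<in> K" shows "g (x + of_int m) = g x + of_int m"
proof (induction m rule: int_induct[where k = 0])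
  case (step1 i)
  have "x + of_int i \<in> K" using assms K_shift_int by blast
  from g_props(3)[OF this] step1 show ?case by (simp add: add.assoc)
next
  case (step2 i)
  have "x + of_int (i - 1) \<in> K" using assms K_shift_int by blast
  from g_props(3)[OF this] step2 show ?case by (simp add: algebra_simps)
qed simp

lemma g_surj: assumes "y \<in> K" shows "\<exists>x\<in>K. g x = y"
proof -
  obtain z where z: "z \<in> Z" "q z = circ y" using assms q_props(1) unfolding K_def by (metis imageE mem_Collect_eq)
  obtain x where x: "circ x = z" using z Z_circle circ_surj by (metis subsetD)
  have xK: "x \<in> K" using x z by (simp add: K_def)
  obtain k :: int where k: "y = g x + of_int k" using g_props(1)[OF xK] x z circ_eq_iff[of "g x" y] by auto
  show ?thesis using g_shift_int[OF xK, of k] k xK K_shift_int by metis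
qed

definition h where "h y = (SOME x. x \<in> K \<and> g x = y)"

lemma h: "y \<in> K \<Longrightarrow> h y \<in> K \<and> g (h y) = y"
  using someI_ex[of "\<lambda>x. x \<in> K \<and> g x = y"] g_surj unfolding h_def by blast

lemma height_continuous: "continuous_on Z height"
proof -
  have "continuous_on (fst ` A) (the_inv_into A fst)"
    by (rule continuous_on_inv_into[OF _ compact_A fst_inj]) (intro continuous_intros)
  then show ?thesis unfolding Z_def height_def by (intro continuous_intros)
qed

lemma pt_continuous: "continuous_on K pt"
  unfolding pt_def
  by (intro continuous_intros continuous_on_compose2[OF height_continuous continuous_on_subset[OF continuous_circ]])
     (auto simp: K_def)

text \<open>
  An interval in \<open>K\<close> would give a nontrivial connected piece of the Cantor set.
\<close>

lemma K_nowhere_dense: assumes "x < y" shows "\<exists>z. x < z \<and> z < y \<and> z \<notin> K"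
proof (rule ccontr)
  assume no: "\<not> ?thesis"
  define u v where "u = x + min (y - x) 1 / 3" and "v = x + min (y - x) 1 / 2"
  have uv: "x < u" "u < v" "v < y" "v < u + 1" using assms by (auto simp: u_def v_def min_def field_simps)
  have sub: "{u..v} \<subseteq> K" using no uv by auto
  have "continuous_on {u..v} (\<lambda>t. (circ t, height (circ t)))"
    by (intro continuous_intros continuous_on_compose2[OF height_continuous] continuous_on_subset[OF continuous_circ])
       (use sub in \<open>auto simp: K_def\<close>)
  then have "connected ((\<lambda>t. (circ t, height (circ t))) ` {u..v})" by (rule connected_continuous_image) simp
  moreover have "(\<lambda>t. (circ t, height (circ t))) ` {u..v} \<subseteq> A" using sub height by (auto simp: K_def)
  moreover have "(circ u, height (circ u)) \<in> (\<lambda>t. (circ t, height (circ t))) ` {u..v}"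
    "(circ v, height (circ v)) \<in> (\<lambda>t. (circ t, height (circ t))) ` {u..v}" using uv by auto
  ultimately have "(circ v, height (circ v)) \<in> connected_component_set A (circ u, height (circ u))"
    unfolding connected_component_def by blast
  moreover have "(circ u, height (circ u)) \<in> A"
  proof -
    have "u \<in> K" using sub uv by auto
    then show ?thesis using height by (simp add: K_def)
  qed
  ultimately have "circ v = circ u" using cantor unfolding cantor_set_def by auto
  then show False using circ_eq_close[of v u] uv by auto
qed

sublocale circle_lift K g h
proof
  have "compact Z" unfolding Z_def by (intro compact_continuous_image compact_A continuous_intros)
  then have "closed (circ -` Z)"
    using continuous_closed_vimage[OF compact_imp_closed] continuous_circ
    by (metis continuous_on_eq_continuous_at open_UNIV UNIV_I)
  moreover have "K = circ -` Z" by (auto simp: K_def)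
  ultimately show "closed K" by simp
  show "x + 1 \<in> K \<longleftrightarrow> x \<in> K" for x using K_shift_int[of x 1] by simp
  show "h (g x) = x" if "x \<in> K" for x
    using h[OF g_in_K[OF that]] g_props(2)[OF that] g_props(2)[of "h (g x)" x] that
    by (metis less_irrefl linorder_neqE)
  show "\<exists>z. x < z \<and> z < y \<and> z \<notin> K" if "x < y" for x y using K_nowhere_dense[OF that] .
  obtain z where "z \<in> Z" using A_nonempty Z_def by auto
  then obtain x where "circ x = z" using Z_circle circ_surj by (metis subsetD)
  then show "K \<noteq> {}" using \<open>z \<in> Z\<close> by (auto simp: K_def)
qed (use g_in_K h g_props in auto)

lemma fn_pt: "x \<in> K \<Longrightarrow> (f ^^ n) (proj2 (pt x)) = proj2 (pt ((g ^^ n) x))"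
  by (induction n) (auto simp: f_pt gn_in)

lemma circ_K: "circ x \<in> Z \<longleftrightarrow> x \<in> K" by (simp add: K_def)

text \<open>
  The arc over a gap is open in the circle, and adding its two end points makes it closed. A connected
  set that contains the arc but avoids the end points is therefore equal to it.
\<close>

lemma gap_arc:
  assumes "gap a b"
  shows gap_arc_component: "circ ` {a<..<b} \<in> gaps A"
    and gap_arc_ends: "gap_ends A (circ ` {a<..<b}) = {proj2 (pt a), proj2 (pt b)}"
proof -
  let ?I = "circ ` {a<..<b}"
  have ab: "a \<in> K" "b \<in> K" "a < b" "\<And>z. a < z \<Longrightarrow> z < b \<Longrightarrow> z \<notin> K" using assms by (auto simp: gap_def)
  have cl: "closed (circ ` {a..b})"
    by (intro compact_imp_closed compact_continuous_image continuous_on_subset[OF continuous_circ]) auto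
  have icc: "circ ` {a..b} = ?I \<union> {circ a, circ b}"
  proof -
    have "{a..b} = {a<..<b} \<union> {a, b}" using ab(3) by auto
    then show ?thesis by auto
  qed
  have disj: "?I \<inter> Z = {}" using ab(4) by (auto simp: circ_K)
  show "?I \<in> gaps A"
    unfolding gaps_def Z_def[symmetric] in_components_maximal
  proof (intro conjI allI impI)
    show "?I \<noteq> {}" using ab(3) by simp
    show "?I \<subseteq> circle - Z" using disj circ_in_circle by blast
    show "connected ?I" by (intro connected_continuous_image continuous_on_subset[OF continuous_circ]) auto
    fix d assume d: "d \<noteq> {} \<and> ?I \<subseteq> d \<and> d \<subseteq> circle - Z \<and> connected d"
    have ends: "circ a \<notin> d" "circ b \<notin> d" using d ab by (auto simp: circ_K)
    have "openin (top_of_set d) ?I"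
      by (rule openin_subset_trans[OF circ_open_image]) (use d in auto)
    moreover have "closedin (top_of_set d) ?I"
    proof -
      have "?I = d \<inter> circ ` {a..b}" unfolding icc using d ends by auto
      then show ?thesis using cl by (metis closedin_closed_Int)
    qed
    ultimately have "?I = {} \<or> ?I = d" using d connected_clopen by blast
    then show "d = ?I" using ab(3) by auto
  qed
  have "closure ?I \<subseteq> circ ` {a..b}" by (rule closure_minimal[OF _ cl]) auto
  moreover have "circ a \<in> closure ?I" "circ b \<in> closure ?I"
  proof -
    have "circ ` closure {a<..<b} \<subseteq> closure ?I"
      by (rule image_closure_subset[OF continuous_on_subset[OF continuous_circ]]) (auto intro: closure_subset[THEN subsetD])
    then show "circ a \<in> closure ?I" "circ b \<in> closure ?I" using ab(3) by auto
  qed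
  ultimately have cl_iff: "z \<in> closure ?I \<longleftrightarrow> z = circ a \<or> z = circ b" if "z \<in> Z" for z
    using that disj icc by blast
  show "gap_ends A ?I = {proj2 (pt a), proj2 (pt b)}"
  proof
    show "gap_ends A ?I \<subseteq> {proj2 (pt a), proj2 (pt b)}"
    proof
      fix x assume x: "x \<in> gap_ends A ?I"
      then have xA: "x \<in> A" "fst x \<in> Z" by (auto simp: gap_ends_def Z_def)
      have "fst x = circ a \<or> fst x = circ b" using cl_iff[OF xA(2)] x by (simp add: gap_ends_def)
      then show "x \<in> {proj2 (pt a), proj2 (pt b)}" using height_unique[OF xA(1)] by (auto simp: pt_def proj2_def)
    qed
    show "{proj2 (pt a), proj2 (pt b)} \<subseteq> gap_ends A ?I"
      using pt_in ab cl_iff circ_K by (auto simp: gap_ends_def pt_def proj2_def)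
  qed
qed

text \<open>
  Two gaps with the same set of end points could only be interchanged if together they filled the
  circle, and then the Cantor set would have two points.
\<close>

lemma gap_determined_by_ends:
  assumes ab: "gap a b" and cd: "gap c d" and eq: "{circ a, circ b} = {circ c, circ d}"
  shows "\<exists>m::int. c = a + of_int m"
proof (cases "circ a = circ c")
  case True then show ?thesis by (simp add: circ_eq_iff)
next
  case False
  then have "circ b = circ c" "circ a = circ d" using eq by (auto simp: doubleton_eq_iff)
  then obtain m l :: int where ml: "c = b + of_int m" "d = a + of_int l" by (auto simp: circ_eq_iff)
  have "gap b (d + of_int (- m))" using cd gap_shift_int[of b m "d + of_int (- m)"] ml by simp
  have Kab: "a \<in> K" "b \<in> K" "a < b" using ab by (auto simp: gap_def)
  have "Z \<subseteq> {circ a, circ b}"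
  proof
    fix z assume z: "z \<in> Z"
    then obtain x where x: "circ x = z" "a \<le> x" "x < a + 1" using Z_circle circ_lift_in_unit by (metis subsetD)
    have xK: "x \<in> K" using x(1) z circ_K by blast
    have a1: "a + of_int (l - m) = d + of_int (- m)" using ml by simp
    have "b < a + of_int (l - m)" using \<open>gap b (d + of_int (- m))\<close> a1 by (simp add: gap_def)
    then have "a < a + of_int (l - m)" using Kab by linarith
    then have "1 \<le> l - m" by simp
    then have "a + 1 \<le> a + of_int (l - m)" by simp
    then have "x < d + of_int (- m)" using x a1 by linarith
    then have "\<not> b < x" using \<open>gap b (d + of_int (- m))\<close> xK by (auto simp: gap_def)
    moreover have "\<not> (a < x \<and> x < b)" using ab xK by (auto simp: gap_def)
    ultimately have "x = a \<or> x = b" using x by linarith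
    then show "z \<in> {circ a, circ b}" using x by auto
  qed
  then show ?thesis using infinite_Z finite_subset by blast
qed

text \<open>
  That the quotient has a single element makes any two gaps related to the same gaps, hence to each
  other.
\<close>

lemma gap_orbits_comparable:
  assumes holes: "has_holes 1 f A" and ab: "gap a b" and cd: "gap c d"
  shows "\<exists>(n::nat) (m::int). c = (g ^^ n) a + of_int m \<or> c = (h ^^ n) a + of_int m"
proof -
  let ?I = "circ ` {a<..<b}" and ?J = "circ ` {c<..<d}" and ?r = "gap_orbit_rel f A"
  have IJ: "?I \<in> gaps A" "?J \<in> gaps A" using gap_arc_component ab cd by auto
  have "card (gaps A // ?r) = 1" using holes by (simp add: has_holes_def)
  moreover have "?r `` {?I} \<in> gaps A // ?r" "?r `` {?J} \<in> gaps A // ?r" using IJ by (auto simp: quotient_def)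
  ultimately have "?r `` {?I} = ?r `` {?J}" by (metis card_1_singletonE singletonD)
  moreover have "?J \<in> ?r `` {?J}" using IJ unfolding gap_orbit_rel_def by (auto intro: exI[of _ 0])
  ultimately have "(?I, ?J) \<in> ?r" by blast
  then obtain n where n: "(f ^^ n) ` {proj2 (pt a), proj2 (pt b)} = {proj2 (pt c), proj2 (pt d)} \<or>
      (f ^^ n) ` {proj2 (pt c), proj2 (pt d)} = {proj2 (pt a), proj2 (pt b)}"
    unfolding gap_orbit_rel_def gap_arc_ends[OF ab, symmetric] gap_arc_ends[OF cd, symmetric] by blast
  have K: "a \<in> K" "b \<in> K" "c \<in> K" "d \<in> K" using ab cd by (auto simp: gap_def)
  have fst_pt: "fst (proj2 (pt x)) = circ x" for x by (simp add: pt_def proj2_def)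
  consider (forward) "(f ^^ n) ` {proj2 (pt a), proj2 (pt b)} = {proj2 (pt c), proj2 (pt d)}"
    | (backward) "(f ^^ n) ` {proj2 (pt c), proj2 (pt d)} = {proj2 (pt a), proj2 (pt b)}"
    using n by blast
  then show ?thesis
  proof cases
    case forward
    then have "fst ` {proj2 (pt ((g ^^ n) a)), proj2 (pt ((g ^^ n) b))} = fst ` {proj2 (pt c), proj2 (pt d)}"
      using K by (simp add: fn_pt)
    then have "{circ ((g ^^ n) a), circ ((g ^^ n) b)} = {circ c, circ d}" by (simp add: fst_pt)
    from gap_determined_by_ends[OF gap_gn[OF ab] cd this] show ?thesis by blast
  next
    case backward
    then have "fst ` {proj2 (pt ((g ^^ n) c)), proj2 (pt ((g ^^ n) d))} = fst ` {proj2 (pt a), proj2 (pt b)}"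
      using K by (simp add: fn_pt)
    then have "{circ ((g ^^ n) c), circ ((g ^^ n) d)} = {circ a, circ b}" by (simp add: fst_pt)
    from gap_determined_by_ends[OF gap_gn[OF cd] ab this]
    obtain m :: int where m: "a = (g ^^ n) c + of_int m" by blast
    have "(h ^^ n) a = c + of_int m" unfolding m using hn_shift_int[OF gn_in[OF K(3)]] hn_gn[OF K(3)] by simp
    then have "c = (h ^^ n) a + of_int (- m)" by simp
    then show ?thesis by blast
  qed
qed

lemma no_periodic_points: assumes p: "p \<in> A" and n: "(f ^^ n) p = p" shows "n = 0"
proof (rule ccontr)
  assume "n \<noteq> 0"
  define B where "B = (\<lambda>i. (f ^^ i) p) ` {..<n}"
  have fn: "(f ^^ i) p \<in> A" for i using p f_A by (induction i) auto
  have "f ` B = (\<lambda>i. (f ^^ Suc i) p) ` {..<n}" by (auto simp: B_def)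
  also have "\<dots> = B"
  proof
    show "(\<lambda>i. (f ^^ Suc i) p) ` {..<n} \<subseteq> B"
    proof (rule image_subsetI)
      fix i assume "i \<in> {..<n}"
      then have "i < n" by simp
      then consider "Suc i < n" | "Suc i = n" by linarith
      then show "(f ^^ Suc i) p \<in> B"
      proof cases
        case 1 then show ?thesis unfolding B_def by blast
      next
        case 2
        then have "(f ^^ Suc i) p = (f ^^ 0) p" using n by simp
        then show ?thesis unfolding B_def using \<open>n \<noteq> 0\<close> by blast
      qed
    qed
    show "B \<subseteq> (\<lambda>i. (f ^^ Suc i) p) ` {..<n}"
      unfolding B_def
    proof (rule image_subsetI)
      fix i assume "i \<in> {..<n}"
      then have i: "i < n" by simp
      show "(f ^^ i) p \<in> (\<lambda>i. (f ^^ Suc i) p) ` {..<n}"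
      proof (cases i)
        case 0
        then have "(f ^^ i) p = (f ^^ Suc (n - 1)) p" using n \<open>n \<noteq> 0\<close> by simp
        then show ?thesis by (rule image_eqI) (use \<open>n \<noteq> 0\<close> in simp)
      next
        case (Suc j) then show ?thesis using i by auto
      qed
    qed
  qed
  finally have "B = A"
    using fn \<open>n \<noteq> 0\<close> by (intro minimal) (auto simp: B_def intro: finite_imp_compact)
  then show False using infinite_A by (metis B_def finite_imageI finite_lessThan)
qed

lemma lift_aperiodic: assumes "a \<in> K" "(g ^^ n) a = a + of_int m" shows "n = 0"
proof (rule no_periodic_points[OF pt_in[OF assms(1)]])
  show "(f ^^ n) (proj2 (pt a)) = proj2 (pt a)" using assms by (simp add: fn_pt pt_shift_int)
qed

end

section \<open>Hamiltonian flows and the lifted return map\<close>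

lemma frechet_derivative_translate:
  fixes f :: "'a::real_normed_vector \<Rightarrow> 'b::real_normed_vector"
  assumes "\<And>y. f (y + a) = f y + b"
  shows "frechet_derivative f (at (x + a)) = frechet_derivative f (at x)"
proof -
  have 1: "(f has_derivative D) (at x)" if "(f has_derivative D) (at (x + a))" for D
  proof -
    have "((\<lambda>y. y + a) has_derivative (\<lambda>v. v)) (at x)" by (auto intro!: derivative_eq_intros)
    from has_derivative_compose[OF this that] have "((\<lambda>y. f y + b) has_derivative D) (at x)" by (simp add: assms)
    then have "((\<lambda>y. f y + b - b) has_derivative (\<lambda>v. D v - 0)) (at x)"
      by (intro has_derivative_diff has_derivative_const)
    then show ?thesis by simp
  qed
  have 2: "(f has_derivative D) (at (x + a))" if "(f has_derivative D) (at x)" for D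
  proof -
    have inv: "f (y - a) = f y - b" for y using assms[of "y - a"] by simp
    have "((\<lambda>y. y - a) has_derivative (\<lambda>v. v)) (at (x + a))" by (auto intro!: derivative_eq_intros)
    moreover have "(f has_derivative D) (at (x + a - a))" using that by simp
    ultimately have "((\<lambda>y. f y - b) has_derivative D) (at (x + a))"
      using has_derivative_compose[of "\<lambda>y. y - a" "\<lambda>v. v" "x + a" UNIV f D] by (simp add: inv)
    then have "((\<lambda>y. f y - b + b) has_derivative (\<lambda>v. D v + 0)) (at (x + a))"
      by (intro has_derivative_add has_derivative_const)
    then show ?thesis by simp
  qed
  show ?thesis unfolding frechet_derivative_def using 1 2 by metis
qed


lemma has_vector_derivative_within_singleton: "(c has_vector_derivative D) (at t within {t})"
proof -
  have "\<not> t islimpt {t}" by (simp add: islimpt_finite)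
  then have "at t within {t} = bot" by (simp add: trivial_limit_within)
  then show ?thesis by (simp add: has_vector_derivative_def has_derivative_def bounded_linear_scaleR_left)
qed

lemma integral_curve_eq_solves: "integral_curve = solves"
  by (simp add: fun_eq_iff integral_curve_def solves_def)

lemma ham_vf_props:
  fixes G :: "phase_cover \<Rightarrow> real"
  assumes "(G has_derivative D) (at x)"
  shows ham_vf_eq: "ham_vf G x = (D (0,1,0,0), - D (1,0,0,0), D (0,0,0,1), - D (0,0,1,0))"
    and omega0_ham_vf: "omega0 (ham_vf G x) v = D v"
proof -
  have lin: "linear D" using assms by (rule has_derivative_linear)
  have D: "frechet_derivative G (at x) = D" using frechet_derivative_at[OF assms] by simp
  have rep: "D (a, b, c, d) = a * D (1,0,0,0) + b * D (0,1,0,0) + c * D (0,0,1,0) + d * D (0,0,0,1)" for a b c d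
  proof -
    have "(a, b, c, d) = a *\<^sub>R (1,0,0,0) + b *\<^sub>R (0,1,0,0) + c *\<^sub>R (0,0,1,0) + d *\<^sub>R ((0,0,0,1) :: phase_cover)" by simp
    then show ?thesis by (simp only: linear_add[OF lin] linear_scale[OF lin] real_scaleR_def)
  qed
  let ?X = "(D (0,1,0,0), - D (1,0,0,0), D (0,0,0,1), - D (0,0,1,0))"
  have X: "omega0 ?X v = D v" for v
  proof -
    obtain a b c d where v: "v = (a, b, c, d)" by (cases v)
    show ?thesis unfolding v by (simp add: omega0_def rep[of a b c d])
  qed
  have uniq: "Y = ?X" if "\<forall>v. omega0 Y v = D v" for Y
  proof -
    obtain a b c d where Y: "Y = (a, b, c, d)" by (cases Y)
    show ?thesis using that[THEN spec, of "(1,0,0,0)"] that[THEN spec, of "(0,1,0,0)"]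
      that[THEN spec, of "(0,0,1,0)"] that[THEN spec, of "(0,0,0,1)"] by (simp add: Y omega0_def)
  qed
  show eq: "ham_vf G x = ?X" unfolding ham_vf_def D
    by (rule the_equality) (use X uniq in auto)
  show "omega0 (ham_vf G x) v = D v" unfolding eq by (rule X)
qed

lemma ham_vf_deck:
  "ham_vf (G \<circ> proj4) (p + (of_int k, 0, of_int l, 0)) = ham_vf (G \<circ> proj4) p"
  unfolding ham_vf_def by (subst frechet_derivative_translate[where b = 0]) auto

lemma solves_translate:
  assumes "\<And>x. V (x + d) = V x" "solves V t c" shows "solves V t (\<lambda>s. c s + d)"
  using assms unfolding solves_def by (auto intro!: derivative_eq_intros)

text \<open>
  The vector field is periodic in the angles. So two integral curves whose starting points agree in
  the phase space differ by a deck transformation, and uniqueness on the cover is enough for the flow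
  downstairs to be well defined.
\<close>

lemma ham_flow_eqI:
  assumes c: "solves (ham_vf (G \<circ> proj4)) t c"
    and unique: "\<And>c'. solves (ham_vf (G \<circ> proj4)) t c' \<Longrightarrow> c' 0 = c 0 \<Longrightarrow> c' t = c t"
  shows "ham_flow G t (proj4 (c 0)) = proj4 (c t)"
  unfolding ham_flow_def integral_curve_eq_solves
proof (rule the_equality)
  fix w assume "\<exists>c'. solves (ham_vf (G \<circ> proj4)) t c' \<and> proj4 (c' 0) = proj4 (c 0) \<and> proj4 (c' t) = w"
  then obtain c' where c': "solves (ham_vf (G \<circ> proj4)) t c'" "proj4 (c' 0) = proj4 (c 0)" "proj4 (c' t) = w"
    by blast
  obtain k l :: int where kl: "c 0 = c' 0 + (of_int k, 0, of_int l, 0)" using c'(2) proj4_eq_iff by metis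
  have "solves (ham_vf (G \<circ> proj4)) t (\<lambda>s. c' s + (of_int k, 0, of_int l, 0))"
    by (rule solves_translate[OF ham_vf_deck c'(1)])
  from unique[OF this] kl have "c' t + (of_int k, 0, of_int l, 0) = c t" by simp
  then show "w = proj4 (c t)" using c'(3) by (metis proj4_deck)
qed (use c in blast)

lemma lift_flow_eqI:
  assumes c: "solves (ham_vf (G \<circ> proj4)) t c"
    and unique: "\<And>c'. solves (ham_vf (G \<circ> proj4)) t c' \<Longrightarrow> c' 0 = c 0 \<Longrightarrow> c' t = c t"
  shows "lift_flow G t (c 0) = c t"
  unfolding lift_flow_def integral_curve_eq_solves
proof (rule the_equality)
  fix y assume "\<exists>c'. solves (ham_vf (G \<circ> proj4)) t c' \<and> c' 0 = c 0 \<and> c' t = y"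
  then obtain c' where "solves (ham_vf (G \<circ> proj4)) t c'" "c' 0 = c 0" "c' t = y" by blast
  then show "y = c t" using unique[of c'] by simp
qed (use c in blast)

definition pr3 :: "phase_cover \<Rightarrow> real \<times> real \<times> real" where
  "pr3 p = (fst p, fst (snd p), fst (snd (snd p)))"

lemma bounded_linear_pr3: "bounded_linear pr3"
  unfolding pr3_def by (intro bounded_linear_intros)

locale smooth_hamiltonian =
  fixes H :: "complex \<times> real \<times> complex \<Rightarrow> real" and \<epsilon> h :: real
  assumes smooth: "Cinf (H \<circ> proj3)"
begin

abbreviation "G0 \<equiv> Hhat H \<epsilon> \<circ> proj4"
abbreviation "W \<equiv> ham_vf G0"
abbreviation "F \<equiv> ret_lift H \<epsilon> h"
abbreviation "\<Phi> \<equiv> ham_flow (Hhat H \<epsilon>)"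

definition D3 where "D3 y = frechet_derivative (H \<circ> proj3) (at y)"

lemma H_deriv: "((H \<circ> proj3) has_derivative D3 y) (at y)"
proof -
  have "Ck 1 (H \<circ> proj3)" using smooth by (simp add: Cinf_def)
  then show ?thesis unfolding D3_def using Ck_1_iff frechet_derivative_works by metis
qed

lemma D3_lipschitz: "locally_lipschitz_field (\<lambda>y. D3 y v)"
proof -
  have "Ck (Suc 1) (H \<circ> proj3)" using smooth by (simp only: Cinf_def)
  then have "Ck 1 (\<lambda>y. D3 y v)" unfolding D3_def by (simp only: Ck.simps)
  then show ?thesis by (rule Ck_1_locally_lipschitz)
qed

lemma G0_eq: "G0 = (\<lambda>p. snd (snd (snd p)) + (fst (snd p))\<^sup>2 / 2 + \<epsilon> * (H \<circ> proj3) (pr3 p))"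
  by (auto simp: fun_eq_iff Hhat_def proj4_def proj3_def pr3_def)

definition DG where
  "DG p v = snd (snd (snd v)) + fst (snd p) * fst (snd v) + \<epsilon> * D3 (pr3 p) (pr3 v)"

lemma G0_deriv: "(G0 has_derivative DG p) (at p)"
proof -
  have 1: "((\<lambda>p. (H \<circ> proj3) (pr3 p)) has_derivative (\<lambda>v. D3 (pr3 p) (pr3 v))) (at p)"
    by (rule has_derivative_compose[OF bounded_linear_imp_has_derivative[OF bounded_linear_pr3] H_deriv])
  have 2: "((\<lambda>p. snd (snd (snd p))) has_derivative (\<lambda>v. snd (snd (snd v)))) (at p)"
    "((\<lambda>p. fst (snd p)) has_derivative (\<lambda>v. fst (snd v))) (at p)" for p :: phase_cover
    by (intro bounded_linear_imp_has_derivative bounded_linear_intros)+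
  have 3: "((\<lambda>p. (fst (snd p))\<^sup>2 / 2) has_derivative (\<lambda>v. fst (snd p) * fst (snd v))) (at p)"
    by (rule has_derivative_eq_rhs, (rule derivative_intros 2)+) (auto simp: fun_eq_iff)
  have "((\<lambda>p. snd (snd (snd p)) + (fst (snd p))\<^sup>2 / 2 + \<epsilon> * (H \<circ> proj3) (pr3 p)) has_derivative
      (\<lambda>v. snd (snd (snd v)) + fst (snd p) * fst (snd v) + \<epsilon> * D3 (pr3 p) (pr3 v))) (at p)"
    by (intro has_derivative_add 2 3 has_derivative_mult_right 1)
  then show ?thesis unfolding G0_eq DG_def .
qed

lemma pr3_simps: "pr3 (a, b, c, d) = (a, b, c)" by (simp add: pr3_def)

lemma D3_zero: "D3 y (0, 0, 0) = 0"
  using linear_0[OF has_derivative_linear[OF H_deriv, of y]] by (simp add: zero_prod_def)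

lemma W_eq: "W p = (fst (snd p) + \<epsilon> * D3 (pr3 p) (0,1,0), - (\<epsilon> * D3 (pr3 p) (1,0,0)), 1, - (\<epsilon> * D3 (pr3 p) (0,0,1)))"
  unfolding ham_vf_eq[OF G0_deriv] by (simp add: DG_def pr3_simps D3_zero)

lemma W_lipschitz: "locally_lipschitz_field W"
proof -
  have e: "locally_lipschitz_field (\<lambda>p. c *\<^sub>R D3 (pr3 p) v)" for v and c :: real
    by (intro locally_lipschitz_scaleR locally_lipschitz_const
        locally_lipschitz_compose[OF D3_lipschitz locally_lipschitz_bounded_linear[OF bounded_linear_pr3]])
  have "locally_lipschitz_field (\<lambda>p::phase_cover. fst (snd p))"
    by (intro locally_lipschitz_bounded_linear bounded_linear_intros)
  then have "locally_lipschitz_field (\<lambda>p. (fst (snd p) + \<epsilon> *\<^sub>R D3 (pr3 p) (0,1,0),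
      (- \<epsilon>) *\<^sub>R D3 (pr3 p) (1,0,0), 1 :: real, (- \<epsilon>) *\<^sub>R D3 (pr3 p) (0,0,1)))"
    by (intro locally_lipschitz_Pair locally_lipschitz_add e locally_lipschitz_const)
  moreover have "W = (\<lambda>p. (fst (snd p) + \<epsilon> *\<^sub>R D3 (pr3 p) (0,1,0),
      (- \<epsilon>) *\<^sub>R D3 (pr3 p) (1,0,0), 1, (- \<epsilon>) *\<^sub>R D3 (pr3 p) (0,0,1)))"
    by (rule ext) (simp add: W_eq del: comp_apply)
  ultimately show ?thesis by simp
qed

lemma W_unique: "solves W t c \<Longrightarrow> solves W t c' \<Longrightarrow> c' 0 = c 0 \<Longrightarrow> c' t = c t"
  using solves_unique[OF W_lipschitz, of t c' c t] by auto

lemma W_deck: "W (p + (of_int k, 0, of_int l, 0)) = W p" by (rule ham_vf_deck)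

lemma DG_W: "DG p (W p) = 0"
  using omega0_ham_vf[OF G0_deriv, of p "W p"] by (cases "W p") (simp add: omega0_def)

lemma energy_conserved: assumes "solves W t c" "s \<in> closed_segment 0 t" shows "G0 (c s) = G0 (c 0)"
proof -
  have "((\<lambda>s. G0 (c s)) has_derivative (\<lambda>v. 0)) (at s within closed_segment 0 t)"
    if "s \<in> closed_segment 0 t" for s
  proof -
    have "(c has_derivative (\<lambda>v. v *\<^sub>R W (c s))) (at s within closed_segment 0 t)"
      using assms(1) that by (auto simp: solves_def has_vector_derivative_def)
    from has_derivative_compose[OF this G0_deriv]
    have "((\<lambda>s. G0 (c s)) has_derivative (\<lambda>v. DG (c s) (v *\<^sub>R W (c s)))) (at s within closed_segment 0 t)" .
    then show ?thesis by (simp add: linear_scale[OF has_derivative_linear[OF G0_deriv]] DG_W)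
  qed
  from has_derivative_zero_constant[OF convex_closed_segment this]
  obtain k where "\<And>s. s \<in> closed_segment 0 t \<Longrightarrow> G0 (c s) = k" by blast
  then show ?thesis using assms(2) by simp
qed

text \<open>
  The Hamiltonian is \<open>u\<close> plus a function of the other variables, so \<open>ds/dt = 1\<close>.
\<close>

lemma angle_advances:
  assumes "solves W t c" shows "fst (snd (snd (c t))) = fst (snd (snd (c 0))) + t"
proof -
  have "((\<lambda>s. fst (snd (snd (c s))) - s) has_derivative (\<lambda>v. 0)) (at s within closed_segment 0 t)"
    if "s \<in> closed_segment 0 t" for s
  proof -
    have "(c has_derivative (\<lambda>v. v *\<^sub>R W (c s))) (at s within closed_segment 0 t)"
      using assms that by (auto simp: solves_def has_vector_derivative_def)
    from has_derivative_diff[OF has_derivative_fst[OF has_derivative_snd[OF has_derivative_snd[OF this]]] has_derivative_ident]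
    have "((\<lambda>s. fst (snd (snd (c s))) - s) has_derivative (\<lambda>v. fst (snd (snd (v *\<^sub>R W (c s)))) - v)) (at s within closed_segment 0 t)" .
    then show ?thesis by (simp add: W_eq del: comp_apply)
  qed
  from has_derivative_zero_constant[OF convex_closed_segment this]
  obtain k where "\<And>s. s \<in> closed_segment 0 t \<Longrightarrow> fst (snd (snd (c s))) - s = k" by blast
  from this[of t] this[of 0] show ?thesis by simp
qed

lemma sect_lift_simps:
  shows G0_sect: "G0 (sect_lift H \<epsilon> h x) = h"
    and third_sect: "fst (snd (snd (sect_lift H \<epsilon> h x))) = 0"
    and proj4_sect: "proj4 (sect_lift H \<epsilon> h x) = sect H \<epsilon> h (proj2 x)"
    and sect_lift_deck: "sect_lift H \<epsilon> h (x + (of_int k, 0)) = sect_lift H \<epsilon> h x + (of_int k, 0, 0, 0)"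
    and sect_lift_first: "(fst (sect_lift H \<epsilon> h x), fst (snd (sect_lift H \<epsilon> h x))) = x"
  by (cases x; simp add: sect_lift_def Hhat_def proj4_def sect_def proj2_def)+

lemma on_section:
  assumes "G0 p = h" "fst (snd (snd p)) = of_int n"
  shows "p = sect_lift H \<epsilon> h (fst p, fst (snd p)) + (0, 0, of_int n, 0)"
proof -
  obtain a b c d where p: "p = (a, b, c, d)" by (cases p)
  have "circ c = 1" using assms(2) circ_add_int[of 0 n] by (simp add: p)
  then show ?thesis using assms by (simp add: p Hhat_def proj4_def sect_lift_def)
qed

lemma ret_lift_solution:
  assumes "solves W (of_int n) c" "c 0 = sect_lift H \<epsilon> h x"
  shows "c (of_int n) = sect_lift H \<epsilon> h (F n x) + (0, 0, of_int n, 0)"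
proof -
  have "lift_flow (Hhat H \<epsilon>) (of_int n) (c 0) = c (of_int n)"
    using lift_flow_eqI[of "Hhat H \<epsilon>" "of_int n" c] W_unique[OF assms(1)] assms(1) by blast
  then have F: "F n x = (fst (c (of_int n)), fst (snd (c (of_int n))))"
    by (simp add: ret_lift_def assms(2) case_prod_unfold)
  show ?thesis unfolding F
  proof (rule on_section)
    show "G0 (c (of_int n)) = h" using energy_conserved[OF assms(1), of "of_int n"] assms(2) G0_sect by simp
    show "fst (snd (snd (c (of_int n)))) = of_int n"
      using angle_advances[OF assms(1)] third_sect by (simp add: assms(2))
  qed
qed

lemma ret_dom_iff: "x \<in> ret_dom H \<epsilon> h n \<longleftrightarrow> (\<exists>c. solves W (of_int n) c \<and> c 0 = sect_lift H \<epsilon> h x)"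
  by (simp add: ret_dom_def lift_flow_dom_def integral_curve_eq_solves)

lemma ret_lift_add:
  assumes x: "x \<in> ret_dom H \<epsilon> h (int m)" and y: "F (int m) x \<in> ret_dom H \<epsilon> h (int n)"
  shows "x \<in> ret_dom H \<epsilon> h (int (m + n))" "F (int (m + n)) x = F (int n) (F (int m) x)"
proof -
  obtain c where c: "solves W (of_int (int m)) c" "c 0 = sect_lift H \<epsilon> h x" using x ret_dom_iff by blast
  obtain c' where c': "solves W (of_int (int n)) c'" "c' 0 = sect_lift H \<epsilon> h (F (int m) x)" using y ret_dom_iff by blast
  let ?p = "(of_int 0, 0, of_int (int m), 0) :: phase_cover"
  let ?c = "\<lambda>t. if t \<le> of_int (int m) then c t else c' (t - of_int (int m)) + ?p"
  have sol: "solves W (of_int (int m) + of_int (int n)) ?c"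
    by (rule solves_append[OF c(1) c'(1) _ _ W_deck]) (use ret_lift_solution[OF c] c'(2) in auto)
  then have sol': "solves W (of_int (int (m + n))) ?c" by simp
  have c0: "?c 0 = sect_lift H \<epsilon> h x" using c(2) by simp
  show "x \<in> ret_dom H \<epsilon> h (int (m + n))" using sol' c0 ret_dom_iff by blast
  have end1: "?c (of_int (int (m + n))) = sect_lift H \<epsilon> h (F (int (m + n)) x) + (0, 0, of_int (int (m + n)), 0)"
    by (rule ret_lift_solution[OF sol' c0])
  have end2: "?c (of_int (int (m + n))) = sect_lift H \<epsilon> h (F (int n) (F (int m) x)) + (0, 0, of_int (int n), 0) + ?p"
    using ret_lift_solution[OF c'] ret_lift_solution[OF c] c'(2) by (cases "n = 0") auto
  have "sect_lift H \<epsilon> h (F (int (m + n)) x) = sect_lift H \<epsilon> h (F (int n) (F (int m) x))"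
    using end1 unfolding end2 by (simp add: add.assoc add.commute[of "real n"])
  then show "F (int (m + n)) x = F (int n) (F (int m) x)" by (metis sect_lift_first)
qed

lemma ret_lift_0: "x \<in> ret_dom H \<epsilon> h 0" "F 0 x = x"
proof -
  have "solves W (of_int 0) (\<lambda>_. sect_lift H \<epsilon> h x)"
    by (simp add: solves_def has_vector_derivative_within_singleton)
  then show "x \<in> ret_dom H \<epsilon> h 0" using ret_dom_iff by blast
  have "solves W (of_int 0) (\<lambda>_. sect_lift H \<epsilon> h x)"
    by (simp add: solves_def has_vector_derivative_within_singleton)
  from ret_lift_solution[OF this refl]
  have "sect_lift H \<epsilon> h x = sect_lift H \<epsilon> h (F 0 x)" by (simp add: zero_prod_def[symmetric])
  then show "F 0 x = x" by (metis sect_lift_first)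
qed

text \<open>
  The solution curve, read from its end point with the angle \<open>s\<close> lowered by \<open>n\<close>, is a solution for the
  negative time.
\<close>

lemma ret_lift_minus:
  assumes "x \<in> ret_dom H \<epsilon> h (int n)"
  shows "F (- int n) (F (int n) x) = x"
proof -
  obtain c where c: "solves W (of_int (int n)) c" "c 0 = sect_lift H \<epsilon> h x" using assms ret_dom_iff by blast
  let ?c = "\<lambda>s. c (s + of_int (int n)) + (of_int 0, 0, of_int (- int n), 0)"
  have "solves W (of_int (- int n)) (\<lambda>s. c (s + of_int (int n)))"
    unfolding solves_def
  proof
    fix s assume s: "s \<in> closed_segment 0 (real_of_int (- int n))"
    have img: "(\<lambda>s. s + of_int (int n)) ` closed_segment 0 (real_of_int (- int n)) = closed_segment 0 (of_int (int n))"
      by (auto simp: closed_segment_eq_real_ivl image_iff intro!: bexI[of _ "_ - real n"])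
    have "(c has_vector_derivative W (c (s + of_int (int n)))) (at (s + of_int (int n)) within (\<lambda>s. s + of_int (int n)) ` closed_segment 0 (real_of_int (- int n)))"
      using c(1) s unfolding solves_def img by (metis (no_types, lifting) img imageI)
    moreover have "((\<lambda>s. s + of_int (int n)) has_vector_derivative 1) (at s within closed_segment 0 (real_of_int (- int n)))"
      by (auto intro!: derivative_eq_intros)
    ultimately have "((c \<circ> (\<lambda>s. s + of_int (int n))) has_vector_derivative 1 *\<^sub>R W (c (s + of_int (int n)))) (at s within closed_segment 0 (real_of_int (- int n)))"
      by (intro vector_diff_chain_within)
    then show "((\<lambda>s. c (s + of_int (int n))) has_vector_derivative W (c (s + of_int (int n)))) (at s within closed_segment 0 (real_of_int (- int n)))"
      by (simp add: o_def)
  qed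
  then have sol: "solves W (of_int (- int n)) ?c" by (intro solves_translate W_deck)
  have "?c 0 = sect_lift H \<epsilon> h (F (int n) x)" using ret_lift_solution[OF c] by (simp add: zero_prod_def)
  from ret_lift_solution[OF sol this]
  have "c 0 + (0, 0, - real n, 0) = sect_lift H \<epsilon> h (F (- int n) (F (int n) x)) + (0, 0, - real n, 0)" by simp
  then have "sect_lift H \<epsilon> h x = sect_lift H \<epsilon> h (F (- int n) (F (int n) x))" by (simp only: add_right_cancel c(2))
  then show ?thesis by (metis sect_lift_first)
qed

lemma ret_lift_deck:
  assumes "x \<in> ret_dom H \<epsilon> h n"
  shows "x + (of_int k, 0) \<in> ret_dom H \<epsilon> h n" "F n (x + (of_int k, 0)) = F n x + (of_int k, 0)"
proof -
  obtain c where c: "solves W (of_int n) c" "c 0 = sect_lift H \<epsilon> h x" using assms ret_dom_iff by blast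
  let ?c = "\<lambda>s. c s + (of_int k, 0, of_int 0, 0)"
  have sol: "solves W (of_int n) ?c" by (rule solves_translate[OF W_deck c(1)])
  have 0: "?c 0 = sect_lift H \<epsilon> h (x + (of_int k, 0))" using c(2) by (simp add: sect_lift_deck)
  show "x + (of_int k, 0) \<in> ret_dom H \<epsilon> h n" using sol 0 ret_dom_iff by blast
  have "sect_lift H \<epsilon> h (F n x) + (0, 0, of_int n, 0) + (of_int k, 0, of_int 0, 0) =
      sect_lift H \<epsilon> h (F n (x + (of_int k, 0))) + (0, 0, of_int n, 0)"
    using ret_lift_solution[OF sol 0] ret_lift_solution[OF c] by simp
  then have "sect_lift H \<epsilon> h (F n x + (of_int k, 0)) = sect_lift H \<epsilon> h (F n (x + (of_int k, 0)))"
    by (simp add: sect_lift_deck)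
  then show "F n (x + (of_int k, 0)) = F n x + (of_int k, 0)" by (metis sect_lift_first)
qed

lemma ret_proj2:
  assumes "x \<in> ret_dom H \<epsilon> h 1" shows "ret H \<epsilon> h (proj2 x) = proj2 (F 1 x)"
proof -
  obtain c where c: "solves W (of_int 1) c" "c 0 = sect_lift H \<epsilon> h x" using assms ret_dom_iff by blast
  have c1: "solves W 1 c" using c(1) by simp
  have "\<Phi> 1 (proj4 (c 0)) = proj4 (c 1)"
    using ham_flow_eqI[of "Hhat H \<epsilon>" 1 c] W_unique[OF c1] c1 by blast
  also have "c 1 = sect_lift H \<epsilon> h (F 1 x) + (of_int 0, 0, of_int 1, 0)" using ret_lift_solution[OF c] by simp
  finally have "\<Phi> 1 (sect H \<epsilon> h (proj2 x)) = sect H \<epsilon> h (proj2 (F 1 x))"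
    by (simp only: c(2) proj4_sect proj4_deck)
  then show ?thesis unfolding ret_def by (simp add: sect_def case_prod_unfold)
qed

lemma ret_lift_pow:
  assumes "\<And>i. i < n \<Longrightarrow> (F 1 ^^ i) x \<in> ret_dom H \<epsilon> h 1"
  shows "x \<in> ret_dom H \<epsilon> h (int n) \<and> F (int n) x = (F 1 ^^ n) x"
  using assms
proof (induction n)
  case 0
  then show ?case using ret_lift_0 by simp
next
  case (Suc n)
  then have IH: "x \<in> ret_dom H \<epsilon> h (int n)" "F (int n) x = (F 1 ^^ n) x" by auto
  have "F (int n) x \<in> ret_dom H \<epsilon> h (int 1)" using Suc.prems[of n] IH by simp
  from ret_lift_add[OF IH(1) this] IH show ?case by simp
qed

definition gsol :: "(real \<Rightarrow> phase_cover) \<Rightarrow> bool" where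
  "gsol c \<longleftrightarrow> (\<forall>t. (c has_vector_derivative W (c t)) (at t))"

lemma gsol_solves: "gsol c \<Longrightarrow> solves W t c"
  unfolding gsol_def solves_def by (auto intro: has_vector_derivative_at_within)

lemma gsol_shift: assumes "gsol c" shows "gsol (\<lambda>t. c (t + s))"
  unfolding gsol_def
proof
  fix t
  have "((c \<circ> (\<lambda>t. t + s)) has_vector_derivative 1 *\<^sub>R W (c (t + s))) (at t)"
    using assms unfolding gsol_def
    by (intro vector_diff_chain_at) (auto intro!: derivative_eq_intros)
  then show "((\<lambda>t. c (t + s)) has_vector_derivative W (c (t + s))) (at t)" by (simp add: o_def)
qed

lemma gsol_flow: assumes "gsol c" shows "\<Phi> t (proj4 (c s)) = proj4 (c (s + t))"
proof -
  have "\<Phi> t (proj4 (c (0 + s))) = proj4 (c (t + s))"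
  proof (rule ham_flow_eqI[where c = "\<lambda>t. c (t + s)"])
    show sol: "solves W t (\<lambda>t. c (t + s))" by (rule gsol_solves[OF gsol_shift[OF assms]])
    show "c' t = c (t + s)" if "solves W t c'" "c' 0 = c (0 + s)" for c'
      using W_unique[OF sol that(1)] that(2) by simp
  qed
  then show ?thesis by (simp add: add.commute)
qed

text \<open>
  Solutions over one return time through the points of a two-sided orbit of the return map fit
  together, because each ends on the section at the next point of the orbit.
\<close>

lemma global_solution:
  assumes E: "E \<subseteq> ret_dom H \<epsilon> h 1" and surj: "F 1 ` E = E" and x: "x \<in> E"
  obtains c where "gsol c" "c 0 = sect_lift H \<epsilon> h x"
proof -
  define g where "g = inv_into E (F 1)"
  have g: "g y \<in> E \<and> F 1 (g y) = y" if "y \<in> E" for y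
    using inv_into_into[of y "F 1" E] f_inv_into_f[of y "F 1" E] that unfolding g_def surj by blast
  define X where "X i = (if 0 \<le> i then (F 1 ^^ nat i) x else (g ^^ nat (- i)) x)" for i :: int
  have fwd: "(F 1 ^^ n) x \<in> E" and bwd: "(g ^^ n) x \<in> E" for n
    using x surj g by (induction n) auto
  have X_in: "X i \<in> E" for i using fwd bwd by (simp add: X_def)
  have X_step: "F 1 (X i) = X (i + 1)" for i
  proof -
    consider "0 \<le> i" | "i = -1" | "i < -1" by linarith
    then show ?thesis
    proof cases
      case 1 then have "nat (i + 1) = Suc (nat i)" by simp
      then show ?thesis using 1 by (simp add: X_def)
    next
      case 2 then show ?thesis using g[OF x] by (simp add: X_def)
    next
      case 3 then have "nat (- i) = Suc (nat (- (i + 1)))" by simp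
      then show ?thesis using 3 g[OF bwd] by (simp add: X_def)
    qed
  qed
  have "\<exists>c. solves W 1 c \<and> c 0 = sect_lift H \<epsilon> h (X i)" for i
    using X_in[of i] E ret_dom_iff[of "X i" 1] by (metis of_int_1 subsetD)
  then obtain C where C: "\<And>i. solves W 1 (C i)" "\<And>i. C i 0 = sect_lift H \<epsilon> h (X i)" by metis
  have C1: "C i 1 = sect_lift H \<epsilon> h (X (i + 1)) + (0, 0, 1, 0)" for i
    using ret_lift_solution[of 1 "C i" "X i"] C X_step by simp
  define P where "P i t = C i (t - of_int i) + (of_int 0, 0, of_int i, 0)" for i t
  have der: "(P i has_vector_derivative W (P i t)) (at t within {of_int i..of_int i + 1})"
    if t: "t \<in> {of_int i..of_int i + 1}" for i t
  proof -
    have "((\<lambda>s. s - of_int i) has_vector_derivative 1) (at t within {of_int i..of_int i + 1})"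
      by (auto intro!: derivative_eq_intros)
    moreover have "(\<lambda>s. s - of_int i) ` {of_int i..of_int i + 1} = {0..1::real}"
      by (auto simp: image_iff intro!: bexI[of _ "_ + of_int i"])
    moreover have "(C i has_vector_derivative W (C i (t - of_int i))) (at (t - of_int i) within {0..1})"
      using C(1)[of i] t by (auto simp: solves_def closed_segment_eq_real_ivl)
    ultimately have "((C i \<circ> (\<lambda>s. s - of_int i)) has_vector_derivative 1 *\<^sub>R W (C i (t - of_int i))) (at t within {of_int i..of_int i + 1})"
      by (intro vector_diff_chain_within) auto
    then have "((\<lambda>s. (C i \<circ> (\<lambda>s. s - of_int i)) s + (of_int 0, 0, of_int i, 0)) has_vector_derivative 1 *\<^sub>R W (C i (t - of_int i)) + 0) (at t within {of_int i..of_int i + 1})"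
      by (intro has_vector_derivative_add has_vector_derivative_const)
    moreover have "W (P i t) = W (C i (t - of_int i))" unfolding P_def by (rule W_deck)
    ultimately show ?thesis by (simp add: P_def[abs_def] o_def)
  qed
  have match: "P i (of_int i + 1) = P (i + 1) (of_int i + 1)" for i
    using C1[of i] C(2)[of "i + 1"] by (simp add: P_def)
  define c where "c t = P \<lfloor>t\<rfloor> t" for t
  have "gsol c" unfolding gsol_def c_def using glue_pieces[of P W, OF der match] by blast
  moreover have "c 0 = sect_lift H \<epsilon> h x" by (simp add: c_def P_def C(2) X_def zero_prod_def[symmetric])
  ultimately show thesis by (rule that)
qed

end

section \<open>The flow on the lamination\<close>

lemma proj2_local_lift:
  assumes "0 < e"
  obtains d where "0 < d" "\<And>a. a \<in> circle \<times> UNIV \<Longrightarrow> dist a (proj2 x) < d \<Longrightarrow> \<exists>y. proj2 y = a \<and> dist y x < e"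
proof -
  obtain \<theta> r where x: "x = (\<theta>, r)" by (cases x)
  have e: "0 < e / 2" using assms by simp
  obtain d where d: "0 < d" "\<And>z. z \<in> circle \<Longrightarrow> dist z (circ \<theta>) < d \<Longrightarrow> \<exists>y. circ y = z \<and> dist y \<theta> < e / 2"
    using circ_local_lift[OF e, of \<theta>] by blast
  show thesis
  proof (rule that[of "min d (e / 2)"])
    fix a assume a: "a \<in> circle \<times> UNIV" "dist a (proj2 x) < min d (e / 2)"
    obtain z r' where az: "a = (z, r')" by (cases a)
    have "dist z (circ \<theta>) < d" "dist r' r < e / 2"
      using a(2) dist_fst_le[of a "proj2 x"] dist_snd_le[of a "proj2 x"] by (auto simp: az x proj2_def)
    moreover obtain y where "circ y = z" "dist y \<theta> < e / 2" using d(2)[of z] calculation a(1) by (auto simp: az)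
    moreover have "dist (y, r') (\<theta>, r) \<le> dist y \<theta> + dist r' r"
      unfolding dist_Pair_Pair by (intro sqrt_sum_squares_le_sum) auto
    ultimately show "\<exists>y. proj2 y = a \<and> dist y x < e"
      by (intro exI[of _ "(y, r')"]) (auto simp: proj2_def az x)
  qed (use d e in auto)
qed

lemma proj4_local_lift:
  assumes "0 < e"
  obtains d where "0 < d" "\<And>z. z \<in> phase_space \<Longrightarrow> dist z (proj4 p) < d \<Longrightarrow> \<exists>p'. proj4 p' = z \<and> dist p' p < e"
proof -
  obtain \<theta> r s u where p: "p = (\<theta>, r, s, u)" by (cases p)
  have e: "0 < e / 4" using assms by simp
  obtain d1 where d1: "0 < d1" "\<And>z. z \<in> circle \<Longrightarrow> dist z (circ \<theta>) < d1 \<Longrightarrow> \<exists>y. circ y = z \<and> dist y \<theta> < e / 4"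
    using circ_local_lift[OF e, of \<theta>] by blast
  obtain d2 where d2: "0 < d2" "\<And>z. z \<in> circle \<Longrightarrow> dist z (circ s) < d2 \<Longrightarrow> \<exists>y. circ y = z \<and> dist y s < e / 4"
    using circ_local_lift[OF e, of s] by blast
  show thesis
  proof (rule that[of "min (min d1 d2) (e / 4)"])
    fix z assume z: "z \<in> phase_space" "dist z (proj4 p) < min (min d1 d2) (e / 4)"
    obtain a r' b u' where zz: "z = (a, r', b, u')" by (cases z)
    have "dist a (circ \<theta>) \<le> dist z (proj4 p)" "dist r' r \<le> dist z (proj4 p)" "dist b (circ s) \<le> dist z (proj4 p)" "dist u' u \<le> dist z (proj4 p)"
      using dist_fst_le[of z "proj4 p"] order_trans[OF dist_fst_le dist_snd_le[of z "proj4 p"]]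
        order_trans[OF dist_fst_le order_trans[OF dist_snd_le dist_snd_le[of z "proj4 p"]]]
        order_trans[OF dist_snd_le order_trans[OF dist_snd_le dist_snd_le[of z "proj4 p"]]]
      by (auto simp: zz p proj4_def)
    then have cl: "dist a (circ \<theta>) < d1" "dist r' r < e / 4" "dist b (circ s) < d2" "dist u' u < e / 4" using z(2) by linarith+
    obtain y1 where y1: "circ y1 = a" "dist y1 \<theta> < e / 4" using d1(2)[of a] cl z(1) by (auto simp: zz phase_space_def)
    obtain y2 where y2: "circ y2 = b" "dist y2 s < e / 4" using d2(2)[of b] cl z(1) by (auto simp: zz phase_space_def)
    have tri: "dist (v, w) (v', w') \<le> dist v v' + dist w w'" for v v' :: real and w w' :: "'b::metric_space"
      unfolding dist_Pair_Pair by (intro sqrt_sum_squares_le_sum) auto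
    have "dist (y1, r', y2, u') p < e"
      unfolding p using tri[of y1 "(r', y2, u')" \<theta> "(r, s, u)"] tri[of r' "(y2, u')" r "(s, u)"] tri[of y2 u' s u] y1 y2 cl
      by linarith
    then show "\<exists>p'. proj4 p' = z \<and> dist p' p < e"
      by (intro exI[of _ "(y1, r', y2, u')"]) (auto simp: proj4_def zz y1 y2)
  qed (use d1 d2 e in auto)
qed

lemma continuous_on_phase_space:
  fixes g :: "phase \<Rightarrow> real"
  assumes "continuous_on UNIV (g \<circ> proj4)" shows "continuous_on phase_space g"
  unfolding continuous_on_iff
proof (intro ballI allI impI)
  fix z :: phase and e :: real assume z: "z \<in> phase_space" and e: "0 < e"
  obtain p where p: "proj4 p = z"
  proof -
    obtain a r b u where zz: "z = (a, r, b, u)" by (cases z)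
    then obtain \<theta> s where "a = circ \<theta>" "b = circ s" using z circ_surj by (auto simp: phase_space_def) (metis circ_surj mem_sphere_0)
    then show thesis using that[of "(\<theta>, r, s, u)"] by (simp add: proj4_def zz)
  qed
  obtain \<eta> where \<eta>: "0 < \<eta>" "\<And>p'. dist p' p < \<eta> \<Longrightarrow> dist (g (proj4 p')) (g (proj4 p)) < e"
    using assms e unfolding continuous_on_iff by (metis UNIV_I comp_apply)
  obtain d where d: "0 < d" "\<And>z. z \<in> phase_space \<Longrightarrow> dist z (proj4 p) < d \<Longrightarrow> \<exists>p'. proj4 p' = z \<and> dist p' p < \<eta>"
    using proj4_local_lift[OF \<eta>(1), of p] by blast
  show "\<exists>d>0. \<forall>x'\<in>phase_space. dist x' z < d \<longrightarrow> dist (g x') (g z) < e"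
    using d \<eta>(2) p by (intro exI[of _ d]) metis
qed

text \<open>
  Every point of the compact set \<open>A\<close> returns to the section, and \<open>A\<close> is invariant under the return map.
\<close>

locale flow_lamination = smooth_hamiltonian +
  fixes A :: "annulus set"
  assumes A_circle: "A \<subseteq> circle \<times> UNIV" and compact_A: "compact A"
    and A_dom: "\<And>x. proj2 x \<in> A \<Longrightarrow> x \<in> ret_dom H \<epsilon> h 1"
    and ret_A: "ret H \<epsilon> h ` A = A"
begin

abbreviation "f \<equiv> ret H \<epsilon> h"
abbreviation "\<iota> \<equiv> sect H \<epsilon> h"
abbreviation "S \<equiv> lamination H \<epsilon> h A"

definition E where "E = {x. proj2 x \<in> A}"

lemma proj2_surj: assumes "a \<in> A" obtains x where "x \<in> E" "proj2 x = a"
proof -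
  obtain z r where a: "a = (z, r)" by (cases a)
  then have "z \<in> circle" using assms A_circle by blast
  then obtain \<theta> where "z = circ \<theta>" by (rule circ_surj)
  then show thesis using that[of "(\<theta>, r)"] assms a by (simp add: E_def proj2_def)
qed

lemma f_proj2: "x \<in> E \<Longrightarrow> f (proj2 x) = proj2 (F 1 x)"
  using A_dom ret_proj2 by (simp add: E_def)

lemma F_E: "F 1 ` E = E"
proof
  show "F 1 ` E \<subseteq> E"
  proof
    fix y assume "y \<in> F 1 ` E"
    then obtain x where x: "x \<in> E" "y = F 1 x" by blast
    have "f (proj2 x) \<in> A" using ret_A x(1) unfolding E_def by blast
    then show "y \<in> E" using f_proj2[OF x(1)] x(2) by (simp add: E_def)
  qed
  show "E \<subseteq> F 1 ` E"
  proof
    fix y assume y: "y \<in> E"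
    then have "proj2 y \<in> f ` A" unfolding ret_A by (simp add: E_def)
    then obtain a where a: "proj2 y = f a" "a \<in> A" by (rule imageE)
    obtain x where x: "x \<in> E" "proj2 x = a" using proj2_surj[OF a(2)] by blast
    have "proj2 (F 1 x) = proj2 y" using f_proj2[OF x(1)] x(2) a(1) by simp
    then obtain k :: int where k: "y = F 1 x + (of_int k, 0)" using proj2_eq_iff by blast
    have "x \<in> ret_dom H \<epsilon> h 1" using x A_dom by (simp add: E_def)
    then have "y = F 1 (x + (of_int k, 0))" using ret_lift_deck(2) k by simp
    moreover have "x + (of_int k, 0) \<in> E" using x by (simp add: E_def)
    ultimately show "y \<in> F 1 ` E" by blast
  qed
qed

definition sol where "sol x = (SOME c. gsol c \<and> c 0 = sect_lift H \<epsilon> h x)"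

lemma sol: assumes "x \<in> E" shows gsol_sol: "gsol (sol x)" and sol_0: "sol x 0 = sect_lift H \<epsilon> h x"
proof -
  have "\<exists>c. gsol c \<and> c 0 = sect_lift H \<epsilon> h x"
    using global_solution[OF _ F_E assms] A_dom by (metis E_def mem_Collect_eq subsetI)
  from someI_ex[OF this] show "gsol (sol x)" "sol x 0 = sect_lift H \<epsilon> h x" unfolding sol_def by auto
qed

text \<open>
  Time \<open>t\<close> along the orbit of a point of the section. This map presents the lamination as a quotient of
  \<open>A \<times> \<real>\<close>.
\<close>

definition k where "k p = \<Phi> (snd p) (\<iota> (fst p))"

lemma k_lift: "x \<in> E \<Longrightarrow> k (proj2 x, t) = proj4 (sol x t)"
  using gsol_flow[OF gsol_sol, of x t 0] by (simp add: k_def sol_0 proj4_sect)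

lemma \<Phi>_k: "a \<in> A \<Longrightarrow> \<Phi> t (k (a, s)) = k (a, s + t)"
  by (metis proj2_surj k_lift gsol_flow gsol_sol)

lemma k_0: "a \<in> A \<Longrightarrow> k (a, 0) = \<iota> a"
  by (metis proj2_surj k_lift sol_0 proj4_sect)

lemma S_eq: "S = k ` (A \<times> UNIV)"
proof -
  have "S = (\<Union>a\<in>A. \<Union>t. {\<Phi> t (\<iota> a)})" unfolding lamination_def by blast
  also have "\<dots> = k ` (A \<times> UNIV)" unfolding k_def by force
  finally show ?thesis .
qed

lemma k_1: assumes a: "a \<in> A" shows "k (a, 1) = \<iota> (f a)"
proof -
  obtain x where x: "x \<in> E" "proj2 x = a" using proj2_surj[OF a] by blast
  have "sol x 1 = sect_lift H \<epsilon> h (F 1 x) + (of_int 0, 0, of_int 1, 0)"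
    using ret_lift_solution[of 1 "sol x" x] gsol_solves[OF gsol_sol[OF x(1)], of 1] sol_0[OF x(1)] by simp
  then have "k (a, 1) = proj4 (sect_lift H \<epsilon> h (F 1 x))"
    using k_lift[OF x(1), of 1] x(2) by (simp only: proj4_deck)
  then show ?thesis using f_proj2[OF x(1)] x(2) by (simp add: proj4_sect)
qed

lemma sect_lift_lipschitz: "locally_lipschitz_field (sect_lift H \<epsilon> h)"
proof -
  have H1: "locally_lipschitz_field (H \<circ> proj3)"
    using smooth by (intro Ck_1_locally_lipschitz) (simp add: Cinf_def)
  have lin: "locally_lipschitz_field (\<lambda>x::plane. (fst x, snd x, 0::real))"
    by (intro locally_lipschitz_bounded_linear bounded_linear_intros)
  have snd: "locally_lipschitz_field (\<lambda>x::plane. snd x)" "locally_lipschitz_field (\<lambda>x::plane. fst x)"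
    by (intro locally_lipschitz_bounded_linear bounded_linear_intros)+
  have "locally_lipschitz_field (\<lambda>x. (fst x, snd x, 0 :: real,
      h + ((- 1 / 2) *\<^sub>R (snd x *\<^sub>R snd x) + (- \<epsilon>) *\<^sub>R (H \<circ> proj3) (fst x, snd x, 0))))"
    by (intro locally_lipschitz_Pair locally_lipschitz_add locally_lipschitz_scaleR locally_lipschitz_const snd
        locally_lipschitz_compose[OF H1 lin])
  moreover have "sect_lift H \<epsilon> h = (\<lambda>x. (fst x, snd x, 0 :: real,
      h + ((- 1 / 2) *\<^sub>R (snd x *\<^sub>R snd x) + (- \<epsilon>) *\<^sub>R (H \<circ> proj3) (fst x, snd x, 0))))"
    by (auto simp: fun_eq_iff sect_lift_def proj3_def power2_eq_square)
  ultimately show ?thesis by simp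
qed

text \<open>
  Lipschitz dependence of the global solutions on the base point, locally uniform in time.
\<close>

lemma sol_dependence:
  assumes x0: "x0 \<in> E" and N: "0 \<le> N"
  obtains d C where "0 < d" "0 \<le> C" "\<And>x y t. x \<in> E \<Longrightarrow> y \<in> E \<Longrightarrow> dist x x0 < d \<Longrightarrow> dist y x0 < d \<Longrightarrow>
     \<bar>t\<bar> \<le> N \<Longrightarrow> norm (sol x t - sol y t) \<le> C * norm (x - y)"
proof -
  obtain d1 C1 where 1: "0 < d1" "0 \<le> C1"
    "\<And>c1 c2 s. solves W N c1 \<Longrightarrow> solves W N c2 \<Longrightarrow> norm (c1 0 - sol x0 0) < d1 \<Longrightarrow>
           norm (c2 0 - sol x0 0) < d1 \<Longrightarrow> s \<in> closed_segment 0 N \<Longrightarrow>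
           norm (c1 s - c2 s) \<le> C1 * norm (c1 0 - c2 0)"
    using lipschitz_dependence[OF W_lipschitz gsol_solves[OF gsol_sol[OF x0], of N]] by metis
  obtain d2 C2 where 2: "0 < d2" "0 \<le> C2"
    "\<And>c1 c2 s. solves W (- N) c1 \<Longrightarrow> solves W (- N) c2 \<Longrightarrow> norm (c1 0 - sol x0 0) < d2 \<Longrightarrow>
           norm (c2 0 - sol x0 0) < d2 \<Longrightarrow> s \<in> closed_segment 0 (- N) \<Longrightarrow>
           norm (c1 s - c2 s) \<le> C2 * norm (c1 0 - c2 0)"
    using lipschitz_dependence[OF W_lipschitz gsol_solves[OF gsol_sol[OF x0], of "- N"]] by metis
  obtain L where L: "L-lipschitz_on (cball 0 (norm x0 + 1)) (sect_lift H \<epsilon> h)"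
    using sect_lift_lipschitz unfolding locally_lipschitz_field_def by blast
  have L0: "0 \<le> L" using L by (rule lipschitz_on_nonneg)
  define d where "d = min 1 (min d1 d2 / (L + 1))"
  have d: "0 < d" "d \<le> 1" "L * d < min d1 d2"
  proof -
    show "0 < d" "d \<le> 1" using 1 2 L0 by (auto simp: d_def)
    have "L * d \<le> L * (min d1 d2 / (L + 1))" using L0 by (intro mult_left_mono) (auto simp: d_def)
    moreover have "L * (m / (L + 1)) < m" if "0 < m" for m :: real using L0 that by (simp add: field_simps)
    moreover have "0 < min d1 d2" using 1(1) 2(1) by simp
    ultimately show "L * d < min d1 d2" by fastforce
  qed
  have inb: "x \<in> cball 0 (norm x0 + 1)" if "dist x x0 < d" for x
    using that d norm_triangle_sub[of x x0] by (simp add: dist_norm)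
  have lip: "norm (sol x 0 - sol y 0) \<le> L * norm (x - y)" if "x \<in> E" "y \<in> E" "dist x x0 < d" "dist y x0 < d" for x y
    using lipschitz_onD[OF L inb[OF that(3)] inb[OF that(4)]] that by (simp add: sol_0 dist_norm)
  show thesis
  proof (rule that[of d "max C1 C2 * L"])
    fix x y t assume xy: "x \<in> E" "y \<in> E" "dist x x0 < d" "dist y x0 < d" and t: "\<bar>t\<bar> \<le> N"
    have small: "norm (sol z 0 - sol x0 0) < min d1 d2" if "z \<in> E" "dist z x0 < d" for z
    proof -
      have "norm (sol z 0 - sol x0 0) \<le> L * norm (z - x0)" using that x0 d by (intro lip) auto
      also have "\<dots> \<le> L * d" using that L0 by (intro mult_left_mono) (auto simp: dist_norm)
      finally show ?thesis using d by linarith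
    qed
    have "norm (sol x t - sol y t) \<le> max C1 C2 * norm (sol x 0 - sol y 0)"
    proof (cases "0 \<le> t")
      case True
      have "norm (sol x t - sol y t) \<le> C1 * norm (sol x 0 - sol y 0)"
        by (rule 1(3)) (use xy t True small[of x] small[of y] gsol_solves gsol_sol in \<open>auto simp: closed_segment_eq_real_ivl\<close>)
      also have "\<dots> \<le> max C1 C2 * norm (sol x 0 - sol y 0)" by (intro mult_right_mono) auto
      finally show ?thesis .
    next
      case False
      have "norm (sol x t - sol y t) \<le> C2 * norm (sol x 0 - sol y 0)"
        by (rule 2(3)) (use xy t False small[of x] small[of y] gsol_solves gsol_sol in \<open>auto simp: closed_segment_eq_real_ivl\<close>)
      also have "\<dots> \<le> max C1 C2 * norm (sol x 0 - sol y 0)" by (intro mult_right_mono) auto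
      finally show ?thesis .
    qed
    also have "\<dots> \<le> max C1 C2 * (L * norm (x - y))" using lip xy 1(2) by (intro mult_left_mono) auto
    finally show "norm (sol x t - sol y t) \<le> max C1 C2 * L * norm (x - y)" by simp
  qed (use d 1 L0 in auto)
qed

lemma k_continuous: "continuous_on (A \<times> UNIV) k"
  unfolding continuous_on_iff
proof (intro ballI allI impI)
  fix p :: "annulus \<times> real" and e :: real assume p: "p \<in> A \<times> UNIV" and e: "0 < e"
  obtain a t0 where at: "p = (a, t0)" by (cases p)
  obtain x0 where x0: "x0 \<in> E" "proj2 x0 = a" using proj2_surj[of a] p at by blast
  define N where "N = \<bar>t0\<bar> + 1"
  have "isCont proj4 (sol x0 t0)" using continuous_proj4 continuous_on_eq_continuous_at[OF open_UNIV] by blast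
  then obtain e1 where e1: "0 < e1" "\<And>q. dist q (sol x0 t0) < e1 \<Longrightarrow> dist (proj4 q) (proj4 (sol x0 t0)) < e"
    using e unfolding continuous_at_eps_delta by blast
  have "isCont (sol x0) t0" using gsol_sol[OF x0(1)] unfolding gsol_def
    by (intro has_vector_derivative_continuous[of _ "W (sol x0 t0)"]) auto
  then obtain e2 where e2: "0 < e2" "\<And>t. dist t t0 < e2 \<Longrightarrow> dist (sol x0 t) (sol x0 t0) < e1 / 2"
    using e1(1) unfolding continuous_at_eps_delta by (metis half_gt_zero)
  obtain d C where d: "0 < d" "0 \<le> C" "\<And>x y t. x \<in> E \<Longrightarrow> y \<in> E \<Longrightarrow> dist x x0 < d \<Longrightarrow> dist y x0 < d \<Longrightarrow>
     \<bar>t\<bar> \<le> N \<Longrightarrow> norm (sol x t - sol y t) \<le> C * norm (x - y)"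
    using sol_dependence[OF x0(1), of N] unfolding N_def by auto
  define e3 where "e3 = min d (e1 / (2 * (C + 1)))"
  have e3: "0 < e3" "C * e3 < e1 / 2"
  proof -
    show "0 < e3" using d e1 by (simp add: e3_def)
    have "C * e3 \<le> C * (e1 / (2 * (C + 1)))" using d by (intro mult_left_mono) (auto simp: e3_def)
    also have "\<dots> < e1 / 2" using d e1 by (simp add: field_simps)
    finally show "C * e3 < e1 / 2" .
  qed
  obtain d' where d': "0 < d'" "\<And>a'. a' \<in> circle \<times> UNIV \<Longrightarrow> dist a' (proj2 x0) < d' \<Longrightarrow> \<exists>y. proj2 y = a' \<and> dist y x0 < e3"
    using proj2_local_lift[OF e3(1), of x0] by blast
  show "\<exists>d>0. \<forall>p'\<in>A \<times> UNIV. dist p' p < d \<longrightarrow> dist (k p') (k p) < e"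
  proof (intro exI[of _ "min d' (min e2 1)"] conjI ballI impI)
    fix p' assume p': "p' \<in> A \<times> UNIV" "dist p' p < min d' (min e2 1)"
    obtain a' t where at': "p' = (a', t)" by (cases p')
    have cl: "dist a' a < d'" "dist t t0 < e2" "\<bar>t - t0\<bar> < 1"
      using p'(2) dist_fst_le[of p' p] dist_snd_le[of p' p] by (auto simp: at at' dist_real_def)
    obtain y where y: "proj2 y = a'" "dist y x0 < e3" using d'(2)[of a'] cl(1) x0 p' A_circle at' by auto
    have yE: "y \<in> E" using y p' at' by (auto simp: E_def)
    have "norm (sol y t - sol x0 t) \<le> C * norm (y - x0)"
      by (rule d(3)) (use yE x0 y cl d in \<open>auto simp: e3_def N_def\<close>)
    also have "\<dots> \<le> C * e3" using y d by (intro mult_left_mono) (auto simp: dist_norm)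
    finally have "dist (sol y t) (sol x0 t) < e1 / 2" using e3 by (simp add: dist_norm)
    moreover have "dist (sol x0 t) (sol x0 t0) < e1 / 2" using e2(2) cl by simp
    ultimately have "dist (sol y t) (sol x0 t0) < e1" using dist_triangle_half_l dist_commute by metis
    then show "dist (k p') (k p) < e"
      using e1(2) k_lift[OF yE, of t] k_lift[OF x0(1), of t0] by (simp add: at at' y x0)
  qed (use d' e2 in auto)
qed

lemma \<iota>_in_S: "a \<in> A \<Longrightarrow> \<iota> a \<in> S"
  unfolding S_eq by (rule image_eqI[of _ _ "(a, 0)"]) (auto simp: k_0)

lemma k_int: "a \<in> A \<Longrightarrow> \<exists>b\<in>A. \<forall>t. k (a, of_int m + t) = k (b, t)"
proof (induction m arbitrary: a rule: int_induct[where k = 0])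
  case base
  then show ?case by (intro bexI[of _ a]) auto
next
  case (step1 i)
  then obtain b where b: "b \<in> A" "\<And>t. k (a, of_int i + t) = k (b, t)" by blast
  have fb: "f b \<in> A" using ret_A b by blast
  have "k (a, of_int (i + 1) + t) = k (f b, t)" for t
  proof -
    have "k (a, of_int (i + 1) + t) = k (b, 1 + t)" using b(2)[of "1 + t"] by (simp add: add.assoc)
    also have "\<dots> = \<Phi> t (k (b, 1))" using \<Phi>_k[OF b(1)] by simp
    also have "\<dots> = \<Phi> t (k (f b, 0))" using k_1[OF b(1)] k_0[OF fb] by simp
    also have "\<dots> = k (f b, t)" using \<Phi>_k[OF fb] by simp
    finally show ?thesis .
  qed
  then show ?case using fb by blast
next
  case (step2 i)
  then obtain b where b: "b \<in> A" "\<And>t. k (a, of_int i + t) = k (b, t)" by blast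
  obtain b' where b': "b' \<in> A" "f b' = b" using ret_A b(1) by (metis imageE)
  have "k (a, of_int (i - 1) + t) = k (b', t)" for t
  proof -
    have "k (a, of_int (i - 1) + t) = k (b, -1 + t)" using b(2)[of "-1 + t"] by (simp add: algebra_simps)
    also have "\<dots> = \<Phi> (-1 + t) (k (b, 0))" using \<Phi>_k[OF b(1)] by simp
    also have "\<dots> = \<Phi> (-1 + t) (k (b', 1))" using k_1[OF b'(1)] k_0[OF b(1)] b'(2) by simp
    also have "\<dots> = k (b', t)" using \<Phi>_k[OF b'(1)] by simp
    finally show ?thesis .
  qed
  then show ?case using b' by blast
qed

lemma S_eq_unit: "S = k ` (A \<times> {0..1})"
proof
  show "S \<subseteq> k ` (A \<times> {0..1})"
  proof
    fix z assume "z \<in> S"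
    then obtain a t where at: "a \<in> A" "z = k (a, t)" by (auto simp: S_eq)
    obtain b where b: "b \<in> A" "\<And>s. k (a, of_int \<lfloor>t\<rfloor> + s) = k (b, s)" using k_int[OF at(1)] by blast
    have "z = k (b, frac t)" using at(2) b(2)[of "frac t"] by (simp add: frac_def)
    moreover have "frac t \<in> {0..1}" using frac_lt_1[of t] by (simp add: less_imp_le)
    ultimately show "z \<in> k ` (A \<times> {0..1})" using b(1) by blast
  qed
qed (auto simp: S_eq)

lemma compact_S: "compact S"
  unfolding S_eq_unit
  by (intro compact_continuous_image continuous_on_subset[OF k_continuous] compact_Times compact_A) auto

text \<open>
  On \<open>A \<times> [0, 1]\<close> the flow is the translation of the second argument of \<open>k\<close>. Continuity passes to the
  lamination because a continuous map of a compact space onto a Hausdorff space is a quotient map.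
\<close>

lemma \<Phi>_continuous: "continuous_on (UNIV \<times> S) (\<lambda>(t, z). \<Phi> t z)"
proof -
  have bounded: "continuous_on ({-N..N} \<times> S) (\<lambda>(t, z). \<Phi> t z)" for N
  proof -
    let ?X = "{-N..N} \<times> (A \<times> {0..1::real})" and ?Y = "{-N..N} \<times> S"
    let ?m = "\<lambda>p :: real \<times> annulus \<times> real. (fst p, k (snd p))"
    have kc: "continuous_on ?X (\<lambda>p. k (snd p))"
      by (rule continuous_on_compose2[OF k_continuous]) (auto intro!: continuous_intros)
    have "quotient_map (top_of_set ?X) (top_of_set ?Y) ?m"
    proof (rule continuous_imp_quotient_map)
      show "continuous_map (top_of_set ?X) (top_of_set ?Y) ?m"
        using kc by (auto simp: S_eq_unit intro!: continuous_intros)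
      show "compact_space (top_of_set ?X)" by (simp add: compact_space_subtopology compact_Times compact_A)
      show "?m ` topspace (top_of_set ?X) = topspace (top_of_set ?Y)"
      proof -
        have "?m = map_prod id k" by (simp add: fun_eq_iff map_prod_def)
        moreover have "map_prod id k ` ?X = ?Y"
          unfolding S_eq_unit by (rule map_prod_surj_on) simp_all
        ultimately show ?thesis by (simp only: topspace_euclidean_subtopology)
      qed
    qed (simp add: Hausdorff_space_subtopology)
    moreover have "continuous_map (top_of_set ?X) euclidean ((\<lambda>(t, z). \<Phi> t z) \<circ> ?m)"
    proof -
      have "continuous_on ?X (\<lambda>p. k (fst (snd p), snd (snd p) + fst p))"
        by (rule continuous_on_compose2[OF k_continuous]) (auto intro!: continuous_intros)
      moreover have "((\<lambda>(t, z). \<Phi> t z) \<circ> ?m) p = k (fst (snd p), snd (snd p) + fst p)" if "p \<in> ?X" for p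
        using that \<Phi>_k by (auto simp: case_prod_unfold)
      ultimately show ?thesis by (simp cong: continuous_on_cong)
    qed
    ultimately have "continuous_map (top_of_set ?Y) euclidean (\<lambda>(t, z). \<Phi> t z)"
      by (rule continuous_compose_quotient_map)
    then show ?thesis by simp
  qed
  show ?thesis unfolding continuous_on_iff
  proof (intro ballI allI impI)
    fix p :: "real \<times> phase" and e :: real assume p: "p \<in> UNIV \<times> S" and e: "0 < e"
    define N where "N = \<bar>fst p\<bar> + 1"
    have "p \<in> {-N..N} \<times> S" using p by (cases p) (auto simp: N_def)
    then obtain d where d: "0 < d" "\<And>p'. p' \<in> {-N..N} \<times> S \<Longrightarrow> dist p' p < d \<Longrightarrow> dist (case p' of (t, z) \<Rightarrow> \<Phi> t z) (case p of (t, z) \<Rightarrow> \<Phi> t z) < e"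
      using bounded[of N] e unfolding continuous_on_iff by meson
    show "\<exists>d>0. \<forall>p'\<in>UNIV \<times> S. dist p' p < d \<longrightarrow> dist (case p' of (t, z) \<Rightarrow> \<Phi> t z) (case p of (t, z) \<Rightarrow> \<Phi> t z) < e"
    proof (intro exI[of _ "min d 1"] conjI ballI impI)
      fix p' assume p': "p' \<in> UNIV \<times> S" "dist p' p < min d 1"
      have "\<bar>fst p' - fst p\<bar> < 1" using dist_fst_le[of p' p] p'(2) by (simp add: dist_real_def)
      then have "p' \<in> {-N..N} \<times> S" using p'(1) by (cases p') (auto simp: N_def)
      then show "dist (case p' of (t, z) \<Rightarrow> \<Phi> t z) (case p of (t, z) \<Rightarrow> \<Phi> t z) < e" using d(2) p'(2) by simp
    qed (use d in auto)
  qed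
qed

sublocale compact_flow S \<Phi>
proof
  show "compact S" by (rule compact_S)
  show "continuous_on (UNIV \<times> S) (\<lambda>(t, z). \<Phi> t z)" by (rule \<Phi>_continuous)
  fix t z assume z: "z \<in> S"
  then obtain a s where a: "a \<in> A" "z = k (a, s)" by (auto simp: S_eq)
  show "\<Phi> t z \<in> S" using a \<Phi>_k by (auto simp: S_eq)
  show "\<Phi> 0 z = z" using a \<Phi>_k by simp
  show "\<Phi> (s' + t) z = \<Phi> s' (\<Phi> t z)" for s' using a \<Phi>_k by (simp add: add_ac)
qed

lemma \<iota>_inj: "inj_on \<iota> A"
  by (auto simp: inj_on_def sect_def)

lemma \<iota>_continuous: "continuous_on A \<iota>"
proof -
  have "continuous_on A (\<lambda>a. k (a, 0))"
    by (rule continuous_on_compose2[OF k_continuous]) (auto intro!: continuous_intros)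
  then show ?thesis using k_0 by (simp cong: continuous_on_cong)
qed

lemma \<iota>_return: assumes "a \<in> A" "b \<in> A" "\<Phi> t (\<iota> a) = \<iota> b" shows "t \<in> \<int>"
proof -
  obtain x where x: "x \<in> E" "proj2 x = a" using proj2_surj[OF assms(1)] by blast
  have "proj4 (sol x t) = \<iota> b" using k_lift[OF x(1), of t] x(2) assms(3) by (simp add: k_def)
  moreover have "fst (snd (snd (sol x t))) = t"
    using angle_advances[OF gsol_solves[OF gsol_sol[OF x(1)]], of t] sol_0[OF x(1)] third_sect by simp
  ultimately have "circ t = circ 0" by (cases "sol x t"; cases b) (auto simp: proj4_def sect_def)
  then obtain k :: int where "t = of_int k" using circ_eq_iff[of 0 t] by auto
  then show ?thesis by simp
qed

lemma suspension: "C0_conjugate (top_of_set S) \<Phi> (suspension_space A f) suspension_flow"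
proof (rule suspension_conjugate[OF compact_A ret_A \<iota>_continuous \<iota>_inj])
  show "\<Phi> 1 (\<iota> a) = \<iota> (f a)" if "a \<in> A" for a using k_1[OF that] by (simp add: k_def)
  show "\<exists>t a. a \<in> A \<and> z = \<Phi> t (\<iota> a)" if "z \<in> S" for z using that unfolding lamination_def by blast
qed (use \<iota>_return \<iota>_in_S in auto)

end

section \<open>The reparametrized flow\<close>

text \<open>
  In this locale \<open>W'\<close> denotes the Hamiltonian vector field of the reparametrized Hamiltonian on the
  cover. It is continuous, but off the energy surface it involves the derivative of \<open>\<phi>\<close> and may fail
  to be Lipschitz.
\<close>

locale reparametrized_lamination = flow_lamination +
  fixes \<phi> :: "phase \<Rightarrow> real"
  assumes \<phi>_pos: "\<And>z. z \<in> phase_space \<Longrightarrow> 0 < \<phi> z" and \<phi>_C1: "Ck 1 (\<phi> \<circ> proj4)"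
begin

abbreviation "\<Phi>' \<equiv> ham_flow (Hhat_reparam H \<epsilon> h \<phi>)"
abbreviation "W' \<equiv> ham_vf (Hhat_reparam H \<epsilon> h \<phi> \<circ> proj4)"
abbreviation "W\<phi> \<equiv> ham_vf (\<phi> \<circ> proj4)"

lemma \<phi>_proj4_pos: "0 < \<phi> (proj4 p)"
  using \<phi>_pos proj4_in_phase_space by blast

lemma \<phi>_lipschitz: "locally_lipschitz_field (\<lambda>p. \<phi> (proj4 p))"
  using Ck_1_locally_lipschitz[OF \<phi>_C1] by (simp add: o_def)

lemma inverse_\<phi>_lipschitz: "locally_lipschitz_field (\<lambda>p. 1 / \<phi> (proj4 p))"
  by (rule locally_lipschitz_inverse[OF \<phi>_lipschitz \<phi>_proj4_pos])

lemma S_phase_space: "S \<subseteq> phase_space"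
proof
  fix z assume "z \<in> S"
  then obtain a t where "a \<in> A" "z = k (a, t)" by (auto simp: S_eq)
  moreover obtain x where "x \<in> E" "proj2 x = a" using proj2_surj[OF calculation(1)] by blast
  ultimately show "z \<in> phase_space" using k_lift proj4_in_phase_space by metis
qed

sublocale time_change S \<Phi> "\<lambda>z. 1 / \<phi> z"
proof
  have "continuous_on UNIV ((\<lambda>z. 1 / \<phi> z) \<circ> proj4)"
    using locally_lipschitz_continuous[OF inverse_\<phi>_lipschitz] by (simp add: o_def)
  from continuous_on_subset[OF continuous_on_phase_space[OF this] S_phase_space]
  show "continuous_on S (\<lambda>z. 1 / \<phi> z)" .
  show "0 < 1 / \<phi> z" if "z \<in> S" for z using \<phi>_pos[of z] subsetD[OF S_phase_space that] by simp
qed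

definition D\<phi> where "D\<phi> p = frechet_derivative (\<phi> \<circ> proj4) (at p)"

lemma \<phi>_deriv: "((\<phi> \<circ> proj4) has_derivative D\<phi> p) (at p)"
  using \<phi>_C1 Ck_1_iff frechet_derivative_works unfolding D\<phi>_def by metis

lemma W\<phi>_continuous: "continuous_on UNIV W\<phi>"
proof -
  have c: "continuous_on UNIV (\<lambda>p. D\<phi> p v)" for v using \<phi>_C1 Ck_1_iff unfolding D\<phi>_def by metis
  have "W\<phi> = (\<lambda>p. (D\<phi> p (0,1,0,0), - D\<phi> p (1,0,0,0), D\<phi> p (0,0,0,1), - D\<phi> p (0,0,1,0)))"
    using ham_vf_eq[OF \<phi>_deriv] by (rule ext)
  then show ?thesis by (simp add: c continuous_intros)
qed

lemma W'_eq: "W' p = \<phi> (proj4 p) *\<^sub>R W p + (G0 p - h) *\<^sub>R W\<phi> p"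
proof -
  have "((\<lambda>p. (\<phi> \<circ> proj4) p * (G0 p - h)) has_derivative
      (\<lambda>v. (\<phi> \<circ> proj4) p * (DG p v - 0) + D\<phi> p v * (G0 p - h))) (at p)"
    by (intro has_derivative_mult \<phi>_deriv has_derivative_diff G0_deriv has_derivative_const)
  moreover have "Hhat_reparam H \<epsilon> h \<phi> \<circ> proj4 = (\<lambda>p. (\<phi> \<circ> proj4) p * (G0 p - h))"
    by (simp add: fun_eq_iff Hhat_reparam_def)
  ultimately have der: "((Hhat_reparam H \<epsilon> h \<phi> \<circ> proj4) has_derivative
      (\<lambda>v. (\<phi> \<circ> proj4) p * (DG p v - 0) + D\<phi> p v * (G0 p - h))) (at p)" by simp
  show ?thesis
    unfolding ham_vf_eq[OF der] ham_vf_eq[OF \<phi>_deriv] ham_vf_eq[OF G0_deriv]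
    by (simp add: algebra_simps)
qed

text \<open>
  Along an integral curve of \<open>W'\<close> the deviation \<open>G0 - h\<close> of the energy satisfies a linear differential
  equation with a continuous coefficient, so it stays zero.
\<close>

lemma energy_surface_invariant:
  assumes c: "solves W' t c" and c0: "G0 (c 0) = h" and s: "s \<in> closed_segment 0 t"
  shows "G0 (c s) = h"
proof -
  define I where "I = closed_segment 0 t"
  define \<kappa> where "\<kappa> s = omega0 (W (c s)) (W\<phi> (c s))" for s
  have cont_c: "continuous_on I c" unfolding I_def by (rule solves_continuous[OF c])
  have "continuous_on I (\<lambda>s. W (c s))" "continuous_on I (\<lambda>s. W\<phi> (c s))"
    using continuous_on_compose2[OF locally_lipschitz_continuous[OF W_lipschitz] cont_c]
      continuous_on_compose2[OF W\<phi>_continuous cont_c] by auto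
  then have "continuous_on I \<kappa>"
    unfolding \<kappa>_def omega0_def case_prod_unfold by (intro continuous_intros)
  moreover obtain a b where I: "I = {a..b}" unfolding I_def closed_segment_eq_real_ivl by metis
  ultimately obtain g where g: "\<And>x. x \<in> I \<Longrightarrow> (g has_vector_derivative \<kappa> x) (at x within I)"
    using antiderivative_continuous[of a b \<kappa>] by metis
  have e_der: "((\<lambda>s. G0 (c s) - h) has_real_derivative (G0 (c s) - h) * \<kappa> s) (at s within I)" if s: "s \<in> I" for s
  proof -
    have "(c has_derivative (\<lambda>v. v *\<^sub>R W' (c s))) (at s within I)"
      using c s by (auto simp: I_def solves_def has_vector_derivative_def)
    from has_derivative_compose[OF this G0_deriv]
    have 1: "((\<lambda>s. G0 (c s)) has_derivative (\<lambda>v. DG (c s) (v *\<^sub>R W' (c s)))) (at s within I)" .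
    have lin: "linear (DG (c s))" using G0_deriv has_derivative_linear by blast
    have 2: "DG (c s) (v *\<^sub>R W' (c s)) = v * ((G0 (c s) - h) * \<kappa> s)" for v
      unfolding W'_eq \<kappa>_def omega0_ham_vf[OF G0_deriv]
      by (simp only: linear_add[OF lin] linear_scale[OF lin] DG_W) simp
    have "((\<lambda>s. G0 (c s) - h) has_derivative (\<lambda>v. v * ((G0 (c s) - h) * \<kappa> s) - 0)) (at s within I)"
      using 1 unfolding 2 by (intro has_derivative_diff has_derivative_const)
    moreover have "(\<lambda>v. v * ((G0 (c s) - h) * \<kappa> s) - 0) = (*) ((G0 (c s) - h) * \<kappa> s)"
      by (simp add: fun_eq_iff)
    ultimately show ?thesis unfolding has_field_derivative_def by simp
  qed
  \<comment> \<open>\<open>exp (- g)\<close> is an integrating factor\<close>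
  have "((\<lambda>s. (G0 (c s) - h) * exp (- g s)) has_derivative (\<lambda>v. 0)) (at s within I)" if s: "s \<in> I" for s
  proof -
    have "(g has_real_derivative \<kappa> s) (at s within I)"
      using g[OF s] by (simp add: has_real_derivative_iff_has_vector_derivative)
    then have "((\<lambda>s. exp (- g s)) has_real_derivative exp (- g s) * (- \<kappa> s)) (at s within I)"
      by (auto intro!: derivative_eq_intros)
    from DERIV_mult[OF e_der[OF s] this]
    have "((\<lambda>s. (G0 (c s) - h) * exp (- g s)) has_real_derivative
       ((G0 (c s) - h) * \<kappa> s) * exp (- g s) + exp (- g s) * (- \<kappa> s) * (G0 (c s) - h)) (at s within I)"
      .
    then have "((\<lambda>s. (G0 (c s) - h) * exp (- g s)) has_real_derivative 0) (at s within I)"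
      by (simp add: algebra_simps)
    moreover have "(*) (0::real) = (\<lambda>v. 0)" by (simp add: fun_eq_iff)
    ultimately show ?thesis by (simp only: has_field_derivative_def)
  qed
  then obtain m where "\<And>s. s \<in> I \<Longrightarrow> (G0 (c s) - h) * exp (- g s) = m"
    using has_derivative_zero_constant[of I "\<lambda>s. (G0 (c s) - h) * exp (- g s)"] unfolding I_def by blast
  from this[of s] this[of 0] show ?thesis using s c0 by (simp add: I_def)
qed

text \<open>
  On the energy surface \<open>W'\<close> is \<open>\<phi>\<close> times \<open>W\<close>, which is locally Lipschitz.
\<close>

lemma W'_unique:
  assumes c: "solves W' t c" "solves W' t c'" "c' 0 = c 0" and c0: "G0 (c 0) = h"
  shows "c' t = c t"
proof -
  let ?V = "\<lambda>p. \<phi> (proj4 p) *\<^sub>R W p"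
  have V: "locally_lipschitz_field ?V" by (intro locally_lipschitz_scaleR \<phi>_lipschitz W_lipschitz)
  have sol: "solves ?V t d" if "solves W' t d" "G0 (d 0) = h" for d
    using that(1) energy_surface_invariant[OF that] unfolding solves_def by (simp add: W'_eq)
  show ?thesis using solves_unique[OF V sol[OF c(2)] sol[OF c(1) c0]] c(3) c0 by simp
qed

lemma J_inverse_deriv:
  assumes z: "z \<in> S"
  obtains \<sigma> where "\<And>s. \<sigma> (J z s) = s" "\<And>\<tau>. (\<sigma> has_real_derivative \<phi> (\<Phi> (\<sigma> \<tau>) z)) (at \<tau>)"
proof -
  have inj: "inj (J z)" unfolding inj_def using J_strict_mono[OF z] by (metis less_irrefl linorder_neqE)
  define \<sigma> where "\<sigma> = inv (J z)"
  have \<sigma>: "\<sigma> (J z s) = s" for s unfolding \<sigma>_def using inj by simp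
  show thesis
  proof (rule that[OF \<sigma>])
    fix \<tau>
    obtain s where s: "J z s = \<tau>" by (rule J_surj[OF z])
    have "isCont (J z) y" for y using J_deriv[OF z] by (rule DERIV_isCont)
    then have "isCont \<sigma> (J z s)" by (intro isCont_inverse_function[of 1 s \<sigma> "J z"] \<sigma>) auto
    moreover have "1 / \<phi> (\<Phi> s z) \<noteq> 0" using q_pos[OF flow_in[OF z], of s] by simp
    moreover have "J z (\<sigma> y) = y" for y using J_surj[OF z, of y] \<sigma> by metis
    ultimately have "(\<sigma> has_real_derivative inverse (1 / \<phi> (\<Phi> s z))) (at (J z s))"
      using DERIV_inverse_function[where f = "J z" and g = \<sigma> and x = "J z s" and D = "1 / \<phi> (\<Phi> s z)"
          and a = "J z s - 1" and b = "J z s + 1"]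
        J_deriv[OF z, of s] \<sigma>[of s] by simp
    then show "(\<sigma> has_real_derivative \<phi> (\<Phi> (\<sigma> \<tau>) z)) (at \<tau>)" using \<sigma>[of s] s by simp
  qed
qed

text \<open>
  If \<open>c\<close> is an orbit of the original flow and \<open>\<sigma>\<close> the inverse function of \<open>J z\<close>, then \<open>c \<circ> \<sigma>\<close> is an
  integral curve of \<open>W'\<close>, since \<open>\<sigma>' = \<phi>\<close> along the orbit.
\<close>

lemma reparametrized_flow: assumes z: "z \<in> S" shows "\<Phi>' (J z s) z = \<Phi> s z"
proof -
  obtain a t where a: "a \<in> A" "z = k (a, t)" using z by (auto simp: S_eq)
  obtain x where x: "x \<in> E" "proj2 x = a" using proj2_surj[OF a(1)] by blast
  define c where "c s = sol x (s + t)" for s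
  have c: "gsol c" unfolding c_def by (rule gsol_shift[OF gsol_sol[OF x(1)]])
  have zc: "z = proj4 (c 0)" using k_lift[OF x(1), of t] x(2) a(2) by (simp add: c_def)
  have flow: "\<Phi> s z = proj4 (c s)" for s using gsol_flow[OF c, of s 0] zc by simp
  have energy: "G0 (c s) = h" for s
    using energy_conserved[OF gsol_solves[OF gsol_sol[OF x(1)]], of "s + t" "s + t"] sol_0[OF x(1)] G0_sect
    by (simp add: c_def)
  obtain \<sigma> where \<sigma>: "\<And>s. \<sigma> (J z s) = s" "\<And>\<tau>. (\<sigma> has_real_derivative \<phi> (\<Phi> (\<sigma> \<tau>) z)) (at \<tau>)"
    using J_inverse_deriv[OF z] by metis
  have der: "((\<lambda>\<tau>. c (\<sigma> \<tau>)) has_vector_derivative W' (c (\<sigma> \<tau>))) (at \<tau>)" for \<tau>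
  proof -
    have "(c has_vector_derivative W (c (\<sigma> \<tau>))) (at (\<sigma> \<tau>))" using c unfolding gsol_def by blast
    moreover have "(\<sigma> has_vector_derivative \<phi> (\<Phi> (\<sigma> \<tau>) z)) (at \<tau>)"
      using \<sigma>(2) by (simp add: has_real_derivative_iff_has_vector_derivative)
    ultimately have "((c \<circ> \<sigma>) has_vector_derivative \<phi> (\<Phi> (\<sigma> \<tau>) z) *\<^sub>R W (c (\<sigma> \<tau>))) (at \<tau>)"
      by (intro vector_diff_chain_at)
    moreover have "W' (c (\<sigma> \<tau>)) = \<phi> (\<Phi> (\<sigma> \<tau>) z) *\<^sub>R W (c (\<sigma> \<tau>))"
      unfolding W'_eq by (simp add: flow energy[unfolded comp_def])
    ultimately show ?thesis by (simp add: comp_def)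
  qed
  then have sol': "solves W' t (\<lambda>\<tau>. c (\<sigma> \<tau>))" for t
    unfolding solves_def by (meson has_vector_derivative_at_within)
  have \<sigma>0: "\<sigma> 0 = 0" using \<sigma>(1)[of 0] J_0[OF z] by simp
  have "\<Phi>' (J z s) (proj4 (c (\<sigma> 0))) = proj4 (c (\<sigma> (J z s)))"
  proof (rule ham_flow_eqI[OF sol'])
    show "c' (J z s) = c (\<sigma> (J z s))" if "solves W' (J z s) c'" "c' 0 = c (\<sigma> 0)" for c'
      by (rule W'_unique[OF sol' that]) (rule energy)
  qed
  then show ?thesis using \<sigma>(1) \<sigma>0 zc flow by simp
qed

lemma J_locally_lipschitz:
  assumes x0: "x0 \<in> E"
  obtains d C where "0 < d" "0 \<le> C" "\<And>x y. x \<in> E \<Longrightarrow> y \<in> E \<Longrightarrow> dist x x0 < d \<Longrightarrow> dist y x0 < d \<Longrightarrow>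
     \<bar>J (\<iota> (proj2 x)) 1 - J (\<iota> (proj2 y)) 1\<bar> \<le> C * norm (x - y)"
proof -
  obtain d C where d: "0 < d" "0 \<le> C" "\<And>x y t. x \<in> E \<Longrightarrow> y \<in> E \<Longrightarrow> dist x x0 < d \<Longrightarrow> dist y x0 < d \<Longrightarrow>
     \<bar>t\<bar> \<le> 1 \<Longrightarrow> norm (sol x t - sol y t) \<le> C * norm (x - y)"
    using sol_dependence[OF x0, of 1] by auto
  have "continuous_on {0..1} (sol x0)"
    using gsol_sol[OF x0] unfolding gsol_def
    by (meson continuous_at_imp_continuous_on has_vector_derivative_continuous)
  then have "bounded (sol x0 ` {0..1})" by (intro compact_imp_bounded compact_continuous_image) auto
  then obtain B where B: "\<And>t. t \<in> {0..1} \<Longrightarrow> norm (sol x0 t) \<le> B" unfolding bounded_iff by blast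
  obtain L where L: "L-lipschitz_on (cball 0 (B + C * d)) (\<lambda>p. 1 / \<phi> (proj4 p))"
    using inverse_\<phi>_lipschitz unfolding locally_lipschitz_field_def by blast
  have L0: "0 \<le> L" using L by (rule lipschitz_on_nonneg)
  have inb: "sol x t \<in> cball 0 (B + C * d)" if "x \<in> E" "dist x x0 < d" "t \<in> {0..1}" for x t
  proof -
    have "norm (sol x t - sol x0 t) \<le> C * norm (x - x0)" by (rule d(3)) (use that x0 d in auto)
    also have "\<dots> \<le> C * d" using that d by (intro mult_left_mono) (auto simp: dist_norm)
    finally show ?thesis using norm_triangle_sub[of "sol x t" "sol x0 t"] B[OF that(3)] by simp
  qed
  have fl: "\<Phi> t (\<iota> (proj2 x)) = proj4 (sol x t)" if "x \<in> E" for x t using k_lift[OF that, of t] by (simp add: k_def)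
  show thesis
  proof (rule that[of d "L * C"])
    fix x y assume xy: "x \<in> E" "y \<in> E" "dist x x0 < d" "dist y x0 < d"
    let ?x = "\<iota> (proj2 x)" and ?y = "\<iota> (proj2 y)"
    have in_S: "?x \<in> S" "?y \<in> S" using xy \<iota>_in_S by (auto simp: E_def)
    have "norm ((J ?x 1 - J ?y 1) - (J ?x 0 - J ?y 0)) \<le> (L * C * norm (x - y)) * norm (1 - 0 :: real)"
    proof (rule field_differentiable_bound[of "{0..1}" "\<lambda>s. J ?x s - J ?y s" "\<lambda>s. 1 / \<phi> (\<Phi> s ?x) - 1 / \<phi> (\<Phi> s ?y)"])
      fix s :: real assume s: "s \<in> {0..1}"
      show "((\<lambda>s. J ?x s - J ?y s) has_field_derivative 1 / \<phi> (\<Phi> s ?x) - 1 / \<phi> (\<Phi> s ?y)) (at s within {0..1})"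
        using J_deriv[OF in_S(1)] J_deriv[OF in_S(2)] by (intro DERIV_subset[OF DERIV_diff]) auto
      have "dist (1 / \<phi> (proj4 (sol x s))) (1 / \<phi> (proj4 (sol y s))) \<le> L * dist (sol x s) (sol y s)"
        by (rule lipschitz_onD[OF L]) (use inb xy s in auto)
      also have "\<dots> \<le> L * (C * norm (x - y))"
        using d(3)[OF xy, of s] s L0 by (intro mult_left_mono) (auto simp: dist_norm)
      finally show "norm (1 / \<phi> (\<Phi> s ?x) - 1 / \<phi> (\<Phi> s ?y)) \<le> L * C * norm (x - y)"
        by (simp add: fl xy dist_real_def)
    qed auto
    then show "\<bar>J ?x 1 - J ?y 1\<bar> \<le> L * C * norm (x - y)" by (simp add: J_0 in_S)
  qed (use d L0 in auto)
qed

end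

section \<open>The twist map along the Aubry-Mather set\<close>

lemma det2_nondegenerate: assumes "\<And>w. det2 v w = 0" shows "v = 0"
  using assms[of "(1, 0)"] assms[of "(0, 1)"] by (cases v) (simp add: det2_def zero_prod_def)

locale twist_lamination = flow_lamination H \<epsilon> h A + OC: ordered_cantor_set A "ret H \<epsilon> h"
  for H \<epsilon> h A +
  fixes R :: real
  assumes R_pos: "0 < R" and twist: "monotone_twist R (ret_lift H \<epsilon> h) (ret_dom H \<epsilon> h)"
    and A_strip: "A \<subseteq> circle \<times> {- R / 2..R / 2}"
begin

abbreviation "DF x \<equiv> frechet_derivative (F 1) (at x)"

lemma twist_facts:
  shows strip_dom: "\<bar>snd x\<bar> \<le> R \<Longrightarrow> x \<in> ret_dom H \<epsilon> h 1"
    and F_deriv: "\<bar>snd x\<bar> \<le> R \<Longrightarrow> (F 1 has_derivative DF x) (at x)"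
    and DF_continuous: "continuous_on {x. \<bar>snd x\<bar> \<le> R} (\<lambda>x. DF x v)"
    and DF_det: "\<bar>snd x\<bar> \<le> R \<Longrightarrow> det2 (DF x v) (DF x w) = det2 v w"
    and DF_twist: "\<bar>snd x\<bar> \<le> R \<Longrightarrow> 0 < fst (DF x (0, 1))"
  using twist unfolding monotone_twist_def Let_def frechet_derivative_works by blast+

lemma E_strip: "x \<in> E \<Longrightarrow> \<bar>snd x\<bar> \<le> R / 2"
proof -
  assume "x \<in> E"
  then have "proj2 x \<in> circle \<times> {- R / 2..R / 2}" using A_strip unfolding E_def by blast
  then show ?thesis by (cases x) (auto simp: proj2_def abs_le_iff)
qed

lemma pt_E: "x \<in> OC.K \<Longrightarrow> OC.pt x \<in> E" using OC.pt_in by (simp add: E_def)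

lemma DF_deck: assumes "\<bar>snd x\<bar> < R" shows "DF (x + (of_int j, 0)) = DF x"
proof -
  let ?a = "(of_int j, 0) :: plane"
  have "((\<lambda>y. y - ?a) has_derivative (\<lambda>v. v)) (at (x + ?a))" by (auto intro!: derivative_eq_intros)
  moreover have "(F 1 has_derivative DF x) (at (x + ?a - ?a))" using F_deriv assms by simp
  ultimately have "((\<lambda>y. F 1 (y - ?a)) has_derivative DF x) (at (x + ?a))"
    by (rule has_derivative_compose)
  then have "((\<lambda>y. F 1 (y - ?a) + ?a) has_derivative (\<lambda>v. DF x v + 0)) (at (x + ?a))"
    by (intro has_derivative_add has_derivative_const)
  then have 1: "((\<lambda>y. F 1 (y - ?a) + ?a) has_derivative DF x) (at (x + ?a))" by simp
  have "(F 1 has_derivative DF x) (at (x + ?a))"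
  proof (rule has_derivative_transform_within_open[OF 1])
    show "open {y::plane. \<bar>snd y\<bar> < R}" by (intro open_Collect_less continuous_intros)
    show "F 1 (y - ?a) + ?a = F 1 y" if "y \<in> {y. \<bar>snd y\<bar> < R}" for y
      using ret_lift_deck(2)[of "y - ?a" 1 j] strip_dom[of "y - ?a"] that by simp
  qed (use assms in simp)
  then show ?thesis using frechet_derivative_at by metis
qed

lemma F_pt: assumes "x \<in> OC.K" shows "\<exists>k::int. F 1 (OC.pt x) = OC.pt (OC.g x) + (of_int k, 0)"
proof -
  have "proj2 (OC.pt (OC.g x)) = proj2 (F 1 (OC.pt x))" using OC.f_pt[OF assms] f_proj2[OF pt_E[OF assms]] by simp
  then show ?thesis by (simp add: proj2_eq_iff)
qed

lemma F_continuous: "continuous_on {x. \<bar>snd x\<bar> \<le> R} (F 1)"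
  by (intro continuous_at_imp_continuous_on ballI) (use F_deriv has_derivative_continuous in blast)

text \<open>
  The lifts \<open>F 1\<close> and \<open>g\<close> differ by an integer at each point, and by uniform continuity this integer is
  the same at nearby points.
\<close>

lemma increments_agree:
  obtains d where "0 < d" "\<And>x y. x \<in> OC.K \<Longrightarrow> y \<in> OC.K \<Longrightarrow> \<bar>y - x\<bar> < d \<Longrightarrow>
    F 1 (OC.pt y) - F 1 (OC.pt x) = OC.pt (OC.g y) - OC.pt (OC.g x)"
proof -
  have half: "0 < (1 / 2 :: real)" by simp
  have strip: "OC.pt x \<in> {x. \<bar>snd x\<bar> \<le> R}" if "x \<in> OC.K" for x
    using E_strip[OF pt_E[OF that]] R_pos by simp
  have cont: "continuous_on OC.K (\<lambda>x. F 1 (OC.pt x))"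
    by (rule continuous_on_compose2[OF F_continuous OC.pt_continuous]) (use strip in blast)
  have shift: "F 1 (OC.pt (x + of_int m)) = F 1 (OC.pt x) + (of_int m, 0)" if "x \<in> OC.K" for x m
    using ret_lift_deck(2)[OF strip_dom, of "OC.pt x" m] strip[OF that] by (simp add: OC.pt_shift_int)
  obtain d1 where d1: "0 < d1" "\<And>x y. x \<in> OC.K \<Longrightarrow> y \<in> OC.K \<Longrightarrow> \<bar>y - x\<bar> < d1 \<Longrightarrow> dist (F 1 (OC.pt y)) (F 1 (OC.pt x)) < 1 / 2"
    by (rule OC.uniformly_continuous_on_K[OF cont _ half]) (simp add: shift dist_norm, blast)
  obtain d2 where d2: "0 < d2" "\<forall>x\<in>OC.K. \<forall>y\<in>OC.K. \<bar>y - x\<bar> < d2 \<longrightarrow> \<bar>(OC.g ^^ 1) y - (OC.g ^^ 1) x\<bar> < 1 / 2"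
    using OC.gn_uniformly_continuous[OF half, of 1] by blast
  show thesis
  proof (rule that[of "min d1 d2"])
    fix x y assume xy: "x \<in> OC.K" "y \<in> OC.K" "\<bar>y - x\<bar> < min d1 d2"
    obtain k l :: int where k: "F 1 (OC.pt x) = OC.pt (OC.g x) + (of_int k, 0)" and l: "F 1 (OC.pt y) = OC.pt (OC.g y) + (of_int l, 0)"
      using F_pt xy by blast
    have "\<bar>fst (F 1 (OC.pt y)) - fst (F 1 (OC.pt x))\<bar> < 1 / 2"
      using d1(2)[OF xy(1,2)] xy(3) dist_fst_le[of "F 1 (OC.pt y)" "F 1 (OC.pt x)"] by (simp add: dist_real_def)
    then have "\<bar>(OC.g y - OC.g x) + (of_int l - of_int k)\<bar> < 1 / 2" unfolding k l by (simp add: OC.pt_def algebra_simps)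
    moreover have "\<bar>OC.g y - OC.g x\<bar> < 1 / 2" using d2(2) xy by simp
    ultimately have "\<bar>of_int (l - k) :: real\<bar> < 1" unfolding of_int_diff abs_less_iff by linarith
    then have "l = k" by linarith
    then show "F 1 (OC.pt y) - F 1 (OC.pt x) = OC.pt (OC.g y) - OC.pt (OC.g x)" unfolding k l by simp
  qed (use d1 d2 in auto)
qed

lemma DF_linear: "\<bar>snd x\<bar> \<le> R \<Longrightarrow> linear (DF x)"
  using F_deriv has_derivative_linear by blast

lemma linear_plane: fixes L :: "plane \<Rightarrow> plane" assumes "linear L" shows "L v = fst v *\<^sub>R L (1, 0) + snd v *\<^sub>R (L (0, 1) :: plane)"
proof -
  have "v = fst v *\<^sub>R (1, 0) + snd v *\<^sub>R (0, 1)" by (cases v) simp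
  then show ?thesis using linear_add[OF assms] linear_scale[OF assms] by metis
qed

lemma linear_plane_le:
  fixes L :: "plane \<Rightarrow> plane"
  assumes "linear L" "norm (L (1, 0)) \<le> c" "norm (L (0, 1)) \<le> c" shows "norm (L v :: plane) \<le> 2 * c * norm v"
proof -
  have "norm (L v) \<le> \<bar>fst v\<bar> * norm (L (1, 0)) + \<bar>snd v\<bar> * norm (L (0, 1))"
    unfolding linear_plane[OF assms(1), of v] by (rule order_trans[OF norm_triangle_ineq]) simp
  also have "\<dots> \<le> norm v * c + norm v * c"
    using assms fst_le_norm[of v] snd_le_norm[of v] by (intro add_mono mult_mono) auto
  finally show ?thesis by simp
qed

abbreviation strip :: "plane set" where "strip \<equiv> {-1..2} \<times> {- R / 2..R / 2}"

lemma compact_strip: "compact strip" by (intro compact_Times) auto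

lemma strip_DF_continuous: "continuous_on strip (\<lambda>x. DF x v)"
  by (rule continuous_on_subset[OF DF_continuous]) (use R_pos in auto)

lemma DF_uniform:
  assumes "0 < e"
  obtains d where "0 < d" "\<And>p p' v. p \<in> strip \<Longrightarrow> p' \<in> strip \<Longrightarrow> dist p p' < d \<Longrightarrow> norm (DF p v - DF p' v) \<le> e * norm v"
proof -
  have uc: "\<exists>d>0. \<forall>p\<in>strip. \<forall>p'\<in>strip. dist p p' < d \<longrightarrow> dist (DF p v) (DF p' v) < e / 2" for v
    using compact_uniformly_continuous[OF strip_DF_continuous compact_strip, of v] assms
    unfolding uniformly_continuous_on_def by (metis dist_commute half_gt_zero)
  obtain d1 where d1: "0 < d1" "\<And>p p'. p \<in> strip \<Longrightarrow> p' \<in> strip \<Longrightarrow> dist p p' < d1 \<Longrightarrow> dist (DF p (1, 0)) (DF p' (1, 0)) < e / 2"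
    using uc by meson
  obtain d2 where d2: "0 < d2" "\<And>p p'. p \<in> strip \<Longrightarrow> p' \<in> strip \<Longrightarrow> dist p p' < d2 \<Longrightarrow> dist (DF p (0, 1)) (DF p' (0, 1)) < e / 2"
    using uc by meson
  show thesis
  proof (rule that[of "min d1 d2"])
    fix p p' v assume p: "p \<in> strip" "p' \<in> strip" "dist p p' < min d1 d2"
    have inR: "\<bar>snd p\<bar> \<le> R" "\<bar>snd p'\<bar> \<le> R" using p R_pos by auto
    have "linear (\<lambda>v. DF p v - DF p' v)" using DF_linear inR by (intro linear_compose_sub) auto
    then have "norm (DF p v - DF p' v) \<le> 2 * (e / 2) * norm v"
      by (rule linear_plane_le) (use d1(2)[OF p(1,2)] d2(2)[OF p(1,2)] p(3) in \<open>auto simp: dist_norm\<close>)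
    then show "norm (DF p v - DF p' v) \<le> e * norm v" by simp
  qed (use d1 d2 in auto)
qed

lemma shift_to_strip:
  assumes "x \<in> OC.K"
  obtains m :: int where "OC.pt x + (of_int m, 0) \<in> strip" "0 \<le> x + of_int m" "x + of_int m < 1"
proof -
  obtain m :: int where m: "0 \<le> x + of_int m" "x + of_int m < 0 + 1" by (rule OC.shift_into_unit[OF assms])
  have "\<bar>snd (OC.pt x)\<bar> \<le> R / 2" by (rule E_strip[OF pt_E[OF assms]])
  then show thesis using m by (intro that[of m]) (auto simp: OC.pt_def)
qed

lemma DF_pt_deck: "x \<in> OC.K \<Longrightarrow> DF (OC.pt x + (of_int m, 0)) = DF (OC.pt x)"
  using DF_deck[of "OC.pt x" m] E_strip[OF pt_E, of x] R_pos by simp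

sublocale TG: twist_graph OC.K OC.g OC.h "\<lambda>x. OC.height (circ x)" "\<lambda>x. DF (OC.pt x)"
proof (rule twist_graph.intro, rule OC.circle_lift_axioms, rule twist_graph_axioms.intro)
  fix x assume x: "x \<in> OC.K"
  have inR: "\<bar>snd (OC.pt x)\<bar> \<le> R" using E_strip[OF pt_E[OF x]] R_pos by simp
  show "linear (DF (OC.pt x))" by (rule DF_linear[OF inR])
  show "det2 (DF (OC.pt x) v) (DF (OC.pt x) w) = det2 v w" for v w by (rule DF_det[OF inR])
next
  have bd: "\<exists>c. \<forall>p\<in>strip. norm (DF p v) \<le> c" for v
    using compact_imp_bounded[OF compact_continuous_image[OF strip_DF_continuous compact_strip], of v]
    unfolding bounded_iff by blast
  obtain c1 c2 where c: "\<And>p. p \<in> strip \<Longrightarrow> norm (DF p (1, 0)) \<le> c1" "\<And>p. p \<in> strip \<Longrightarrow> norm (DF p (0, 1)) \<le> c2"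
    using bd by meson
  have "norm (DF (OC.pt x) v) \<le> 2 * max c1 c2 * norm v" if x: "x \<in> OC.K" for x v
  proof -
    obtain m :: int where m: "OC.pt x + (of_int m, 0) \<in> strip" by (rule shift_to_strip[OF x])
    have inR: "\<bar>snd (OC.pt x)\<bar> \<le> R" using E_strip[OF pt_E[OF x]] R_pos by simp
    show ?thesis using c(1)[OF m] c(2)[OF m] unfolding DF_pt_deck[OF x]
      by (intro linear_plane_le DF_linear inR) auto
  qed
  then show "\<exists>c. \<forall>x\<in>OC.K. \<forall>v. norm (DF (OC.pt x) v) \<le> c * norm v" by blast
next
  have "strip \<noteq> {}" using R_pos by auto
  moreover have "continuous_on strip (\<lambda>p. fst (DF p (0, 1)))" by (intro continuous_on_fst strip_DF_continuous)
  ultimately obtain p0 where p0: "p0 \<in> strip" "\<And>p. p \<in> strip \<Longrightarrow> fst (DF p0 (0, 1)) \<le> fst (DF p (0, 1))"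
    using continuous_attains_inf[OF compact_strip] by blast
  have "fst (DF p0 (0, 1)) \<le> fst (DF (OC.pt x) (0, 1))" if x: "x \<in> OC.K" for x
  proof -
    obtain m :: int where m: "OC.pt x + (of_int m, 0) \<in> strip" by (rule shift_to_strip[OF x])
    show ?thesis using p0(2)[OF m] unfolding DF_pt_deck[OF x] .
  qed
  moreover have "0 < fst (DF p0 (0, 1))" using p0(1) R_pos by (intro DF_twist) auto
  ultimately show "\<exists>b>0. \<forall>x\<in>OC.K. b \<le> fst (DF (OC.pt x) (0, 1))" by blast
next
  fix e :: real assume e: "0 < e"
  obtain d1 where d1: "0 < d1" "\<And>x y. x \<in> OC.K \<Longrightarrow> y \<in> OC.K \<Longrightarrow> \<bar>y - x\<bar> < d1 \<Longrightarrow>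
    F 1 (OC.pt y) - F 1 (OC.pt x) = OC.pt (OC.g y) - OC.pt (OC.g x)" using increments_agree by metis
  obtain d2 where d2: "0 < d2" "\<And>p p' v. p \<in> strip \<Longrightarrow> p' \<in> strip \<Longrightarrow> dist p p' < d2 \<Longrightarrow> norm (DF p v - DF p' v) \<le> e * norm v"
    using DF_uniform[OF e] by metis
  obtain d3 where d3: "0 < d3" "\<And>x y. x \<in> OC.K \<Longrightarrow> y \<in> OC.K \<Longrightarrow> \<bar>y - x\<bar> < d3 \<Longrightarrow> dist (OC.pt y) (OC.pt x) < d2"
    by (rule OC.uniformly_continuous_on_K[OF OC.pt_continuous _ d2(1)]) (simp add: OC.pt_shift_int dist_norm, blast)
  have main: "norm (OC.pt (OC.g y) - OC.pt (OC.g x) - DF (OC.pt x) (OC.pt y - OC.pt x)) \<le> e * norm (OC.pt y - OC.pt x)"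
    if x: "x \<in> OC.K" and y: "y \<in> OC.K" and xy: "\<bar>y - x\<bar> < min (min d1 1) d3" for x y
  proof -
    obtain m :: int where m: "OC.pt x + (of_int m, 0) \<in> strip" "0 \<le> x + of_int m" "x + of_int m < 1"
      by (rule shift_to_strip[OF x])
    let ?p = "OC.pt x + (of_int m, 0)" and ?p' = "OC.pt y + (of_int m, 0)"
    have p': "?p' \<in> strip" using E_strip[OF pt_E[OF y]] m xy by (auto simp: OC.pt_def)
    have "convex strip" by (intro convex_Times) auto
    then have seg: "closed_segment ?p ?p' \<subseteq> strip" using m(1) p' by (simp add: closed_segment_subset)
    have inR: "\<bar>snd p\<bar> \<le> R" if "p \<in> strip" for p using that R_pos by auto
    have "norm (F 1 ?p' - F 1 ?p - DF ?p (?p' - ?p)) \<le> norm (?p' - ?p) * e"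
    proof (rule differentiable_bound_linearization[where S = "closed_segment ?p ?p'" and f' = "\<lambda>p. DF p" and ?x0.0 = ?p])
      show "?p + t *\<^sub>R (?p' - ?p) \<in> closed_segment ?p ?p'" if "t \<in> {0..1}" for t
        using that unfolding closed_segment_def by (auto simp: algebra_simps intro!: exI[of _ t])
      show "(F 1 has_derivative DF p) (at p within closed_segment ?p ?p')" if "p \<in> closed_segment ?p ?p'" for p
        using F_deriv[OF inR] that seg by (blast intro: has_derivative_at_withinI)
      show "onorm (DF p - DF ?p) \<le> e" if p: "p \<in> closed_segment ?p ?p'" for p
      proof (rule onorm_le)
        fix v
        have "dist p ?p \<le> dist ?p' ?p" using p dist_in_closed_segment(1)[OF p] by (simp add: dist_commute)
        also have "\<dots> < d2" using d3(2)[OF x y] xy by (simp add: dist_norm)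
        finally show "norm ((DF p - DF ?p) v) \<le> e * norm v"
          using d2(2)[of p ?p v] p seg m(1) by auto
      qed
    qed simp
    moreover have "F 1 ?p' - F 1 ?p = F 1 (OC.pt y) - F 1 (OC.pt x)"
      using ret_lift_deck(2)[OF A_dom, of "OC.pt x" m] ret_lift_deck(2)[OF A_dom, of "OC.pt y" m] OC.pt_in x y by simp
    moreover have "F 1 (OC.pt y) - F 1 (OC.pt x) = OC.pt (OC.g y) - OC.pt (OC.g x)" using d1(2)[OF x y] xy by simp
    ultimately show ?thesis by (simp add: DF_pt_deck[OF x] mult.commute)
  qed
  show "\<exists>d>0. \<forall>x\<in>OC.K. \<forall>y\<in>OC.K. \<bar>y - x\<bar> < d \<longrightarrow>
       norm ((OC.g y, OC.height (circ (OC.g y))) - (OC.g x, OC.height (circ (OC.g x))) - DF (OC.pt x) ((y, OC.height (circ y)) - (x, OC.height (circ x))))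
       \<le> e * norm ((y, OC.height (circ y)) - (x, OC.height (circ x)))"
    using main d1(1) d3(1) unfolding OC.pt_def by (intro exI[of _ "min (min d1 1) d3"]) auto
qed

lemma F_pow_pt: assumes x: "x \<in> OC.K" shows "\<exists>k::int. (F 1 ^^ n) (OC.pt x) = OC.pt ((OC.g ^^ n) x) + (of_int k, 0)"
proof (induction n)
  case 0 show ?case by (rule exI[of _ 0]) (simp add: zero_prod_def[symmetric])
next
  case (Suc n)
  then obtain k :: int where k: "(F 1 ^^ n) (OC.pt x) = OC.pt ((OC.g ^^ n) x) + (of_int k, 0)" by blast
  have gx: "(OC.g ^^ n) x \<in> OC.K" by (rule OC.gn_in[OF x])
  obtain l :: int where l: "F 1 (OC.pt ((OC.g ^^ n) x)) = OC.pt (OC.g ((OC.g ^^ n) x)) + (of_int l, 0)" using F_pt[OF gx] by blast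
  have "F 1 (OC.pt ((OC.g ^^ n) x) + (of_int k, 0)) = F 1 (OC.pt ((OC.g ^^ n) x)) + (of_int k, 0)"
    using ret_lift_deck(2)[OF A_dom] OC.pt_in[OF gx] by blast
  then have "(F 1 ^^ Suc n) (OC.pt x) = OC.pt ((OC.g ^^ Suc n) x) + (of_int (l + k), 0)"
    using k l by (simp add: add.assoc)
  then show ?case by blast
qed

text \<open>
  Where the first \<open>n\<close> points of the orbit stay in the open strip, \<open>F n\<close> is the \<open>n\<close>-th iterate of
  \<open>F 1\<close>. These sets are open, so derivatives may be computed there.
\<close>

definition U where "U n = {y. \<forall>i<n. \<bar>snd ((F 1 ^^ i) y)\<bar> < R}"

lemma U_open: "open (U n) \<and> continuous_on (U n) (F 1 ^^ n)"
proof (induction n)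
  case 0 show ?case by (simp add: U_def id_def)
next
  case (Suc n)
  let ?T = "{y::plane. \<bar>snd y\<bar> < R}"
  have T: "open ?T" by (intro open_Collect_less continuous_intros)
  have eq: "U (Suc n) = U n \<inter> (F 1 ^^ n) -` ?T" by (auto simp: U_def less_Suc_eq)
  have "open (U (Suc n))" unfolding eq using Suc T by (intro continuous_open_preimage) auto
  moreover have "continuous_on (U (Suc n)) (\<lambda>y. F 1 ((F 1 ^^ n) y))"
  proof (rule continuous_on_compose2[OF F_continuous])
    show "continuous_on (U (Suc n)) (F 1 ^^ n)" using Suc by (rule continuous_on_subset[OF conjunct2]) (auto simp: eq)
  qed (auto simp: eq)
  ultimately show ?case by (simp add: comp_def)
qed

lemma U_pt: assumes "x \<in> OC.K" shows "OC.pt x \<in> U n"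
proof -
  have "\<bar>snd ((F 1 ^^ i) (OC.pt x))\<bar> < R" for i
  proof -
    obtain k :: int where "(F 1 ^^ i) (OC.pt x) = OC.pt ((OC.g ^^ i) x) + (of_int k, 0)" using F_pow_pt[OF assms] by blast
    then show ?thesis using E_strip[OF pt_E[OF OC.gn_in[OF assms]], of i] R_pos by simp
  qed
  then show ?thesis by (simp add: U_def)
qed

lemma F_on_U: assumes "y \<in> U n" shows "y \<in> ret_dom H \<epsilon> h (int n)" "F (int n) y = (F 1 ^^ n) y"
  using ret_lift_pow[of n y] strip_dom assms by (auto simp: U_def less_imp_le)

lemma Fn_deriv: assumes x: "x \<in> OC.K" shows "(F (int n) has_derivative TG.An n x) (at (OC.pt x))"
proof -
  have "((F 1 ^^ n) has_derivative TG.An n x) (at (OC.pt x))"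
  proof (induction n)
    case 0
    have "TG.An 0 x = (\<lambda>v. v)" by auto
    then show ?case by (simp add: id_def)
  next
    case (Suc n)
    obtain k :: int where k: "(F 1 ^^ n) (OC.pt x) = OC.pt ((OC.g ^^ n) x) + (of_int k, 0)" using F_pow_pt[OF x] by blast
    have gx: "(OC.g ^^ n) x \<in> OC.K" by (rule OC.gn_in[OF x])
    have "(F 1 has_derivative DF ((F 1 ^^ n) (OC.pt x))) (at ((F 1 ^^ n) (OC.pt x)))"
      unfolding k using E_strip[OF pt_E[OF gx]] R_pos by (intro F_deriv) simp
    from has_derivative_compose[OF Suc this]
    have "((\<lambda>y. F 1 ((F 1 ^^ n) y)) has_derivative (\<lambda>v. DF (OC.pt ((OC.g ^^ n) x)) (TG.An n x v))) (at (OC.pt x))"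
      unfolding k DF_pt_deck[OF gx] .
    moreover have "TG.An (Suc n) x = (\<lambda>v. DF (OC.pt ((OC.g ^^ n) x)) (TG.An n x v))" by auto
    ultimately show ?case by (simp add: comp_def)
  qed
  then show ?thesis
    by (rule has_derivative_transform_within_open[OF _ conjunct1[OF U_open, of n] U_pt[OF x]]) (simp add: F_on_U)
qed

lemma An_det: "x \<in> OC.K \<Longrightarrow> det2 (TG.An n x v) (TG.An n x w) = det2 v w"
  by (induction n) (simp_all add: TG.A_det OC.gn_in)

text \<open>
  \<open>F (- n)\<close> is a left inverse of \<open>F n\<close> near the invariant set, and the derivative of \<open>F n\<close> is invertible
  because it preserves areas.
\<close>

lemma F_minus_deriv:
  assumes x: "x \<in> OC.K"
  obtains B where "(F (- int n) has_derivative B) (at (F (int n) (OC.pt x)))" "\<And>v. B (TG.An n x v) = v"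
proof -
  have lin: "linear (TG.An n x)" by (rule TG.An_linear[OF x])
  have "inj (TG.An n x)"
  proof (rule linear_injective_0[OF lin, THEN iffD2], intro allI impI)
    fix v assume "TG.An n x v = 0"
    then have "det2 v w = 0" for w using An_det[OF x, of n v w] by (simp add: det2_def)
    then show "v = 0" by (rule det2_nondegenerate)
  qed
  then obtain B where B: "\<And>v. B (TG.An n x v) = v" "\<And>v. TG.An n x (B v) = v"
    using linear_injective_isomorphism[OF lin] by blast
  have "continuous_on (U n) (F (int n))"
    using U_open[of n] F_on_U by (simp cong: continuous_on_cong)
  then have "(F (- int n) has_derivative B) (at (F (int n) (OC.pt x)))"
  proof (rule has_derivative_inverse_strong[OF conjunct1[OF U_open] U_pt[OF x] _ _ Fn_deriv[OF x]])
    show "F (- int n) (F (int n) y) = y" if "y \<in> U n" for y by (rule ret_lift_minus[OF F_on_U(1)[OF that]])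
    show "TG.An n x \<circ> B = id" using B(2) by (simp only: fun_eq_iff comp_apply id_apply) simp
  qed
  then show thesis using B that by blast
qed

lemma expansive:
  assumes "hyperbolic_set F A" shows "expansive_circle_lift OC.K OC.g OC.h"
proof -
  obtain Es Eu C \<Lambda> where C: "0 < C" "0 < \<Lambda>" "\<Lambda> < 1"
    and all: "\<forall>x. proj2 x \<in> A \<longrightarrow>
           subspace (Es (proj2 x)) \<and> subspace (Eu (proj2 x)) \<and> Es (proj2 x) \<inter> Eu (proj2 x) = {0} \<and>
           {v + w | v w. v \<in> Es (proj2 x) \<and> w \<in> Eu (proj2 x)} = UNIV \<and>
           DF x ` Es (proj2 x) = Es (proj2 (F 1 x)) \<and> DF x ` Eu (proj2 x) = Eu (proj2 (F 1 x)) \<and>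
           (\<forall>n::nat. \<forall>v \<in> Es (proj2 x). norm (frechet_derivative (F (int n)) (at x) v) \<le> C * \<Lambda> ^ n * norm v) \<and>
           (\<forall>n::nat. \<forall>v \<in> Eu (proj2 x). norm (frechet_derivative (F (- int n)) (at x) v) \<le> C * \<Lambda> ^ n * norm v)"
    using assms unfolding hyperbolic_set_def by (elim exE conjE)
  have hyp: "{v + w | v w. v \<in> Es (proj2 x) \<and> w \<in> Eu (proj2 x)} = UNIV \<and>
           DF x ` Es (proj2 x) = Es (proj2 (F 1 x)) \<and> DF x ` Eu (proj2 x) = Eu (proj2 (F 1 x)) \<and>
           (\<forall>n::nat. \<forall>v \<in> Es (proj2 x). norm (frechet_derivative (F (int n)) (at x) v) \<le> C * \<Lambda> ^ n * norm v) \<and>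
           (\<forall>n::nat. \<forall>v \<in> Eu (proj2 x). norm (frechet_derivative (F (- int n)) (at x) v) \<le> C * \<Lambda> ^ n * norm v)"
    if "proj2 x \<in> A" for x
    using all[THEN spec, THEN mp, OF that] by (elim conjE) (intro conjI; assumption)
  have step: "proj2 (F 1 (OC.pt x)) = proj2 (OC.pt (OC.g x))" if "x \<in> OC.K" for x
    using F_pt[OF that] by auto
  define es eu where "es x = Es (proj2 (OC.pt x))" and "eu x = Eu (proj2 (OC.pt x))" for x
  have es_inv: "DF (OC.pt x) v \<in> es (OC.g x)" if "x \<in> OC.K" "v \<in> es x" for x v
  proof -
    have "DF (OC.pt x) ` Es (proj2 (OC.pt x)) = Es (proj2 (F 1 (OC.pt x)))"
      using hyp[OF OC.pt_in[OF that(1)]] by (elim conjE)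
    moreover have "DF (OC.pt x) v \<in> DF (OC.pt x) ` Es (proj2 (OC.pt x))"
      using that(2) unfolding es_def by (rule imageI)
    ultimately show ?thesis by (simp only: step[OF that(1)] es_def)
  qed
  have eu_inv: "DF (OC.pt x) v \<in> eu (OC.g x)" if "x \<in> OC.K" "v \<in> eu x" for x v
  proof -
    have "DF (OC.pt x) ` Eu (proj2 (OC.pt x)) = Eu (proj2 (F 1 (OC.pt x)))"
      using hyp[OF OC.pt_in[OF that(1)]] by (elim conjE)
    moreover have "DF (OC.pt x) v \<in> DF (OC.pt x) ` Eu (proj2 (OC.pt x))"
      using that(2) unfolding eu_def by (rule imageI)
    ultimately show ?thesis by (simp only: step[OF that(1)] eu_def)
  qed
  have eu_n: "TG.An n x v \<in> eu ((OC.g ^^ n) x)" if "x \<in> OC.K" "v \<in> eu x" for n x v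
    using that by (induction n) (auto simp: eu_inv OC.gn_in)
  interpret HT: hyperbolic_twist_graph OC.K OC.g OC.h "\<lambda>x. OC.height (circ x)" "\<lambda>x. DF (OC.pt x)" es eu C \<Lambda>
  proof
    fix x v assume x: "x \<in> OC.K"
    note hx = hyp[OF OC.pt_in[OF x]]
    have "{v + w | v w. v \<in> es x \<and> w \<in> eu x} = UNIV" using hx unfolding es_def eu_def by (elim conjE)
    then have "v \<in> {v + w | v w. v \<in> es x \<and> w \<in> eu x}" by simp
    then show "\<exists>vs\<in>es x. \<exists>vu\<in>eu x. v = vs + vu" by blast
    show "norm (TG.An n x v) \<le> C * \<Lambda> ^ n * norm v" if v: "v \<in> es x" for n
    proof -
      have "norm (frechet_derivative (F (int n)) (at (OC.pt x)) v) \<le> C * \<Lambda> ^ n * norm v"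
        using hx v unfolding es_def by (elim conjE) (rule bspec, erule spec)
      then show ?thesis using frechet_derivative_at[OF Fn_deriv[OF x]] by simp
    qed
    show "norm v \<le> C * \<Lambda> ^ n * norm (TG.An n x v)" if v: "v \<in> eu x" for n
    proof -
      obtain B where B: "(F (- int n) has_derivative B) (at (F (int n) (OC.pt x)))" "\<And>v. B (TG.An n x v) = v"
        using F_minus_deriv[OF x] by metis
      obtain k :: int where k: "F (int n) (OC.pt x) = OC.pt ((OC.g ^^ n) x) + (of_int k, 0)"
        using F_pow_pt[OF x] F_on_U(2)[OF U_pt[OF x]] by metis
      have "proj2 (F (int n) (OC.pt x)) = proj2 (OC.pt ((OC.g ^^ n) x))" unfolding k by simp
      moreover from this have "proj2 (F (int n) (OC.pt x)) \<in> A" using OC.pt_in[OF OC.gn_in[OF x]] by simp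
      ultimately have mem: "proj2 (F (int n) (OC.pt x)) \<in> A" "TG.An n x v \<in> Eu (proj2 (F (int n) (OC.pt x)))"
        using eu_n[OF x v, of n] unfolding eu_def by simp_all
      have "\<forall>m::nat. \<forall>v \<in> Eu (proj2 (F (int n) (OC.pt x))).
          norm (frechet_derivative (F (- int m)) (at (F (int n) (OC.pt x))) v) \<le> C * \<Lambda> ^ m * norm v"
        using hyp[OF mem(1)] by (elim conjE)
      note this[THEN spec, of n]
      from bspec[OF this mem(2)]
      have "norm (frechet_derivative (F (- int n)) (at (F (int n) (OC.pt x))) (TG.An n x v)) \<le> C * \<Lambda> ^ n * norm (TG.An n x v)" .
      then show ?thesis using frechet_derivative_at[OF B(1)] B(2) by simp
    qed
  qed (use C es_inv eu_inv in auto)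
  show ?thesis by unfold_locales (rule HT.expansion_on_K)
qed

end

section \<open>Rigidity of the lamination\<close>

locale rigid_lamination = twist_lamination H \<epsilon> h A R + reparametrized_lamination H \<epsilon> h A \<phi>
  for H \<epsilon> h A R \<phi> +
  fixes \<nu> :: "phase measure"
  assumes hyperbolic: "hyperbolic_set (ret_lift H \<epsilon> h) A" and holes: "has_holes 1 (ret H \<epsilon> h) A"
    and invariant: "invariant_prob (lamination H \<epsilon> h A) (ham_flow (Hhat H \<epsilon>)) \<nu>"
    and mean: "(LINT z|\<nu>. 1 / \<phi> z) = 1"
begin

abbreviation "base x \<equiv> \<iota> (proj2 (OC.pt x))"
abbreviation "P x \<equiv> J (base x) 1"

lemma TG_pt: "TG.pt = OC.pt"
  by (simp add: fun_eq_iff TG.pt_def OC.pt_def)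

lemma base_in_S: "x \<in> OC.K \<Longrightarrow> base x \<in> S"
  using OC.pt_in \<iota>_in_S by blast

text \<open>
  The return time is locally a Lipschitz function of the point of the plane, and the points of the set
  depend in a Lipschitz way on their angle.
\<close>

lemma P_locally_lipschitz:
  assumes u0: "u0 \<in> OC.K"
  shows "\<exists>r>0. \<exists>C. \<forall>u\<in>OC.K. \<forall>v\<in>OC.K. \<bar>u - u0\<bar> < r \<longrightarrow> \<bar>v - u0\<bar> < r \<longrightarrow> \<bar>P v - P u\<bar> \<le> C * \<bar>v - u\<bar>"
proof -
  obtain L dL where L: "1 \<le> L" "0 < dL"
    "\<And>x y. x \<in> OC.K \<Longrightarrow> y \<in> OC.K \<Longrightarrow> \<bar>y - x\<bar> < dL \<Longrightarrow> norm (OC.pt y - OC.pt x) \<le> L * \<bar>y - x\<bar>"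
    using TG.pt_locally_lipschitz unfolding TG_pt by metis
  obtain d C where d: "0 < d" "0 \<le> C" "\<And>x y. x \<in> E \<Longrightarrow> y \<in> E \<Longrightarrow> dist x (OC.pt u0) < d \<Longrightarrow> dist y (OC.pt u0) < d \<Longrightarrow>
     \<bar>J (\<iota> (proj2 x)) 1 - J (\<iota> (proj2 y)) 1\<bar> \<le> C * norm (x - y)"
    using J_locally_lipschitz[OF pt_E[OF u0]] by metis
  define r where "r = min (dL / 2) (d / L)"
  have r: "0 < r" "r \<le> dL / 2" "L * r \<le> d" using L d by (auto simp: r_def min_def field_simps)
  have near: "dist (OC.pt u) (OC.pt u0) < d" if "u \<in> OC.K" "\<bar>u - u0\<bar> < r" for u
  proof -
    have "norm (OC.pt u - OC.pt u0) \<le> L * \<bar>u - u0\<bar>" using that r L by (intro L(3) u0) auto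
    also have "\<dots> < L * r" using that L by (intro mult_strict_left_mono) auto
    finally show ?thesis using r by (simp add: dist_norm)
  qed
  have "\<bar>P v - P u\<bar> \<le> (C * L) * \<bar>v - u\<bar>" if uv: "u \<in> OC.K" "v \<in> OC.K" "\<bar>u - u0\<bar> < r" "\<bar>v - u0\<bar> < r" for u v
  proof -
    have "\<bar>v - u\<bar> < dL" using uv r by linarith
    then have "norm (OC.pt v - OC.pt u) \<le> L * \<bar>v - u\<bar>" using uv by (intro L(3))
    then have "C * norm (OC.pt v - OC.pt u) \<le> C * (L * \<bar>v - u\<bar>)" using d by (intro mult_left_mono)
    moreover have "\<bar>P v - P u\<bar> \<le> C * norm (OC.pt v - OC.pt u)"
      by (rule d(3)[OF pt_E[OF uv(2)] pt_E[OF uv(1)] near[OF uv(2,4)] near[OF uv(1,3)]])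
    ultimately show ?thesis by simp
  qed
  then show ?thesis using r(1) by blast
qed

lemma P_shift: "P (x + of_int m) = P x"
  by (simp add: OC.pt_shift_int)

lemma J1_bounded: obtains M where "0 \<le> M" "\<And>z. z \<in> S \<Longrightarrow> \<bar>J z 1\<bar> \<le> M"
proof -
  have "bounded ((\<lambda>z. J z 1) ` S)"
    by (intro compact_imp_bounded compact_continuous_image J_continuous compact_S)
  then obtain M where M: "\<forall>z\<in>S. \<bar>J z 1\<bar> \<le> M" by (auto simp: bounded_iff)
  show thesis by (rule that[of "max M 0"]) (use M in \<open>auto simp: le_max_iff_disj\<close>)
qed

lemma P_lipschitz:
  obtains L where "\<And>u v. u \<in> OC.K \<Longrightarrow> v \<in> OC.K \<Longrightarrow> u \<le> v \<Longrightarrow> \<bar>P v - P u\<bar> \<le> L * (v - u)"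
proof -
  obtain r C where rC: "\<And>u0. u0 \<in> OC.K \<Longrightarrow> 0 < r u0"
    "\<And>u0 u v. u0 \<in> OC.K \<Longrightarrow> u \<in> OC.K \<Longrightarrow> v \<in> OC.K \<Longrightarrow> \<bar>u - u0\<bar> < r u0 \<Longrightarrow> \<bar>v - u0\<bar> < r u0 \<Longrightarrow> \<bar>P v - P u\<bar> \<le> C u0 * \<bar>v - u\<bar>"
    using P_locally_lipschitz by metis
  have "compact (OC.K \<inter> {0..1})" by (simp add: closed_Int_compact OC.closed_K)
  then obtain U where U: "U \<subseteq> OC.K \<inter> {0..1}" "finite U" "OC.K \<inter> {0..1} \<subseteq> (\<Union>u\<in>U. ball u (r u / 2))"
    by (rule compactE_image[of _ "OC.K \<inter> {0..1}" "\<lambda>u. ball u (r u / 2)"]) (use rC(1) in auto)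
  define \<delta> where "\<delta> = Min (insert 1 ((\<lambda>u. r u / 2) ` U))"
  define C' where "C' = Max (insert 0 (C ` U))"
  have "0 < r u" if "u \<in> U" for u using rC(1) U(1) that by blast
  then have \<delta>_pos: "0 < \<delta>" unfolding \<delta>_def using U(2) by simp
  have \<delta>_le: "\<delta> \<le> r u / 2" if "u \<in> U" for u
    unfolding \<delta>_def using U(2) that by (intro Min_le) auto
  note \<delta> = \<delta>_pos \<delta>_le
  have C': "C u \<le> C'" if "u \<in> U" for u unfolding C'_def using U(2) that by (intro Max_ge) auto
  obtain M where M: "0 \<le> M" "\<And>z. z \<in> S \<Longrightarrow> \<bar>J z 1\<bar> \<le> M" using J1_bounded by metis
  have close: "\<bar>P v - P u\<bar> \<le> C' * (v - u)" if uv: "u \<in> OC.K" "v \<in> OC.K" "u \<le> v" "v - u < \<delta>" for u v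
  proof -
    obtain m :: int where m: "0 \<le> u + of_int m" "u + of_int m < 0 + 1" by (rule OC.shift_into_unit[OF uv(1)])
    have K': "u + of_int m \<in> OC.K" "v + of_int m \<in> OC.K" using uv OC.K_shift_int by auto
    then obtain u0 where u0: "u0 \<in> U" "dist u0 (u + of_int m) < r u0 / 2" using U(3) m by auto
    have near: "\<bar>(u + of_int m) - u0\<bar> < r u0 / 2" using u0(2) unfolding dist_real_def by linarith
    have "\<bar>P (v + of_int m) - P (u + of_int m)\<bar> \<le> C u0 * \<bar>(v + of_int m) - (u + of_int m)\<bar>"
    proof (rule rC(2)[OF _ K'])
      show "u0 \<in> OC.K" using U(1) u0(1) by blast
      show "\<bar>u + of_int m - u0\<bar> < r u0" using near by linarith
      show "\<bar>v + of_int m - u0\<bar> < r u0" using near uv(3,4) \<delta>(2)[OF u0(1)] by linarith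
    qed
    also have "\<dots> \<le> C' * (v - u)" using C'[OF u0(1)] uv by (simp add: mult_right_mono)
    finally show ?thesis by (simp only: P_shift)
  qed
  show thesis
  proof (rule that[of "max C' (2 * M / \<delta>)"])
    fix u v assume uv: "u \<in> OC.K" "v \<in> OC.K" "u \<le> v"
    show "\<bar>P v - P u\<bar> \<le> max C' (2 * M / \<delta>) * (v - u)"
    proof (cases "v - u < \<delta>")
      case True
      have "C' * (v - u) \<le> max C' (2 * M / \<delta>) * (v - u)" using uv by (intro mult_right_mono) auto
      then show ?thesis using close[OF uv True] by linarith
    next
      case False
      have "\<bar>P v - P u\<bar> \<le> 2 * M" using M(2)[OF base_in_S[OF uv(1)]] M(2)[OF base_in_S[OF uv(2)]] by linarith
      also have "\<dots> = 2 * M / \<delta> * \<delta>" using \<delta> by simp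
      also have "\<dots> \<le> 2 * M / \<delta> * (v - u)" using False M \<delta> by (intro mult_left_mono) auto
      also have "\<dots> \<le> max C' (2 * M / \<delta>) * (v - u)" using uv by (intro mult_right_mono) auto
      finally show ?thesis .
    qed
  qed
qed

lemma flow_base: "x \<in> OC.K \<Longrightarrow> \<Phi> (real n) (base x) = base ((OC.g ^^ n) x)"
proof (induction n)
  case 0 then show ?case using flow_0 base_in_S by simp
next
  case (Suc n)
  let ?y = "(OC.g ^^ n) x"
  have y: "?y \<in> OC.K" by (rule OC.gn_in[OF Suc.prems])
  have "\<Phi> (real (Suc n)) (base x) = \<Phi> 1 (\<Phi> (real n) (base x))"
    using flow_add[OF base_in_S[OF Suc.prems], of 1 "real n"] by (simp add: add.commute)
  also have "\<dots> = k (proj2 (OC.pt ?y), 1)" using Suc by (simp add: k_def)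
  also have "\<dots> = base (OC.g ?y)" using k_1[OF OC.pt_in[OF y]] OC.f_pt[OF y] by simp
  finally show ?case by simp
qed

lemma J_base: "x \<in> OC.K \<Longrightarrow> J (base x) (real n) = (\<Sum>i<n. P ((OC.g ^^ i) x))"
proof (induction n)
  case 0 then show ?case using J_0 base_in_S by simp
next
  case (Suc n)
  have "J (base x) (1 + real n) = J (base x) (real n) + J (\<Phi> (real n) (base x)) 1"
    by (rule J_add[OF base_in_S[OF Suc.prems]])
  then show ?case using Suc by (simp add: flow_base add.commute)
qed

lemma J_base_bounded_oscillation:
  obtains C where "\<And>n x y. x \<in> OC.K \<Longrightarrow> y \<in> OC.K \<Longrightarrow> \<bar>J (base y) (real n) - J (base x) (real n)\<bar> \<le> C"
proof -
  interpret EX: expansive_circle_lift OC.K OC.g OC.h by (rule expansive[OF hyperbolic])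
  obtain z where "z \<notin> OC.K" using OC.nowhere_dense[of 0 1] by auto
  then obtain a0 b0 where gap0: "OC.gap a0 b0" using OC.gap_around by metis
  have a0: "a0 \<in> OC.K" using gap0 by (simp add: OC.gap_def)
  interpret OG: one_gap_orbit OC.K OC.g OC.h a0 b0
  proof
    show "OC.gap a0 b0" by (rule gap0)
    show "\<exists>n m. c = (OC.g ^^ n) a0 + of_int m \<or> c = (OC.h ^^ n) a0 + of_int m" if "OC.gap c d" for c d
      using OC.gap_orbits_comparable[OF holes gap0 that] .
    show "n = 0" if "(OC.g ^^ n) a0 = a0 + of_int m" for n m by (rule OC.lift_aperiodic[OF a0 that])
    show "\<exists>L. \<forall>u\<in>OC.K. \<forall>v\<in>OC.K. u \<le> v \<longrightarrow> OC.g v - OC.g u \<le> L * (v - u)" by (rule TG.g_lipschitz_on_K)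
  qed
  obtain L where L: "\<And>u v. u \<in> OC.K \<Longrightarrow> v \<in> OC.K \<Longrightarrow> u \<le> v \<Longrightarrow> \<bar>P v - P u\<bar> \<le> L * (v - u)" using P_lipschitz by metis
  obtain C where C: "\<And>n x y. x \<in> OC.K \<Longrightarrow> y \<in> OC.K \<Longrightarrow>
     \<bar>(\<Sum>i<n. P ((OC.g ^^ i) y)) - (\<Sum>i<n. P ((OC.g ^^ i) x))\<bar> \<le> C"
    using OG.birkhoff_sums_bounded[of "\<lambda>x. P x" L] P_shift L by metis
  show thesis by (rule that[of C]) (simp add: J_base C)
qed

lemma J_time_lipschitz:
  obtains M where "0 \<le> M" "\<And>z s t. z \<in> S \<Longrightarrow> \<bar>J z t - J z s\<bar> \<le> M * \<bar>t - s\<bar>"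
proof -
  obtain m M where M: "0 < m" "\<And>z. z \<in> S \<Longrightarrow> m \<le> 1 / \<phi> z \<and> 1 / \<phi> z \<le> M" by (metis q_bounds)
  have "\<bar>J z t - J z s\<bar> \<le> max M 0 * \<bar>t - s\<bar>" if z: "z \<in> S" for z s t
  proof -
    have "norm (J z t - J z s) \<le> max M 0 * norm (t - s)"
    proof (rule field_differentiable_bound[of UNIV "J z" "\<lambda>t. 1 / \<phi> (\<Phi> t z)"])
      fix u
      show "(J z has_field_derivative 1 / \<phi> (\<Phi> u z)) (at u within UNIV)" using J_deriv[OF z] by simp
      show "norm (1 / \<phi> (\<Phi> u z)) \<le> max M 0"
        using M(2)[OF flow_in[OF z], of u] M(1) by (auto simp: le_max_iff_disj)
    qed auto
    then show ?thesis by simp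
  qed
  then show thesis by (intro that[of "max M 0"]) auto
qed

text \<open>
  Every point of the lamination lies at most one time unit after a base point, and \<open>J\<close> changes by a
  bounded amount in bounded time. So the bound for base points and integer times carries over.
\<close>

lemma J_bounded_oscillation:
  obtains C where "\<And>z z' t. z \<in> S \<Longrightarrow> z' \<in> S \<Longrightarrow> 0 \<le> t \<Longrightarrow> \<bar>J z t - J z' t\<bar> \<le> C"
proof -
  obtain M where M: "0 \<le> M" "\<And>z s t. z \<in> S \<Longrightarrow> \<bar>J z t - J z s\<bar> \<le> M * \<bar>t - s\<bar>" using J_time_lipschitz by metis
  obtain C where C: "\<And>n x y. x \<in> OC.K \<Longrightarrow> y \<in> OC.K \<Longrightarrow> \<bar>J (base y) (real n) - J (base x) (real n)\<bar> \<le> C"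
    using J_base_bounded_oscillation by metis
  \<comment> \<open>the two shifts cost at most \<open>2 M\<close> and \<open>M\<close>\<close>
  have near: "\<exists>x\<in>OC.K. \<bar>J z t - J (base x) (real (nat \<lfloor>t\<rfloor>))\<bar> \<le> 3 * M" if z: "z \<in> S" and t: "0 \<le> t" for z t
  proof -
    obtain a s where a: "a \<in> A" "s \<in> {0..1}" "z = k (a, s)" using z by (auto simp: S_eq_unit)
    obtain y where y: "y \<in> E" "proj2 y = a" using proj2_surj[OF a(1)] by blast
    then obtain x where x: "x \<in> OC.K" "y = OC.pt x" using OC.in_A_iff_pt[of y] by (auto simp: E_def)
    have za: "z = \<Phi> s (base x)" using a(3) y x by (simp add: k_def)
    have "J (base x) (t + s) = J (base x) s + J z t" unfolding za by (rule J_add[OF base_in_S[OF x(1)]])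
    moreover have "\<bar>J (base x) (t + s) - J (base x) (real (nat \<lfloor>t\<rfloor>))\<bar> \<le> M * 2"
    proof (rule order_trans[OF M(2)[OF base_in_S[OF x(1)]] mult_left_mono[OF _ M(1)]])
      have "real (nat \<lfloor>t\<rfloor>) = of_int \<lfloor>t\<rfloor>" using t by simp
      then show "\<bar>t + s - real (nat \<lfloor>t\<rfloor>)\<bar> \<le> 2" using a(2) by simp linarith
    qed
    moreover have "\<bar>J (base x) s - J (base x) 0\<bar> \<le> M * 1"
      by (rule order_trans[OF M(2)[OF base_in_S[OF x(1)]] mult_left_mono[OF _ M(1)]]) (use a(2) in auto)
    ultimately have "\<bar>J z t - J (base x) (real (nat \<lfloor>t\<rfloor>))\<bar> \<le> 3 * M"
      using J_0[OF base_in_S[OF x(1)]] by (simp add: abs_le_iff)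
    then show ?thesis using x(1) by blast
  qed
  show thesis
  proof (rule that[of "C + 6 * M"])
    fix z z' t assume z: "z \<in> S" "z' \<in> S" "0 \<le> (t::real)"
    obtain x where x: "x \<in> OC.K" "\<bar>J z t - J (base x) (real (nat \<lfloor>t\<rfloor>))\<bar> \<le> 3 * M" using near[OF z(1,3)] by blast
    obtain y where y: "y \<in> OC.K" "\<bar>J z' t - J (base y) (real (nat \<lfloor>t\<rfloor>))\<bar> \<le> 3 * M" using near[OF z(2,3)] by blast
    show "\<bar>J z t - J z' t\<bar> \<le> C + 6 * M" using C[OF y(1) x(1), of "nat \<lfloor>t\<rfloor>"] x(2) y(2) by linarith
  qed
qed

lemma \<nu>_facts:
  shows space_\<nu>: "space \<nu> = S" and sets_\<nu>: "sets \<nu> = sets (restrict_space borel S)"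
    and prob_\<nu>: "emeasure \<nu> S = 1" and flow_measurable: "\<Phi> t \<in> measurable \<nu> \<nu>" and flow_distr: "distr \<nu> \<nu> (\<Phi> t) = \<nu>"
  using invariant unfolding invariant_prob_def by blast+

lemma continuous_measurable_\<nu>:
  fixes u :: "phase \<Rightarrow> real"
  assumes "continuous_on S u" shows "u \<in> borel_measurable \<nu>"
  using borel_measurable_continuous_on_restrict[OF assms] measurable_cong_sets[OF sets_\<nu> refl] by blast

lemma q_mean: "(\<integral>\<^sup>+ z. ennreal (1 / \<phi> z) \<partial>\<nu>) = 1"
proof -
  interpret finite_measure \<nu> by (rule finite_measureI) (simp add: space_\<nu> prob_\<nu>)
  obtain m M where M: "0 < m" "\<And>z. z \<in> S \<Longrightarrow> m \<le> 1 / \<phi> z \<and> 1 / \<phi> z \<le> M" by (metis q_bounds)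
  have pos: "0 \<le> 1 / \<phi> z" if "z \<in> S" for z using M(1) M(2)[OF that] by linarith
  have "integrable \<nu> (\<lambda>z. 1 / \<phi> z)"
  proof (rule integrable_const_bound[of _ M])
    show "AE z in \<nu>. norm (1 / \<phi> z) \<le> M"
    proof (rule AE_I2)
      fix z assume "z \<in> space \<nu>"
      then have "z \<in> S" by (simp add: space_\<nu>)
      then show "norm (1 / \<phi> z) \<le> M" using pos M(2) by (metis abs_of_nonneg real_norm_def)
    qed
  qed (rule continuous_measurable_\<nu>[OF q_continuous])
  then have "(\<integral>\<^sup>+ z. ennreal (1 / \<phi> z) \<partial>\<nu>) = ennreal (LINT z|\<nu>. 1 / \<phi> z)"
    by (rule nn_integral_eq_integral) (rule AE_I2, simp only: space_\<nu> pos)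
  then show ?thesis using mean by simp
qed

text \<open>
  By Fubini's theorem and the invariance of \<open>\<nu>\<close>, the mean of \<open>J z t\<close> is \<open>t\<close> times the mean of
  \<open>1 / \<phi>\<close>.
\<close>

lemma J_mean: assumes t: "0 \<le> t" shows "(\<integral>\<^sup>+ z. ennreal (J z t) \<partial>\<nu>) = ennreal t"
proof -
  interpret finite_measure \<nu> by (rule finite_measureI) (simp add: space_\<nu> prob_\<nu>)
  interpret pair_sigma_finite lborel \<nu> by unfold_locales
  let ?f = "\<lambda>p. ennreal (1 / \<phi> (\<Phi> (fst p) (snd p))) * indicator {0..t} (fst p)"
  have meas: "?f \<in> borel_measurable (lborel \<Otimes>\<^sub>M \<nu>)"
  proof -
    have id: "(\<lambda>z. z) \<in> measurable \<nu> borel"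
      using measurable_cong_sets[OF sets_\<nu> refl] by (metis measurable_ident_sets measurable_restrict_space1 id_def measurable_ident)
    have "(\<lambda>p. (fst p, snd p)) \<in> measurable (lborel \<Otimes>\<^sub>M \<nu>) (borel \<Otimes>\<^sub>M borel)"
      by (intro measurable_Pair measurable_compose[OF measurable_snd id]) (simp add: measurable_fst[of lborel \<nu>, simplified])
    then have "(\<lambda>p. p) \<in> measurable (lborel \<Otimes>\<^sub>M \<nu>) borel" by (simp add: borel_prod)
    then have "(\<lambda>p. p) \<in> measurable (lborel \<Otimes>\<^sub>M \<nu>) (restrict_space borel (UNIV \<times> S))"
      by (intro measurable_restrict_space2) (auto simp: space_pair_measure space_\<nu>)
    from measurable_compose[OF this borel_measurable_continuous_on_restrict[OF q_flow_continuous]]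
    have "(\<lambda>p. 1 / \<phi> (\<Phi> (fst p) (snd p))) \<in> borel_measurable (lborel \<Otimes>\<^sub>M \<nu>)" by (simp add: case_prod_unfold)
    then show ?thesis by measurable
  qed
  have inner: "(\<integral>\<^sup>+ s. ?f (s, z) \<partial>lborel) = ennreal (J z t)" if z: "z \<in> S" for z
  proof -
    have "continuous_on UNIV (\<lambda>s. 1 / \<phi> (\<Phi> s z))"
      using continuous_on_compose2[OF q_flow_continuous, of UNIV "\<lambda>s. (s, z)"] z
      by (simp add: continuous_on_Pair image_subset_iff)
    then have "(\<lambda>s. 1 / \<phi> (\<Phi> s z)) \<in> borel_measurable borel" by (rule borel_measurable_continuous_onI)
    then have "(\<integral>\<^sup>+ s. ennreal (1 / \<phi> (\<Phi> s z)) * indicator {0..t} s \<partial>lborel) = ennreal (J z t - J z 0)"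
      by (rule nn_integral_FTC_Icc) (use J_deriv[OF z] t q_pos[OF flow_in[OF z]] in \<open>auto intro: less_imp_le\<close>)
    then show ?thesis using J_0[OF z] by simp
  qed
  have outer: "(\<integral>\<^sup>+ z. ?f (s, z) \<partial>\<nu>) = indicator {0..t} s" for s
  proof -
    have qm: "(\<lambda>z. ennreal (1 / \<phi> z)) \<in> borel_measurable \<nu>"
      using continuous_measurable_\<nu>[OF q_continuous] by measurable
    have "(\<integral>\<^sup>+ z. ennreal (1 / \<phi> (\<Phi> s z)) \<partial>\<nu>) = (\<integral>\<^sup>+ z. ennreal (1 / \<phi> z) \<partial>distr \<nu> \<nu> (\<Phi> s))"
      by (rule nn_integral_distr[symmetric, OF flow_measurable]) (simp add: qm)
    then have "(\<integral>\<^sup>+ z. ennreal (1 / \<phi> (\<Phi> s z)) \<partial>\<nu>) = 1" by (simp only: flow_distr q_mean)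
    moreover have "(\<lambda>z. ennreal (1 / \<phi> (\<Phi> s z))) \<in> borel_measurable \<nu>"
      by (rule measurable_compose[OF flow_measurable qm])
    ultimately show ?thesis by (simp add: nn_integral_multc)
  qed
  have "(\<integral>\<^sup>+ z. ennreal (J z t) \<partial>\<nu>) = (\<integral>\<^sup>+ z. (\<integral>\<^sup>+ s. ?f (s, z) \<partial>lborel) \<partial>\<nu>)"
    by (rule nn_integral_cong) (simp only: space_\<nu> inner)
  also have "\<dots> = (\<integral>\<^sup>+ s. (\<integral>\<^sup>+ z. ?f (s, z) \<partial>\<nu>) \<partial>lborel)" by (rule Fubini[OF meas])
  also have "\<dots> = (\<integral>\<^sup>+ s. indicator {0..t} s \<partial>lborel)" by (simp only: outer)
  also have "\<dots> = ennreal t" using t by simp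
  finally show ?thesis .
qed

text \<open>
  A function with mean \<open>t\<close> and oscillation at most \<open>C\<close> differs from \<open>t\<close> by at most \<open>C\<close>.
\<close>

lemma J_bounded: obtains B where "\<And>z t. z \<in> S \<Longrightarrow> \<bar>J z t - t\<bar> \<le> B"
proof -
  interpret finite_measure \<nu> by (rule finite_measureI) (simp add: space_\<nu> prob_\<nu>)
  obtain C where C: "\<And>z z' t. z \<in> S \<Longrightarrow> z' \<in> S \<Longrightarrow> 0 \<le> t \<Longrightarrow> \<bar>J z t - J z' t\<bar> \<le> C" using J_bounded_oscillation by metis
  have fwd: "\<bar>J z t - t\<bar> \<le> C" if z: "z \<in> S" and t: "0 \<le> t" for z t
  proof -
    have J_nonneg: "0 \<le> J z' t" if "z' \<in> S" for z'
      using J_strict_mono[OF that, of 0 t] J_0[OF that] t by (cases "t = 0") auto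
    have "ennreal (J z t - C) * 1 \<le> ennreal t"
    proof -
      have "(\<integral>\<^sup>+ z'. ennreal (J z t - C) \<partial>\<nu>) \<le> (\<integral>\<^sup>+ z'. ennreal (J z' t) \<partial>\<nu>)"
      proof (rule nn_integral_mono)
        fix z' assume "z' \<in> space \<nu>"
        then show "ennreal (J z t - C) \<le> ennreal (J z' t)" using C[OF z _ t, of z'] by (intro ennreal_leI) (simp add: space_\<nu> abs_le_iff)
      qed
      then show ?thesis by (simp add: J_mean[OF t] space_\<nu> prob_\<nu>)
    qed
    then have 1: "J z t - C \<le> t" using t by (simp add: ennreal_le_iff)
    have "ennreal t \<le> ennreal (J z t + C) * 1"
    proof -
      have "(\<integral>\<^sup>+ z'. ennreal (J z' t) \<partial>\<nu>) \<le> (\<integral>\<^sup>+ z'. ennreal (J z t + C) \<partial>\<nu>)"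
      proof (rule nn_integral_mono)
        fix z' assume "z' \<in> space \<nu>"
        then show "ennreal (J z' t) \<le> ennreal (J z t + C)" using C[OF z _ t, of z'] by (intro ennreal_leI) (simp add: space_\<nu> abs_le_iff)
      qed
      then show ?thesis by (simp add: J_mean[OF t] space_\<nu> prob_\<nu>)
    qed
    moreover have "0 \<le> J z t + C" using J_nonneg[OF z] C[OF z z t] by simp
    ultimately have "t \<le> J z t + C" by (simp add: ennreal_le_iff)
    then show ?thesis using 1 by (simp add: abs_le_iff)
  qed
  have "\<bar>J z t - t\<bar> \<le> C" if z: "z \<in> S" for z t
  proof (cases "0 \<le> t")
    case False
    have "J z (- t + t) = J z t + J (\<Phi> t z) (- t)" by (rule J_add[OF z])
    then have "J z t = - J (\<Phi> t z) (- t)" using J_0[OF z] by simp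
    moreover have "\<bar>J (\<Phi> t z) (- t) - (- t)\<bar> \<le> C" by (rule fwd[OF flow_in[OF z]]) (use False in simp)
    ultimately show ?thesis by (simp add: abs_le_iff)
  qed (rule fwd[OF z])
  then show thesis by (rule that)
qed

text \<open>
  An invariant closed subset meets the section in a compact invariant subset of the minimal set.
\<close>

lemma S_minimal:
  assumes C: "C \<subseteq> S" "closed C" "C \<noteq> {}" and inv: "\<And>t z. z \<in> C \<Longrightarrow> \<Phi> t z \<in> C"
  shows "C = S"
proof -
  define B where "B = A \<inter> \<iota> -` C"
  have "closed B" unfolding B_def
    by (rule continuous_closed_preimage[OF \<iota>_continuous compact_imp_closed[OF compact_A] C(2)])
  then have "compact B" using compact_A by (metis B_def closed_Int_compact inf.idem inf_assoc inf_commute)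
  have flow1: "\<Phi> 1 (\<iota> a) = \<iota> (f a)" if "a \<in> A" for a using k_1[OF that] by (simp add: k_def)
  have "B = A"
  proof (rule OC.minimal[OF _ \<open>compact B\<close>])
    show "B \<subseteq> A" by (simp add: B_def)
    obtain z where z: "z \<in> C" using C(3) by blast
    then obtain a t where a: "a \<in> A" "z = \<Phi> t (\<iota> a)" using C(1) unfolding lamination_def by blast
    have "\<iota> a = \<Phi> (- t) z" using flow_minus[OF \<iota>_in_S[OF a(1)]] a(2) by simp
    then have "a \<in> B" using a(1) inv[OF z] by (simp add: B_def)
    then show "B \<noteq> {}" by blast
    show "f ` B = B"
    proof
      show "f ` B \<subseteq> B"
      proof (rule image_subsetI)
        fix a assume a: "a \<in> B"
        then have "f a \<in> A" using ret_A by (auto simp: B_def)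
        moreover have "\<iota> (f a) \<in> C" using a inv[of "\<iota> a" 1] flow1[of a] by (simp add: B_def)
        ultimately show "f a \<in> B" by (simp add: B_def)
      qed
      show "B \<subseteq> f ` B"
      proof
        fix a assume a: "a \<in> B"
        then have "a \<in> f ` A" unfolding ret_A by (simp add: B_def)
        then obtain b where b: "a = f b" "b \<in> A" by (rule imageE)
        have "\<iota> b = \<Phi> (- 1) (\<iota> a)" using flow_minus[OF \<iota>_in_S[OF b(2)], of 1] flow1[OF b(2)] b(1) by simp
        then have "b \<in> B" using b(2) a inv[of "\<iota> a" "-1"] by (simp add: B_def)
        then show "a \<in> f ` B" using b(1) by blast
      qed
    qed
  qed
  have "S \<subseteq> C"
  proof
    fix z assume "z \<in> S"
    then obtain a t where a: "a \<in> A" "z = \<Phi> t (\<iota> a)" unfolding lamination_def by blast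
    then have "\<iota> a \<in> C" using \<open>B = A\<close> by (auto simp: B_def)
    then show "z \<in> C" using inv a(2) by simp
  qed
  then show ?thesis using C(1) by blast
qed

text \<open>
  A periodic orbit would return to the section after an integer time and produce a periodic point of the
  return map.
\<close>

lemma flow_free: assumes z: "z \<in> S" and eq: "\<Phi> t z = z" shows "t = 0"
proof -
  obtain a s where a: "a \<in> A" "z = \<Phi> s (\<iota> a)" using z unfolding lamination_def by blast
  have aS: "\<iota> a \<in> S" by (rule \<iota>_in_S[OF a(1)])
  have "\<Phi> t (\<iota> a) = \<Phi> t (\<Phi> (- s) z)" using flow_minus[OF aS] a(2) by simp
  also have "\<dots> = \<Phi> (- s) (\<Phi> t z)" using flow_add[OF z, of t "-s"] flow_add[OF z, of "-s" t] by (simp add: add.commute)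
  also have "\<dots> = \<iota> a" using eq flow_minus[OF aS] a(2) by simp
  finally have fix_a: "\<Phi> t (\<iota> a) = \<iota> a" .
  then have fix_a': "\<Phi> (- t) (\<iota> a) = \<iota> a" using flow_minus[OF aS, of t] by simp
  obtain y where y: "y \<in> E" "proj2 y = a" using proj2_surj[OF a(1)] by blast
  then obtain x where x: "x \<in> OC.K" "y = OC.pt x" using OC.in_A_iff_pt[of y] by (auto simp: E_def)
  have nat0: "n = 0" if "\<Phi> (real n) (\<iota> a) = \<iota> a" for n
  proof -
    have "base ((OC.g ^^ n) x) = base x" using flow_base[OF x(1), of n] that y x by simp
    then have "proj2 (OC.pt ((OC.g ^^ n) x)) = proj2 (OC.pt x)"
      using \<iota>_inj OC.pt_in[OF x(1)] OC.pt_in[OF OC.gn_in[OF x(1)]] by (meson inj_onD)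
    then have "(f ^^ n) (proj2 (OC.pt x)) = proj2 (OC.pt x)" using OC.fn_pt[OF x(1)] by simp
    then show ?thesis by (rule OC.no_periodic_points[OF OC.pt_in[OF x(1)]])
  qed
  have "t \<in> \<int>" using \<iota>_return[OF a(1) a(1) fix_a] .
  then obtain m :: int where m: "t = of_int m" by (rule Ints_cases)
  show ?thesis
  proof (cases "0 \<le> m")
    case True
    then show ?thesis using nat0[of "nat m"] fix_a m by simp
  next
    case False
    then show ?thesis using nat0[of "nat (- m)"] fix_a' m by simp
  qed
qed

theorem conjugate_to_flow: "C0_conjugate (top_of_set S) \<Phi>' (top_of_set S) \<Phi>"
proof -
  obtain B where B: "\<And>z t. z \<in> S \<Longrightarrow> \<bar>J z t - t\<bar> \<le> B" using J_bounded by metis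
  show ?thesis
  proof (rule gottschalk_hedlund[of B])
    show "C = S" if "C \<subseteq> S" "closed C" "C \<noteq> {}" "\<And>t z. z \<in> C \<Longrightarrow> \<Phi> t z \<in> C" for C
      by (rule S_minimal[OF that])
    show "\<bar>J z t - t\<bar> \<le> B" if "z \<in> S" for z t using that by (rule B)
  next
    fix w assume w: "continuous_on S w" "\<And>z s. z \<in> S \<Longrightarrow> w (\<Phi> s z) = w z + (J z s - s)"
    show ?thesis
    proof (rule time_change_conjugate[OF w(1)])
      show "w (\<Phi> s z) = w z + (J z s - s)" if "z \<in> S" for z s using that by (rule w(2))
      show "t = 0" if "z \<in> S" "\<Phi> t z = z" for z t using that by (rule flow_free)
      show "\<Phi>' (J z s) z = \<Phi> s z" if "z \<in> S" for z s using that by (rule reparametrized_flow)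
    qed
  qed
qed

end

theorem theorem3p2:
  fixes H :: "complex \<times> real \<times> complex \<Rightarrow> real"
    and \<epsilon> h R \<alpha> :: real
    and A0 \<A> :: "(complex \<times> real) set"
    and \<phi> :: "complex \<times> real \<times> complex \<times> real \<Rightarrow> real"
    and \<nu> :: "(complex \<times> real \<times> complex \<times> real) measure"
  defines "f \<equiv> ret H \<epsilon> h" and "F \<equiv> ret_lift H \<epsilon> h" and "D \<equiv> ret_dom H \<epsilon> h"
    and "S \<equiv> lamination H \<epsilon> h \<A>"
    and "\<Phi> \<equiv> ham_flow (Hhat H \<epsilon>)"
    and "\<Phi>' \<equiv> ham_flow (Hhat_reparam H \<epsilon> h \<phi>)"
  assumes "Cinf (H \<circ> proj3)"
    and "kupka_smale F D"
    and "0 < R" and "monotone_twist R F D"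
    and "A0 \<subseteq> circle \<times> {- R / 2..R / 2}" and "invariant_annulus f A0"
    and "\<A> \<subseteq> A0" and "\<alpha> \<notin> \<rat>" and "aubry_mather f F \<alpha> \<A>"
    and "hyperbolic_set F \<A>"
    and "has_holes 1 f \<A>"
    and "\<forall>x \<in> phase_space. 0 < \<phi> x" and "Ck 1 (\<phi> \<circ> proj4)"
    and "invariant_prob S \<Phi> \<nu>" and "(LINT x|\<nu>. 1 / \<phi> x) = 1"
  shows "C0_conjugate (top_of_set S) \<Phi>' (top_of_set S) \<Phi> \<and>
         C0_conjugate (top_of_set S) \<Phi>' (suspension_space \<A> f) suspension_flow"
proof -
  have strip: "\<A> \<subseteq> circle \<times> {- R / 2..R / 2}" using assms by blast
  have ordered: "f_ordered f \<A>" and min: "\<And>B. B \<subseteq> \<A> \<Longrightarrow> B \<noteq> {} \<Longrightarrow> f_ordered f B \<Longrightarrow> B = \<A>"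
    and cantor: "cantor_set \<A>"
    using assms unfolding aubry_mather_def minimal_f_ordered_def by blast+
  have dom: "x \<in> D 1" if "proj2 x \<in> \<A>" for x
  proof -
    have "proj2 x \<in> circle \<times> {- R / 2..R / 2}" using strip that by blast
    then have "\<bar>snd x\<bar> \<le> R" using \<open>0 < R\<close> by (cases x) (auto simp: proj2_def)
    then show ?thesis using \<open>monotone_twist R F D\<close> unfolding monotone_twist_def Let_def by blast
  qed
  have minimal: "B = \<A>" if B: "B \<subseteq> \<A>" "compact B" "B \<noteq> {}" "f ` B = B" for B
  proof (rule min[OF B(1,3)])
    have "inj_on fst B" using ordered B(1) unfolding f_ordered_def by (meson inj_on_subset)
    moreover have "\<forall>x\<in>B. \<forall>y\<in>B. \<forall>z\<in>B. cyclic (fst x) (fst y) (fst z) \<longrightarrow> cyclic (fst (f x)) (fst (f y)) (fst (f z))"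
      using ordered B(1) unfolding f_ordered_def by (meson subsetD)
    ultimately show "f_ordered f B" using B unfolding f_ordered_def by blast
  qed
  have "compact \<A>" "f ` \<A> = \<A>" using ordered unfolding f_ordered_def by blast+
  moreover have "\<A> \<subseteq> circle \<times> UNIV" using strip by blast
  ultimately have "flow_lamination H \<epsilon> h \<A>"
    using dom \<open>Cinf (H \<circ> proj3)\<close> unfolding f_def D_def
    by (intro flow_lamination.intro smooth_hamiltonian.intro flow_lamination_axioms.intro)
  moreover have "ordered_cantor_set \<A> f"
    using \<open>\<A> \<subseteq> circle \<times> UNIV\<close> ordered cantor minimal by (rule ordered_cantor_set.intro)
  moreover have "twist_lamination_axioms H \<epsilon> h \<A> R"
    using \<open>0 < R\<close> \<open>monotone_twist R F D\<close> strip unfolding F_def D_def by (rule twist_lamination_axioms.intro)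
  moreover have "reparametrized_lamination_axioms \<phi>"
    using \<open>\<forall>x \<in> phase_space. 0 < \<phi> x\<close> \<open>Ck 1 (\<phi> \<circ> proj4)\<close>
    by (intro reparametrized_lamination_axioms.intro) blast+
  moreover have "rigid_lamination_axioms H \<epsilon> h \<A> \<phi> \<nu>"
    using \<open>hyperbolic_set F \<A>\<close> \<open>has_holes 1 f \<A>\<close> \<open>invariant_prob S \<Phi> \<nu>\<close> \<open>(LINT x|\<nu>. 1 / \<phi> x) = 1\<close>
    unfolding F_def f_def S_def \<Phi>_def by (rule rigid_lamination_axioms.intro)
  ultimately have "rigid_lamination H \<epsilon> h \<A> R \<phi> \<nu>"
    unfolding f_def by (intro rigid_lamination.intro twist_lamination.intro reparametrized_lamination.intro)
  then interpret rigid_lamination H \<epsilon> h \<A> R \<phi> \<nu> .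
  have "C0_conjugate (top_of_set S) \<Phi>' (top_of_set S) \<Phi>"
    unfolding S_def \<Phi>_def \<Phi>'_def by (rule conjugate_to_flow)
  moreover have "C0_conjugate (top_of_set S) \<Phi> (suspension_space \<A> f) suspension_flow"
    unfolding S_def \<Phi>_def f_def by (rule suspension)
  ultimately show ?thesis using C0_conjugate_trans by blast
qed

end
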